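(* Let $\mathbb{K}$ be a field of characteristic $0$ and $\mathbb{K}[\mathbf{x}]=\mathbb{K}[x_1,\ldots,x_n]$. Let $\mathbb{K}[\mathbf{x}]/I$ be a finite monomial algebra (with $I$ a full monomial ideal), and let $(B,\mathfrak{m})$ be a finite-dimensional local $\mathbb{K}$-algebra with residue field $\mathbb{K}$. Assume that $\dim_{\mathbb{K}}(\mathfrak{m}/\mathfrak{m}^2)=n$ and that $\operatorname{Aut}^0_{\mathbb{K}}(B)$ is isomorphic to $\operatorname{Aut}^0_{\mathbb{K}}(\mathbb{K}[\mathbf{x}]/I)$ as algebraic $\mathbb{K}$-groups. Then $B$ is isomorphic to $\mathbb{K}[\mathbf{x}]/I$ as $\mathbb{K}$-algebras.
   Context: A monomial ideal $I\subset\mathbb{K}[\mathbf{x}]$ is an ideal generated by monomials $\mathbf{x}^m=x_1^{m_1}\cdots x_n^{m_n}$, $m\in\mathbb{Z}_{\ge0}^n$; a monomial algebra is a quotient $\mathbb{K}[\mathbf{x}]/I$ by a monomial ideal. Standing convention: monomial ideals are full, i.e. $x_i\notin I$ for all $1\le i\le n$, and "finite" means finite-dimensional as a $\mathbb{K}$-vector space. For a finite $\mathbb{K}$-algebra $A$, $\operatorname{Aut}_{\mathbb{K}}(A)$ is a linear algebraic group and $\operatorname{Aut}^0_{\mathbb{K}}(A)$ denotes its neutral (identity) connected component. *)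

theory Defs
  imports Main
begin

text \<open>A monomial ideal I of K[x_1..x_n] is encoded by the set E of exponent
vectors m (functions nat => nat vanishing at indices >= n) with x^m in I.
Such a set is exactly an upward closed set of exponent vectors.\<close>

definition expvecs :: "nat \<Rightarrow> (nat \<Rightarrow> nat) set" where
  "expvecs n = {m. \<forall>i\<ge>n. m i = 0}"

definition unitvec :: "nat \<Rightarrow> nat \<Rightarrow> nat" where
  "unitvec i = (\<lambda>j. if j = i then 1 else 0)"

definition addvec :: "(nat \<Rightarrow> nat) \<Rightarrow> (nat \<Rightarrow> nat) \<Rightarrow> nat \<Rightarrow> nat" where
  "addvec a b = (\<lambda>i. a i + b i)"

definition monomial_ideal :: "nat \<Rightarrow> (nat \<Rightarrow> nat) set \<Rightarrow> bool" where
  "monomial_ideal n E \<longleftrightarrow> E \<subseteq> expvecs n \<and> (\<lambda>_. 0) \<notin> E \<and>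
     (\<forall>m\<in>E. \<forall>m'\<in>expvecs n. (\<forall>i. m i \<le> m' i) \<longrightarrow> m' \<in> E)"

definition full_monomial_ideal :: "nat \<Rightarrow> (nat \<Rightarrow> nat) set \<Rightarrow> bool" where
  "full_monomial_ideal n E \<longleftrightarrow> (\<forall>i<n. unitvec i \<notin> E)"

definition std_monos :: "nat \<Rightarrow> (nat \<Rightarrow> nat) set \<Rightarrow> (nat \<Rightarrow> nat) set" where
  "std_monos n E = expvecs n - E"

text \<open>The monomial algebra K[x]/I, realised on its standard-monomial basis:
elements are coefficient functions supported on the standard monomials.\<close>
definition mcar :: "nat \<Rightarrow> (nat \<Rightarrow> nat) set \<Rightarrow> ((nat \<Rightarrow> nat) \<Rightarrow> 'k::field) set" where
  "mcar n E = {u. \<forall>m. m \<notin> std_monos n E \<longrightarrow> u m = 0}"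

definition madd :: "((nat \<Rightarrow> nat) \<Rightarrow> 'k::field) \<Rightarrow> ((nat \<Rightarrow> nat) \<Rightarrow> 'k) \<Rightarrow> (nat \<Rightarrow> nat) \<Rightarrow> 'k" where
  "madd u v = (\<lambda>m. u m + v m)"

definition msmul :: "'k::field \<Rightarrow> ((nat \<Rightarrow> nat) \<Rightarrow> 'k) \<Rightarrow> (nat \<Rightarrow> nat) \<Rightarrow> 'k" where
  "msmul c u = (\<lambda>m. c * u m)"

definition mmul :: "nat \<Rightarrow> (nat \<Rightarrow> nat) set \<Rightarrow>
    ((nat \<Rightarrow> nat) \<Rightarrow> 'k::field) \<Rightarrow> ((nat \<Rightarrow> nat) \<Rightarrow> 'k) \<Rightarrow> (nat \<Rightarrow> nat) \<Rightarrow> 'k" where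
  "mmul n E u v = (\<lambda>m. if m \<in> std_monos n E then
      (\<Sum>(a, b) \<in> {(a, b). a \<in> std_monos n E \<and> b \<in> std_monos n E \<and> addvec a b = m}. u a * v b)
    else 0)"

definition mone :: "(nat \<Rightarrow> nat) \<Rightarrow> 'k::field" where
  "mone = (\<lambda>m. if m = (\<lambda>_. 0) then 1 else 0)"

text \<open>A commutative K-algebra is a commutative ring 'b with a ring homomorphism
iota : K -> 'b; scalar multiplication is c . x = iota c * x.\<close>
definition alg_structure :: "('k::field \<Rightarrow> 'b::comm_ring_1) \<Rightarrow> bool" where
  "alg_structure \<iota> \<longleftrightarrow> (\<forall>a b. \<iota> (a + b) = \<iota> a + \<iota> b) \<and>
     (\<forall>a b. \<iota> (a * b) = \<iota> a * \<iota> b) \<and> \<iota> 1 = 1"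

definition is_basis :: "('k::field \<Rightarrow> 'b::comm_ring_1) \<Rightarrow> 'b list \<Rightarrow> bool" where
  "is_basis \<iota> bs \<longleftrightarrow> (\<forall>x. \<exists>!c. (\<forall>k\<ge>length bs. c k = 0) \<and>
      x = (\<Sum>k<length bs. \<iota> (c k) * bs ! k))"

definition coords :: "('k::field \<Rightarrow> 'b::comm_ring_1) \<Rightarrow> 'b list \<Rightarrow> 'b \<Rightarrow> nat \<Rightarrow> 'k" where
  "coords \<iota> bs x = (THE c. (\<forall>k\<ge>length bs. c k = 0) \<and>
      x = (\<Sum>k<length bs. \<iota> (c k) * bs ! k))"

definition is_ideal :: "'b::comm_ring_1 set \<Rightarrow> bool" where
  "is_ideal J \<longleftrightarrow> 0 \<in> J \<and> (\<forall>x\<in>J. \<forall>y\<in>J. x + y \<in> J) \<and> (\<forall>x\<in>J. \<forall>r. r * x \<in> J)"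

definition is_maximal_ideal :: "'b::comm_ring_1 set \<Rightarrow> bool" where
  "is_maximal_ideal J \<longleftrightarrow> is_ideal J \<and> 1 \<notin> J \<and>
     (\<forall>J'. is_ideal J' \<and> J \<subseteq> J' \<and> 1 \<notin> J' \<longrightarrow> J' = J)"

definition local_ring_with :: "'b::comm_ring_1 set \<Rightarrow> bool" where
  "local_ring_with mm \<longleftrightarrow> is_maximal_ideal mm \<and> (\<forall>J. is_maximal_ideal J \<longrightarrow> J = mm)"

definition ideal_sq :: "'b::comm_ring_1 set \<Rightarrow> 'b set" where
  "ideal_sq mm = {x. \<exists>(L::nat) a b. (\<forall>k<L. a k \<in> mm \<and> b k \<in> mm) \<and> x = (\<Sum>k<L. a k * b k)}"

definition cotangent_dim :: "('k::field \<Rightarrow> 'b::comm_ring_1) \<Rightarrow> 'b set \<Rightarrow> nat \<Rightarrow> bool" where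
  "cotangent_dim \<iota> mm n \<longleftrightarrow> (\<exists>v. (\<forall>i<n. v i \<in> mm) \<and>
     (\<forall>c. (\<Sum>i<n. \<iota> (c i) * v i) \<in> ideal_sq mm \<longrightarrow> (\<forall>i<n. c i = 0)) \<and>
     (\<forall>x\<in>mm. \<exists>c. x - (\<Sum>i<n. \<iota> (c i) * v i) \<in> ideal_sq mm))"

definition alg_iso_to_monalg :: "('k::field \<Rightarrow> 'b::comm_ring_1) \<Rightarrow> nat \<Rightarrow> (nat \<Rightarrow> nat) set \<Rightarrow>
    ('b \<Rightarrow> (nat \<Rightarrow> nat) \<Rightarrow> 'k) \<Rightarrow> bool" where
  "alg_iso_to_monalg \<iota> n E f \<longleftrightarrow> bij_betw f UNIV (mcar n E) \<and>
     (\<forall>x y. f (x + y) = madd (f x) (f y)) \<and>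
     (\<forall>c x. f (\<iota> c * x) = msmul c (f x)) \<and>
     (\<forall>x y. f (x * y) = mmul n E (f x) (f y)) \<and>
     f 1 = mone"

text \<open>N x N matrices are functions nat => nat => K vanishing outside [0,N)^2.\<close>
definition padded :: "nat \<Rightarrow> (nat \<Rightarrow> nat \<Rightarrow> 'k::field) \<Rightarrow> bool" where
  "padded N g \<longleftrightarrow> (\<forall>i j. \<not> (i < N \<and> j < N) \<longrightarrow> g i j = 0)"

definition mat_mul :: "nat \<Rightarrow> (nat \<Rightarrow> nat \<Rightarrow> 'k::field) \<Rightarrow> (nat \<Rightarrow> nat \<Rightarrow> 'k) \<Rightarrow> nat \<Rightarrow> nat \<Rightarrow> 'k" where
  "mat_mul N g h = (\<lambda>i j. if i < N \<and> j < N then (\<Sum>k<N. g i k * h k j) else 0)"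

definition mat_id :: "nat \<Rightarrow> nat \<Rightarrow> nat \<Rightarrow> 'k::field" where
  "mat_id N = (\<lambda>i j. if i < N \<and> i = j then 1 else 0)"

definition is_inverse :: "nat \<Rightarrow> (nat \<Rightarrow> nat \<Rightarrow> 'k::field) \<Rightarrow> (nat \<Rightarrow> nat \<Rightarrow> 'k) \<Rightarrow> bool" where
  "is_inverse N g h \<longleftrightarrow> padded N h \<and> mat_mul N g h = mat_id N \<and> mat_mul N h g = mat_id N"

definition invertible_mat :: "nat \<Rightarrow> (nat \<Rightarrow> nat \<Rightarrow> 'k::field) \<Rightarrow> bool" where
  "invertible_mat N g \<longleftrightarrow> padded N g \<and> (\<exists>h. is_inverse N g h)"

definition mat_inv :: "nat \<Rightarrow> (nat \<Rightarrow> nat \<Rightarrow> 'k::field) \<Rightarrow> nat \<Rightarrow> nat \<Rightarrow> 'k" where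
  "mat_inv N g = (SOME h. is_inverse N g h)"

text \<open>Regular functions on GL_N defined over K: the K-algebra generated by the
matrix entries and the entries of the inverse (= K[g_ij, 1/det]).\<close>
inductive_set reg_fun :: "nat \<Rightarrow> ((nat \<Rightarrow> nat \<Rightarrow> 'k::field) \<Rightarrow> 'k) set" for N where
  rf_const: "(\<lambda>g. c) \<in> reg_fun N"
| rf_entry: "i < N \<Longrightarrow> j < N \<Longrightarrow> (\<lambda>g. g i j) \<in> reg_fun N"
| rf_inv_entry: "i < N \<Longrightarrow> j < N \<Longrightarrow> (\<lambda>g. mat_inv N g i j) \<in> reg_fun N"
| rf_add: "f \<in> reg_fun N \<Longrightarrow> h \<in> reg_fun N \<Longrightarrow> (\<lambda>g. f g + h g) \<in> reg_fun N"
| rf_mul: "f \<in> reg_fun N \<Longrightarrow> h \<in> reg_fun N \<Longrightarrow> (\<lambda>g. f g * h g) \<in> reg_fun N"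

definition zclosed_in :: "nat \<Rightarrow> (nat \<Rightarrow> nat \<Rightarrow> 'k::field) set \<Rightarrow> (nat \<Rightarrow> nat \<Rightarrow> 'k) set \<Rightarrow> bool" where
  "zclosed_in N S C \<longleftrightarrow> C \<subseteq> S \<and>
     (\<exists>F. F \<subseteq> reg_fun N \<and> C = {g \<in> S. \<forall>f\<in>F. f g = 0})"

definition zconnected :: "nat \<Rightarrow> (nat \<Rightarrow> nat \<Rightarrow> 'k::field) set \<Rightarrow> bool" where
  "zconnected N C \<longleftrightarrow> \<not> (\<exists>A B. zclosed_in N C A \<and> zclosed_in N C B \<and>
      A \<noteq> {} \<and> B \<noteq> {} \<and> A \<inter> B = {} \<and> A \<union> B = C)"

definition neutral_comp :: "nat \<Rightarrow> (nat \<Rightarrow> nat \<Rightarrow> 'k::field) set \<Rightarrow> (nat \<Rightarrow> nat \<Rightarrow> 'k) set" where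
  "neutral_comp N G = \<Union> {C. C \<subseteq> G \<and> mat_id N \<in> C \<and> zconnected N C}"

definition alg_group_iso :: "nat \<Rightarrow> (nat \<Rightarrow> nat \<Rightarrow> 'k::field) set \<Rightarrow> nat \<Rightarrow> (nat \<Rightarrow> nat \<Rightarrow> 'k) set \<Rightarrow> bool" where
  "alg_group_iso N G M H \<longleftrightarrow> (\<exists>\<phi>. bij_betw \<phi> G H \<and>
     (\<forall>g\<in>G. \<forall>h\<in>G. \<phi> (mat_mul N g h) = mat_mul M (\<phi> g) (\<phi> h)) \<and>
     (\<forall>i<M. \<forall>j<M. \<exists>f\<in>reg_fun N. \<forall>g\<in>G. \<phi> g i j = f g) \<and>
     (\<forall>i<N. \<forall>j<N. \<exists>f\<in>reg_fun M. \<forall>h\<in>H. inv_into G \<phi> h i j = f h))"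

text \<open>For an N-dimensional algebra with basis e_0..e_{N-1}, structure constants
sc (e_i e_j = sum_k sc i j k e_k) and unit with coordinates u, Aut_K is the group of
invertible matrices g (g e_k = sum_l g l k e_l) that are multiplicative and fix 1.\<close>
definition aut_mats :: "nat \<Rightarrow> (nat \<Rightarrow> nat \<Rightarrow> nat \<Rightarrow> 'k::field) \<Rightarrow> (nat \<Rightarrow> 'k) \<Rightarrow> (nat \<Rightarrow> nat \<Rightarrow> 'k) set" where
  "aut_mats N sc u = {g. invertible_mat N g \<and>
     (\<forall>i<N. \<forall>j<N. \<forall>l<N. (\<Sum>k<N. sc i j k * g l k) =
        (\<Sum>p<N. \<Sum>q<N. g p i * g q j * sc p q l)) \<and>
     (\<forall>l<N. (\<Sum>k<N. g l k * u k) = u l)}"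

definition Aut_B :: "('k::field \<Rightarrow> 'b::comm_ring_1) \<Rightarrow> 'b list \<Rightarrow> (nat \<Rightarrow> nat \<Rightarrow> 'k) set" where
  "Aut_B \<iota> bs = aut_mats (length bs) (\<lambda>i j k. coords \<iota> bs (bs ! i * bs ! j) k) (coords \<iota> bs 1)"

definition Aut_M :: "(nat \<Rightarrow> nat) list \<Rightarrow> (nat \<Rightarrow> nat \<Rightarrow> 'k::field) set" where
  "Aut_M ms = aut_mats (length ms)
     (\<lambda>i j k. if addvec (ms ! i) (ms ! j) = ms ! k then 1 else 0)
     (\<lambda>k. if k < length ms \<and> ms ! k = (\<lambda>_. 0) then 1 else 0)"

text \<open>Aut^0_K(B) is isomorphic to Aut^0_K(K[x]/I) as algebraic K-groups (computed
with respect to some bases; the isomorphism class does not depend on the choice).\<close>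
definition aut0_isomorphic :: "('k::field \<Rightarrow> 'b::comm_ring_1) \<Rightarrow> nat \<Rightarrow> (nat \<Rightarrow> nat) set \<Rightarrow> bool" where
  "aut0_isomorphic \<iota> n E \<longleftrightarrow> (\<exists>bs ms. is_basis \<iota> bs \<and> distinct ms \<and> set ms = std_monos n E \<and>
     alg_group_iso (length bs) (neutral_comp (length bs) (Aut_B \<iota> bs))
                   (length ms) (neutral_comp (length ms) (Aut_M ms :: (nat \<Rightarrow> nat \<Rightarrow> 'k) set)))"

end

theory Submission
 imports Defs "HOL-Library.Function_Algebras" "HOL-Computational_Algebra.Computational_Algebra"
begin

text \<open>A monomial algebra carries the torus \<open>T\<close> of diagonal automorphisms, and the multiplicities
 \<open>wt n S a\<close> of the \<open>T\<close>-weights on its derivations can be read off from the group alone, because a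
 derivation \<open>x\<^sup>a x\<^sub>m \<partial>\<^sub>m\<close> of nonzero weight exponentiates to a polynomial curve in the neutral
 component and regular homomorphisms have differentials. Transporting \<open>T\<close> to \<open>B\<close> diagonalises the
 maximal ideal; as the coordinates of \<open>T\<close> are regular functions of its image, the weights of \<open>n\<close>
 homogeneous generators form a \<open>\<int>\<close>-basis of the character lattice. So distinct monomials in these
 generators have distinct weights and \<open>B\<close> is itself a monomial algebra. It remains to show that
 a lattice isomorphism preserving all multiplicities forces the two staircases to agree up to a
 permutation of the variables. Weights \<open>uv i\<close> with multiplicity at least 2 are matched first; the
 remaining variables divide only monomials on a single chain, and are counted by the multiplicities.\<close>

section \<open>Monomial derivations and staircases\<close>

text \<open>The lattice isomorphism need not come from a permutation of the variables. If all
  products of two variables vanish, \<open>-1\<close> on the lattice preserves every multiplicity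
  and sends no unit vector to a unit vector. So weights can be followed only for the variables in
  \<open>K\<close>, called thick below: multiplicity at least 2, or a weight whose double is again a
  weight, rules out negative coordinates, and unit vectors are the indecomposable nonnegative
  vectors. For the other variables, called thin, only numbers survive: how many have a given chain,
  and how many derivations involve blocks without thick variables. The critical case has exactly two
  thick variables: multiplicities of thick weights alone would still allow two staircases to differ
  along an antidiagonal, and the position of the maximal monomials has to be used.

  On the group side a tangent vector is the linear coefficient of a polynomial curve through the
  identity, so no Lie algebra has to be built. Weight 0 has no polynomial exponentials of this kind,
  but its multiplicity is n for every staircase.\<close>

definition uv :: "nat \<Rightarrow> nat \<Rightarrow> int" where
 "uv i = (\<lambda>j. if j = i then 1 else 0)"

definition Zn :: "nat \<Rightarrow> (nat \<Rightarrow> int) set" where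
 "Zn n = {v. \<forall>i\<ge>n. v i = 0}"

lemma uv_same [simp]: "uv i i = 1" by (simp add: uv_def)
lemma uv_other: "j \<noteq> i \<Longrightarrow> uv i j = 0" by (simp add: uv_def)
lemma uv_apply: "uv i j = (if j = i then 1 else 0)" by (simp add: uv_def)
lemma uv_nonneg [simp]: "0 \<le> uv i" by (simp add: uv_def le_fun_def)
lemma uv_nonneg_at [simp]: "0 \<le> uv i j" by (simp add: uv_def)
lemma uv_neq_0 [simp]: "uv i \<noteq> 0" by (metis uv_same zero_fun_apply zero_neq_one)
lemma uv_inject [simp]: "uv i = uv j \<longleftrightarrow> i = j"
 by (metis uv_other uv_same zero_neq_one)

lemma Zn_0 [simp]: "0 \<in> Zn n" by (simp add: Zn_def)
lemma Zn_add [intro, simp]: "a \<in> Zn n \<Longrightarrow> b \<in> Zn n \<Longrightarrow> a + b \<in> Zn n" by (simp add: Zn_def)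
lemma Zn_diff [intro, simp]: "a \<in> Zn n \<Longrightarrow> b \<in> Zn n \<Longrightarrow> a - b \<in> Zn n" by (simp add: Zn_def)
lemma Zn_uminus [intro, simp]: "a \<in> Zn n \<Longrightarrow> - a \<in> Zn n" by (simp add: Zn_def)
lemma Zn_uv [intro, simp]: "i < n \<Longrightarrow> uv i \<in> Zn n" by (simp add: Zn_def uv_def)
lemma Zn_le: "0 \<le> a \<Longrightarrow> a \<le> b \<Longrightarrow> b \<in> Zn n \<Longrightarrow> a \<in> Zn n"
proof -
 assume a: "0 \<le> a" "a \<le> b" "b \<in> Zn n"
 have "a i = 0" if "i \<ge> n" for i
 proof -
  have "b i = 0" using a(3) that by (simp add: Zn_def)
  then show ?thesis using a(1,2) le_funD[of 0 a i] le_funD[of a b i] by simp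
 qed
 then show ?thesis by (simp add: Zn_def)
qed
lemma Zn_ge: "a \<in> Zn n \<Longrightarrow> a i \<noteq> 0 \<Longrightarrow> i < n"
 unfolding Zn_def by (metis (mono_tags, lifting) mem_Collect_eq not_less)

lemma uv_le_iff: "0 \<le> v \<Longrightarrow> uv i \<le> v \<longleftrightarrow> 1 \<le> v i"
 by (auto simp: le_fun_def uv_def)

lemma le_add_uv [simp]: "a \<le> a + uv i"
 by (simp add: le_fun_def uv_def)

lemma nonneg_neq_0: "0 \<le> v \<Longrightarrow> v \<noteq> 0 \<Longrightarrow> \<exists>i. 1 \<le> (v :: nat \<Rightarrow> int) i"
 by (metis (no_types, lifting) ext int_one_le_iff_zero_less le_fun_def order_le_less zero_fun_apply)

text \<open>Climbs from 0 to \<open>v\<close> one unit vector at a time, by induction on total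
  degree. The step may use that the new vector is still below \<open>v\<close>, which keeps the path
  inside any set closed under going down.\<close>

lemma Zn_nonneg_induct [consumes 2, case_names zero add]:
 assumes "0 \<le> v" "v \<in> Zn n" "P 0"
  and step: "\<And>w i. 0 \<le> w \<Longrightarrow> i < n \<Longrightarrow> w + uv i \<le> v \<Longrightarrow> P w \<Longrightarrow> P (w + uv i)"
 shows "P v"
proof -
 have "\<forall>w. 0 \<le> w \<and> w \<le> v \<and> nat (\<Sum>i<n. w i) = k \<longrightarrow> P w" for k
 proof (induction k)
  case 0
  show ?case
  proof (intro allI impI; elim conjE)
   fix w assume w: "0 \<le> w" "w \<le> v" "nat (\<Sum>i<n. w i) = 0"
   have "w \<in> Zn n" using w assms Zn_le by blast
   moreover have "(\<Sum>i<n. w i) = 0"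
    using w sum_nonneg[of "{..<n}" w] by (auto simp: le_fun_def)
   then have "\<forall>i<n. w i = 0"
    using w by (subst (asm) sum_nonneg_eq_0_iff) (auto simp: le_fun_def)
   ultimately have "w j = 0" for j by (cases "j < n") (auto simp: Zn_def)
   then have "w = 0" by (simp add: fun_eq_iff)
   then show "P w" using assms by simp
  qed
 next
  case (Suc k)
  show ?case
  proof (intro allI impI; elim conjE)
   fix w assume w: "0 \<le> w" "w \<le> v" "nat (\<Sum>i<n. w i) = Suc k"
   have wZ: "w \<in> Zn n" using w assms Zn_le by blast
   have "w \<noteq> 0" using w(3) by (auto simp: zero_fun_def)
   then obtain i where i: "1 \<le> w i" using nonneg_neq_0 w by blast
   then have "i < n" using Zn_ge[OF wZ, of i] by auto
   define u where "u = w - uv i"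
   have "uv i \<le> w" using w i uv_le_iff by blast
   then have u: "0 \<le> u" unfolding u_def by simp
   have "u \<le> w" unfolding u_def by (auto simp: le_fun_def uv_apply)
   then have u2: "u \<le> v" using w(2) by (rule order_trans)
   have "(\<Sum>j<n. u j) = (\<Sum>j<n. w j) - (\<Sum>j<n. uv i j)" unfolding u_def by (simp add: sum_subtractf)
   also have "(\<Sum>j<n. uv i j) = 1" using \<open>i < n\<close> by (simp add: uv_def)
   finally have "nat (\<Sum>j<n. u j) = k" using w(3) by linarith
   then have "P u" using Suc.IH u u2 by blast
   moreover have "u + uv i = w" unfolding u_def by simp
   ultimately show "P w" using step[OF u \<open>i < n\<close>] w(2) by metis
  qed
 qed
 then show ?thesis using assms by blast
qed

section \<open>Staircases of standard monomials and multiplicities of weights\<close>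

definition downset :: "nat \<Rightarrow> (nat \<Rightarrow> int) set \<Rightarrow> bool" where
 "downset n S \<longleftrightarrow> finite S \<and> (\<forall>p\<in>S. 0 \<le> p \<and> p \<in> Zn n) \<and>
  (\<forall>p\<in>S. \<forall>q. 0 \<le> q \<and> q \<le> p \<longrightarrow> q \<in> S) \<and> (\<forall>i<n. uv i \<in> S) \<and> 0 \<in> S"

text \<open>\<^prop>\<open>allowed n S a m\<close> says that \<open>x\<^sup>a x\<^sub>m \<partial>\<^sub>m\<close> induces a nonzero derivation of the monomial
 algebra with standard monomials \<open>S\<close>, so that \<open>wt n S a\<close> is the multiplicity of the torus weight
 \<open>a\<close> in the Lie algebra of derivations.\<close>

definition allowed :: "nat \<Rightarrow> (nat \<Rightarrow> int) set \<Rightarrow> (nat \<Rightarrow> int) \<Rightarrow> nat \<Rightarrow> bool" where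
 "allowed n S a m \<longleftrightarrow> m < n \<and> a + uv m \<in> S \<and>
  (\<forall>q. 0 \<le> q \<and> q \<in> Zn n \<and> 1 \<le> q m \<and> q + a \<in> S \<longrightarrow> q \<in> S)"

definition wt :: "nat \<Rightarrow> (nat \<Rightarrow> int) set \<Rightarrow> (nat \<Rightarrow> int) \<Rightarrow> nat" where
 "wt n S a = card {m. allowed n S a m}"

locale staircase =
 fixes n :: nat and S :: "(nat \<Rightarrow> int) set"
 assumes downset: "downset n S"
begin

abbreviation w where "w \<equiv> wt n S"

lemma downset_conj: "finite S" "\<forall>p\<in>S. 0 \<le> p \<and> p \<in> Zn n"
  "\<forall>p\<in>S. \<forall>q. 0 \<le> q \<and> q \<le> p \<longrightarrow> q \<in> S" "\<forall>i<n. uv i \<in> S" "0 \<in> S"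
 by (rule downset[unfolded downset_def, THEN conjunct1]
  downset[unfolded downset_def, THEN conjunct2, THEN conjunct1]
  downset[unfolded downset_def, THEN conjunct2, THEN conjunct2, THEN conjunct1]
  downset[unfolded downset_def, THEN conjunct2, THEN conjunct2, THEN conjunct2, THEN conjunct1]
  downset[unfolded downset_def, THEN conjunct2, THEN conjunct2, THEN conjunct2, THEN conjunct2])+

lemma finite_S [simp]: "finite S" by (rule downset_conj)
lemma S_nonneg: "p \<in> S \<Longrightarrow> 0 \<le> p" using downset_conj(2) by simp
lemma S_nonneg_at: "p \<in> S \<Longrightarrow> 0 \<le> p i" using le_funD[OF S_nonneg, of p i] by simp
lemma S_Zn: "p \<in> S \<Longrightarrow> p \<in> Zn n" using downset_conj(2) by simp
lemma S_down: "p \<in> S \<Longrightarrow> 0 \<le> q \<Longrightarrow> q \<le> p \<Longrightarrow> q \<in> S"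
 by (rule downset_conj(3)[rule_format, OF _ conjI])
lemma S_uv: "i < n \<Longrightarrow> uv i \<in> S" using downset_conj(4) by simp
lemma S_0: "0 \<in> S" by (rule downset_conj)

lemma finite_allowed [simp]: "finite {m. allowed n S a m}"
 by (rule finite_subset[of _ "{..<n}"]) (auto simp: allowed_def)

lemma w_pos: "0 < w a \<longleftrightarrow> (\<exists>m. allowed n S a m)"
 unfolding wt_def by (auto simp: card_gt_0_iff)

lemma allowed_S: assumes "allowed n S a m" shows "m < n" "a + uv m \<in> S"
 using assms unfolding allowed_def by blast+

lemma allowed_nonneg: "0 \<le> a \<Longrightarrow> allowed n S a m \<longleftrightarrow> m < n \<and> a + uv m \<in> S"
proof -
 assume "0 \<le> a"
 then have "q \<in> S" if "0 \<le> q" "q + a \<in> S" for q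
  using S_down[OF that(2,1)] by simp
 then show ?thesis unfolding allowed_def by blast
qed

lemma w_nonneg: "0 \<le> a \<Longrightarrow> w a = card {m. m < n \<and> a + uv m \<in> S}"
 unfolding wt_def by (rule arg_cong[where f = card]) (auto simp: allowed_nonneg)

text \<open>Since \<open>a + uv m\<close> is the exponent of a standard monomial, only the
  differentiated variable can be divided out, and only once.\<close>

lemma allowed_neg:
 assumes "allowed n S a m"
 shows "i \<noteq> m \<Longrightarrow> 0 \<le> a i" "-1 \<le> a m"
proof -
 have "0 \<le> (a + uv m) i" for i using assms S_nonneg_at allowed_S(2) by blast
 from this[of i] this[of m] show "i \<noteq> m \<Longrightarrow> 0 \<le> a i" "-1 \<le> a m" by (auto simp: uv_apply)
qed

lemma w_pos_ge: assumes "0 < w a" shows "-1 \<le> a i"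
proof -
 obtain m where "allowed n S a m" using w_pos assms by auto
 from allowed_neg(1)[OF this, of i] allowed_neg(2)[OF this] show ?thesis by (cases "i = m") auto
qed

lemma w_pos_neg:
 assumes "0 < w a" "a m < 0"
 shows "allowed n S a m" "a m = -1" "\<And>i. i \<noteq> m \<Longrightarrow> 0 \<le> a i" "a + uv m \<in> S" "m < n"
proof -
 obtain m' where m': "allowed n S a m'" using assms w_pos by auto
 then have "m' = m" using allowed_neg(1)[OF m', of m] assms by auto
 with m' show "allowed n S a m" by simp
 then show "a m = -1" "\<And>i. i \<noteq> m \<Longrightarrow> 0 \<le> a i" "a + uv m \<in> S" "m < n"
  using allowed_neg[of a m] allowed_S[of a m] assms(2) by auto
qed

text \<open>The negative coordinate names the differentiated variable, so the weight determines the
  monomial derivation.\<close>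

lemma w_neg_le_1:
 assumes "a m < 0" shows "w a \<le> 1"
proof -
 have "{m'. allowed n S a m'} \<subseteq> {m}" using assms allowed_neg(1)[of a _ m]
  by (auto simp: not_less[symmetric])
 then show ?thesis unfolding wt_def using card_mono[of "{m}"] by auto
qed

lemma w_pos_nonneg_S: "0 < w a \<Longrightarrow> 0 \<le> a \<Longrightarrow> a \<in> S"
 using w_pos allowed_nonneg S_down[of "a + uv _" a] le_add_uv by blast

lemma w_antimono:
 assumes "0 \<le> a" "a \<le> b" shows "w b \<le> w a"
proof -
 have "0 \<le> b" using assms by (rule order_trans)
 have "{m. m < n \<and> b + uv m \<in> S} \<subseteq> {m. m < n \<and> a + uv m \<in> S}"
 proof (rule Collect_mono, rule impI, elim conjE, rule conjI)
  fix m assume "b + uv m \<in> S"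
  moreover have "0 \<le> a + uv m" using assms(1) le_add_uv by (rule order_trans)
  ultimately show "a + uv m \<in> S" using S_down assms add_right_mono by blast
 qed
 then show ?thesis by (simp add: w_nonneg assms \<open>0 \<le> b\<close> card_mono)
qed

lemma w_posI: "0 \<le> a \<Longrightarrow> m < n \<Longrightarrow> a + uv m \<in> S \<Longrightarrow> 0 < w a"
 using w_pos allowed_nonneg by blast

text \<open>These monomials span the socle of the algebra.\<close>

definition maxl :: "(nat \<Rightarrow> int) \<Rightarrow> bool" where
 "maxl p \<longleftrightarrow> p \<in> S \<and> (\<forall>m<n. p + uv m \<notin> S)"

lemma w_maxl: "maxl p \<Longrightarrow> w p = 0"
 using w_nonneg[of p] S_nonneg unfolding maxl_def by auto

lemma not_maxl_w: "p \<in> S \<Longrightarrow> \<not> maxl p \<Longrightarrow> 0 < w p"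
 unfolding maxl_def using w_posI S_nonneg by blast

lemma maxl_ge: assumes "maxl p" "q \<in> S" "p \<le> q" shows "q = p"
proof (rule ccontr)
 assume "q \<noteq> p"
 then obtain m where "1 \<le> (q - p) m" using nonneg_neq_0[of "q - p"] assms
  by (auto simp: le_fun_def fun_eq_iff)
 then have m: "p m < q m" by simp
 have "0 \<le> p m" using assms S_nonneg_at unfolding maxl_def by auto
 with m have "m < n" using S_Zn[OF assms(2)] Zn_ge[of q n m] by auto
 have "p + uv m \<le> q" using assms m by (auto simp: le_fun_def uv_apply)
 moreover have "0 \<le> p + uv m"
  using assms S_nonneg le_add_uv unfolding maxl_def by (blast intro: order_trans)
 ultimately have "p + uv m \<in> S" using S_down[OF assms(2)] by blast
 with \<open>m < n\<close> show False using assms unfolding maxl_def by auto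
qed

lemma ex_maxl: assumes "p \<in> S" shows "\<exists>q. maxl q \<and> p \<le> q"
proof -
 obtain q where q: "q \<in> S" "p \<le> q" "\<forall>r\<in>S. q \<le> r \<longrightarrow> q = r"
  using finite_has_maximal2[OF finite_S assms] by metis
 have "q + uv m \<notin> S" for m
 proof
  assume "q + uv m \<in> S"
  then have "q = q + uv m" using q(3) by (auto simp: le_fun_def uv_apply)
  then show False by simp
 qed
 then show ?thesis using q unfolding maxl_def by auto
qed

text \<open>A socle monomial is killed by every variable, so one may send x_m to it and all other
  monomials to 0. Maximality of \<open>p\<close> is what makes this compatible with the
  relations.\<close>

lemma allowed_maxl:
 assumes "maxl p" "m < n" shows "allowed n S (p - uv m) m"
proof -
 have "q \<in> S" if q: "0 \<le> q" "1 \<le> q m" "q + (p - uv m) \<in> S" for q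
 proof -
  have "uv m \<le> q" using q uv_le_iff by auto
  then have "p \<le> q + (p - uv m)" by (auto simp: le_fun_def)
  then have "q + (p - uv m) = p" using maxl_ge assms q by auto
  then have "q = uv m" by (auto simp: fun_eq_iff)
  then show ?thesis using S_uv assms by auto
 qed
 moreover have "p - uv m + uv m \<in> S" using assms unfolding maxl_def by simp
 ultimately show ?thesis using assms(2) unfolding allowed_def by blast
qed

lemma w_maxl_diff: "maxl p \<Longrightarrow> m < n \<Longrightarrow> 0 < w (p - uv m)"
 using allowed_maxl w_pos by blast

text \<open>The compatibility condition inside \<open>allowed\<close>, applied to
  \<open>p - a\<close>: a standard monomial above the image of x_m can be moved back along the
  derivation.\<close>

lemma allowedD: "allowed n S a m \<Longrightarrow> p \<in> S \<Longrightarrow> a + uv m \<le> p \<Longrightarrow> p - a \<in> S"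
proof -
 assume a: "allowed n S a m" "p \<in> S" "a + uv m \<le> p"
 have "uv m \<le> p - a"
 proof (rule le_funI)
  show "uv m x \<le> (p - a) x" for x using le_funD[OF a(3), of x] by simp
 qed
 have "0 \<le> p - a" by (rule order_trans[OF uv_nonneg \<open>uv m \<le> p - a\<close>])
 moreover have "1 \<le> (p - a) m" using le_funD[OF \<open>uv m \<le> p - a\<close>, of m] by simp
 moreover have "p - a \<in> Zn n"
 proof -
  have "a + uv m \<in> Zn n" "m < n" using a(1) S_Zn allowed_S by blast+
  then have "a \<in> Zn n" using Zn_diff[of "a + uv m" n "uv m"] by auto
  then show ?thesis using S_Zn a by auto
 qed
 moreover have "p - a + a \<in> S" using a by simp
 ultimately show ?thesis using a(1) unfolding allowed_def by blast
qed

text \<open>Phrased through multiplicities alone, so that every weight-preserving lattice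
  isomorphism respects it. The second alternative catches variables all of whose multiples are their
  own powers, such as x in K[x]/(x^4), where the multiplicity is only 1.\<close>

definition bigv :: "(nat \<Rightarrow> int) \<Rightarrow> bool" where
 "bigv a \<longleftrightarrow> 2 \<le> w a \<or> (1 \<le> w a \<and> 1 \<le> w (a + a))"

text \<open>A negative coordinate forces multiplicity at most 1, and doubling makes it at most -2,
  which no weight can have.\<close>

lemma bigv_nonneg: assumes "bigv a" shows "0 \<le> a"
proof (rule ccontr)
 assume "\<not> 0 \<le> a"
 then obtain m where m: "a m < 0" by (auto simp: le_fun_def not_le)
 then have "w a \<le> 1" by (rule w_neg_le_1)
 then have "1 \<le> w (a + a)" using assms unfolding bigv_def by auto
 then have "0 < w (a + a)" by linarith
 from w_pos_ge[OF this, of m] have "-1 \<le> a m + a m" unfolding plus_fun_apply .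
 then show False using m by linarith
qed

lemma bigv_uv: assumes "bigv a" "1 \<le> a m" shows "bigv (uv m)"
proof -
 have "uv m \<le> a" using bigv_nonneg[OF assms(1)] assms uv_le_iff by auto
 then have "w a \<le> w (uv m)" "w (a + a) \<le> w (uv m + uv m)"
  using w_antimono[OF uv_nonneg] w_antimono[OF add_nonneg_nonneg[OF uv_nonneg uv_nonneg] add_mono]
  by blast+
 then show ?thesis using assms unfolding bigv_def by linarith
qed

text \<open>The thick variables. Their unit vectors are the ones that a weight-preserving
  isomorphism must send to unit vectors, see \<open>big_unit\<close>.\<close>

definition K :: "nat set" where "K = {i. i < n \<and> bigv (uv i)}"

lemma K_less: "i \<in> K \<Longrightarrow> i < n" by (simp add: K_def)
lemma finite_K [simp]: "finite K" by (rule finite_subset[of _ "{..<n}"]) (auto simp: K_def)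

lemma K_w: "i \<in> K \<Longrightarrow> 0 < w (uv i)" unfolding K_def bigv_def by (elim CollectE conjE disjE) linarith+
lemma K_not_maxl: "i \<in> K \<Longrightarrow> \<not> maxl (uv i)"
 using K_w[of i] w_maxl[of "uv i"] by linarith

end

section \<open>Thin variables and their chains\<close>

definition vsc :: "int \<Rightarrow> (nat \<Rightarrow> int) \<Rightarrow> nat \<Rightarrow> int" where
 "vsc q v = (\<lambda>x. q * v x)"

lemma vsc_apply [simp]: "vsc q v x = q * v x" by (simp add: vsc_def)
lemma vsc_0 [simp]: "vsc 0 v = 0" by (simp add: fun_eq_iff)
lemma vsc_1 [simp]: "vsc 1 v = v" by (simp add: fun_eq_iff)
lemma vsc_add: "vsc (a + b) v = vsc a v + vsc b v" by (simp add: fun_eq_iff algebra_simps)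
lemma vsc_nonneg: "0 \<le> q \<Longrightarrow> 0 \<le> v \<Longrightarrow> 0 \<le> vsc q v" by (simp add: le_fun_def)
lemma vsc_mono: "a \<le> b \<Longrightarrow> 0 \<le> v \<Longrightarrow> vsc a v \<le> vsc b v"
 by (simp add: le_fun_def mult_right_mono)
lemma vsc_Zn [simp]: "v \<in> Zn n \<Longrightarrow> vsc q v \<in> Zn n" by (simp add: Zn_def)

lemma le_step:
 assumes "0 \<le> q" "q \<le> p" "p \<in> Zn n" "q \<noteq> p"
 shows "\<exists>m<n. q + uv m \<le> p"
proof -
 have "0 \<le> p - q" "p - q \<noteq> 0" using assms by auto
 then obtain m where m: "1 \<le> (p - q) m" using nonneg_neq_0 by blast
 then have "q + uv m \<le> p" using assms(2) by (auto simp: le_fun_def uv_def)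
 moreover have "p m \<noteq> 0" using m le_funD[OF assms(1), of m] by auto
 then have "m < n" using assms(3) Zn_ge by blast
 ultimately show ?thesis by auto
qed

context staircase
begin

text \<open>Since \<open>w (uv i)\<close> is at most 1, at most one variable j has a nonzero product
  with x_i, and no other variable can occur in a standard multiple of x_i. If there is no such
  variable, the convention is \<open>j = i\<close> and \<open>Q = 0\<close>. If
  \<open>j = i\<close>, the second clause of \<open>bigv\<close> stops the chain at the
  square.\<close>

lemma thin_ex:
 assumes i: "i < n" "i \<notin> K"
 shows "\<exists>j Q. j < n \<and> 0 \<le> Q \<and> (j = i \<longrightarrow> Q \<le> 1) \<and> (Q = 0 \<longrightarrow> j = i) \<and>
  (\<forall>p\<in>S. 1 \<le> p i \<longrightarrow> (\<exists>q\<ge>0. p = uv i + vsc q (uv j))) \<and>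
  (\<forall>q\<ge>0. uv i + vsc q (uv j) \<in> S \<longleftrightarrow> q \<le> Q)"
proof (cases "\<exists>m<n. uv i + uv m \<in> S")
 case False
 have "p = uv i" if "p \<in> S" "1 \<le> p i" for p
 proof (rule ccontr)
  assume "p \<noteq> uv i"
  moreover have "uv i \<le> p" using that S_nonneg uv_le_iff by blast
  ultimately obtain m where "m < n" "uv i + uv m \<le> p"
   using le_step[OF uv_nonneg _ S_Zn[OF \<open>p \<in> S\<close>]] by metis
  then show False using False S_down[OF that(1)] by (meson add_nonneg_nonneg uv_nonneg)
 qed
 note only = this
 have mem: "uv i + vsc q (uv i) \<in> S \<longleftrightarrow> q \<le> 0" if "0 \<le> q" for q
 proof
  assume a: "uv i + vsc q (uv i) \<in> S"
  have "1 \<le> (uv i + vsc q (uv i)) i" using that by simp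
  then have "uv i + vsc q (uv i) = uv i" using only a by blast
  then have "(uv i + vsc q (uv i)) i = uv i i" by (rule fun_cong)
  then show "q \<le> 0" using that by (simp add: uv_apply)
 next
  assume "q \<le> 0" then show "uv i + vsc q (uv i) \<in> S" using S_uv that i by simp
 qed
 have form: "\<exists>q\<ge>0. p = uv i + vsc q (uv i)" if "p \<in> S" "1 \<le> p i" for p
  using only[OF that] by (intro exI[of _ 0]) (simp add: fun_eq_iff)
 show ?thesis
  by (intro exI[of _ i] exI[of _ "0::int"], intro conjI ballI impI allI)
   (rule i(1) order_refl zero_le_one refl form mem; assumption?)+
next
 case True
 then obtain j where j: "j < n" "uv i + uv j \<in> S" by auto
 have w1: "w (uv i) = 1" "w (uv i + uv i) = 0"
  using i w_posI[OF uv_nonneg j] unfolding K_def bigv_def mem_Collect_eq by linarith+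
 have uniq: "m = j" if "uv i + uv m \<in> S" for m
 proof -
  have m: "m < n"
  proof (rule Zn_ge[OF S_Zn[OF that]])
   show "(uv i + uv m) m \<noteq> 0" by (simp add: uv_apply)
  qed
  have "card {m. m < n \<and> uv i + uv m \<in> S} = 1" using w1(1) w_nonneg[of "uv i"] by simp
  then obtain c where "{m. m < n \<and> uv i + uv m \<in> S} = {c}" using card_1_singletonE by blast
  moreover have "m \<in> {m. m < n \<and> uv i + uv m \<in> S}" "j \<in> {m. m < n \<and> uv i + uv m \<in> S}"
   using m j that by simp_all
  ultimately show ?thesis by simp
 qed
 have form: "\<exists>q\<ge>0. p = uv i + vsc q (uv j)" if p: "p \<in> S" "1 \<le> p i" for p
 proof -
  have le: "uv i \<le> p" using p S_nonneg uv_le_iff by blast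
  have "(p - uv i) x = 0" if "x \<noteq> j" for x
  proof (rule ccontr)
   assume "(p - uv i) x \<noteq> 0"
   then have "1 \<le> (p - uv i) x" using le_funD[OF le, of x] by simp
   then have "uv i + uv x \<le> p" using le by (auto simp: le_fun_def uv_def)
   then have "uv i + uv x \<in> S" using S_down[OF p(1)] by (meson add_nonneg_nonneg uv_nonneg)
   then show False using uniq that by blast
  qed
  then have "p = uv i + vsc ((p - uv i) j) (uv j)" by (auto simp: fun_eq_iff uv_apply)
  moreover have "0 \<le> (p - uv i) j" using le_funD[OF le, of j] by simp
  ultimately show ?thesis by blast
 qed
 define X where "X = {q. 0 \<le> q \<and> uv i + vsc q (uv j) \<in> S}"
 have "(\<lambda>q. uv i + vsc q (uv j)) ` X \<subseteq> S" unfolding X_def by auto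
 moreover have "inj_on (\<lambda>q. uv i + vsc q (uv j)) X"
 proof (rule inj_onI)
  fix a b assume "uv i + vsc a (uv j) = uv i + vsc b (uv j)"
  then have "vsc a (uv j) j = vsc b (uv j) j" by simp
  then show "a = b" by simp
 qed
 ultimately have "finite X" using finite_S finite_imageD finite_subset by metis
 moreover have "1 \<in> X" unfolding X_def using j by simp
 ultimately have Q: "Max X \<in> X" "1 \<le> Max X" "\<And>q. q \<in> X \<Longrightarrow> q \<le> Max X"
  using Max_in Max_ge by blast+
 have "uv i + vsc q (uv j) \<in> S \<longleftrightarrow> q \<le> Max X" if "0 \<le> q" for q
 proof
  assume "uv i + vsc q (uv j) \<in> S" then show "q \<le> Max X" using Q(3) that X_def by blast
 next
  assume "q \<le> Max X"
  then have "uv i + vsc q (uv j) \<le> uv i + vsc (Max X) (uv j)"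
   by (intro add_left_mono vsc_mono) auto
  moreover have "0 \<le> uv i + vsc q (uv j)" by (intro add_nonneg_nonneg vsc_nonneg that uv_nonneg)
  moreover have "uv i + vsc (Max X) (uv j) \<in> S" using Q(1) unfolding X_def by blast
  ultimately show "uv i + vsc q (uv j) \<in> S" using S_down by blast
 qed
 note mem = this
 have "Max X \<le> 1" if "j = i"
 proof (rule ccontr)
  assume "\<not> Max X \<le> 1"
  then have "uv i + vsc 2 (uv i) \<in> S" using mem[of 2] that by simp
  moreover have "uv i + vsc 2 (uv i) = uv i + uv i + uv i" by (simp add: fun_eq_iff)
  ultimately have "0 < w (uv i + uv i)" using w_posI[of "uv i + uv i" i] i
   by (metis add_nonneg_nonneg uv_nonneg)
  then show False using w1 by simp
 qed
 note self = this
 have "0 \<le> Max X" "Max X = 0 \<longrightarrow> j = i" using Q(2) by linarith+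
 then show ?thesis using j(1) self
  by (intro exI[of _ j] exI[of _ "Max X"], intro conjI ballI impI allI) (assumption | erule mp | rule form mem self; assumption)+
qed

definition J :: "nat \<Rightarrow> nat" where
 "J i = (SOME j. \<exists>Q. j < n \<and> 0 \<le> Q \<and> (j = i \<longrightarrow> Q \<le> 1) \<and> (Q = 0 \<longrightarrow> j = i) \<and>
  (\<forall>p\<in>S. 1 \<le> p i \<longrightarrow> (\<exists>q\<ge>0. p = uv i + vsc q (uv j))) \<and>
  (\<forall>q\<ge>0. uv i + vsc q (uv j) \<in> S \<longleftrightarrow> q \<le> Q))"

definition Q :: "nat \<Rightarrow> int" where
 "Q i = (SOME Q. J i < n \<and> 0 \<le> Q \<and> (J i = i \<longrightarrow> Q \<le> 1) \<and> (Q = 0 \<longrightarrow> J i = i) \<and>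
  (\<forall>p\<in>S. 1 \<le> p i \<longrightarrow> (\<exists>q\<ge>0. p = uv i + vsc q (uv (J i)))) \<and>
  (\<forall>q\<ge>0. uv i + vsc q (uv (J i)) \<in> S \<longleftrightarrow> q \<le> Q))"

definition top :: "nat \<Rightarrow> nat \<Rightarrow> int" where
 "top i = uv i + vsc (Q i) (uv (J i))"

lemma thin:
 assumes "i < n" "i \<notin> K"
 shows thin_J: "J i < n" and thin_Q: "0 \<le> Q i" and thin_self: "J i = i \<Longrightarrow> Q i \<le> 1"
  and thin_Q0: "Q i = 0 \<Longrightarrow> J i = i"
  and thin_form: "p \<in> S \<Longrightarrow> 1 \<le> p i \<Longrightarrow> \<exists>q\<ge>0. q \<le> Q i \<and> p = uv i + vsc q (uv (J i))"
  and thin_mem: "0 \<le> q \<Longrightarrow> uv i + vsc q (uv (J i)) \<in> S \<longleftrightarrow> q \<le> Q i"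
proof -
 have "J i < n \<and> 0 \<le> Q i \<and> (J i = i \<longrightarrow> Q i \<le> 1) \<and> (Q i = 0 \<longrightarrow> J i = i) \<and>
  (\<forall>p\<in>S. 1 \<le> p i \<longrightarrow> (\<exists>q\<ge>0. p = uv i + vsc q (uv (J i)))) \<and>
  (\<forall>q\<ge>0. uv i + vsc q (uv (J i)) \<in> S \<longleftrightarrow> q \<le> Q i)"
  unfolding Q_def by (rule someI_ex, unfold J_def, rule someI_ex, rule thin_ex[OF assms])
 then have c: "J i < n" "0 \<le> Q i" "J i = i \<longrightarrow> Q i \<le> 1" "Q i = 0 \<longrightarrow> J i = i"
  "\<forall>p\<in>S. 1 \<le> p i \<longrightarrow> (\<exists>q\<ge>0. p = uv i + vsc q (uv (J i)))"
  "\<forall>q\<ge>0. uv i + vsc q (uv (J i)) \<in> S \<longleftrightarrow> q \<le> Q i" by blast+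
 show "J i < n" "0 \<le> Q i" "J i = i \<Longrightarrow> Q i \<le> 1" "Q i = 0 \<Longrightarrow> J i = i"
  "0 \<le> q \<Longrightarrow> uv i + vsc q (uv (J i)) \<in> S \<longleftrightarrow> q \<le> Q i"
  using c by blast+
 assume p: "p \<in> S" "1 \<le> p i"
 then obtain q where "0 \<le> q" "p = uv i + vsc q (uv (J i))" using c(5) by blast
 then show "\<exists>q\<ge>0. q \<le> Q i \<and> p = uv i + vsc q (uv (J i))" using c(6) p(1) by blast
qed

lemma thin_le_top:
 assumes "i < n" "i \<notin> K" "p \<in> S" "1 \<le> p i" shows "p \<le> top i"
proof -
 obtain q where "0 \<le> q" "q \<le> Q i" "p = uv i + vsc q (uv (J i))" using thin_form[OF assms] by blast
 then show ?thesis unfolding top_def by (intro ord_eq_le_trans[OF _ add_left_mono[OF vsc_mono]]) auto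
qed

lemma top_S: "i < n \<Longrightarrow> i \<notin> K \<Longrightarrow> top i \<in> S"
 unfolding top_def using thin_mem thin_Q by blast

lemma top_apply_self: "i < n \<Longrightarrow> i \<notin> K \<Longrightarrow> 1 \<le> top i i"
 unfolding top_def using thin_Q[of i] by (simp add: uv_apply)

lemma maxl_top: assumes "i < n" "i \<notin> K" shows "maxl (top i)"
 unfolding maxl_def
proof (intro conjI allI impI notI)
 show "top i \<in> S" using top_S assms .
 fix m assume "top i + uv m \<in> S"
 moreover have "1 \<le> (top i + uv m) i" using top_apply_self[OF assms] uv_nonneg_at[of m i] by (simp add: add_increasing2)
 ultimately have "top i + uv m \<le> top i" using thin_le_top assms by blast
 from le_funD[OF this, of m] show False by simp
qed

text \<open>The product of x_i and its thin partner must lie on the chains of both, so each is the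
  partner of the other and neither can be multiplied further. The two variables form a block cut off
  from all others.\<close>

lemma box:
 assumes i: "i < n" "i \<notin> K" and j: "J i \<notin> K" "J i \<noteq> i"
 shows "Q i = 1" "J (J i) = i" "Q (J i) = 1"
proof -
 have Q1: "1 \<le> Q i" using thin_Q[OF i] thin_Q0[OF i] j by linarith
 have jn: "J i < n" using thin_J[OF i] .
 have "uv i + vsc 1 (uv (J i)) \<in> S" using thin_mem[OF i, of 1] Q1 by simp
 then have *: "uv i + uv (J i) \<in> S" by simp
 moreover have "1 \<le> (uv i + uv (J i)) (J i)" by (simp add: uv_apply)
 ultimately obtain q where q: "0 \<le> q" "q \<le> Q (J i)" "uv i + uv (J i) = uv (J i) + vsc q (uv (J (J i)))"
  using thin_form[OF jn j(1)] by blast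
 then have eq: "uv i = vsc q (uv (J (J i)))" by (metis add.commute add_left_cancel)
 have "J (J i) = i"
 proof (rule ccontr)
  assume "J (J i) \<noteq> i"
  then have "vsc q (uv (J (J i))) i = 0" by (simp add: uv_apply)
  then show False using eq by (metis uv_same zero_neq_one)
 qed
 then show JJ: "J (J i) = i" .
 have "Q x \<le> 1" if x: "x < n" "x \<notin> K" "J x \<notin> K" "J x \<noteq> x" "J x < n" "J (J x) = x" for x
 proof (rule ccontr)
  assume "\<not> Q x \<le> 1"
  then have "uv x + vsc 2 (uv (J x)) \<in> S" using thin_mem[OF x(1,2), of 2] by simp
  moreover have "1 \<le> (uv x + vsc 2 (uv (J x))) (J x)" by (simp add: uv_apply)
  ultimately obtain r where "uv x + vsc 2 (uv (J x)) = uv (J x) + vsc r (uv x)"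
   using thin_form[OF x(5,3)] x(6) by metis
  from fun_cong[OF this, of "J x"] show False using x(4) by (simp add: uv_apply)
 qed
 from this[of i] this[of "J i"] have "Q i \<le> 1" "Q (J i) \<le> 1" using i j jn JJ by auto
 moreover have "1 \<le> Q (J i)" using q eq
  by (metis JJ fun_cong mult.right_neutral uv_same vsc_apply)
 ultimately show "Q i = 1" "Q (J i) = 1" using Q1 by auto
qed

end

section \<open>Lattice isomorphisms that preserve multiplicities\<close>

locale wpair = A: staircase n S + B: staircase n S' for n S S' +
 fixes \<psi> \<psi>' :: "(nat \<Rightarrow> int) \<Rightarrow> nat \<Rightarrow> int"
 assumes map_add: "a \<in> Zn n \<Longrightarrow> b \<in> Zn n \<Longrightarrow> \<psi> (a + b) = \<psi> a + \<psi> b"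
  and map_add': "a \<in> Zn n \<Longrightarrow> b \<in> Zn n \<Longrightarrow> \<psi>' (a + b) = \<psi>' a + \<psi>' b"
  and closed: "a \<in> Zn n \<Longrightarrow> \<psi> a \<in> Zn n"
  and closed': "a \<in> Zn n \<Longrightarrow> \<psi>' a \<in> Zn n"
  and inv: "a \<in> Zn n \<Longrightarrow> \<psi>' (\<psi> a) = a"
  and inv': "a \<in> Zn n \<Longrightarrow> \<psi> (\<psi>' a) = a"
  and weight: "a \<in> Zn n \<Longrightarrow> wt n S' (\<psi> a) = wt n S a"

sublocale wpair \<subseteq> swap: wpair n S' S \<psi>' \<psi>
 by unfold_locales (auto simp: map_add map_add' closed closed' inv inv' weight[symmetric])

context wpair
begin

lemma map_0: "\<psi> 0 = 0"
 using map_add[of 0 0] by (metis Zn_0 add.right_neutral add_left_cancel)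

lemma map_diff: "a \<in> Zn n \<Longrightarrow> b \<in> Zn n \<Longrightarrow> \<psi> (a - b) = \<psi> a - \<psi> b"
 using map_add[of "a - b" b] by (metis Zn_diff add_diff_cancel diff_add_cancel)

lemma map_uminus: "a \<in> Zn n \<Longrightarrow> \<psi> (- a) = - \<psi> a"
 using map_diff[of 0 a] map_0 by simp

lemma bigv_map: "a \<in> Zn n \<Longrightarrow> A.bigv a \<Longrightarrow> B.bigv (\<psi> a)"
 unfolding A.bigv_def B.bigv_def by (metis Zn_add map_add weight)

lemma nonneg_map:
 assumes "0 \<le> v" "v \<in> Zn n" "\<And>m. 1 \<le> v m \<Longrightarrow> m < n \<Longrightarrow> A.bigv (uv m)"
 shows "0 \<le> \<psi> v"
 using assms(1,2)
proof (induction rule: Zn_nonneg_induct)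
 case zero then show ?case by (simp only: map_0 order_refl)
next
 case (add w i)
 have "1 \<le> v i" using le_funD[OF add(3), of i] le_funD[OF add(1), of i] by simp
 then have "0 \<le> \<psi> (uv i)" using assms(3) add(2) bigv_map B.bigv_nonneg by blast
 moreover have "w \<in> Zn n" using Zn_le[of w v] add(1,3) assms(2) le_add_uv order_trans by blast
 ultimately show ?case using add(2,4) map_add[OF \<open>w \<in> Zn n\<close> Zn_uv[OF add(2)]] add_nonneg_nonneg by metis
qed

end

context wpair
begin

text \<open>The image of \<open>uv i\<close> is big, hence nonnegative, and so is every unit below
  it. Pulling back a splitting of the image into a unit and a rest splits \<open>uv i\<close> into
  nonnegative vectors; as unit vectors are indecomposable, the rest is 0.\<close>

lemma big_unit:
 assumes "i \<in> A.K" shows "\<exists>m\<in>B.K. \<psi> (uv i) = uv m"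
proof -
 define a where "a = \<psi> (uv i)"
 have i: "i < n" "A.bigv (uv i)" using assms unfolding A.K_def by auto
 have big: "B.bigv a" unfolding a_def by (rule bigv_map[OF Zn_uv[OF i(1)] i(2)])
 have aZ: "a \<in> Zn n" unfolding a_def by (rule closed[OF Zn_uv[OF i(1)]])
 have a0: "0 \<le> a" by (rule B.bigv_nonneg[OF big])
 have ia: "\<psi>' a = uv i" unfolding a_def using inv i by blast
 have "a \<noteq> 0"
 proof
  assume "a = 0"
  then have "uv i = 0" using ia swap.map_0 by metis
  then show False using uv_neq_0 by blast
 qed
 then obtain m where m: "1 \<le> a m" using nonneg_neq_0[OF a0] by blast
 then have "a m \<noteq> 0" by linarith
 then have mn: "m < n" by (rule Zn_ge[OF aZ])
 have bigs: "B.bigv (uv x)" if "1 \<le> a x" for x by (rule B.bigv_uv[OF big that])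
 have "uv m \<le> a" using uv_le_iff[OF a0] m by blast
 then have "0 \<le> a - uv m" by simp
 moreover have "a - uv m \<in> Zn n" by (intro Zn_diff aZ Zn_uv mn)
 moreover have "B.bigv (uv x)" if "1 \<le> (a - uv m) x" for x
  using that bigs[of x] uv_nonneg_at[of m x] by simp
 ultimately have 1: "0 \<le> \<psi>' (a - uv m)" by (rule swap.nonneg_map)
 have 2: "0 \<le> \<psi>' (uv m)" by (rule A.bigv_nonneg[OF swap.bigv_map[OF Zn_uv[OF mn] bigs[OF m]]])
 have sum: "uv i = \<psi>' (a - uv m) + \<psi>' (uv m)"
  using map_add'[OF \<open>a - uv m \<in> Zn n\<close> Zn_uv[OF mn]] ia by simp
 have "\<psi>' (uv m) \<noteq> 0" using inv'[OF Zn_uv[OF mn]] map_0 uv_neq_0 by metis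
 then obtain x where x: "1 \<le> \<psi>' (uv m) x" using nonneg_neq_0 2 by blast
 have "\<psi>' (a - uv m) y = 0" for y
 proof -
  have "uv i y = \<psi>' (a - uv m) y + \<psi>' (uv m) y" for y using fun_cong[OF sum, of y] by simp
  from this[of x] this[of y] x show ?thesis
   using le_funD[OF 1, of x] le_funD[OF 2, of x] le_funD[OF 1, of y] le_funD[OF 2, of y]
   by (cases "x = y") (auto simp: uv_apply split: if_splits)
 qed
 then have "\<psi>' (a - uv m) = 0" by (simp add: fun_eq_iff)
 then have "a - uv m = 0" using inv'[OF \<open>a - uv m \<in> Zn n\<close>] map_0 by metis
 then have "a = uv m" by simp
 then show ?thesis using bigs[OF m] mn unfolding a_def B.K_def by blast
qed

end

lemma Zn_pos_neg:
 assumes "v \<in> Zn n"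
 obtains a b where "0 \<le> a" "a \<in> Zn n" "0 \<le> b" "b \<in> Zn n" "v = a - b"
  "\<And>x. v x = 0 \<Longrightarrow> a x = 0 \<and> b x = 0"
proof
 let ?a = "\<lambda>x. max 0 (v x)" and ?b = "\<lambda>x. max 0 (- v x)"
 show "0 \<le> ?a" "0 \<le> ?b" by (auto intro!: le_funI)
 show "?a \<in> Zn n" "?b \<in> Zn n" using assms by (auto simp: Zn_def)
 show "v = ?a - ?b" by (auto simp: fun_eq_iff max_def)
 show "v x = 0 \<Longrightarrow> ?a x = 0 \<and> ?b x = 0" for x by simp
qed

lemma sum_uv: "finite A \<Longrightarrow> (\<Sum>i\<in>A. uv m i) = (if m \<in> A then 1 else 0)"
 by (simp add: uv_def)

section \<open>The sublattice of the thick variables\<close>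

context staircase
begin

definition ZK :: "(nat \<Rightarrow> int) set" where
 "ZK = {v \<in> Zn n. \<forall>i. i \<notin> K \<longrightarrow> v i = 0}"

definition thins :: "nat set" where "thins = {i. i < n \<and> i \<notin> K}"

definition deg_thin :: "(nat \<Rightarrow> int) \<Rightarrow> int" where
 "deg_thin v = (\<Sum>i\<in>thins. v i)"

text \<open>The share of the thin variables in the multiplicity of a nonnegative weight, as made
  explicit in \<open>w_split\<close>.\<close>

definition nu :: "(nat \<Rightarrow> int) \<Rightarrow> nat" where
 "nu p = card {i \<in> thins. p + uv i \<in> S}"

definition max0 :: "(nat \<Rightarrow> int) set" where
 "max0 = {p \<in> ZK. maxl p}"

lemma finite_thins [simp]: "finite thins" by (simp add: thins_def)
lemma ZK_Zn: "v \<in> ZK \<Longrightarrow> v \<in> Zn n" by (simp add: ZK_def)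
lemma ZK_at: "v \<in> ZK \<Longrightarrow> i \<notin> K \<Longrightarrow> v i = 0" by (simp add: ZK_def)
lemma ZK_add: "a \<in> ZK \<Longrightarrow> b \<in> ZK \<Longrightarrow> a + b \<in> ZK" by (simp add: ZK_def)
lemma ZK_diff: "a \<in> ZK \<Longrightarrow> b \<in> ZK \<Longrightarrow> a - b \<in> ZK" by (simp add: ZK_def)
lemma ZK_uv: "z \<in> K \<Longrightarrow> uv z \<in> ZK" using K_less by (auto simp: ZK_def uv_apply)
lemma ZK_0: "0 \<in> ZK" by (simp add: ZK_def)
lemma ZK_vsc: "v \<in> ZK \<Longrightarrow> vsc q v \<in> ZK" by (simp add: ZK_def)

lemma deg_thin_add: "deg_thin (a + b) = deg_thin a + deg_thin b"
 by (simp add: deg_thin_def sum.distrib)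
lemma deg_thin_diff: "deg_thin (a - b) = deg_thin a - deg_thin b"
 by (simp add: deg_thin_def sum_subtractf)
lemma deg_thin_uv: "deg_thin (uv i) = (if i \<in> thins then 1 else 0)"
 by (simp add: deg_thin_def sum_uv)
lemma deg_thin_ZK: "v \<in> ZK \<Longrightarrow> deg_thin v = 0"
 by (simp add: deg_thin_def thins_def ZK_def)

lemma ZK_if_deg_thin: "0 \<le> v \<Longrightarrow> v \<in> Zn n \<Longrightarrow> deg_thin v \<le> 0 \<Longrightarrow> v \<in> ZK"
proof -
 assume v: "0 \<le> v" "v \<in> Zn n" "deg_thin v \<le> 0"
 have nn: "0 \<le> v i" for i using le_funD[OF v(1), of i] by simp
 have "v i = 0" if "i \<notin> K" for i
 proof (cases "i < n")
  case True
  have "v i \<le> deg_thin v" unfolding deg_thin_def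
   by (rule member_le_sum) (use True that nn in \<open>auto simp: thins_def\<close>)
  then show ?thesis using v(3) nn[of i] by linarith
 next
  case False then show ?thesis using v(2) by (simp add: Zn_def)
 qed
 then show ?thesis using v(2) unfolding ZK_def by blast
qed

text \<open>A plain partial derivative would turn the relation saying that x_l kills a socle
  monomial into a nonzero multiple of that monomial.\<close>

lemma not_allowed_0: "\<not> allowed n S (- uv l) l"
proof
 assume a: "allowed n S (- uv l) l"
 obtain p where p: "maxl p" using ex_maxl[OF S_0] by blast
 have "p \<in> S" using p maxl_def by blast
 moreover have "- uv l + uv l \<le> p" using S_nonneg[OF \<open>p \<in> S\<close>] by simp
 ultimately have "p - (- uv l) \<in> S" using allowedD[OF a] by blast
 then have "p + uv l \<in> S" by simp
 moreover have "l < n" using allowed_S(1)[OF a] .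
 ultimately show False using p maxl_def by blast
qed

text \<open>If a thin x divided \<open>p\<close>, then \<open>p\<close> and \<open>p - a\<close>
  would both lie on the chain of x, which runs along a thick variable dividing
  \<open>a + uv l\<close>. Such a chain has no room for a second thin factor, but
  \<open>p - a\<close> has gained a factor x_l.\<close>

lemma allowed_thin:
 assumes a: "allowed n S a l" "l \<notin> K" "a + uv l \<in> ZK" and p: "p \<in> S" "a + uv l \<le> p"
 shows "p \<in> ZK"
proof (rule ccontr)
 assume "p \<notin> ZK"
 then obtain x where "x \<notin> K" "p x \<noteq> 0" using S_Zn[OF p(1)] unfolding ZK_def by blast
 then have x: "x < n" "x \<notin> K" "1 \<le> p x"
  using Zn_ge[OF S_Zn[OF p(1)]] S_nonneg_at[OF p(1), of x] by auto
 define g where "g = a + uv l"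
 have g: "g \<in> S" "g \<le> p" "g \<in> ZK" using a p allowed_S unfolding g_def by blast+
 have "g \<noteq> 0"
 proof
  assume "g = 0"
  then have "a = - uv l" unfolding g_def by (simp add: eq_neg_iff_add_eq_0)
  then show False using not_allowed_0 a(1) by blast
 qed
 then obtain z where z: "1 \<le> g z" using nonneg_neq_0[OF S_nonneg[OF g(1)]] by blast
 have zK: "z \<in> K" using ZK_at[OF g(3), of z] z by (cases "z \<in> K") auto
 obtain q where q: "0 \<le> q" "p = uv x + vsc q (uv (J x))" using thin_form[OF x(1,2) p(1) x(3)] by blast
 have "1 \<le> p z" using z le_funD[OF g(2), of z] by linarith
 then have Jx: "J x = z" using fun_cong[OF q(2), of z] zK x(2) by (auto simp: uv_apply split: if_splits)
 have r: "p - a \<in> S" using allowedD[OF a(1) p] .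
 have pa: "(p - a) y = p y - g y + uv l y" for y unfolding g_def by simp
 have "1 \<le> (p - a) x" using pa[of x] x ZK_at[OF g(3) x(2)] uv_nonneg_at[of l x] by linarith
 then obtain q' where q': "p - a = uv x + vsc q' (uv z)" using thin_form[OF x(1,2) r] Jx by blast
 have "z \<noteq> x" "z \<noteq> l" using zK x a by auto
 have "1 \<le> (p - a) l" using pa[of l] ZK_at[OF g(3) a(2)] S_nonneg_at[OF p(1), of l] by simp
 moreover have "(p - a) l = uv x l" using fun_cong[OF q', of l] \<open>z \<noteq> l\<close> by (simp add: uv_apply)
 ultimately have "x = l" by (auto simp: uv_apply split: if_splits)
 moreover have "(p - a) x = 1" using fun_cong[OF q', of x] \<open>z \<noteq> x\<close> by (simp add: uv_apply)
 ultimately show False using pa[of x] x(3) ZK_at[OF g(3) x(2)] by simp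
qed

text \<open>A weight of negative thin degree comes from a derivation sending a thin variable to a
  purely thick monomial. By \<open>allowed_thin\<close> a maximal monomial above that one would be
  purely thick too.\<close>

lemma deg_thin_nonneg:
 assumes "max0 = {}" "0 < w a" "a \<in> Zn n" shows "0 \<le> deg_thin a"
proof (rule ccontr)
 assume neg: "\<not> 0 \<le> deg_thin a"
 have "\<exists>l\<in>thins. a l < 0"
 proof (rule ccontr)
  assume "\<not> ?thesis"
  then have "0 \<le> deg_thin a" unfolding deg_thin_def by (intro sum_nonneg) (auto simp: not_less)
  then show False using neg by blast
 qed
 then obtain l where l: "l < n" "l \<notin> K" "a l < 0" unfolding thins_def by blast
 note al = w_pos_neg(1,4)[OF assms(2) l(3)]
 have "deg_thin (a + uv l) \<le> 0" using neg l by (simp add: deg_thin_add deg_thin_uv thins_def)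
 then have g: "a + uv l \<in> ZK" using ZK_if_deg_thin S_nonneg S_Zn al(2) by blast
 obtain p where p: "maxl p" "a + uv l \<le> p" using ex_maxl[OF al(2)] by blast
 then have "p \<in> S" unfolding maxl_def by blast
 then have "p \<in> ZK" using allowed_thin[OF al(1) l(2) g] p(2) by blast
 then show False using p(1) assms(1) unfolding max0_def by blast
qed

text \<open>A standard \<open>b\<close> is a weight unless it is maximal, and then
  \<open>b - uv z\<close> is one. Conversely, \<open>b z = 0\<close> makes \<open>b - uv z\<close>
  negative at \<open>z\<close>, so a derivation of that weight can only send x_z to the monomial
  \<open>b\<close>. Membership is thereby expressed through multiplicities.\<close>

lemma nonfull_iff:
 assumes "b \<in> ZK" "0 \<le> b" "z \<in> K" "b z = 0"
 shows "b \<in> S \<longleftrightarrow> 0 < w b \<or> 0 < w (b - uv z)"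
proof
 assume b: "b \<in> S"
 show "0 < w b \<or> 0 < w (b - uv z)"
 proof (cases "maxl b")
  case True show ?thesis by (rule disjI2[OF w_maxl_diff[OF True K_less[OF assms(3)]]])
 next
  case False show ?thesis by (rule disjI1[OF not_maxl_w[OF b False]])
 qed
next
 assume "0 < w b \<or> 0 < w (b - uv z)"
 then show "b \<in> S"
 proof
  assume "0 < w b" then show ?thesis by (rule w_pos_nonneg_S[OF _ assms(2)])
 next
  assume a: "0 < w (b - uv z)"
  have "(b - uv z) z < 0" using assms(4) by simp
  from w_pos_neg(4)[OF a this] have "b - uv z + uv z \<in> S" .
  moreover have "b - uv z + uv z = b" by (rule diff_add_cancel)
  ultimately show ?thesis by (rule back_subst[of "\<lambda>x. x \<in> S"])
 qed
qed

lemma w_split: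
 assumes "0 \<le> p" shows "w p = card {z \<in> K. p + uv z \<in> S} + nu p"
proof -
 have "{m. m < n \<and> p + uv m \<in> S} = {z \<in> K. p + uv z \<in> S} \<union> {i \<in> thins. p + uv i \<in> S}"
  using K_less by (auto simp: thins_def)
 moreover have "card ({z \<in> K. p + uv z \<in> S} \<union> {i \<in> thins. p + uv i \<in> S}) =
   card {z \<in> K. p + uv z \<in> S} + card {i \<in> thins. p + uv i \<in> S}"
  by (rule card_Un_disjoint) (auto simp: thins_def)
 ultimately show ?thesis using w_nonneg[OF assms] by (simp add: nu_def)
qed

lemma nu_pos:
 assumes "0 < nu p" obtains i where "i \<in> thins" "p + uv i \<in> S"
proof -
 have "{i \<in> thins. p + uv i \<in> S} \<noteq> {}" using assms unfolding nu_def by (metis card.empty less_irrefl)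
 then show ?thesis using that by blast
qed

lemma nu_pos_form:
 assumes "i \<in> thins" "p + uv i \<in> S" "p \<in> ZK"
 obtains q where "0 \<le> q" "q \<le> Q i" "p = vsc q (uv (J i))" "p \<noteq> 0 \<Longrightarrow> J i \<in> K"
proof -
 have i: "i < n" "i \<notin> K" using assms unfolding thins_def by auto
 have "1 \<le> (p + uv i) i" using ZK_at[OF assms(3) i(2)] by simp
 then obtain q where q: "0 \<le> q" "q \<le> Q i" "p + uv i = uv i + vsc q (uv (J i))"
  using thin_form[OF i assms(2)] by blast
 then have p: "p = vsc q (uv (J i))" by (metis add.commute add_left_cancel)
 have "J i \<in> K" if "p \<noteq> 0"
 proof (rule ccontr)
  assume "J i \<notin> K"
  then have "p (J i) = 0" using ZK_at[OF assms(3)] by blast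
  then have "q = 0" using p by simp
  then show False using p that by simp
 qed
 then show ?thesis using that q p by blast
qed

text \<open>The chain of a thin variable runs along a single variable.\<close>

lemma nu_two_zero:
 assumes "p \<in> ZK" "y1 \<noteq> y2" "1 \<le> p y1" "1 \<le> p y2" shows "nu p = 0"
proof (rule ccontr)
 assume "nu p \<noteq> 0"
 then obtain i where i: "i \<in> thins" "p + uv i \<in> S" using nu_pos by blast
 then obtain q where "p = vsc q (uv (J i))" using nu_pos_form assms(1) by metis
 from fun_cong[OF this, of y1] fun_cong[OF this, of y2] show False
  using assms by (auto simp: uv_apply split: if_splits)
qed

end

section \<open>Pairs of staircases with the thick variables already matched\<close>

locale fpair = wpair +
 assumes K_eq: "B.K = A.K" and fixK: "z \<in> A.K \<Longrightarrow> \<psi> (uv z) = uv z"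

sublocale fpair \<subseteq> fswap: fpair n S' S \<psi>' \<psi>
proof unfold_locales
 show "A.K = B.K" using K_eq by simp
 fix z assume "z \<in> B.K"
 then show "\<psi>' (uv z) = uv z" using K_eq fixK[of z] inv[OF Zn_uv, of z] A.K_less by metis
qed

context fpair
begin

abbreviation KK where "KK \<equiv> A.K"

lemma ZK_eq: "B.ZK = A.ZK" unfolding A.ZK_def B.ZK_def K_eq ..
lemma thins_eq: "B.thins = A.thins" unfolding A.thins_def B.thins_def K_eq ..
lemma deg_thin_eq: "B.deg_thin = A.deg_thin" unfolding A.deg_thin_def B.deg_thin_def thins_eq ..

lemma fix_ZK: assumes "v \<in> A.ZK" shows "\<psi> v = v"
proof -
 have nn: "\<psi> a = a" if "0 \<le> a" "a \<in> Zn n" "\<And>x. v x = 0 \<Longrightarrow> a x = 0" for a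
  using that(1,2)
 proof (induction rule: Zn_nonneg_induct)
  case zero then show ?case by (rule map_0)
 next
  case (add w i)
  have "1 \<le> a i" using le_funD[OF add(3), of i] le_funD[OF add(1), of i] by simp
  then have "i \<in> KK" using that(3)[of i] A.ZK_at[OF assms, of i] by (cases "i \<in> KK") auto
  then have "\<psi> (uv i) = uv i" by (rule fixK)
  moreover have "w \<in> Zn n" using Zn_le[of w a] add(1,3) that(2) le_add_uv order_trans by blast
  ultimately show ?case using add(2,4) map_add[of w "uv i"] Zn_uv by metis
 qed
 obtain a b where ab: "0 \<le> a" "a \<in> Zn n" "0 \<le> b" "b \<in> Zn n" "v = a - b"
  "\<And>x. v x = 0 \<Longrightarrow> a x = 0 \<and> b x = 0" using Zn_pos_neg[OF A.ZK_Zn[OF assms]] by metis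
 have "\<psi> a = a" "\<psi> b = b" using nn ab by blast+
 then show ?thesis using map_diff[OF ab(2,4)] ab(5) by simp
qed

lemma w_fix: "v \<in> A.ZK \<Longrightarrow> B.w v = A.w v"
 using weight[OF A.ZK_Zn] fix_ZK by metis

lemma nonfull_eq:
 assumes "b \<in> A.ZK" "0 \<le> b" "z \<in> KK" "b z = 0" shows "b \<in> S \<longleftrightarrow> b \<in> S'"
 using A.nonfull_iff[OF assms] B.nonfull_iff[of b z] assms w_fix[of b] w_fix[of "b - uv z"]
  A.ZK_diff[OF assms(1) A.ZK_uv[OF assms(3)]] by (simp add: K_eq ZK_eq)

end

context fpair
begin

text \<open>If some thick variable is missing, \<open>nonfull_eq\<close> decides. Otherwise equal
  multiplicities at \<open>a = b - uv z\<close> give equally many thick extensions of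
  \<open>a\<close> in both sets. All of these except \<open>b\<close> have smaller exponent at
  \<open>z\<close> and agree by induction, hence \<open>b\<close> agrees too.\<close>

lemma coincide_if_nu:
 assumes z: "z \<in> KK"
  and nu: "\<And>a. 0 \<le> a \<Longrightarrow> a \<in> A.ZK \<Longrightarrow> a \<noteq> 0 \<Longrightarrow> (\<And>y. y \<in> KK - {z} \<Longrightarrow> 1 \<le> a y) \<Longrightarrow> A.nu a = B.nu a"
 shows "b \<in> A.ZK \<Longrightarrow> 0 \<le> b \<Longrightarrow> b \<in> S \<longleftrightarrow> b \<in> S'"
proof (induction "nat (b z)" arbitrary: b rule: less_induct)
 case less
 note bK = less(2) and b0 = less(3)
 have nn: "0 \<le> b x" for x using le_funD[OF b0, of x] by simp
 show ?case
 proof (cases "\<exists>y\<in>KK. b y = 0")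
  case True then show ?thesis using nonfull_eq bK b0 by blast
 next
  case False
  then have full: "1 \<le> b y" if "y \<in> KK" for y using False that nn[of y] by (cases "b y = 0") auto
  define a where "a = b - uv z"
  have aK: "a \<in> A.ZK" unfolding a_def by (rule A.ZK_diff[OF bK A.ZK_uv[OF z]])
  have a0: "0 \<le> a" unfolding a_def using uv_le_iff[OF b0, of z] full[OF z] by simp
  have b: "b = a + uv z" unfolding a_def by simp
  show ?thesis
  proof (cases "a = 0")
   case True
   then have "b = uv z" using b by simp
   then show ?thesis using A.S_uv B.S_uv A.K_less[OF z] by blast
  next
   case a: False
   have "1 \<le> a y" if "y \<in> KK - {z}" for y using that full[of y] unfolding a_def by (simp add: uv_apply)
   then have nus: "A.nu a = B.nu a" using nu[OF a0 aK a] by blast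
   have eq: "a + uv y \<in> S \<longleftrightarrow> a + uv y \<in> S'" if "y \<in> KK - {z}" for y
   proof (rule less(1))
    show "nat ((a + uv y) z) < nat (b z)" using that full[OF z] unfolding a_def by (simp add: uv_apply)
    show "a + uv y \<in> A.ZK" using A.ZK_add[OF aK A.ZK_uv] that by blast
    show "0 \<le> a + uv y" using a0 le_add_uv order_trans by blast
   qed
   have "card {y \<in> KK. a + uv y \<in> S} = card {y \<in> KK. a + uv y \<in> S'}"
    using A.w_split[OF a0] B.w_split[OF a0] nus w_fix[OF aK] by (simp add: K_eq)
   moreover have "card {y \<in> KK. a + uv y \<in> T} = card {y \<in> KK - {z}. a + uv y \<in> T} + (if a + uv z \<in> T then 1 else 0)" for T
   proof (cases "a + uv z \<in> T")
    case True
    then have "{y \<in> KK. a + uv y \<in> T} = insert z {y \<in> KK - {z}. a + uv y \<in> T}" using z by auto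
    then show ?thesis using True by simp
   next
    case False
    then have "{y \<in> KK. a + uv y \<in> T} = {y \<in> KK - {z}. a + uv y \<in> T}" by auto
    then show ?thesis using False by simp
   qed
   moreover have "{y \<in> KK - {z}. a + uv y \<in> S} = {y \<in> KK - {z}. a + uv y \<in> S'}" using eq by blast
   ultimately have "(if a + uv z \<in> S then 1 else 0) = (if a + uv z \<in> S' then 1 else (0::nat))" by simp
   then show ?thesis using b by (simp split: if_splits)
  qed
 qed
qed

text \<open>A vector that is full outside \<open>z\<close> now involves two variables, which
  excludes thin extensions on both sides.\<close>

lemma coincide_ge3:
 assumes "3 \<le> card KK" "b \<in> A.ZK" "0 \<le> b" shows "b \<in> S \<longleftrightarrow> b \<in> S'"
proof -
 have "KK \<noteq> {}" using assms(1) by auto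
 then obtain z where z: "z \<in> KK" by blast
 have c: "2 \<le> card (KK - {z})" using assms(1) z by simp
 then have "KK - {z} \<noteq> {}" by (metis card.empty not_numeral_le_zero)
 then obtain y1 where y1: "y1 \<in> KK - {z}" by blast
 then have "1 \<le> card (KK - {z} - {y1})" using c by simp
 then have "KK - {z} - {y1} \<noteq> {}" by (metis card.empty not_one_le_zero)
 then obtain y2 where "y2 \<in> KK - {z} - {y1}" by blast
 with y1 have y: "y1 \<in> KK - {z}" "y2 \<in> KK - {z}" "y1 \<noteq> y2" by simp_all
 show ?thesis
 proof (rule coincide_if_nu[OF z _ assms(2,3)])
  fix a assume a: "a \<in> A.ZK" "\<And>y. y \<in> KK - {z} \<Longrightarrow> 1 \<le> a y"
  have "A.nu a = 0" by (rule A.nu_two_zero[OF a(1) y(3) a(2)[OF y(1)] a(2)[OF y(2)]])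
  moreover have "B.nu a = 0" by (rule B.nu_two_zero[OF _ y(3) a(2)[OF y(1)] a(2)[OF y(2)]]) (use a ZK_eq in blast)
  ultimately show "A.nu a = B.nu a" by simp
 qed
qed

text \<open>If \<open>A.max0\<close> were empty, all weights of S would have nonnegative thin
  degree. Pulling back the weights \<open>m - uv k\<close> and \<open>uv k\<close> (or
  \<open>uv k - uv z\<close>) of S' then forces thin degree 0 on every
  \<open>\<psi>' (uv k)\<close>, although \<open>\<psi>'\<close> is onto and thin variables
  exist.\<close>

lemma max0_transfer:
 assumes "KK \<noteq> {}" "A.thins \<noteq> {}" "B.max0 \<noteq> {}" shows "A.max0 \<noteq> {}"
proof
 assume e: "A.max0 = {}"
 obtain z where z: "z \<in> KK" using assms(1) by blast
 obtain m where m: "m \<in> A.ZK" "B.maxl m" using assms(3) ZK_eq unfolding B.max0_def by blast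
 have pos: "0 \<le> A.deg_thin (\<psi>' a)" if "0 < B.w a" "a \<in> Zn n" for a
  using A.deg_thin_nonneg[OF e, of "\<psi>' a"] closed'[OF that(2)] that swap.weight[OF that(2)] by simp
 have unit: "A.deg_thin (\<psi>' (uv k)) = 0" if k: "k < n" for k
 proof (cases "k \<in> KK")
  case True
  then have "\<psi>' (uv k) = uv k" using fswap.fixK K_eq by blast
  then show ?thesis using A.deg_thin_uv True A.thins_def by simp
 next
  case False
  have "\<psi>' (m - uv k) = m - \<psi>' (uv k)"
   using swap.map_diff[OF A.ZK_Zn[OF m(1)] Zn_uv[OF k]] fswap.fix_ZK[of m] m ZK_eq by simp
  then have "A.deg_thin (\<psi>' (uv k)) \<le> 0"
   using pos[OF B.w_maxl_diff[OF m(2) k]] A.ZK_Zn[OF m(1)] k A.deg_thin_ZK[OF m(1)]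
   by (simp add: A.deg_thin_diff)
  moreover have "0 \<le> A.deg_thin (\<psi>' (uv k))"
  proof (cases "B.maxl (uv k)")
   case True
   have "\<psi>' (uv k - uv z) = \<psi>' (uv k) - uv z"
    using swap.map_diff[OF Zn_uv[OF k] Zn_uv[OF A.K_less[OF z]]] fswap.fixK[of z] z K_eq by simp
   moreover have "A.deg_thin (uv z) = 0" using A.deg_thin_ZK[OF A.ZK_uv[OF z]] .
   ultimately show ?thesis using pos[OF B.w_maxl_diff[OF True A.K_less[OF z]]] k A.K_less[OF z]
    by (simp add: A.deg_thin_diff)
  next
   case False
   then have "0 < B.w (uv k)" using B.not_maxl_w B.S_uv[OF k] by blast
   then show ?thesis using pos k by blast
  qed
  ultimately show ?thesis by simp
 qed
 have nn: "A.deg_thin (\<psi>' a) = 0" if "0 \<le> a" "a \<in> Zn n" for a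
  using that
 proof (induction rule: Zn_nonneg_induct)
  case zero then show ?case using A.deg_thin_ZK[OF A.ZK_0] by (simp only: swap.map_0)
 next
  case (add w i)
  have "w \<in> Zn n" using Zn_le[of w a] add(1,3) that(2) le_add_uv order_trans by blast
  then have "\<psi>' (w + uv i) = \<psi>' w + \<psi>' (uv i)" using map_add' Zn_uv[OF add(2)] by blast
  then show ?case using add(4) unit[OF add(2)] by (simp only: A.deg_thin_add)
 qed
 obtain i where i: "i \<in> A.thins" using assms(2) by blast
 then have "i < n" unfolding A.thins_def by blast
 then obtain a b where ab: "0 \<le> a" "a \<in> Zn n" "0 \<le> b" "b \<in> Zn n" "\<psi> (uv i) = a - b"
  using Zn_pos_neg[OF closed[OF Zn_uv]] by metis
 have "uv i = \<psi>' a - \<psi>' b" using inv[OF Zn_uv[OF \<open>i < n\<close>]] ab swap.map_diff by metis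
 then have "A.deg_thin (uv i) = 0" using nn[OF ab(1,2)] nn[OF ab(3,4)] by (simp add: A.deg_thin_diff)
 then show False using i A.deg_thin_uv by simp
qed

end

context fpair
begin

text \<open>At the last power of x_j in S the missing thick extension has to be compensated by a
  thin one, so S has no purely thick maximal monomial. In S' the next power is maximal, because its
  multiplicity can be computed in S, where it is not standard. This contradicts
  \<open>max0_transfer\<close>.\<close>

lemma coincide_card1_aux:
 assumes K: "KK = {j}" and b: "b \<in> A.ZK" "0 \<le> b" "b \<in> S'" "b \<notin> S" shows False
proof -
 have bj: "b = vsc (b j) (uv j)" using A.ZK_at[OF b(1)] K by (auto simp: fun_eq_iff uv_apply)
 have jn: "j < n" using A.K_less K by blast
 have bnn: "0 \<le> b j" using le_funD[OF b(2), of j] by simp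
 define X where "X = {q. 0 \<le> q \<and> vsc q (uv j) \<in> S}"
 have X: "q < b j" if "q \<in> X" for q
 proof (rule ccontr)
  assume "\<not> q < b j"
  then have "b \<le> vsc q (uv j)" using bj vsc_mono[of "b j" q "uv j"] by simp
  then show False using A.S_down that b unfolding X_def by blast
 qed
 then have "X \<subseteq> {0..<b j}" unfolding X_def by auto
 then have fin: "finite X" using finite_subset by blast
 have X1: "1 \<in> X" unfolding X_def using A.S_uv[OF jn] by simp
 define a where "a = Max X"
 have a: "a \<in> X" "1 \<le> a" using Max_in[OF fin] Max_ge[OF fin X1] X1 unfolding a_def by blast+
 have aS: "vsc a (uv j) \<in> S" using a(1) unfolding X_def by blast
 have suc: "vsc a (uv j) + uv j = vsc (a + 1) (uv j)" by (simp add: vsc_add)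
 have nS: "vsc (a + 1) (uv j) \<notin> S"
 proof
  assume "vsc (a + 1) (uv j) \<in> S"
  then have "a + 1 \<in> X" using a(2) unfolding X_def by simp
  then show False using Max_ge[OF fin] unfolding a_def by fastforce
 qed
 have S': "vsc (a + 1) (uv j) \<in> S'"
 proof (rule B.S_down[OF b(3)])
  show "0 \<le> vsc (a + 1) (uv j)" using a(2) by (intro vsc_nonneg) auto
  show "vsc (a + 1) (uv j) \<le> b" using X[OF a(1)] bj vsc_mono[of "a + 1" "b j" "uv j"] by simp
 qed
 have ZKv: "vsc q (uv j) \<in> A.ZK" for q using A.ZK_vsc[OF A.ZK_uv] K by blast
 have nn: "0 \<le> vsc a (uv j)" "0 \<le> vsc (a + 1) (uv j)" using a(2) by (auto intro!: vsc_nonneg)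
 have "card {z \<in> KK. vsc a (uv j) + uv z \<in> S} = 0" using K nS suc by auto
 moreover have "{z \<in> KK. vsc a (uv j) + uv z \<in> S'} = {j}" using K S' suc by auto
 then have "card {z \<in> KK. vsc a (uv j) + uv z \<in> S'} = 1" by simp
 ultimately have "A.nu (vsc a (uv j)) = 1 + B.nu (vsc a (uv j))"
  using A.w_split[OF nn(1)] B.w_split[OF nn(1)] w_fix[OF ZKv[of a]] unfolding K_eq by linarith
 then have "0 < A.nu (vsc a (uv j))" by linarith
 then obtain i where i: "i \<in> A.thins" "vsc a (uv j) + uv i \<in> S" by (rule A.nu_pos)
 have "A.max0 = {}"
 proof (rule ccontr)
  assume "A.max0 \<noteq> {}"
  then obtain p where p: "p \<in> A.ZK" "A.maxl p" unfolding A.max0_def by blast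
  have pS: "p \<in> S" using p A.maxl_def by blast
  have pj: "p = vsc (p j) (uv j)" using A.ZK_at[OF p(1)] K by (auto simp: fun_eq_iff uv_apply)
  then have "vsc (p j) (uv j) \<in> S" using pS by metis
  then have "p j \<in> X" using A.S_nonneg_at[OF pS] unfolding X_def by blast
  then have "p j \<le> a" using Max_ge[OF fin] unfolding a_def by blast
  then have "vsc (p j) (uv j) \<le> vsc a (uv j)" by (rule vsc_mono[OF _ uv_nonneg])
  then have "p \<le> vsc a (uv j)" by (subst pj)
  then have "p + uv i \<le> vsc a (uv j) + uv i" by (rule add_right_mono)
  moreover have "0 \<le> p + uv i" using A.S_nonneg[OF pS] le_add_uv order_trans by blast
  ultimately have "p + uv i \<in> S" using A.S_down[OF i(2)] by blast
  then show False using p(2) i(1) unfolding A.maxl_def A.thins_def by blast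
 qed
 moreover have "B.maxl (vsc (a + 1) (uv j))"
 proof (rule ccontr)
  assume "\<not> ?thesis"
  then have "0 < B.w (vsc (a + 1) (uv j))" using B.not_maxl_w[OF S'] by blast
  then have "0 < A.w (vsc (a + 1) (uv j))" using w_fix[OF ZKv] by simp
  then show False using A.w_pos_nonneg_S[OF _ nn(2)] nS by blast
 qed
 then have "B.max0 \<noteq> {}" using ZKv ZK_eq unfolding B.max0_def by blast
 ultimately show False using max0_transfer K i(1) by blast
qed

end

context fpair
begin

lemma coincide_card1:
 assumes "card KK = 1" "b \<in> A.ZK" "0 \<le> b" shows "b \<in> S \<longleftrightarrow> b \<in> S'"
proof -
 obtain j where K: "KK = {j}" using assms(1) card_1_singletonE by blast
 then have "B.K = {j}" using K_eq by simp
 then show ?thesis using coincide_card1_aux[OF K assms(2,3)] fswap.coincide_card1_aux[of j b] assms(2,3) ZK_eq by blast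
qed

end

section \<open>Matching the large variables\<close>

context staircase
begin

text \<open>The bounds \<open>top i - uv z\<close> are weights themselves by
  \<open>w_maxl_diff\<close>, so this finds the maximal weights in the coset of \<open>uv i\<close>
  modulo the thick lattice. The differentiated variable must be thick because the chain of x_i
  admits no second thin factor.\<close>

lemma root_plus_chain:
 assumes i: "i < n" "i \<notin> K" "J i \<in> K \<or> Q i = 0" and a: "0 < w a" "\<And>x. x \<notin> K \<Longrightarrow> a x = uv i x"
 shows "\<exists>z\<in>K. a \<le> top i - uv z"
proof -
 obtain m where m: "allowed n S a m" using a(1) w_pos by blast
 define g where "g = a + uv m"
 have gS: "g \<in> S" unfolding g_def by (rule allowed_S(2)[OF m])
 have gx: "g x = uv i x + uv m x" if "x \<notin> K" for x using a(2)[OF that] unfolding g_def by simp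
 have gi: "1 \<le> g i" using gx[OF i(2)] by simp
 obtain q where q: "0 \<le> q" "q \<le> Q i" "g = uv i + vsc q (uv (J i))" using thin_form[OF i(1,2) gS gi] by blast
 have "m \<in> K"
 proof (rule ccontr)
  assume mK: "m \<notin> K"
  have "uv m m = q * uv (J i) m" using gx[OF mK] fun_cong[OF q(3), of m] by simp
  then have "q \<noteq> 0" "J i = m" by (auto simp: uv_apply split: if_splits)
  then show False using i(3) mK q by auto
 qed
 moreover have "a = g - uv m" unfolding g_def by (rule eq_diff_eq[THEN iffD2, OF refl])
 ultimately show ?thesis using thin_le_top[OF i(1,2) gS gi] diff_right_mono by blast
qed

text \<open>Any other weight of the coset would send a thick x_m to x_i. As x_i has a nonzero
  product with its partner, x_m would have one with that partner as well, but the partner has no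
  thick multiples.\<close>

lemma root_plus_isolated:
 assumes i: "i < n" "i \<notin> K" "J i \<notin> K" "Q i \<noteq> 0" and a: "0 < w a" "\<And>x. x \<notin> K \<Longrightarrow> a x = uv i x"
 shows "a = uv i"
proof -
 obtain m where m: "allowed n S a m" using a(1) w_pos by blast
 define g where "g = a + uv m"
 have gS: "g \<in> S" unfolding g_def by (rule allowed_S(2)[OF m])
 have gx: "g x = uv i x + uv m x" if "x \<notin> K" for x using a(2)[OF that] unfolding g_def by simp
 have gi: "1 \<le> g i" using gx[OF i(2)] by simp
 obtain q where q: "0 \<le> q" "q \<le> Q i" "g = uv i + vsc q (uv (J i))" using thin_form[OF i(1,2) gS gi] by blast
 have gK: "g x = 0" if "x \<in> K" for x using fun_cong[OF q(3), of x] that i by (auto simp: uv_apply)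
 have ag: "a x = g x - uv m x" for x unfolding g_def by simp
 have "m \<notin> K"
 proof
  assume mK: "m \<in> K"
  have "J i \<noteq> m" using mK i by auto
  then have "q * 1 = 0" using gx[OF i(3)] fun_cong[OF q(3), of "J i"] by (simp add: uv_apply)
  then have "q = 0" by simp
  then have g: "g = uv i" using q(3) by simp
  have p: "uv i + uv (J i) \<in> S" using thin_mem[OF i(1,2), of 1] thin_Q[OF i(1,2)] i(4) by simp
  have "a + uv m \<le> uv i + uv (J i)" using g unfolding g_def by simp
  from allowedD[OF m p this] have r: "uv i + uv (J i) - a \<in> S" .
  have rx: "(uv i + uv (J i) - a) x = uv (J i) x + uv m x" for x
   using ag[of x] g by simp
  have "1 \<le> (uv i + uv (J i) - a) (J i)" using rx[of "J i"] by simp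
  then obtain q' where eq: "uv i + uv (J i) - a = uv (J i) + vsc q' (uv (J (J i)))"
   using thin_form[OF thin_J[OF i(1,2)] i(3) r] by blast
  have "uv (J i) m + uv m m = uv (J i) m + q' * uv (J (J i)) m"
   using rx[of m] fun_cong[OF eq, of m] by (simp only: plus_fun_apply vsc_apply)
  then have "q' * uv (J (J i)) m = 1" by simp
  then have "J (J i) = m" by (auto simp: uv_apply split: if_splits)
  moreover have "J (J i) \<notin> K" using box(2)[OF i(1,2,3)] i by (cases "J i = i") auto
  ultimately show False using mK by blast
 qed
 have "a x = uv i x" for x
 proof (cases "x \<in> K")
  case True
  then have "x \<noteq> m" "x \<noteq> i" using \<open>m \<notin> K\<close> i by auto
  then show ?thesis using ag[of x] gK[OF True] by (simp add: uv_apply)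
 next
  case False then show ?thesis by (rule a(2))
 qed
 then show ?thesis by (rule ext)
qed

text \<open>Such a derivation sends x_l to a purely thick monomial, and by
  \<open>allowed_thin\<close> every maximal monomial above it is purely thick. So the maximal
  weights of this coset record \<open>max0\<close>.\<close>

lemma root_minus:
 assumes l: "l \<notin> K" and a: "0 < w a" "\<And>x. x \<notin> K \<Longrightarrow> a x = - uv l x"
 shows "\<exists>p\<in>max0. a \<le> p - uv l"
proof -
 have "a l < 0" using a(2)[OF l] by simp
 note al = w_pos_neg(1,4)[OF a(1) this]
 have g: "a + uv l \<in> ZK" using S_Zn[OF al(2)] a(2) unfolding ZK_def by simp
 obtain p where p: "maxl p" "a + uv l \<le> p" using ex_maxl[OF al(2)] by blast
 then have "p \<in> S" unfolding maxl_def by blast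
 then have "p \<in> max0" using allowed_thin[OF al(1) l g _ p(2)] p(1) unfolding max0_def by blast
 moreover have "a \<le> p - uv l" using p(2) by (simp add: le_diff_eq)
 ultimately show ?thesis by blast
qed

lemma max0_antichain: "p \<in> max0 \<Longrightarrow> q \<in> max0 \<Longrightarrow> p \<le> q \<Longrightarrow> p = q"
 using maxl_ge[of p q] unfolding max0_def maxl_def by blast

lemma w_max0: "p \<in> max0 \<Longrightarrow> l < n \<Longrightarrow> 0 < w (p - uv l)"
 using w_maxl_diff[of p l] unfolding max0_def by blast

end

section \<open>Exactly two thick variables\<close>

locale fpair2 = fpair +
 fixes z1 z2 :: nat
 assumes K2: "A.K = {z1, z2}" and z12: "z1 \<noteq> z2"

context fpair2
begin

definition pt :: "int \<Rightarrow> int \<Rightarrow> nat \<Rightarrow> int" where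
 "pt x y = vsc x (uv z1) + vsc y (uv z2)"

lemma z1K: "z1 \<in> KK" and z2K: "z2 \<in> KK" using K2 by auto
lemma z1n: "z1 < n" and z2n: "z2 < n" using A.K_less z1K z2K by auto

lemma pt_z1 [simp]: "pt x y z1 = x" and pt_z2 [simp]: "pt x y z2 = y"
 using z12 by (auto simp: pt_def uv_apply)

lemma pt_ZK [simp]: "pt x y \<in> A.ZK"
 unfolding pt_def by (intro A.ZK_add A.ZK_vsc A.ZK_uv z1K z2K)

lemma ZK_pt: "v \<in> A.ZK \<Longrightarrow> v = pt (v z1) (v z2)"
 using A.ZK_at[of v] K2 z12 by (auto simp: pt_def fun_eq_iff uv_apply)

lemma ZK_ext: "u \<in> A.ZK \<Longrightarrow> v \<in> A.ZK \<Longrightarrow> u z1 = v z1 \<Longrightarrow> u z2 = v z2 \<Longrightarrow> u = v"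
 using ZK_pt by metis

lemma pt_nonneg: "0 \<le> x \<Longrightarrow> 0 \<le> y \<Longrightarrow> 0 \<le> pt x y"
 unfolding pt_def by (intro add_nonneg_nonneg vsc_nonneg) auto

lemma pt_mono: "x \<le> x' \<Longrightarrow> y \<le> y' \<Longrightarrow> pt x y \<le> pt x' y'"
 unfolding pt_def by (intro add_mono vsc_mono) auto

lemma pt_add1: "pt x y + uv z1 = pt (x + 1) y" and pt_add2: "pt x y + uv z2 = pt x (y + 1)"
 by (simp_all add: pt_def vsc_add algebra_simps)

lemma ZK_le: "u \<in> A.ZK \<Longrightarrow> v \<in> A.ZK \<Longrightarrow> u z1 \<le> v z1 \<Longrightarrow> u z2 \<le> v z2 \<Longrightarrow> u \<le> v"
 using ZK_pt pt_mono by metis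

lemma wA: assumes "0 \<le> x" "0 \<le> y"
 shows "A.w (pt x y) = of_bool (pt (x + 1) y \<in> S) + of_bool (pt x (y + 1) \<in> S) + A.nu (pt x y)"
proof -
 have "{z \<in> KK. pt x y + uv z \<in> S} =
   (if pt (x + 1) y \<in> S then {z1} else {}) \<union> (if pt x (y + 1) \<in> S then {z2} else {})"
  using K2 pt_add1[of x y] pt_add2[of x y] by auto
 then have "card {z \<in> KK. pt x y + uv z \<in> S} = of_bool (pt (x + 1) y \<in> S) + of_bool (pt x (y + 1) \<in> S)"
  using z12 by simp
 then show ?thesis using A.w_split[OF pt_nonneg[OF assms]] by simp
qed

lemma nuA: "1 \<le> x \<Longrightarrow> 1 \<le> y \<Longrightarrow> A.nu (pt x y) = 0"
 using A.nu_two_zero[OF pt_ZK z12] by simp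

lemma fpair2_swap: "fpair2 n S' S \<psi>' \<psi> z1 z2"
 by unfold_locales (use K2 z12 K_eq in auto)

lemma fpair2_flip: "fpair2 n S S' \<psi> \<psi>' z2 z1"
 by unfold_locales (use K2 z12 in auto)

lemma max0_pt:
 assumes "p \<in> A.max0" shows "p \<in> S" "p \<in> A.ZK" "A.maxl p" "p = pt (p z1) (p z2)" "0 \<le> p z1" "0 \<le> p z2"
 using assms ZK_pt A.S_nonneg_at[of p] unfolding A.max0_def A.maxl_def by blast+

lemma z2_not_max0: "uv z2 \<notin> A.max0"
 using A.K_not_maxl[OF z2K] unfolding A.max0_def by blast

end

context fpair2
begin

interpretation sw: fpair2 n S' S \<psi>' \<psi> z1 z2 by (rule fpair2_swap)

lemma wB: assumes "0 \<le> x" "0 \<le> y"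
 shows "A.w (pt x y) = of_bool (pt (x + 1) y \<in> S') + of_bool (pt x (y + 1) \<in> S') + B.nu (pt x y)"
 using sw.wA[OF assms] w_fix[OF pt_ZK] unfolding pt_def sw.pt_def by simp

lemma nuB: "1 \<le> x \<Longrightarrow> 1 \<le> y \<Longrightarrow> B.nu (pt x y) = 0"
 using sw.nuA unfolding pt_def sw.pt_def by simp

lemma nonfull_pt: "0 \<le> x \<Longrightarrow> 0 \<le> y \<Longrightarrow> x = 0 \<or> y = 0 \<Longrightarrow> pt x y \<in> S \<longleftrightarrow> pt x y \<in> S'"
 using nonfull_eq[OF pt_ZK pt_nonneg z1K] nonfull_eq[OF pt_ZK pt_nonneg z2K] by auto

text \<open>Interior points have no thin extensions, so the two neighbours above
  \<open>pt x y\<close> are counted equally often in S and in S'. A discrepancy at one neighbour is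
  therefore balanced by the opposite discrepancy at the other.\<close>

lemma antidiag_step:
 assumes "1 \<le> x" "1 \<le> y"
 shows "((pt (x + 1) y \<in> S) \<noteq> (pt (x + 1) y \<in> S')) = ((pt x (y + 1) \<in> S) \<noteq> (pt x (y + 1) \<in> S'))"
  and "(pt (x + 1) y \<in> S) \<noteq> (pt (x + 1) y \<in> S') \<Longrightarrow> (pt x (y + 1) \<in> S) = (pt (x + 1) y \<notin> S)"
proof -
 have "of_bool (pt (x + 1) y \<in> S) + of_bool (pt x (y + 1) \<in> S) =
   of_bool (pt (x + 1) y \<in> S') + (of_bool (pt x (y + 1) \<in> S') :: nat)"
  using wA[of x y] wB[of x y] nuA[of x y] nuB[of x y] assms by simp
 then show "((pt (x + 1) y \<in> S) \<noteq> (pt (x + 1) y \<in> S')) = ((pt x (y + 1) \<in> S) \<noteq> (pt x (y + 1) \<in> S'))"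
  "(pt (x + 1) y \<in> S) \<noteq> (pt (x + 1) y \<in> S') \<Longrightarrow> (pt x (y + 1) \<in> S) = (pt (x + 1) y \<notin> S)"
  by (auto simp: of_bool_def split: if_splits)
qed

lemma antidiag:
 assumes "1 \<le> x" "x < D" "1 \<le> x'" "x' < D" "(pt x (D - x) \<in> S) \<noteq> (pt x (D - x) \<in> S')"
 shows "(pt x' (D - x') \<in> S) \<noteq> (pt x' (D - x') \<in> S')"
proof -
 let ?d = "\<lambda>x. (pt x (D - x) \<in> S) \<noteq> (pt x (D - x) \<in> S')"
 have "?d (1 + int k) = ?d 1" if "1 + int k < D" for k
  using that
 proof (induction k)
  case (Suc k)
  have "?d (1 + int k + 1) = ?d (1 + int k)"
   using antidiag_step(1)[of "1 + int k" "D - (1 + int k) - 1"] Suc(2)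
   by (simp add: algebra_simps)
  then show ?case using Suc by (simp add: algebra_simps)
 qed simp
 from this[of "nat (x - 1)"] this[of "nat (x' - 1)"] assms show ?thesis by simp
qed

end

context fpair2
begin

interpretation sw: fpair2 n S' S \<psi>' \<psi> z1 z2 by (rule fpair2_swap)

text \<open>Increase x until the point lies just under the bad antidiagonal. There exactly one of
  the two neighbours belongs to S, so the multiplicity is positive, and it only grows on the way
  back down.\<close>

lemma interior_below:
 assumes "1 \<le> x0" "x0 < D" "(pt x0 (D - x0) \<in> S) \<noteq> (pt x0 (D - x0) \<in> S')"
  and "1 \<le> x" "1 \<le> y" "x + y < D"
 shows "0 < A.w (pt x y)"
proof -
 define u where "u = D - 1 - y"
 have u: "1 \<le> u" "x \<le> u" using assms unfolding u_def by auto
 have "(pt (u + 1) (D - (u + 1)) \<in> S) \<noteq> (pt (u + 1) (D - (u + 1)) \<in> S')"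
  by (rule antidiag[OF assms(1,2) _ _ assms(3)]) (use u assms u_def in auto)
 then have d: "(pt (u + 1) y \<in> S) \<noteq> (pt (u + 1) y \<in> S')" unfolding u_def by simp
 have "pt (u + 1) y \<in> S \<or> pt u (y + 1) \<in> S" using antidiag_step(2)[OF u(1) assms(5) d] by blast
 then have "0 < A.w (pt u y)" using wA[of u y] u assms by auto
 moreover have "A.w (pt u y) \<le> A.w (pt x y)"
  by (rule A.w_antimono[OF pt_nonneg pt_mono]) (use u assms in auto)
 ultimately show ?thesis by linarith
qed

text \<open>It suffices to exclude a point of S on the next antidiagonal. If it also lies in S',
  both sets contain a point below it where they ought to differ. If not, the next antidiagonal is
  bad as well, and the neighbouring point of S' leads to the same contradiction.\<close>

lemma interior_above:
 assumes "1 \<le> x0" "x0 < D" "(pt x0 (D - x0) \<in> S) \<noteq> (pt x0 (D - x0) \<in> S')"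
  and "1 \<le> x" "1 \<le> y" "D < x + y"
 shows "pt x y \<notin> S"
proof
 assume xy: "pt x y \<in> S"
 have diff: "(pt u v \<in> S) \<noteq> (pt u v \<in> S')" if "1 \<le> u" "1 \<le> v" "u + v = D" for u v
 proof -
  have "(pt u (D - u) \<in> S) \<noteq> (pt u (D - u) \<in> S')"
   by (rule antidiag[OF assms(1,2) _ _ assms(3)]) (use that in auto)
  then show ?thesis using that(3) by (metis add_diff_cancel_left')
 qed
 \<comment> \<open>The leftmost point of degree D + 1 with positive coordinates below (x,
   y).\<close>
 define u v where "u = max 1 (D + 1 - y)" and "v = D + 1 - u"
 have uv: "1 \<le> u" "1 \<le> v" "u \<le> x" "v \<le> y" "u + v = D + 1" using assms unfolding u_def v_def by auto
 have "pt u v \<in> S" by (rule A.S_down[OF xy pt_nonneg pt_mono]) (use uv in auto)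
 have downA: "pt a b \<in> S" if "pt a' b' \<in> S" "0 \<le> a" "0 \<le> b" "a \<le> a'" "b \<le> b'" for a b a' b'
  by (rule A.S_down[OF that(1) pt_nonneg pt_mono]) (use that in auto)
 have downB: "pt a b \<in> S'" if "pt a' b' \<in> S'" "0 \<le> a" "0 \<le> b" "a \<le> a'" "b \<le> b'" for a b a' b'
  by (rule B.S_down[OF that(1) pt_nonneg pt_mono]) (use that in auto)
 show False
 proof (cases "pt u v \<in> S'")
  case True
  show False
  proof (cases "2 \<le> u")
   case True
   then show False using diff[of "u - 1" v] uv downA[OF \<open>pt u v \<in> S\<close>, of "u - 1" v]
    downB[OF \<open>pt u v \<in> S'\<close>, of "u - 1" v] by auto
  next
   case False
   then show False using diff[of u "v - 1"] uv downA[OF \<open>pt u v \<in> S\<close>, of u "v - 1"]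
    downB[OF \<open>pt u v \<in> S'\<close>, of u "v - 1"] assms(1,2) by auto
  qed
 next
  case False
  with \<open>pt u v \<in> S\<close> have d: "(pt u v \<in> S) \<noteq> (pt u v \<in> S')" by blast
  show False
  proof (cases "2 \<le> u")
   case True
   then have "(pt (u - 1) (v + 1) \<in> S) \<noteq> (pt (u - 1) (v + 1) \<in> S')" "pt (u - 1) (v + 1) \<notin> S"
    using antidiag_step[of "u - 1" v] d \<open>pt u v \<in> S\<close> uv by auto
   then have "pt (u - 1) (v + 1) \<in> S'" by blast
   then show False using diff[of "u - 1" v] True uv downA[OF \<open>pt u v \<in> S\<close>, of "u - 1" v]
    downB[of "u - 1" "v + 1" "u - 1" v] by auto
  next
   case False
   then have v: "2 \<le> v" using uv assms(1,2) by linarith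
   then have "(pt (u + 1) (v - 1) \<in> S) \<noteq> (pt (u + 1) (v - 1) \<in> S')" "pt (u + 1) (v - 1) \<notin> S"
    using antidiag_step[of u "v - 1"] d \<open>pt u v \<in> S\<close> uv by auto
   then have "pt (u + 1) (v - 1) \<in> S'" by blast
   then show False using diff[of u "v - 1"] v uv downA[OF \<open>pt u v \<in> S\<close>, of u "v - 1"]
    downB[of "u + 1" "v - 1" u "v - 1"] by auto
  qed
 qed
qed

lemma max0_interior_deg:
 assumes "1 \<le> x0" "x0 < D" "(pt x0 (D - x0) \<in> S) \<noteq> (pt x0 (D - x0) \<in> S')"
  and "p \<in> A.max0" "1 \<le> p z1" "1 \<le> p z2"
 shows "p z1 + p z2 = D"
proof -
 note p = max0_pt[OF assms(4)]
 have "A.w (pt (p z1) (p z2)) = 0" using A.w_maxl[OF p(3)] p(4) by simp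
 then have "\<not> p z1 + p z2 < D" using interior_below[OF assms(1-3,5,6)] by auto
 moreover have "\<not> D < p z1 + p z2" using interior_above[OF assms(1-3,5,6)] p(1,4) by auto
 ultimately show ?thesis by linarith
qed

lemma interior_max0:
 assumes "1 \<le> x0" "x0 < D" "(pt x0 (D - x0) \<in> S) \<noteq> (pt x0 (D - x0) \<in> S')"
  and "1 \<le> x" "1 \<le> y" "x + y = D" "pt x y \<in> S"
 shows "pt x y \<in> A.max0"
proof -
 have "pt (x + 1) y \<notin> S" "pt x (y + 1) \<notin> S" by (rule interior_above[OF assms(1-3)]; use assms in simp)+
 then have "A.w (pt x y) = 0" using wA[of x y] nuA[of x y] assms by simp
 then have "A.maxl (pt x y)" using A.not_maxl_w[OF assms(7)] by auto
 then show ?thesis unfolding A.max0_def by simp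
qed

text \<open>On the two axes S and S' agree, and maximality of a standard monomial is visible in its
  multiplicity.\<close>

lemma nonfull_max0:
 assumes "pt x y \<in> B.max0" "x = 0 \<or> y = 0" shows "pt x y \<in> A.max0"
proof -
 have b: "pt x y \<in> S'" "B.maxl (pt x y)" using assms(1) unfolding B.max0_def B.maxl_def by blast+
 have "0 \<le> x" "0 \<le> y" using B.S_nonneg_at[OF b(1), of z1] B.S_nonneg_at[OF b(1), of z2] by simp_all
 then have "pt x y \<in> S" using nonfull_pt assms(2) b(1) by blast
 moreover have "A.w (pt x y) = 0" using B.w_maxl[OF b(2)] w_fix[OF pt_ZK] by simp
 ultimately have "A.maxl (pt x y)" using A.not_maxl_w by fastforce
 then show ?thesis unfolding A.max0_def by simp
qed

text \<open>A chain variable \<open>k\<close> of \<open>S'\<close> is matched, modulo the span of the thick units, with \<open>\<plusminus>\<close> a thin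
 unit of \<open>S\<close>, and comparing maximal roots in the two classes relates the sets \<open>max0\<close>.\<close>

lemma chain_transfer:
 assumes k: "k \<in> B.thins" "B.J k = z1" and ne: "B.max0 \<noteq> {}"
 shows "(\<exists>z\<in>KK. \<exists>q\<ge>0. \<forall>p. p \<in> A.max0 \<longleftrightarrow> p - vsc (B.Q k) (uv z1) + vsc q (uv z) \<in> B.max0) \<or>
  (\<exists>y\<in>A.ZK. A.max0 = {y - uv z1, y - uv z2} \<and> B.max0 = {y - vsc (B.Q k) (uv z1)})"
proof -
 have kn: "k < n" "k \<notin> KK" "k \<notin> B.K" using k K_eq unfolding B.thins_def by auto
 define q' where "q' = B.Q k"
 have topk: "B.top k = uv k + vsc q' (uv z1)" unfolding B.top_def k(2) q'_def ..
 have kj: "B.J k \<in> B.K \<or> B.Q k = 0" using k(2) z1K K_eq by simp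
 \<comment> \<open>\<open>e\<close> and \<open>v\<close> are the pull-backs of x_k and of the top of
   its chain. The weights \<open>p - uv k\<close> and \<open>top k - uv z\<close> of S' thus become
   the weights \<open>p - e\<close> and \<open>v - uv z\<close> of S.\<close>
 define e where "e = \<psi>' (uv k)"
 define v where "v = e + vsc q' (uv z1)"
 have eZ: "e \<in> Zn n" unfolding e_def using closed' Zn_uv[OF kn(1)] by blast
 have vz: "vsc q' (uv z1) \<in> A.ZK" by (intro A.ZK_vsc A.ZK_uv z1K)
 have vZ: "v \<in> Zn n" unfolding v_def by (intro Zn_add eZ A.ZK_Zn[OF vz])
 have psie: "\<psi> e = uv k" unfolding e_def using inv' Zn_uv[OF kn(1)] by blast
 have psiv: "\<psi> v = B.top k"
  unfolding v_def topk using map_add[OF eZ A.ZK_Zn[OF vz]] psie fix_ZK[OF vz] by simp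
 have root_iff: "A.w a = B.w (\<psi> a)" if "a \<in> Zn n" for a using weight[OF that] by simp
 have vroot: "0 < A.w (v - uv z)" if "z \<in> KK" for z
 proof -
  have "\<psi> (v - uv z) = B.top k - uv z"
   using map_diff[OF vZ Zn_uv[OF A.K_less[OF that]]] psiv fixK[OF that] by simp
  then show ?thesis using root_iff[OF Zn_diff[OF vZ Zn_uv[OF A.K_less[OF that]]]]
   B.w_maxl_diff[OF B.maxl_top[OF kn(1,3)] A.K_less[OF that]] by simp
 qed
 have eroot: "0 < A.w (p - e)" if "p \<in> B.max0" for p
 proof -
  have p: "p \<in> A.ZK" using that ZK_eq unfolding B.max0_def by blast
  have "\<psi> (p - e) = p - uv k" using map_diff[OF A.ZK_Zn[OF p] eZ] fix_ZK[OF p] psie by simp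
  then show ?thesis using root_iff[OF Zn_diff[OF A.ZK_Zn[OF p] eZ]] B.w_max0[OF that kn(1)] by simp
 qed
 have v_at: "v x = e x" if "x \<notin> KK" for x using that z1K by (auto simp: v_def uv_apply)
 have "v \<notin> A.ZK"
 proof
  assume "v \<in> A.ZK"
  then have "v = B.top k" using fix_ZK psiv by simp
  then have "v k = 1" using topk z1K kn by (auto simp: uv_apply)
  then show False using \<open>v \<in> A.ZK\<close> A.ZK_at[of v k] kn by simp
 qed
 then obtain x0 where x0: "x0 \<notin> KK" "v x0 \<noteq> 0" using vZ unfolding A.ZK_def by blast
 have cases: "(\<exists>i\<in>A.thins. \<forall>x. x \<notin> KK \<longrightarrow> v x = uv i x) \<or> (\<exists>l\<in>A.thins. \<forall>x. x \<notin> KK \<longrightarrow> v x = - uv l x)"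
 proof (cases "\<exists>l. l \<notin> KK \<and> v l < 0")
  case True
  then obtain l where l: "l \<notin> KK" "v l < 0" by blast
  have ln: "l < n" using Zn_ge[OF vZ, of l] l by simp
  have g: "v - uv z + uv l \<in> S" if "z \<in> KK" for z
  proof (rule A.w_pos_neg(4)[OF vroot[OF that]])
   show "(v - uv z) l < 0" using l(2) uv_nonneg_at[of z l] by (simp only: fun_diff_def)
  qed
  \<comment> \<open>A further thin coordinate x would put \<open>v - uv z1 + uv l\<close> and
    \<open>v - uv z2 + uv l\<close> on one and the same chain, but they differ in two thick
    directions.\<close>
  have "v x = - uv l x" if xK: "x \<notin> KK" for x
  proof (rule ccontr)
   assume "v x \<noteq> - uv l x"
   moreover have gx: "(v - uv z + uv l) x = v x + uv l x" if "z \<in> KK" for z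
    using that \<open>x \<notin> KK\<close> by (auto simp: uv_apply)
   moreover have "0 \<le> (v - uv z1 + uv l) x" using A.S_nonneg_at[OF g[OF z1K]] .
   ultimately have ge: "1 \<le> (v - uv z + uv l) x" if "z \<in> KK" for z
    using gx[OF that] gx[OF z1K] by linarith
   then have "1 \<le> v x + uv l x" using gx[OF z1K] ge[OF z1K] by simp
   then have xn: "x < n" using Zn_ge[OF vZ, of x] ln by (cases "x = l") (auto simp: uv_apply)
   obtain r1 where r1: "v - uv z1 + uv l = uv x + vsc r1 (uv (A.J x))"
    using A.thin_form[OF xn xK g[OF z1K] ge[OF z1K]] by blast
   obtain r2 where r2: "v - uv z2 + uv l = uv x + vsc r2 (uv (A.J x))"
    using A.thin_form[OF xn xK g[OF z2K] ge[OF z2K]] by blast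
   have "x \<noteq> z1" "x \<noteq> z2" "l \<noteq> z1" "l \<noteq> z2" using that l z1K z2K by auto
   then show False using fun_cong[OF r1, of z1] fun_cong[OF r1, of z2] fun_cong[OF r2, of z1]
    fun_cong[OF r2, of z2] z12 by (auto simp: uv_apply split: if_splits)
  qed
  then show ?thesis using ln l unfolding A.thins_def by blast
 next
  case False
  then have nn: "0 \<le> v x" if "x \<notin> KK" for x using that by (meson not_less)
  obtain p where p: "p \<in> B.max0" using ne by blast
  have pK: "p \<in> A.ZK" using p ZK_eq unfolding B.max0_def by blast
  have px: "(p - e) x = - v x" if "x \<notin> KK" for x using A.ZK_at[OF pK that] v_at[OF that] by simp
  have neg: "(p - e) x0 < 0" using px[OF x0(1)] nn[OF x0(1)] x0(2) by simp
  note pn = A.w_pos_neg(2,3,5)[OF eroot[OF p] neg]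
  have "v x = uv x0 x" if "x \<notin> KK" for x
   using px[OF that] nn[OF that] pn(1) pn(2)[of x] by (cases "x = x0") (auto simp: uv_apply)
  then show ?thesis using pn(3) x0 unfolding A.thins_def by blast
 qed
 show ?thesis
 proof (cases "\<exists>i\<in>A.thins. \<forall>x. x \<notin> KK \<longrightarrow> v x = uv i x")
  case True
  then obtain i where i: "i < n" "i \<notin> KK" and vi: "\<And>x. x \<notin> KK \<Longrightarrow> v x = uv i x"
   unfolding A.thins_def by blast
  have vzi: "(v - uv z) x = uv i x" if "z \<in> KK" "x \<notin> KK" for z x
   using vi[OF that(2)] that by (auto simp: uv_apply)
  have chain: "A.J i \<in> KK \<or> A.Q i = 0"
  proof (rule ccontr)
   assume "\<not> ?thesis"
   then have iso: "A.J i \<notin> KK" "A.Q i \<noteq> 0" by blast+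
   have "v - uv z1 = uv i" "v - uv z2 = uv i"
    using A.root_plus_isolated[OF i iso vroot vzi] z1K z2K by blast+
   then have "(v - uv z1) z1 = (v - uv z2) z1" by simp
   then show False using z12 by (simp add: uv_apply)
  qed
  \<comment> \<open>Maximal weights of the two cosets bound each other, so both \<open>d\<close> and
    \<open>- d\<close> lie below differences of thick units. Using this at both thick variables
    leaves only \<open>d = 0\<close>.\<close>
  define d where "d = v - A.top i"
  have topi_at: "A.top i x = uv i x" if "x \<notin> KK" for x
   using that chain by (auto simp: A.top_def uv_apply)
  have topiZ: "A.top i \<in> Zn n" using A.S_Zn[OF A.top_S[OF i]] .
  have dK: "d \<in> A.ZK" using vi topi_at Zn_diff[OF vZ topiZ] unfolding d_def A.ZK_def by simp
  have d1: "\<exists>z'\<in>KK. d \<le> uv z - uv z'" if z: "z \<in> KK" for z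
  proof -
   obtain z' where "z' \<in> KK" "v - uv z \<le> A.top i - uv z'"
    using A.root_plus_chain[OF i chain vroot[OF z] vzi[OF z]] by blast
   then show ?thesis unfolding d_def by (intro bexI[of _ z']) (auto simp: le_fun_def algebra_simps)
  qed
  have psitop: "\<psi> (A.top i) = B.top k - d"
   using map_diff[OF vZ A.ZK_Zn[OF dK]] psiv fix_ZK[OF dK] unfolding d_def by simp
  have d2: "\<exists>z'\<in>KK. - d \<le> uv z - uv z'" if z: "z \<in> KK" for z
  proof -
   have "\<psi> (A.top i - uv z) = B.top k - d - uv z"
    using map_diff[OF topiZ Zn_uv[OF A.K_less[OF z]]] psitop fixK[OF z] by simp
   then have r: "0 < B.w (B.top k - d - uv z)"
    using root_iff[OF Zn_diff[OF topiZ Zn_uv[OF A.K_less[OF z]]]]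
     A.w_maxl_diff[OF A.maxl_top[OF i] A.K_less[OF z]] by simp
   have "(B.top k - d - uv z) x = uv k x" if "x \<notin> B.K" for x
   proof -
    have x: "x \<notin> KK" "x \<noteq> z1" "x \<noteq> z" using that z K_eq z1K by auto
    show ?thesis using A.ZK_at[OF dK x(1)] x by (simp add: topk uv_apply)
   qed
   then obtain z' where "z' \<in> B.K" "B.top k - d - uv z \<le> B.top k - uv z'"
    using B.root_plus_chain[OF kn(1,3) kj r] by blast
   then show ?thesis using K_eq by (intro bexI[of _ z']) (auto simp: le_fun_def algebra_simps)
  qed
  have bound: "f z1 \<le> 0 \<and> f z2 \<le> 0" if "\<And>z. z \<in> KK \<Longrightarrow> \<exists>z'\<in>KK. f \<le> uv z - uv z'" for f :: "nat \<Rightarrow> int"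
  proof -
   have "\<exists>z'\<in>KK. f \<le> uv z1 - uv z'" "\<exists>z'\<in>KK. f \<le> uv z2 - uv z'" using that z1K z2K by blast+
   then consider "f \<le> uv z1 - uv z1" | "f \<le> uv z2 - uv z2" | "f \<le> uv z1 - uv z2" "f \<le> uv z2 - uv z1"
    unfolding K2 bex_simps by (elim disjE exE FalseE) assumption+
   then show ?thesis
    using le_funD[of f "uv z1 - uv z1"] le_funD[of f "uv z2 - uv z2"] le_funD[of f "uv z1 - uv z2" z2]
     le_funD[of f "uv z2 - uv z1" z1] z12 by cases (auto simp: uv_apply)
  qed
  have "d z1 = 0 \<and> d z2 = 0" using bound[of d, OF d1] bound[of "- d", OF d2] by simp
  then have "d = 0" using ZK_ext[OF dK A.ZK_0] by simp
  then have vtop: "v = A.top i" unfolding d_def by simp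
  define z q where "z = (if A.Q i = 0 then z1 else A.J i)" and "q = A.Q i"
  have zK: "z \<in> KK" using chain z1K unfolding z_def by auto
  have q0: "0 \<le> q" unfolding q_def using A.thin_Q[OF i] .
  have topi: "A.top i = uv i + vsc q (uv z)" unfolding A.top_def q_def z_def by simp
  have ei: "e = uv i + vsc q (uv z) - vsc q' (uv z1)" using vtop topi unfolding v_def by (simp add: eq_diff_eq)
  have psii: "\<psi> (uv i) = uv k + vsc q' (uv z1) - vsc q (uv z)"
  proof -
   have "uv i = v - vsc q (uv z)" using vtop topi by (simp add: eq_diff_eq)
   moreover have "vsc q (uv z) \<in> A.ZK" by (intro A.ZK_vsc A.ZK_uv zK)
   ultimately show ?thesis using map_diff[OF vZ A.ZK_Zn] psiv topk fix_ZK by simp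
  qed
  \<comment> \<open>\<open>up\<close> and \<open>down\<close> say that, after the translation, each
    maximal monomial of one side lies below one of the other side. Both sides are antichains, so the
    translation is a bijection between them.\<close>
  have up: "\<exists>m\<in>A.max0. p + vsc q' (uv z1) - vsc q (uv z) \<le> m" if "p \<in> B.max0" for p
  proof -
   have pK: "p \<in> A.ZK" using that ZK_eq unfolding B.max0_def by blast
   have "(p - e) x = - uv i x" if "x \<notin> KK" for x
    using A.ZK_at[OF pK that] vi[OF that] v_at[OF that] by simp
   then obtain m where "m \<in> A.max0" "p - e \<le> m - uv i" using A.root_minus[OF i(2) eroot[OF \<open>p \<in> B.max0\<close>]] by blast
   then show ?thesis unfolding ei by (intro bexI[of _ m]) (auto simp: le_fun_def algebra_simps)
  qed
  have down: "\<exists>p\<in>B.max0. m - vsc q' (uv z1) + vsc q (uv z) \<le> p" if "m \<in> A.max0" for m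
  proof -
   have mK: "m \<in> A.ZK" using max0_pt(2)[OF that] .
   have "\<psi> (m - uv i) = m - (uv k + vsc q' (uv z1) - vsc q (uv z))"
    using map_diff[OF A.ZK_Zn[OF mK] Zn_uv[OF i(1)]] psii fix_ZK[OF mK] by simp
   then have r: "0 < B.w (m - (uv k + vsc q' (uv z1) - vsc q (uv z)))"
    using root_iff[OF Zn_diff[OF A.ZK_Zn[OF mK] Zn_uv[OF i(1)]]] A.w_max0[OF that i(1)] by simp
   have "(m - (uv k + vsc q' (uv z1) - vsc q (uv z))) x = - uv k x" if "x \<notin> B.K" for x
   proof -
    have x: "x \<notin> KK" "x \<noteq> z1" "x \<noteq> z" using that zK K_eq z1K by auto
    show ?thesis using A.ZK_at[OF mK x(1)] x by (simp add: uv_apply)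
   qed
   then obtain p where "p \<in> B.max0" "m - (uv k + vsc q' (uv z1) - vsc q (uv z)) \<le> p - uv k"
    using B.root_minus[OF kn(3) r] by blast
   then show ?thesis by (intro bexI[of _ p]) (auto simp: le_fun_def algebra_simps)
  qed
  have "p \<in> A.max0 \<longleftrightarrow> p - vsc q' (uv z1) + vsc q (uv z) \<in> B.max0" for p
  proof
   assume p: "p \<in> A.max0"
   obtain b where b: "b \<in> B.max0" "p - vsc q' (uv z1) + vsc q (uv z) \<le> b" using down[OF p] by blast
   obtain m where m: "m \<in> A.max0" "b + vsc q' (uv z1) - vsc q (uv z) \<le> m" using up[OF b(1)] by blast
   have 1: "p \<le> b + vsc q' (uv z1) - vsc q (uv z)" using b(2) by (auto simp: le_fun_def algebra_simps)
   then have "p = m" using A.max0_antichain[OF p m(1)] m(2) order_trans by blast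
   then have "p = b + vsc q' (uv z1) - vsc q (uv z)" using 1 m(2) by (intro antisym) auto
   then have "p - vsc q' (uv z1) + vsc q (uv z) = b" by simp
   then show "p - vsc q' (uv z1) + vsc q (uv z) \<in> B.max0" using b(1) by simp
  next
   assume "p - vsc q' (uv z1) + vsc q (uv z) \<in> B.max0"
   then obtain b where b: "b \<in> B.max0" "p - vsc q' (uv z1) + vsc q (uv z) = b" by blast
   have p: "p = b + vsc q' (uv z1) - vsc q (uv z)" using b(2)[symmetric] by simp
   obtain m where m: "m \<in> A.max0" "p \<le> m" using up[OF b(1)] unfolding p by blast
   obtain c where c: "c \<in> B.max0" "m - vsc q' (uv z1) + vsc q (uv z) \<le> c" using down[OF m(1)] by blast
   have 1: "b \<le> m - vsc q' (uv z1) + vsc q (uv z)" using m(2) b(2) by (auto simp: le_fun_def)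
   then have "b = c" using B.max0_antichain[OF b(1) c(1)] c(2) order_trans by blast
   then have "b = m - vsc q' (uv z1) + vsc q (uv z)" using 1 c(2) by (intro antisym) auto
   then have "p = m" unfolding p by simp
   then show "p \<in> A.max0" using m(1) by simp
  qed
  then show ?thesis using zK q0 unfolding q'_def by blast
 next
  case False
  then obtain l where l: "l < n" "l \<notin> KK" and vl: "\<And>x. x \<notin> KK \<Longrightarrow> v x = - uv l x"
   using cases unfolding A.thins_def by blast
  \<comment> \<open>The reflected case: \<open>uv l\<close> is sent to \<open>y - top k\<close>, so
    cosets of positive and negative sign are exchanged and \<open>max0\<close> is described by the
    top of a chain.\<close>
  define y where "y = v + uv l"
  have yK: "y \<in> A.ZK" using vl Zn_add[OF vZ Zn_uv[OF l(1)]] unfolding y_def A.ZK_def by simp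
  have psil: "\<psi> (uv l) = y - B.top k"
  proof -
   have "uv l = y - v" unfolding y_def by simp
   then show ?thesis using map_diff[OF A.ZK_Zn[OF yK] vZ] psiv fix_ZK[OF yK] by simp
  qed
  have up1: "\<exists>m\<in>A.max0. y - uv z \<le> m" if z: "z \<in> KK" for z
  proof -
   have "(v - uv z) x = - uv l x" if "x \<notin> KK" for x
    using vl[OF that] that z by (auto simp: uv_apply)
   then obtain m where "m \<in> A.max0" "v - uv z \<le> m - uv l" using A.root_minus[OF l(2) vroot[OF z]] by blast
   then show ?thesis unfolding y_def by (intro bexI[of _ m]) (auto simp: le_fun_def algebra_simps)
  qed
  have down1: "\<exists>z\<in>KK. m \<le> y - uv z" if "m \<in> A.max0" for m
  proof -
   have mK: "m \<in> A.ZK" using max0_pt(2)[OF that] .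
   have "\<psi> (m - uv l) = m - (y - B.top k)"
    using map_diff[OF A.ZK_Zn[OF mK] Zn_uv[OF l(1)]] psil fix_ZK[OF mK] by simp
   then have r: "0 < B.w (m - (y - B.top k))"
    using root_iff[OF Zn_diff[OF A.ZK_Zn[OF mK] Zn_uv[OF l(1)]]] A.w_max0[OF that l(1)] by simp
   have "(m - (y - B.top k)) x = uv k x" if "x \<notin> B.K" for x
   proof -
    have x: "x \<notin> KK" "x \<noteq> z1" using that K_eq z1K by auto
    show ?thesis using A.ZK_at[OF mK x(1)] A.ZK_at[OF yK x(1)] x by (simp add: topk uv_apply)
   qed
   then obtain z where "z \<in> B.K" "m - (y - B.top k) \<le> B.top k - uv z"
    using B.root_plus_chain[OF kn(1,3) kj r] by blast
   then show ?thesis using K_eq by (intro bexI[of _ z]) (auto simp: le_fun_def algebra_simps)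
  qed
  \<comment> \<open>An antichain bounding and bounded by the two vectors \<open>u - uv z1\<close>
    and \<open>u - uv z2\<close> consists of them.\<close>
  have two: "X = {u - uv z1, u - uv z2}"
   if anti: "\<And>a b. a \<in> X \<Longrightarrow> b \<in> X \<Longrightarrow> a \<le> b \<Longrightarrow> a = b"
    and up: "\<And>z. z \<in> KK \<Longrightarrow> \<exists>m\<in>X. u - uv z \<le> m" and down: "\<And>m. m \<in> X \<Longrightarrow> \<exists>z\<in>KK. m \<le> u - uv z"
   for X and u :: "nat \<Rightarrow> int"
  proof -
   have "m \<in> {u - uv z1, u - uv z2}" if m: "m \<in> X" for m
   proof -
    obtain z where z: "z \<in> KK" "m \<le> u - uv z" using down[OF m] by blast
    obtain m' where m': "m' \<in> X" "u - uv z \<le> m'" using up[OF z(1)] by blast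
    have "m = m'" using anti[OF m m'(1)] z(2) m'(2) order_trans by blast
    then have "m = u - uv z" using z(2) m'(2) by (intro antisym) auto
    then show ?thesis using z(1) unfolding K2 by auto
   qed
   moreover have "u - uv z \<in> X" if z: "z \<in> KK" for z
   proof -
    obtain m where m: "m \<in> X" "u - uv z \<le> m" using up[OF z] by blast
    obtain z' where z': "z' \<in> KK" "m \<le> u - uv z'" using down[OF m(1)] by blast
    have "u - uv z \<le> u - uv z'" using m(2) z'(2) by (rule order_trans)
    then have "uv z' z' \<le> uv z z'" using le_funD[of "u - uv z" "u - uv z'" z'] by simp
    then have "z' = z" by (auto simp: uv_apply split: if_splits)
    then have "u - uv z = m" using m(2) z'(2) by (intro antisym) auto
    then show ?thesis using m(1) by simp
   qed
   ultimately show ?thesis using z1K z2K by blast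
  qed
  have maxA: "A.max0 = {y - uv z1, y - uv z2}" by (rule two[OF A.max0_antichain up1 down1])
  have ey: "e = y - uv l - vsc q' (uv z1)" unfolding y_def v_def by simp
  have el: "(p - e) x = uv l x" if "p \<in> B.max0" "x \<notin> KK" for p x
   using that ZK_eq A.ZK_at[of p x] vl[of x] v_at[of x] unfolding B.max0_def by auto
  show ?thesis
  proof (cases "A.J l \<in> KK \<or> A.Q l = 0")
   case True
   define z q where "z = (if A.Q l = 0 then z1 else A.J l)" and "q = A.Q l"
   have zK: "z \<in> KK" using True z1K unfolding z_def by auto
   have q0: "0 \<le> q" unfolding q_def using A.thin_Q[OF l] .
   have topl: "A.top l = uv l + vsc q (uv z)" unfolding A.top_def q_def z_def by simp
   have vzq: "vsc q (uv z) \<in> A.ZK" by (intro A.ZK_vsc A.ZK_uv zK)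
   define u where "u = y + vsc q (uv z) - vsc q' (uv z1)"
   have down2: "\<exists>z\<in>KK. p \<le> u - uv z" if pB: "p \<in> B.max0" for p
   proof -
    obtain z3 where "z3 \<in> KK" "p - e \<le> A.top l - uv z3"
     using A.root_plus_chain[OF l True eroot[OF pB] el[OF pB]] by blast
    then show ?thesis unfolding ey topl u_def by (intro bexI[of _ z3]) (auto simp: le_fun_def algebra_simps)
   qed
   have up2: "\<exists>p\<in>B.max0. u - uv z3 \<le> p" if z3: "z3 \<in> KK" for z3
   proof -
    have tZ: "A.top l \<in> Zn n" using A.S_Zn[OF A.top_S[OF l]] .
    have "\<psi> (A.top l) = y - B.top k + vsc q (uv z)"
     unfolding topl using map_add[OF Zn_uv[OF l(1)] A.ZK_Zn[OF vzq]] psil fix_ZK[OF vzq] by simp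
    then have "\<psi> (A.top l - uv z3) = y - B.top k + vsc q (uv z) - uv z3"
     using map_diff[OF tZ Zn_uv[OF A.K_less[OF z3]]] fixK[OF z3] by simp
    then have r: "0 < B.w (y - B.top k + vsc q (uv z) - uv z3)"
     using root_iff[OF Zn_diff[OF tZ Zn_uv[OF A.K_less[OF z3]]]]
      A.w_maxl_diff[OF A.maxl_top[OF l] A.K_less[OF z3]] by simp
    have "(y - B.top k + vsc q (uv z) - uv z3) x = - uv k x" if "x \<notin> B.K" for x
    proof -
     have x: "x \<notin> KK" "x \<noteq> z1" "x \<noteq> z" "x \<noteq> z3" using that zK z3 K_eq z1K by auto
     show ?thesis using A.ZK_at[OF yK x(1)] x by (simp add: topk uv_apply)
    qed
    then obtain p where "p \<in> B.max0" "y - B.top k + vsc q (uv z) - uv z3 \<le> p - uv k"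
     using B.root_minus[OF kn(3) r] by blast
    then show ?thesis unfolding topk u_def by (intro bexI[of _ p]) (auto simp: le_fun_def algebra_simps)
   qed
   have maxB: "B.max0 = {u - uv z1, u - uv z2}" by (rule two[OF B.max0_antichain up2 down2])
   have "p \<in> A.max0 \<longleftrightarrow> p - vsc q' (uv z1) + vsc q (uv z) \<in> B.max0" for p
   proof -
    have "p = y - uv x \<longleftrightarrow> p - vsc q' (uv z1) + vsc q (uv z) = u - uv x" for x
     unfolding u_def by (auto simp: fun_eq_iff algebra_simps)
    then show ?thesis unfolding maxA maxB by simp
   qed
   then show ?thesis using zK q0 unfolding q'_def by blast
  next
   case False
   then have iso: "A.J l \<notin> KK" "A.Q l \<noteq> 0" by blast+
   have "p = y - vsc q' (uv z1)" if "p \<in> B.max0" for p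
   proof -
    have "p - e = uv l" by (rule A.root_plus_isolated[OF l iso eroot[OF that] el[OF that]])
    then have "p = uv l + e" by (simp add: diff_eq_eq)
    then show ?thesis unfolding ey by simp
   qed
   then have "B.max0 = {y - vsc q' (uv z1)}" using ne by blast
   then show ?thesis using maxA yK unfolding q'_def by blast
  qed
 qed
qed

end

context fpair2
begin

interpretation sw: fpair2 n S' S \<psi>' \<psi> z1 z2 by (rule fpair2_swap)
interpretation fl: fpair2 n S S' \<psi> \<psi>' z2 z1 by (rule fpair2_flip)

lemma chain_ex:
 assumes "1 \<le> q" "0 < B.nu (vsc q (uv z))" "z \<in> KK"
 shows "\<exists>k\<in>B.thins. B.J k = z \<and> q \<le> B.Q k"
proof -
 obtain k where k: "k \<in> B.thins" "vsc q (uv z) + uv k \<in> S'" using B.nu_pos[OF assms(2)] by blast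
 have vK: "vsc q (uv z) \<in> B.ZK" unfolding ZK_eq by (intro A.ZK_vsc A.ZK_uv assms(3))
 obtain r where r: "r \<le> B.Q k" "vsc q (uv z) = vsc r (uv (B.J k))"
  using B.nu_pos_form[OF k vK] by metis
 have "q = r * uv (B.J k) z" using fun_cong[OF r(2), of z] by simp
 then have "B.J k = z" "q = r" using assms(1) by (auto simp: uv_apply split: if_splits)
 then show ?thesis using k r by blast
qed

text \<open>The discrepancy at \<open>pt (D - 1) 1\<close> must be balanced by a chain variable of
  S' along z1 of length at least D - 1. The alternatives of \<open>chain_transfer\<close> are
  refuted by following the maximal monomial \<open>pt (D - 1) 1\<close> of S. One configuration with
  D = 2 resists and falls to the mirror argument along z2.\<close>

lemma no_difference:
 assumes "1 \<le> x0" "x0 < D" "(pt x0 (D - x0) \<in> S) \<noteq> (pt x0 (D - x0) \<in> S')" and in_S: "pt (D - 1) 1 \<in> S"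
 shows False
proof -
 note diff = assms(1-3)
 have diff': "(sw.pt x0 (D - x0) \<in> S') \<noteq> (sw.pt x0 (D - x0) \<in> S)" using assms(3) by blast
 have D2: "2 \<le> D" using assms by linarith
 have "(pt (D - 1) (D - (D - 1)) \<in> S) \<noteq> (pt (D - 1) (D - (D - 1)) \<in> S')"
  by (rule antidiag[OF assms(1,2) _ _ assms(3)]) (use D2 in auto)
 then have nS': "pt (D - 1) 1 \<notin> S'" using in_S by simp
 have "pt D 0 \<in> S \<longleftrightarrow> pt D 0 \<in> S'" using nonfull_pt D2 by simp
 then have "0 < B.nu (pt (D - 1) 0)" using wA[of "D - 1" 0] wB[of "D - 1" 0] in_S nS' D2 by simp
 then have "0 < B.nu (vsc (D - 1) (uv z1))" unfolding pt_def by simp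
 then obtain k where k: "k \<in> B.thins" "B.J k = z1" "D - 1 \<le> B.Q k" using chain_ex[of "D - 1" z1] z1K D2 by auto
 define q' where "q' = B.Q k"
 have q': "D - 1 \<le> q'" "1 \<le> q'" using k D2 unfolding q'_def by auto
 have maxA: "pt (D - 1) 1 \<in> A.max0" by (rule interior_max0[OF diff]) (use D2 in_S in auto)
 have ne: "B.max0 \<noteq> {}" using fswap.max0_transfer z1K k(1) maxA K_eq by blast
 have posB: "0 \<le> p z1" "0 \<le> p z2" "p = pt (p z1) (p z2)" "p \<in> S'" if "p \<in> B.max0" for p
  using sw.max0_pt[OF that] by blast+
 \<comment> \<open>A maximal monomial of S' linear in z2 would have degree D by
   \<open>max0_interior_deg\<close>, so it would be the very point that S' lacks.\<close>
 have one: False if "pt x 1 \<in> B.max0" for x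
 proof -
  have "0 \<le> x" using posB(1)[OF that] by simp
  moreover have "x \<noteq> 0"
  proof
   assume "x = 0"
   then have "pt x 1 = uv z2" unfolding pt_def by simp
   then show False using sw.z2_not_max0 that by simp
  qed
  ultimately have "1 \<le> x" by simp
  then have "x + 1 = D" using sw.max0_interior_deg[OF assms(1,2) diff' that] by simp
  then have "x = D - 1" by linarith
  then have "pt x 1 = pt (D - 1) 1" by (rule arg_cong[where f = "\<lambda>x. pt x 1"])
  then show False using posB(4)[OF that] nS' by simp
 qed
 from chain_transfer[OF k(1,2) ne, folded q'_def] show False
 proof
  assume "\<exists>z\<in>KK. \<exists>q\<ge>0. \<forall>p. p \<in> A.max0 \<longleftrightarrow> p - vsc q' (uv z1) + vsc q (uv z) \<in> B.max0"
  then obtain z q where z: "z \<in> KK" "0 \<le> q"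
   and iff: "\<And>p. p \<in> A.max0 \<longleftrightarrow> p - vsc q' (uv z1) + vsc q (uv z) \<in> B.max0" by blast
  define p where "p = pt (D - 1) 1 - vsc q' (uv z1) + vsc q (uv z)"
  have p: "p \<in> B.max0" using iff maxA unfolding p_def by blast
  show False
  proof (cases "z = z1 \<or> q = 0")
   case True
   then have "p z2 = 1" using z12 unfolding p_def by (auto simp: uv_apply)
   then show False using one posB(3)[OF p] p by metis
  next
   case False
   then have zz: "z = z2" "1 \<le> q" using z K2 by auto
   \<comment> \<open>The chain is long enough to use up the exponent of z1. The translated point
     lies on an axis, is therefore maximal in S as well, and translating it once more yields a
     negative exponent.\<close>
   have c: "p z1 = D - 1 - q'" unfolding p_def zz using z12 by (simp add: uv_apply)
   then have "p z1 = 0" using posB(1)[OF p] q' by linarith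
   then have pp: "p = pt 0 (p z2)" using posB(3)[OF p] by simp
   then have "p \<in> A.max0" using nonfull_max0[of 0 "p z2"] p by simp
   then have "p - vsc q' (uv z1) + vsc q (uv z2) \<in> B.max0" using iff zz by blast
   then have "0 \<le> (p - vsc q' (uv z1) + vsc q (uv z2)) z1" by (rule posB(1))
   then show False using \<open>p z1 = 0\<close> q' z12 by (simp add: uv_apply)
  qed
 next
  assume "\<exists>y\<in>A.ZK. A.max0 = {y - uv z1, y - uv z2} \<and> B.max0 = {y - vsc q' (uv z1)}"
  then obtain y where y: "y \<in> A.ZK" "A.max0 = {y - uv z1, y - uv z2}" "B.max0 = {y - vsc q' (uv z1)}" by blast
  define p where "p = y - vsc q' (uv z1)"
  have p: "p \<in> B.max0" using y(3) unfolding p_def by simp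
  have pz: "p z1 = y z1 - q'" "p z2 = y z2" using z12 unfolding p_def by (auto simp: uv_apply)
  have "pt (D - 1) 1 = y - uv z1 \<or> pt (D - 1) 1 = y - uv z2" using maxA y(2) by blast
  then show False
  proof
   assume eq: "pt (D - 1) 1 = y - uv z1"
   have "p z2 = 1" using fun_cong[OF eq, of z2] pz z12 by (simp add: uv_apply)
   then show False using one posB(3)[OF p] p by metis
  next
   assume eq: "pt (D - 1) 1 = y - uv z2"
   have yz: "y z1 = D - 1" "y z2 = 2" using fun_cong[OF eq, of z1] fun_cong[OF eq, of z2] z12
    by (simp_all add: uv_apply)
   then have p0: "p z1 = 0" "p z2 = 2" using pz posB(1)[OF p] q' by auto
   then have pp: "p = pt 0 2" using posB(3)[OF p] by simp
   then have "p \<in> A.max0" using nonfull_max0[of 0 2] p by simp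
   then have "p = y - uv z1 \<or> p = y - uv z2" using y(2) by blast
   then have Deq: "D = 2"
   proof
    assume e: "p = y - uv z1" show ?thesis using fun_cong[OF e, of z1] p0 yz by simp
   next
    assume e: "p = y - uv z2" show ?thesis using fun_cong[OF e, of z2] p0 yz by simp
   qed
   have 11: "pt 1 1 \<in> S" "pt 1 1 \<notin> S'" using in_S nS' Deq by simp_all
   have "pt 0 2 \<in> S \<longleftrightarrow> pt 0 2 \<in> S'" using nonfull_pt by simp
   then have "0 < B.nu (pt 0 1)" using wA[of 0 1] wB[of 0 1] 11 by simp
   then have "0 < B.nu (vsc 1 (uv z2))" unfolding pt_def by simp
   then obtain k2 where k2: "k2 \<in> B.thins" "B.J k2 = z2" using chain_ex[of 1 z2] z2K by auto
   from fl.chain_transfer[OF k2 ne] show False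
   proof
    assume "\<exists>z\<in>KK. \<exists>q\<ge>0. \<forall>p. p \<in> A.max0 \<longleftrightarrow> p - vsc (B.Q k2) (uv z2) + vsc q (uv z) \<in> B.max0"
    then obtain z q where iff: "\<And>p. p \<in> A.max0 \<longleftrightarrow> p - vsc (B.Q k2) (uv z2) + vsc q (uv z) \<in> B.max0" by blast
    have "y - uv z1 - vsc (B.Q k2) (uv z2) + vsc q (uv z) = p" "y - uv z2 - vsc (B.Q k2) (uv z2) + vsc q (uv z) = p"
     using iff[of "y - uv z1"] iff[of "y - uv z2"] y(2,3) unfolding p_def by simp_all
    then have "(y - uv z1 - vsc (B.Q k2) (uv z2) + vsc q (uv z)) z1 =
      (y - uv z2 - vsc (B.Q k2) (uv z2) + vsc q (uv z)) z1" by metis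
    then show False using z12 by (simp add: uv_apply)
   next
    assume "\<exists>u\<in>A.ZK. A.max0 = {u - uv z2, u - uv z1} \<and> B.max0 = {u - vsc (B.Q k2) (uv z2)}"
    then obtain u where u: "A.max0 = {u - uv z2, u - uv z1}" "B.max0 = {u - vsc (B.Q k2) (uv z2)}" by blast
    have "p = u - vsc (B.Q k2) (uv z2)" using p u(2) by blast
    from fun_cong[OF this, of z1] have "u z1 = 0" using p0 z12 by (simp add: uv_apply)
    moreover have "u - uv z1 \<in> A.max0" using u(1) by blast
    from max0_pt(5)[OF this] have "1 \<le> u z1" by simp
    ultimately show False by simp
   qed
  qed
 qed
qed

end

context fpair2
begin

interpretation sw: fpair2 n S' S \<psi>' \<psi> z1 z2 by (rule fpair2_swap)

lemma coincide_fpair2: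
 assumes b: "b \<in> A.ZK" "0 \<le> b" shows "b \<in> S \<longleftrightarrow> b \<in> S'"
proof (rule ccontr)
 assume d: "\<not> ?thesis"
 have nn: "0 \<le> b z1" "0 \<le> b z2" using le_funD[OF b(2), of z1] le_funD[OF b(2), of z2] by simp_all
 have "b z1 \<noteq> 0" "b z2 \<noteq> 0" using d nonfull_eq[OF b z1K] nonfull_eq[OF b z2K] by blast+
 then have pos: "1 \<le> b z1" "1 \<le> b z2" using nn by auto
 define D where "D = b z1 + b z2"
 have bp: "b = pt (b z1) (D - b z1)" using ZK_pt[OF b(1)] unfolding D_def by simp
 have diff: "(pt (b z1) (D - b z1) \<in> S) \<noteq> (pt (b z1) (D - b z1) \<in> S')" using d bp by metis
 have x: "1 \<le> b z1" "b z1 < D" using pos D_def by auto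
 have "(pt (D - 1) (D - (D - 1)) \<in> S) \<noteq> (pt (D - 1) (D - (D - 1)) \<in> S')"
  by (rule antidiag[OF x _ _ diff]) (use x in auto)
 then have "pt (D - 1) 1 \<in> S \<or> pt (D - 1) 1 \<in> S'" by auto
 then show False using no_difference[OF x diff] sw.no_difference[OF x] diff by metis
qed

end

context fpair
begin

lemma coincide_ZK:
 assumes b: "b \<in> A.ZK" "0 \<le> b" shows "b \<in> S \<longleftrightarrow> b \<in> S'"
proof -
 consider "card KK = 0" | "card KK = 1" | "card KK = 2" | "3 \<le> card KK" by linarith
 then show ?thesis
 proof cases
  case 1
  then have "KK = {}" by simp
  then have "b = 0" using A.ZK_at[OF b(1)] by (auto simp: fun_eq_iff)
  then show ?thesis using A.S_0 B.S_0 by simp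
 next
  case 2 then show ?thesis using coincide_card1 b by blast
 next
  case 3
  then obtain z1 z2 where "KK = {z1, z2}" "z1 \<noteq> z2" by (metis card_2_iff)
  then interpret fpair2 n S S' \<psi> \<psi>' z1 z2 by unfold_locales
  show ?thesis by (rule coincide_fpair2[OF b])
 next
  case 4 then show ?thesis using coincide_ge3 b by blast
 qed
qed

text \<open>Once the thick extensions agree, \<open>w_split\<close> isolates the thin ones.\<close>

lemma nu_eq:
 assumes "a \<in> A.ZK" "0 \<le> a" shows "A.nu a = B.nu a"
proof -
 have "{z \<in> KK. a + uv z \<in> S} = {z \<in> KK. a + uv z \<in> S'}"
  using coincide_ZK[OF A.ZK_add[OF assms(1) A.ZK_uv] add_nonneg_nonneg[OF assms(2) uv_nonneg]] by blast
 then show ?thesis using A.w_split[OF assms(2)] B.w_split[OF assms(2)] w_fix[OF assms(1)] K_eq by simp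
qed

end

section \<open>Permuting variables\<close>

definition pull :: "(nat \<Rightarrow> nat) \<Rightarrow> (nat \<Rightarrow> int) \<Rightarrow> nat \<Rightarrow> int" where
 "pull \<pi> v = (\<lambda>i. v (\<pi> i))"

text \<open>Permutations of the n variables, extended by the identity so that \<open>inv\<close> is
  a global inverse.\<close>

definition fixbij :: "nat \<Rightarrow> (nat \<Rightarrow> nat) \<Rightarrow> bool" where
 "fixbij n \<pi> \<longleftrightarrow> bij \<pi> \<and> (\<forall>i\<ge>n. \<pi> i = i)"

lemma pull_apply [simp]: "pull \<pi> v i = v (\<pi> i)" by (simp add: pull_def)
lemma pull_add: "pull \<pi> (a + b) = pull \<pi> a + pull \<pi> b" by (simp add: fun_eq_iff)
lemma pull_vsc: "pull \<pi> (vsc q a) = vsc q (pull \<pi> a)" by (simp add: fun_eq_iff)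
lemma pull_nonneg: "0 \<le> v \<Longrightarrow> 0 \<le> pull \<pi> v" by (simp add: le_fun_def)
lemma pull_pull: "pull \<pi> (pull \<sigma> v) = pull (\<sigma> \<circ> \<pi>) v" by (simp add: fun_eq_iff)

lemma fixbij_lt: "fixbij n \<pi> \<Longrightarrow> \<pi> i < n \<longleftrightarrow> i < n"
 unfolding fixbij_def by (metis bij_pointE linorder_not_le)

lemma fixbij_inv: "fixbij n \<pi> \<Longrightarrow> fixbij n (inv \<pi>)"
 unfolding fixbij_def by (metis bij_imp_bij_inv bij_inv_eq_iff)

lemma fixbij_id: "fixbij n id" by (simp add: fixbij_def)

lemma fixbij_comp: "fixbij n \<pi> \<Longrightarrow> fixbij n \<sigma> \<Longrightarrow> fixbij n (\<sigma> \<circ> \<pi>)"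
 unfolding fixbij_def by (simp add: bij_comp)

lemma fixbij_inv_apply: "fixbij n \<pi> \<Longrightarrow> inv \<pi> (\<pi> i) = i" "fixbij n \<pi> \<Longrightarrow> \<pi> (inv \<pi> i) = i"
 unfolding fixbij_def by (simp_all add: bij_is_inj bij_is_surj surj_f_inv_f)

lemma pull_inv: "fixbij n \<pi> \<Longrightarrow> pull \<pi> (pull (inv \<pi>) v) = v" "fixbij n \<pi> \<Longrightarrow> pull (inv \<pi>) (pull \<pi> v) = v"
 by (simp_all add: fun_eq_iff fixbij_inv_apply)

lemma pull_Zn: "fixbij n \<pi> \<Longrightarrow> v \<in> Zn n \<Longrightarrow> pull \<pi> v \<in> Zn n"
 unfolding fixbij_def Zn_def by simp

lemma pull_uv: "fixbij n \<pi> \<Longrightarrow> pull \<pi> (uv i) = uv (inv \<pi> i)"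
proof (rule ext)
 fix x assume "fixbij n \<pi>"
 then have "\<pi> x = i \<longleftrightarrow> x = inv \<pi> i" using fixbij_inv_apply by metis
 then show "pull \<pi> (uv i) x = uv (inv \<pi> i) x" by (simp add: uv_apply)
qed

lemma pull_inv_uv: "fixbij n \<pi> \<Longrightarrow> pull (inv \<pi>) (uv i) = uv (\<pi> i)"
 using pull_uv[OF fixbij_inv, of n \<pi> i] unfolding fixbij_def by (simp add: inv_inv_eq)

lemma pull_image_iff: "fixbij n \<pi> \<Longrightarrow> p \<in> pull \<pi> ` S \<longleftrightarrow> pull (inv \<pi>) p \<in> S"
 using pull_inv[of n \<pi>] by (metis image_iff)

lemma downset_pull:
 assumes "fixbij n \<pi>" "downset n S" shows "downset n (pull \<pi> ` S)"
proof -
 interpret staircase n S by unfold_locales (rule assms(2))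
 show ?thesis
  unfolding downset_def
 proof (intro conjI ballI allI impI)
  show "finite (pull \<pi> ` S)" by simp
  show "0 \<in> pull \<pi> ` S"
  proof (rule image_eqI[OF _ S_0])
   show "0 = pull \<pi> 0" by (rule ext) simp
  qed
  show "uv i \<in> pull \<pi> ` S" if "i < n" for i
  proof (rule image_eqI)
   show "uv i = pull \<pi> (uv (\<pi> i))" unfolding pull_uv[OF assms(1)] fixbij_inv_apply[OF assms(1)] ..
   show "uv (\<pi> i) \<in> S" by (rule S_uv) (use fixbij_lt[OF assms(1)] that in blast)
  qed
 next
  fix p assume p: "p \<in> pull \<pi> ` S"
  then obtain v where v: "v \<in> S" "p = pull \<pi> v" by blast
  show "0 \<le> p" unfolding v(2) by (rule pull_nonneg[OF S_nonneg[OF v(1)]])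
  show "p \<in> Zn n" unfolding v(2) by (rule pull_Zn[OF assms(1) S_Zn[OF v(1)]])
  fix q assume q: "0 \<le> q \<and> q \<le> p"
  have "pull (inv \<pi>) q \<le> v"
  proof (rule le_funI)
   fix x
   have "q (inv \<pi> x) \<le> p (inv \<pi> x)" by (rule le_funD[OF conjunct2[OF q]])
   then show "pull (inv \<pi>) q x \<le> v x" unfolding v(2) by (simp add: fixbij_inv_apply[OF assms(1)])
  qed
  moreover have "0 \<le> pull (inv \<pi>) q" by (rule pull_nonneg) (use q in blast)
  ultimately have "pull (inv \<pi>) q \<in> S" by (intro S_down[OF v(1)])
  then show "q \<in> pull \<pi> ` S" by (rule pull_image_iff[OF assms(1), THEN iffD2])
 qed
qed

lemma allowed_pull_imp:
 assumes "fixbij n \<pi>" "allowed n S a (\<pi> m)" shows "allowed n (pull \<pi> ` S) (pull \<pi> a) m"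
 unfolding allowed_def
proof (intro conjI allI impI)
 have a: "\<pi> m < n" "a + uv (\<pi> m) \<in> S" using assms(2) unfolding allowed_def by blast+
 show "m < n" using a fixbij_lt[OF assms(1)] by blast
 have "pull \<pi> (a + uv (\<pi> m)) = pull \<pi> a + uv m"
  unfolding pull_add pull_uv[OF assms(1)] fixbij_inv_apply[OF assms(1)] ..
 then show "pull \<pi> a + uv m \<in> pull \<pi> ` S" using a(2) by (metis imageI)
 fix q assume q: "0 \<le> q \<and> q \<in> Zn n \<and> 1 \<le> q m \<and> q + pull \<pi> a \<in> pull \<pi> ` S"
 define r where "r = pull (inv \<pi>) q"
 have qr: "q = pull \<pi> r" unfolding r_def pull_inv[OF assms(1)] ..
 have "pull (inv \<pi>) (q + pull \<pi> a) = r + a" unfolding pull_add r_def pull_inv[OF assms(1)] ..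
 then have "r + a \<in> S" using q pull_image_iff[OF assms(1)] by metis
 moreover have "0 \<le> r" unfolding r_def by (rule pull_nonneg) (use q in blast)
 moreover have "r \<in> Zn n" unfolding r_def by (rule pull_Zn[OF fixbij_inv[OF assms(1)]]) (use q in blast)
 moreover have "1 \<le> r (\<pi> m)" using q unfolding r_def by (simp add: fixbij_inv_apply[OF assms(1)])
 ultimately have "r \<in> S" using assms(2) unfolding allowed_def by blast
 then show "q \<in> pull \<pi> ` S" unfolding qr by (rule imageI)
qed

lemma pull_inv_image: "fixbij n \<pi> \<Longrightarrow> pull (inv \<pi>) ` pull \<pi> ` S = S"
 by (simp add: image_image pull_inv)

lemma wt_pull:
 assumes "fixbij n \<pi>" shows "wt n (pull \<pi> ` S) (pull \<pi> a) = wt n S a"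
proof -
 have "allowed n (pull \<pi> ` S) (pull \<pi> a) m \<longleftrightarrow> allowed n S a (\<pi> m)" for m
  using allowed_pull_imp[OF assms, of S a m]
   allowed_pull_imp[OF fixbij_inv[OF assms], of "pull \<pi> ` S" "pull \<pi> a" "\<pi> m"]
  unfolding pull_inv_image[OF assms] pull_inv[OF assms] fixbij_inv_apply[OF assms] by blast
 note iff = this
 have "{m. allowed n S a m} = \<pi> ` {m. allowed n (pull \<pi> ` S) (pull \<pi> a) m}"
 proof (intro set_eqI iffI)
  fix m assume "m \<in> {m. allowed n S a m}"
  then have "allowed n (pull \<pi> ` S) (pull \<pi> a) (inv \<pi> m)" using iff[of "inv \<pi> m"] fixbij_inv_apply[OF assms] by simp
  then show "m \<in> \<pi> ` {m. allowed n (pull \<pi> ` S) (pull \<pi> a) m}"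
   using fixbij_inv_apply(2)[OF assms, of m] by (metis imageI mem_Collect_eq)
 next
  fix m assume "m \<in> \<pi> ` {m. allowed n (pull \<pi> ` S) (pull \<pi> a) m}"
  then show "m \<in> {m. allowed n S a m}" using iff by blast
 qed
 moreover have "inj_on \<pi> {m. allowed n (pull \<pi> ` S) (pull \<pi> a) m}"
  using assms unfolding fixbij_def by (metis bij_is_inj inj_on_subset subset_UNIV)
 ultimately show ?thesis unfolding wt_def using card_image by metis
qed

lemma wpair_pull:
 assumes "wpair n S S' \<psi> \<psi>'" "fixbij n \<pi>"
 shows "wpair n S (pull \<pi> ` S') (\<lambda>v. pull \<pi> (\<psi> v)) (\<lambda>v. \<psi>' (pull (inv \<pi>) v))"
proof -
 interpret wpair n S S' \<psi> \<psi>' by (rule assms(1))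
 note p = assms(2) note pi = fixbij_inv[OF assms(2)]
 show ?thesis
 proof unfold_locales
  show "downset n (pull \<pi> ` S')" by (rule downset_pull[OF p B.downset])
  show "pull \<pi> (\<psi> (a + b)) = pull \<pi> (\<psi> a) + pull \<pi> (\<psi> b)" if "a \<in> Zn n" "b \<in> Zn n" for a b
   using map_add[OF that] by (simp only: pull_add)
  show "\<psi>' (pull (inv \<pi>) (a + b)) = \<psi>' (pull (inv \<pi>) a) + \<psi>' (pull (inv \<pi>) b)" if "a \<in> Zn n" "b \<in> Zn n" for a b
   unfolding pull_add by (rule map_add'[OF pull_Zn[OF pi that(1)] pull_Zn[OF pi that(2)]])
  show "pull \<pi> (\<psi> a) \<in> Zn n" if "a \<in> Zn n" for a by (rule pull_Zn[OF p closed[OF that]])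
  show "\<psi>' (pull (inv \<pi>) a) \<in> Zn n" if "a \<in> Zn n" for a by (rule closed'[OF pull_Zn[OF pi that]])
  show "\<psi>' (pull (inv \<pi>) (pull \<pi> (\<psi> a))) = a" if "a \<in> Zn n" for a
   using inv[OF that] pull_inv[OF p] by simp
  show "pull \<pi> (\<psi> (\<psi>' (pull (inv \<pi>) a))) = a" if "a \<in> Zn n" for a
   using inv'[OF pull_Zn[OF pi that]] pull_inv[OF p] by simp
  show "wt n (pull \<pi> ` S') (pull \<pi> (\<psi> a)) = wt n S a" if "a \<in> Zn n" for a
   unfolding wt_pull[OF p] by (rule weight[OF that])
 qed
qed

section \<open>Bijections of finite sets compatible with extra structure\<close>

lemma fixbij_extend:
 assumes "A \<subseteq> {..<n}" "B \<subseteq> {..<n}" "bij_betw g A B"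
 shows "\<exists>\<pi>. fixbij n \<pi> \<and> (\<forall>a\<in>A. \<pi> a = g a)"
proof -
 have fin: "finite A" "finite B" using assms finite_subset by auto
 have "card ({..<n} - A) = card ({..<n} - B)"
  using assms fin bij_betw_same_card[OF assms(3)] by (simp add: card_Diff_subset)
 then obtain h where h: "bij_betw h ({..<n} - A) ({..<n} - B)" using finite_same_card_bij[of "{..<n} - A" "{..<n} - B"] by auto
 define \<pi> where "\<pi> i = (if i \<in> A then g i else if i < n then h i else i)" for i
 have "bij_betw \<pi> A B" using assms(3) by (rule bij_betw_cong[THEN iffD1, rotated]) (auto simp: \<pi>_def)
 moreover have "bij_betw \<pi> ({..<n} - A) ({..<n} - B)"
  using h by (rule bij_betw_cong[THEN iffD1, rotated]) (auto simp: \<pi>_def)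
 ultimately have "bij_betw \<pi> (A \<union> ({..<n} - A)) (B \<union> ({..<n} - B))" by (rule bij_betw_combine) auto
 moreover have "A \<union> ({..<n} - A) = {..<n}" "B \<union> ({..<n} - B) = {..<n}" using assms by auto
 ultimately have "bij_betw \<pi> {..<n} {..<n}" by simp
 moreover have "bij_betw \<pi> {n..} {n..}"
  by (rule bij_betw_cong[THEN iffD1, OF _ bij_betw_id]) (use assms in \<open>auto simp: \<pi>_def\<close>)
 ultimately have "bij_betw \<pi> ({..<n} \<union> {n..}) ({..<n} \<union> {n..})" by (rule bij_betw_combine) auto
 moreover have "{..<n} \<union> {n..} = UNIV" by auto
 ultimately have "bij \<pi>" by simp
 moreover have "\<forall>i\<ge>n. \<pi> i = i" using assms by (auto simp: \<pi>_def)
 moreover have "\<forall>a\<in>A. \<pi> a = g a" by (simp add: \<pi>_def)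
 ultimately show ?thesis unfolding fixbij_def by blast
qed

lemma fibre_bij:
 assumes "finite A" "finite B" "\<And>l. card {a \<in> A. f a = l} = card {b \<in> B. f' b = l}"
 shows "\<exists>g. bij_betw g A B \<and> (\<forall>a\<in>A. f' (g a) = f a)"
proof -
 have "\<exists>g. bij_betw g {a \<in> A. f a = l} {b \<in> B. f' b = l}" for l
  using finite_same_card_bij[of "{a \<in> A. f a = l}" "{b \<in> B. f' b = l}"] assms by auto
 then obtain G where G: "\<And>l. bij_betw (G l) {a \<in> A. f a = l} {b \<in> B. f' b = l}" by metis
 define g where "g a = G (f a) a" for a
 have gB: "g a \<in> B \<and> f' (g a) = f a" if "a \<in> A" for a
 proof -
  have "G (f a) a \<in> {b \<in> B. f' b = f a}" by (rule bij_betwE[OF G, rule_format]) (use that in simp)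
  then show ?thesis unfolding g_def by simp
 qed
 have "inj_on g A"
 proof (rule inj_onI)
  fix a b assume ab: "a \<in> A" "b \<in> A" "g a = g b"
  then have "f a = f b" using gB by metis
  then have "G (f a) a = G (f a) b" using ab(3) unfolding g_def by simp
  then show "a = b" using inj_onD[OF bij_betw_imp_inj_on[OF G[of "f a"]]] ab \<open>f a = f b\<close> by simp
 qed
 moreover have "g ` A = B"
 proof
  show "g ` A \<subseteq> B" using gB by blast
  show "B \<subseteq> g ` A"
  proof
   fix b assume "b \<in> B"
   then have "b \<in> G (f' b) ` {a \<in> A. f a = f' b}" using bij_betw_imp_surj_on[OF G[of "f' b"]] by simp
   then obtain a where "a \<in> A" "f a = f' b" "b = G (f' b) a" by blast
   then show "b \<in> g ` A" unfolding g_def by (intro image_eqI[of _ _ a]) auto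
  qed
 qed
 ultimately show ?thesis using gB unfolding bij_betw_def by blast
qed

text \<open>The numbers of points and of orbits determine how many orbits have one and two elements.
  Orbits of equal size are removed in pairs. If no such pair exists, one involution is fixed-point
  free and the other is the identity, and equal cardinalities contradict equal orbit counts.\<close>

lemma involution_bij:
 assumes "finite A" "finite B" "card A = card B"
  and "\<And>a. a \<in> A \<Longrightarrow> f a \<in> A \<and> f (f a) = a" "\<And>b. b \<in> B \<Longrightarrow> g b \<in> B \<and> g (g b) = b"
  and "card ((\<lambda>a. {a, f a}) ` A) = card ((\<lambda>b. {b, g b}) ` B)"
 shows "\<exists>h. bij_betw h A B \<and> (\<forall>a\<in>A. h (f a) = g (h a))"
 using assms
proof (induction "card A" arbitrary: A B rule: less_induct)
 case less
 note fA = less(2) and fB = less(3) and cAB = less(4) and f = less(5) and g = less(6) and orb = less(7)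
 have remove: "card ((\<lambda>a. {a, f' a}) ` X) = Suc (card ((\<lambda>a. {a, f' a}) ` (X - {a, f' a})))"
  if X: "finite X" "\<And>a. a \<in> X \<Longrightarrow> f' a \<in> X \<and> f' (f' a) = a" "a \<in> X" for f' X and a :: 'x
 proof -
  have "{a, f' a} \<notin> (\<lambda>a. {a, f' a}) ` (X - {a, f' a})"
  proof
   assume "{a, f' a} \<in> (\<lambda>a. {a, f' a}) ` (X - {a, f' a})"
   then obtain x where x: "x \<in> X - {a, f' a}" "{a, f' a} = {x, f' x}" by (rule imageE)
   have "x \<in> {x, f' x}" by simp
   then show False using x by (metis DiffD2)
  qed
  moreover have "(\<lambda>a. {a, f' a}) ` X = insert {a, f' a} ((\<lambda>a. {a, f' a}) ` (X - {a, f' a}))"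
  proof -
   have "X = insert a (insert (f' a) (X - {a, f' a}))" using X(2)[OF X(3)] X(3) by blast
   then have "(\<lambda>a. {a, f' a}) ` X = (\<lambda>a. {a, f' a}) ` insert a (insert (f' a) (X - {a, f' a}))"
    by (rule arg_cong)
   also have "\<dots> = insert {a, f' a} (insert {f' a, f' (f' a)} ((\<lambda>a. {a, f' a}) ` (X - {a, f' a})))"
    by (simp only: image_insert)
   also have "{f' a, f' (f' a)} = {a, f' a}" using X(2)[OF X(3)] by (simp add: insert_commute)
   finally show ?thesis by simp
  qed
  ultimately show ?thesis using X(1) by simp
 qed
 have step: ?case if a: "a \<in> A" and b: "b \<in> B" and fix_iff: "f a = a \<longleftrightarrow> g b = b" for a b
 proof -
  let ?A = "A - {a, f a}" and ?B = "B - {b, g b}"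
  have cA: "card {a, f a} = card {b, g b}"
  proof (cases "f a = a")
   case True
   moreover have "g b = b" using True fix_iff by blast
   ultimately show ?thesis by simp
  next
   case False
   moreover have "g b \<noteq> b" using False fix_iff by blast
   ultimately show ?thesis by (metis card_2_iff)
  qed
  have c1: "card ?A = card A - card {a, f a}" using f[OF a] a by (intro card_Diff_subset) auto
  have c2: "card ?B = card B - card {b, g b}" using g[OF b] b by (intro card_Diff_subset) auto
  have cc: "card ?A = card ?B" using c1 c2 cA cAB by simp
  have lt: "card ?A < card A" by (rule psubset_card_mono[OF fA]) (use a in blast)
  have stable: "u x \<in> X - {c, u c} \<and> u (u x) = x"
   if "x \<in> X - {c, u c}" "c \<in> X" "\<And>y. y \<in> X \<Longrightarrow> u y \<in> X \<and> u (u y) = y" for x c X and u :: "'x \<Rightarrow> 'x"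
  proof -
   have x: "x \<in> X" "x \<noteq> c" "x \<noteq> u c" using that(1) by simp_all
   have "u x \<noteq> c"
   proof
    assume "u x = c"
    then show False using that(3)[OF x(1)] x(3) by metis
   qed
   moreover have "u x \<noteq> u c"
   proof
    assume "u x = u c"
    then show False using that(3)[OF x(1)] that(3)[OF that(2)] x(2) by metis
   qed
   ultimately show ?thesis using that(3)[of x] that(1) by blast
  qed
  have "card ((\<lambda>a. {a, f a}) ` ?A) = card ((\<lambda>b. {b, g b}) ` ?B)"
   using remove[OF fA f a] remove[OF fB g b] orb by simp
  from less(1)[OF lt finite_Diff[OF fA] finite_Diff[OF fB] cc stable[OF _ a f] stable[OF _ b g] this]
  obtain h where h: "bij_betw h ?A ?B" "\<forall>x\<in>?A. h (f x) = g (h x)" by blast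
  define h' where "h' x = (if x = a then b else if x = f a then g b else h x)" for x
  have "bij_betw h' ?A ?B" using h(1) by (rule bij_betw_cong[THEN iffD1, rotated]) (auto simp: h'_def)
  moreover have "bij_betw h' {a, f a} {b, g b}"
  proof (cases "f a = a")
   case True
   moreover have "g b = b" using True fix_iff by blast
   moreover have "h' a = b" unfolding h'_def by (rule if_P[OF refl])
   ultimately show ?thesis by (simp add: bij_betw_def)
  next
   case False
   moreover have "g b \<noteq> b" using False fix_iff by blast
   moreover have "h' a = b" "h' (f a) = g b" unfolding h'_def using False by simp_all
   ultimately show ?thesis unfolding bij_betw_def inj_on_def by simp
  qed
  ultimately have "bij_betw h' (?A \<union> {a, f a}) (?B \<union> {b, g b})" by (rule bij_betw_combine) auto
  moreover have "?A \<union> {a, f a} = A" "?B \<union> {b, g b} = B" using a b f[OF a] g[OF b] by blast+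
  ultimately have "bij_betw h' A B" by simp
  moreover have "h' (f x) = g (h' x)" if "x \<in> A" for x
  proof (cases "x \<in> ?A")
   case True
   then have "f x \<in> ?A" using stable[OF _ a f] by blast
   then show ?thesis using h(2) True unfolding h'_def by simp
  next
   case False
   have ha: "h' a = b" unfolding h'_def by (rule if_P[OF refl])
   have hfa: "h' (f a) = g b"
   proof (cases "f a = a")
    case True
    then show ?thesis using ha fix_iff by metis
   next
    case False then show ?thesis unfolding h'_def by simp
   qed
   have ffa: "f (f a) = a" "g (g b) = b" using f[OF a] g[OF b] by blast+
   from False have "x = a \<or> x = f a" using that by blast
   then show ?thesis
   proof
    assume "x = a" then show ?thesis by (simp only: ha hfa)
   next
    assume "x = f a" then show ?thesis by (simp only: ha hfa ffa)
   qed
  qed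
  ultimately show ?case by blast
 qed
 show ?case
 proof (cases "A = {}")
  case True
  then have "B = {}" using cAB fB by simp
  then show ?thesis using True by (simp add: bij_betw_def)
 next
  case False
  then have neB: "B \<noteq> {}" using cAB fA by auto
  have no_inj: "\<not> (\<forall>x\<in>X. f' x \<noteq> x)" if X: "finite X" "X \<noteq> {}" "\<And>a. a \<in> X \<Longrightarrow> f' a \<in> X \<and> f' (f' a) = a"
   "card ((\<lambda>a. {a, f' a}) ` X) = card X" for f' and X :: "'y set"
  proof
   assume nf: "\<forall>x\<in>X. f' x \<noteq> x"
   obtain x where x: "x \<in> X" using X(2) by blast
   have fx: "f' x \<in> X" "f' (f' x) = x" using X(3)[OF x] by blast+
   have "{x, f' x} = {f' x, f' (f' x)}" unfolding fx(2) by (rule insert_commute)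
   then have "x = f' x" by (rule inj_onD[OF eq_card_imp_inj_on[OF X(1,4)] _ x fx(1)])
   then show False using nf x by metis
  qed
  have all_fix: "card ((\<lambda>a. {a, f' a}) ` X) = card X" if "\<forall>x\<in>X. f' x = x" for f' and X :: "'y set"
  proof -
   have "(\<lambda>a. {a, f' a}) ` X = (\<lambda>a. {a}) ` X" by (rule image_cong) (use that in simp_all)
   then show ?thesis by (simp add: card_image)
  qed
  show ?thesis
  proof (cases "\<exists>a\<in>A. \<exists>b\<in>B. f a = a \<longleftrightarrow> g b = b")
   case True then show ?thesis using step by blast
  next
   case none: False
   show ?thesis
   proof (cases "\<exists>a\<in>A. f a = a")
    case True
    then obtain a0 where a0: "a0 \<in> A" "f a0 = a0" by blast
    have nf: "\<forall>b\<in>B. g b \<noteq> b" using none a0 by blast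
    obtain b0 where b0: "b0 \<in> B" using neB by blast
    then have "g b0 \<noteq> b0" using nf by blast
    then have "\<forall>a\<in>A. f a = a" using none b0 by blast
    then have "card ((\<lambda>a. {a, f a}) ` A) = card A" by (rule all_fix)
    then have "card ((\<lambda>b. {b, g b}) ` B) = card B" unfolding orb cAB .
    from no_inj[OF fB neB g this] nf show ?thesis by (rule notE)
   next
    case False
    obtain a0 where a0: "a0 \<in> A" using \<open>A \<noteq> {}\<close> by blast
    then have "f a0 \<noteq> a0" using False by blast
    then have "\<forall>b\<in>B. g b = b" using none a0 by blast
    then have "card ((\<lambda>b. {b, g b}) ` B) = card B" by (rule all_fix)
    then have "card ((\<lambda>a. {a, f a}) ` A) = card A" unfolding orb cAB .
    from no_inj[OF fA \<open>A \<noteq> {}\<close> f this] show ?thesis using False by blast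
   qed
  qed
 qed
qed

lemma (in wpair) fpair_if_fixed:
 assumes fixed: "\<And>z. z \<in> A.K \<Longrightarrow> \<psi> (uv z) = uv z" shows "fpair n S S' \<psi> \<psi>'"
proof -
 have "B.K = A.K"
 proof
  show "A.K \<subseteq> B.K"
  proof
   fix z assume z: "z \<in> A.K"
   obtain m where "m \<in> B.K" "\<psi> (uv z) = uv m" using big_unit[OF z] by blast
   then show "z \<in> B.K" using fixed[OF z] by simp
  qed
  show "B.K \<subseteq> A.K"
  proof
   fix m assume m: "m \<in> B.K"
   then obtain z where z: "z \<in> A.K" "\<psi>' (uv m) = uv z" using swap.big_unit by blast
   have "\<psi> (uv z) = uv m" using inv'[OF Zn_uv[OF B.K_less[OF m]]] z(2) by simp
   then show "m \<in> A.K" using fixed[OF z(1)] z(1) by simp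
  qed
 qed
 then show ?thesis using fixed by unfold_locales
qed

text \<open>By \<open>big_unit\<close> thick units go to thick units, bijectively because the
  inverse does the same. A permutation undoing this bijection makes the isomorphism fix
  them.\<close>

lemma (in wpair) ex_fpair:
 shows "\<exists>\<pi>. fixbij n \<pi> \<and> fpair n S (pull \<pi> ` S') (\<lambda>v. pull \<pi> (\<psi> v)) (\<lambda>v. \<psi>' (pull (inv \<pi>) v))"
proof -
 obtain k where k: "\<And>z. z \<in> A.K \<Longrightarrow> k z \<in> B.K \<and> \<psi> (uv z) = uv (k z)" using big_unit by metis
 have "inj_on k A.K"
 proof (rule inj_onI)
  fix x y assume xy: "x \<in> A.K" "y \<in> A.K" "k x = k y"
  then have "\<psi> (uv x) = \<psi> (uv y)" using k by metis
  then have "uv x = uv y" using inv[OF Zn_uv] A.K_less xy by metis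
  then show "x = y" by simp
 qed
 moreover have "k ` A.K = B.K"
 proof
  show "k ` A.K \<subseteq> B.K" using k by blast
  show "B.K \<subseteq> k ` A.K"
  proof
   fix m assume m: "m \<in> B.K"
   then obtain z where z: "z \<in> A.K" "\<psi>' (uv m) = uv z" using swap.big_unit by blast
   have "uv m = \<psi> (uv z)" using inv'[OF Zn_uv[OF B.K_less[OF m]]] z(2) by simp
   then have "uv m = uv (k z)" using k[OF z(1)] by simp
   then show "m \<in> k ` A.K" using z(1) by simp
  qed
 qed
 ultimately have "bij_betw k A.K B.K" unfolding bij_betw_def by blast
 then obtain \<pi> where p: "fixbij n \<pi>" "\<And>z. z \<in> A.K \<Longrightarrow> \<pi> z = k z"
  using fixbij_extend[of A.K n B.K k] A.K_less B.K_less by (metis lessThan_iff subsetI)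
 interpret P: wpair n S "pull \<pi> ` S'" "\<lambda>v. pull \<pi> (\<psi> v)" "\<lambda>v. \<psi>' (pull (inv \<pi>) v)"
  by (rule wpair_pull[OF wpair_axioms p(1)])
 have fixed: "pull \<pi> (\<psi> (uv z)) = uv z" if "z \<in> A.K" for z
  using k[OF that] p(2)[OF that] pull_uv[OF p(1), of "\<pi> z"] fixbij_inv_apply(1)[OF p(1), of z] by simp
 have "fpair n S (pull \<pi> ` S') (\<lambda>v. pull \<pi> (\<psi> v)) (\<lambda>v. \<psi>' (pull (inv \<pi>) v))"
  by (rule P.fpair_if_fixed[OF fixed])
 then show ?thesis using p(1) by blast
qed

section \<open>Chain variables and isolated blocks\<close>

context staircase
begin

definition chains :: "nat set" where "chains = {i \<in> thins. J i \<in> K}"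
text \<open>By \<open>box\<close> these variables form blocks cut off from all others: a single x
  with square 0, a single x with cube 0, or two variables whose product is their only proper
  multiple.\<close>

definition W :: "nat set" where "W = {i \<in> thins. J i \<notin> K}"

lemma thinsD: "i \<in> thins \<Longrightarrow> i < n" "i \<in> thins \<Longrightarrow> i \<notin> K" by (simp_all add: thins_def)

lemma chain_Q: assumes "i \<in> thins" "J i \<in> K" shows "1 \<le> Q i"
proof -
 have "Q i \<noteq> 0"
 proof
  assume "Q i = 0"
  then have "J i = i" using thin_Q0 thinsD[OF assms(1)] by blast
  then show False using assms thinsD by metis
 qed
 then show ?thesis using thin_Q[OF thinsD[OF assms(1)]] by linarith
qed

text \<open>\<open>J\<close> is a choice made separately in each staircase. This form is free of it
  and can be compared after renaming variables.\<close>

lemma chain_iff: assumes i: "i \<in> thins" shows "J i \<in> K \<longleftrightarrow> (\<exists>z\<in>K. uv i + uv z \<in> S)"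
proof
 assume "J i \<in> K"
 moreover have "uv i + vsc 1 (uv (J i)) \<in> S"
  using thin_mem[OF thinsD[OF i], of 1] chain_Q[OF i \<open>J i \<in> K\<close>] by simp
 ultimately show "\<exists>z\<in>K. uv i + uv z \<in> S" by auto
next
 assume "\<exists>z\<in>K. uv i + uv z \<in> S"
 then obtain z where z: "z \<in> K" "uv i + uv z \<in> S" by blast
 have "1 \<le> (uv i + uv z) i" using uv_nonneg_at[of z i] by simp
 then obtain q where "uv i + uv z = uv i + vsc q (uv (J i))" using thin_form[OF thinsD[OF i] z(2)] by blast
 from fun_cong[OF this, of z] have "1 = q * uv (J i) z" by simp
 then have "J i = z" by (auto simp: uv_apply split: if_splits)
 then show "J i \<in> K" using z by simp
qed

lemma nu_chain:
 assumes "j \<in> K" "1 \<le> q" shows "nu (vsc q (uv j)) = card {i \<in> thins. J i = j \<and> q \<le> Q i}"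
proof -
 have "vsc q (uv j) + uv i \<in> S \<longleftrightarrow> J i = j \<and> q \<le> Q i" if i: "i \<in> thins" for i
 proof
  assume s: "vsc q (uv j) + uv i \<in> S"
  obtain r where r: "r \<le> Q i" "vsc q (uv j) = vsc r (uv (J i))"
   using nu_pos_form[OF i s ZK_vsc[OF ZK_uv[OF assms(1)]]] by metis
  from fun_cong[OF r(2), of j] have "q = r * uv (J i) j" by simp
  then have "J i = j" "r = q" using assms(2) by (auto simp: uv_apply split: if_splits)
  then show "J i = j \<and> q \<le> Q i" using r by simp
 next
  assume "J i = j \<and> q \<le> Q i"
  then have "uv i + vsc q (uv j) \<in> S" using thin_mem[OF thinsD[OF i], of q] assms(2) by auto
  then show "vsc q (uv j) + uv i \<in> S" by (simp add: add.commute)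
 qed
 then have "{i \<in> thins. vsc q (uv j) + uv i \<in> S} = {i \<in> thins. J i = j \<and> q \<le> Q i}" by blast
 then show ?thesis unfolding nu_def by simp
qed

text \<open>Subtract the number of chains of length at least q + 1 from that of length at least q.
  Since both are values of \<open>nu\<close>, \<open>nu_eq\<close> makes the fibres of the two
  staircases equinumerous.\<close>

lemma chain_fibre:
 "card {i \<in> chains. (J i, Q i) = l} =
  (if fst l \<in> K \<and> 1 \<le> snd l then nu (vsc (snd l) (uv (fst l))) - nu (vsc (snd l + 1) (uv (fst l))) else 0)"
proof (cases "fst l \<in> K \<and> 1 \<le> snd l")
 case True
 obtain j q where l: "l = (j, q)" by (cases l)
 have jq: "j \<in> K" "1 \<le> q" using True l by simp_all
 have "{i \<in> chains. (J i, Q i) = l} = {i \<in> thins. J i = j \<and> q \<le> Q i} - {i \<in> thins. J i = j \<and> q + 1 \<le> Q i}"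
  using jq l by (auto simp: chains_def)
 moreover have "card ({i \<in> thins. J i = j \<and> q \<le> Q i} - {i \<in> thins. J i = j \<and> q + 1 \<le> Q i}) =
   card {i \<in> thins. J i = j \<and> q \<le> Q i} - card {i \<in> thins. J i = j \<and> q + 1 \<le> Q i}"
  by (rule card_Diff_subset) auto
 ultimately show ?thesis using nu_chain[OF jq] nu_chain[OF jq(1), of "q + 1"] jq l by simp
next
 case False
 then have "{i \<in> chains. (J i, Q i) = l} = {}" using chain_Q by (auto simp: chains_def)
 then have "card {i \<in> chains. (J i, Q i) = l} = 0" by (simp only: card.empty)
 then show ?thesis by (simp only: False if_False)
qed

end

text \<open>Thick variables stay fixed, chain variables are matched along the fibres of (J, Q), and
  the complement of both is \<open>W\<close> on either side.\<close>

lemma (in fpair) ex_core: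
 "\<exists>\<pi>. fixbij n \<pi> \<and> (\<forall>z\<in>KK. \<pi> z = z) \<and> (\<forall>i\<in>A.chains. \<pi> i \<in> B.chains \<and> B.J (\<pi> i) = A.J i \<and> B.Q (\<pi> i) = A.Q i) \<and>
  (\<forall>i\<in>A.W. \<pi> i \<in> B.W)"
proof -
 have v0: "vsc q (uv j) \<in> A.ZK" "0 \<le> vsc q (uv j)" if "j \<in> KK" "1 \<le> q" for q j
  using that by (auto intro!: A.ZK_vsc A.ZK_uv vsc_nonneg)
 have "card {i \<in> A.chains. (A.J i, A.Q i) = l} = card {i \<in> B.chains. (B.J i, B.Q i) = l}" for l
  using A.chain_fibre[of l] B.chain_fibre[of l] nu_eq[OF v0, of "fst l" "snd l"] nu_eq[OF v0, of "fst l" "snd l + 1"] K_eq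
  by simp
 then obtain g where g: "bij_betw g A.chains B.chains" "\<forall>i\<in>A.chains. (B.J (g i), B.Q (g i)) = (A.J i, A.Q i)"
  using fibre_bij[of A.chains B.chains "\<lambda>i. (A.J i, A.Q i)" "\<lambda>i. (B.J i, B.Q i)"]
  unfolding A.chains_def B.chains_def by auto
 define g' where "g' i = (if i \<in> KK then i else g i)" for i
 have disj: "KK \<inter> A.chains = {}" "KK \<inter> B.chains = {}"
  unfolding A.chains_def B.chains_def A.thins_def B.thins_def K_eq by auto
 have "bij_betw g' KK KK" by (rule bij_betw_cong[THEN iffD1, OF _ bij_betw_id]) (simp add: g'_def)
 moreover have "bij_betw g' A.chains B.chains"
  by (rule bij_betw_cong[THEN iffD1, OF _ g(1)]) (use disj in \<open>auto simp: g'_def\<close>)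
 ultimately have "bij_betw g' (KK \<union> A.chains) (KK \<union> B.chains)" by (rule bij_betw_combine) (rule disj)
 moreover have "KK \<union> A.chains \<subseteq> {..<n}" "KK \<union> B.chains \<subseteq> {..<n}"
  using A.K_less A.thinsD B.thinsD unfolding A.chains_def B.chains_def by auto
 ultimately obtain \<pi> where p: "fixbij n \<pi>" "\<forall>i\<in>KK \<union> A.chains. \<pi> i = g' i" using fixbij_extend by blast
 have 1: "\<pi> z = z" if "z \<in> KK" for z using p(2) that unfolding g'_def by simp
 have ch: "\<pi> i = g i" if "i \<in> A.chains" for i using p(2) that disj unfolding g'_def by auto
 have 2: "\<pi> i \<in> B.chains \<and> B.J (\<pi> i) = A.J i \<and> B.Q (\<pi> i) = A.Q i" if "i \<in> A.chains" for i
  using ch[OF that] g that bij_betwE by (metis prod.inject)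
 have 3: "\<pi> i \<in> B.W" if i: "i \<in> A.W" for i
 proof -
  have iW: "i < n" "i \<notin> KK" "i \<notin> A.chains" using i A.thinsD unfolding A.W_def A.chains_def by auto
  have inj: "\<pi> x = \<pi> y \<Longrightarrow> x = y" for x y using fixbij_inv_apply(1)[OF p(1)] by metis
  have "\<pi> i \<notin> KK" using inj[of i "\<pi> i"] 1[of "\<pi> i"] iW(2) by metis
  moreover have "\<pi> i \<notin> B.chains"
  proof
   assume "\<pi> i \<in> B.chains"
   then obtain x where "x \<in> A.chains" "\<pi> i = g x" using g(1) unfolding bij_betw_def by auto
   then have "i = x" using ch inj by metis
   then show False using iW \<open>x \<in> A.chains\<close> by simp
  qed
  moreover have "\<pi> i < n" using fixbij_lt[OF p(1)] iW(1) by blast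
  ultimately show ?thesis unfolding B.W_def B.chains_def B.thins_def K_eq by blast
 qed
 show ?thesis using p(1) 1 2 3 by blast
qed

lemma card_image_cong_kernel:
 assumes "\<And>x y. x \<in> I \<Longrightarrow> y \<in> I \<Longrightarrow> f x = f y \<longleftrightarrow> g x = g y"
 shows "card (f ` I) = card (g ` I)"
proof -
 have "bij_betw (\<lambda>s. g (inv_into I f s)) (f ` I) (g ` I)"
 proof (rule bij_betw_imageI)
  show "inj_on (\<lambda>s. g (inv_into I f s)) (f ` I)"
  proof (rule inj_onI)
   fix s t assume st: "s \<in> f ` I" "t \<in> f ` I" "g (inv_into I f s) = g (inv_into I f t)"
   then have "f (inv_into I f s) = f (inv_into I f t)" using assms[OF inv_into_into[OF st(1)] inv_into_into[OF st(2)]] by blast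
   then show "s = t" unfolding f_inv_into_f[OF st(1)] f_inv_into_f[OF st(2)] .
  qed
  have e: "g (inv_into I f (f x)) = g x" if "x \<in> I" for x
   using assms[OF inv_into_into[of "f x" f I] that] f_inv_into_f[of "f x" f I] that by simp
  then show "(\<lambda>s. g (inv_into I f s)) ` f ` I = g ` I" unfolding image_image by (rule image_cong[OF refl])
 qed
 then show ?thesis by (rule bij_betw_same_card)
qed

section \<open>Counting derivations that touch isolated blocks\<close>

context staircase
begin

text \<open>The pair (g, m) stands for the derivation x^g d/dx_m, whose weight is
  \<open>g - uv m\<close>.\<close>

definition derivs :: "((nat \<Rightarrow> int) \<times> nat) set" where
 "derivs = {(g, m). g \<in> S \<and> allowed n S (g - uv m) m}"

definition iso_points :: "nat set" where "iso_points = {i \<in> W. Q i = 0}"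
definition iso_pairs :: "nat set" where "iso_pairs = {i \<in> W. Q i = 1}"

lemma W_thin: "i \<in> W \<Longrightarrow> i < n" "i \<in> W \<Longrightarrow> i \<notin> K" "i \<in> W \<Longrightarrow> J i \<notin> K"
 unfolding W_def thins_def by blast+

lemma finite_W [simp]: "finite W" unfolding W_def by simp

lemma W_Q: assumes "i \<in> W" shows "Q i = 0 \<or> Q i = 1" "Q i = 0 \<Longrightarrow> J i = i"
proof -
 note t = W_thin[OF assms]
 show "Q i = 0 \<or> Q i = 1"
 proof (cases "J i = i")
  case True then show ?thesis using thin_Q[OF t(1,2)] thin_self[OF t(1,2)] by linarith
 next
  case False then show ?thesis using box(1)[OF t] by blast
 qed
 show "Q i = 0 \<Longrightarrow> J i = i" by (rule thin_Q0[OF t(1,2)])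
qed

lemma W_J: assumes "i \<in> W" shows "J i \<in> W" "J (J i) = i" "Q (J i) = Q i"
proof -
 note t = W_thin[OF assms]
 show 1: "J (J i) = i" by (cases "J i = i") (simp, rule box(2)[OF t])
 show "J i \<in> W" unfolding W_def thins_def using 1 t thin_J[OF t(1,2)] by simp
 show "Q (J i) = Q i" by (cases "J i = i") (simp, use box(1,3)[OF t] in simp)
qed

lemma W_form: assumes "i \<in> W" "p \<in> S" "1 \<le> p i"
 shows "p = uv i \<or> (Q i = 1 \<and> p = uv i + uv (J i))"
proof -
 obtain q where q: "0 \<le> q" "q \<le> Q i" "p = uv i + vsc q (uv (J i))"
  using thin_form[OF W_thin(1)[OF assms(1)] W_thin(2)[OF assms(1)] assms(2,3)] by blast
 then have "q = 0 \<or> (q = 1 \<and> Q i = 1)" using W_Q(1)[OF assms(1)] by linarith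
 then show ?thesis using q(3) by (elim disjE conjE) simp_all
qed

lemma W_top: "i \<in> W \<Longrightarrow> Q i = 0 \<Longrightarrow> top i = uv i" "i \<in> W \<Longrightarrow> Q i = 1 \<Longrightarrow> top i = uv i + uv (J i)"
 unfolding top_def by simp_all

lemma finite_derivs: "finite derivs"
proof (rule finite_subset)
 show "derivs \<subseteq> S \<times> {..<n}" unfolding derivs_def using allowed_S(1) by auto
 show "finite (S \<times> {..<n})" by simp
qed

lemma card_derivs: "card derivs = (\<Sum>a\<in>{a \<in> Zn n. 0 < w a}. w a)"
proof -
 let ?X = "{a \<in> Zn n. 0 < w a}"
 let ?h = "\<lambda>(a, m). (a + uv m, m :: nat)"
 have im: "?h ` (SIGMA a:?X. {m. allowed n S a m}) = derivs"
 proof (intro set_eqI iffI)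
  fix x assume "x \<in> ?h ` (SIGMA a:?X. {m. allowed n S a m})"
  then obtain a m where "x = (a + uv m, m)" "allowed n S a m" by auto
  then show "x \<in> derivs" unfolding derivs_def using allowed_S(2) by simp
 next
  fix x assume "x \<in> derivs"
  then obtain g m where x: "x = (g, m)" "g \<in> S" "allowed n S (g - uv m) m" unfolding derivs_def by blast
  have "m < n" using allowed_S(1)[OF x(3)] .
  then have "g - uv m \<in> ?X" using w_pos x(3) S_Zn[OF x(2)] by blast
  then have "(g - uv m, m) \<in> (SIGMA a:?X. {m. allowed n S a m})" using x(3) by blast
  moreover have "x = ?h (g - uv m, m)" using x(1) by simp
  ultimately show "x \<in> ?h ` (SIGMA a:?X. {m. allowed n S a m})" by (rule rev_image_eqI)
 qed
 have inj: "inj_on ?h (SIGMA a:?X. {m. allowed n S a m})"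
  by (rule inj_onI) (auto simp del: plus_fun_apply)
 have "?X \<subseteq> (\<lambda>(g, m). g - uv m) ` (S \<times> {..<n})"
 proof
  fix a assume "a \<in> ?X"
  then obtain m where "allowed n S a m" using w_pos by blast
  from allowed_S[OF this] show "a \<in> (\<lambda>(g, m). g - uv m) ` (S \<times> {..<n})"
   by (intro image_eqI[of _ _ "(a + uv m, m)"]) simp_all
 qed
 then have finX: "finite ?X" by (rule finite_subset) simp
 have "card derivs = card (SIGMA a:?X. {m. allowed n S a m})" using card_image[OF inj] im by simp
 also have "\<dots> = (\<Sum>a\<in>?X. card {m. allowed n S a m})" using finX by (intro card_SigmaI) auto
 finally show ?thesis unfolding wt_def .
qed

text \<open>If x_m could be sent to x_i, it would have a nonzero product with the partner of x_i,
  because x_i has. But that partner has no nonzero product with a variable other than x_i.\<close>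

lemma allowed_uv_W:
 assumes "i \<in> iso_pairs" "allowed n S (uv i - uv m) m" shows "m = i"
proof (rule ccontr)
 assume mi: "m \<noteq> i"
 have i: "i \<in> W" "Q i = 1" using assms(1) unfolding iso_pairs_def by blast+
 have t: "uv i + uv (J i) \<in> S" using top_S[OF W_thin(1)[OF i(1)] W_thin(2)[OF i(1)]] W_top(2)[OF i] by simp
 have "uv i - uv m + uv m \<le> uv i + uv (J i)" by simp
 from allowedD[OF assms(2) t this] have "uv i + uv (J i) - (uv i - uv m) \<in> S" .
 moreover have "uv i + uv (J i) - (uv i - uv m) = uv (J i) + uv m" by simp
 ultimately have s: "uv (J i) + uv m \<in> S" by metis
 have "1 \<le> (uv (J i) + uv m) (J i)" using uv_nonneg_at[of m "J i"] by simp
 from W_form[OF W_J(1)[OF i(1)] s this] show False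
 proof
  assume "uv (J i) + uv m = uv (J i)" then show False by simp
 next
  assume "Q (J i) = 1 \<and> uv (J i) + uv m = uv (J i) + uv (J (J i))"
  then have "uv m = uv (J (J i))" by (metis add_left_cancel)
  then show False using mi W_J(2)[OF i(1)] by simp
 qed
qed

text \<open>The image is either the maximal monomial of a block, which every variable can be sent
  to, or a variable that is not maximal in its block, which only the variable itself can be sent
  to.\<close>

lemma derivs_W:
 "{(g, m) \<in> derivs. \<exists>i\<in>W. g i \<noteq> 0} = (top ` W) \<times> {..<n} \<union> (\<lambda>i. (uv i, i)) ` iso_pairs"
proof (intro set_eqI iffI)
 fix x assume "x \<in> {(g, m) \<in> derivs. \<exists>i\<in>W. g i \<noteq> 0}"
 then obtain g m i where x: "x = (g, m)" "g \<in> S" "allowed n S (g - uv m) m" "i \<in> W" "g i \<noteq> 0"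
  unfolding derivs_def by auto
 have m: "m < n" using allowed_S(1)[OF x(3)] .
 have "1 \<le> g i" using x(5) S_nonneg_at[OF x(2), of i] by linarith
 from W_form[OF x(4,2) this] consider "g = uv i" "Q i = 0" | "g = uv i" "Q i = 1" | "Q i = 1" "g = uv i + uv (J i)"
  using W_Q(1)[OF x(4)] by blast
 then show "x \<in> (top ` W) \<times> {..<n} \<union> (\<lambda>i. (uv i, i)) ` iso_pairs"
 proof cases
  case 1
  then have "x = (top i, m)" using W_top(1)[OF x(4)] x(1) by metis
  then show ?thesis using x(4) m by blast
 next
  case 2
  then have ip: "i \<in> iso_pairs" using x(4) unfolding iso_pairs_def by blast
  then have "m = i" using allowed_uv_W[OF ip] x(3) 2 by simp
  then show ?thesis using ip x(1) 2 by blast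
 next
  case 3
  then have "x = (top i, m)" using W_top(2)[OF x(4)] x(1) by metis
  then show ?thesis using x(4) m by blast
 qed
next
 fix x assume "x \<in> (top ` W) \<times> {..<n} \<union> (\<lambda>i. (uv i, i)) ` iso_pairs"
 then consider i m where "i \<in> W" "m < n" "x = (top i, m)" | i where "i \<in> iso_pairs" "x = (uv i, i)" by auto
 then show "x \<in> {(g, m) \<in> derivs. \<exists>i\<in>W. g i \<noteq> 0}"
 proof cases
  case 1
  note t = W_thin(1)[OF 1(1)] W_thin(2)[OF 1(1)]
  have "top i i \<noteq> 0" using top_apply_self[OF t] by simp
  then show ?thesis using allowed_maxl[OF maxl_top[OF t] 1(2)] top_S[OF t] 1 unfolding derivs_def by auto
 next
  case 2
  then have i: "i \<in> W" unfolding iso_pairs_def by blast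
  have u: "uv i \<in> S" using S_uv W_thin(1)[OF i] by blast
  have "allowed n S (uv i - uv i) i" using allowed_nonneg[of "uv i - uv i" i] u W_thin(1)[OF i] by simp
  moreover have "uv i i \<noteq> 0" by simp
  ultimately show ?thesis using u 2 i unfolding derivs_def by blast
 qed
qed

lemma card_derivs_W:
 "card {(g, m) \<in> derivs. \<exists>i\<in>W. g i \<noteq> 0} = card (top ` W) * n + card iso_pairs"
proof -
 have "(top ` W) \<times> {..<n} \<inter> (\<lambda>i. (uv i, i)) ` iso_pairs = {}"
 proof (rule ccontr)
  assume "\<not> ?thesis"
  then obtain x where "x \<in> (top ` W) \<times> {..<n}" "x \<in> (\<lambda>i. (uv i, i)) ` iso_pairs" by blast
  then obtain i k where "i \<in> iso_pairs" "k \<in> W" "x = (uv i, i)" "fst x = top k" by auto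
  then have ik: "i \<in> iso_pairs" "k \<in> W" "uv i = top k" by simp_all
  then have i: "i \<in> W" "Q i = 1" unfolding iso_pairs_def by blast+
  have "maxl (uv i)" using maxl_top[OF W_thin(1)[OF ik(2)] W_thin(2)[OF ik(2)]] ik(3) by simp
  moreover have "uv i + uv (J i) \<in> S" using top_S[OF W_thin(1)[OF i(1)] W_thin(2)[OF i(1)]] W_top(2)[OF i] by simp
  ultimately show False using thin_J[OF W_thin(1)[OF i(1)] W_thin(2)[OF i(1)]] unfolding maxl_def by blast
 qed
 moreover have "finite iso_pairs" unfolding iso_pairs_def by simp
 moreover have "card ((\<lambda>i. (uv i, i)) ` iso_pairs) = card iso_pairs" by (rule card_image) (auto simp: inj_on_def)
 ultimately show ?thesis unfolding derivs_W by (simp add: card_Un_disjoint card_cartesian_product)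
qed

lemma card_W_split: "card W = card iso_points + card iso_pairs"
proof -
 have "W = iso_points \<union> iso_pairs" using W_Q(1) unfolding iso_points_def iso_pairs_def by blast
 moreover have "iso_points \<inter> iso_pairs = {}" unfolding iso_points_def iso_pairs_def by auto
 moreover have "finite iso_points" "finite iso_pairs" unfolding iso_points_def iso_pairs_def by simp_all
 ultimately show ?thesis using card_Un_disjoint[of iso_points iso_pairs] by (simp only:)
qed

text \<open>Maximal monomials count the blocks, and the two members of a pair share theirs.\<close>

lemma card_top_W: "card (top ` W) = card iso_points + card ((\<lambda>i. {i, J i}) ` iso_pairs)"
proof -
 have "W = iso_points \<union> iso_pairs" using W_Q(1) unfolding iso_points_def iso_pairs_def by blast
 then have "top ` W = top ` iso_points \<union> top ` iso_pairs" by (metis image_Un)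
 moreover have "top ` iso_points \<inter> top ` iso_pairs = {}"
 proof (rule ccontr)
  assume "\<not> ?thesis"
  then obtain x where "x \<in> top ` iso_points" "x \<in> top ` iso_pairs" by blast
  then obtain i k where ik: "i \<in> iso_points" "k \<in> iso_pairs" "x = top i" "x = top k" by blast
  have "top i = uv i" "top k = uv k + uv (J k)" using ik(1,2) W_top unfolding iso_points_def iso_pairs_def by blast+
  then have "uv i = uv k + uv (J k)" using ik(3,4) by (simp only:)
  then have s: "(\<Sum>x<n. uv i x) = (\<Sum>x<n. (uv k + uv (J k)) x)" by simp
  have k: "k \<in> W" "i \<in> W" using ik unfolding iso_points_def iso_pairs_def by blast+
  show False using s W_thin(1)[OF k(1)] W_thin(1)[OF k(2)] thin_J[OF W_thin(1)[OF k(1)] W_thin(2)[OF k(1)]]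
   by (simp add: sum.distrib sum_uv)
 qed
 moreover have "finite (top ` iso_points)" "finite (top ` iso_pairs)" unfolding iso_points_def iso_pairs_def by simp_all
 moreover have "card (top ` iso_points) = card iso_points"
 proof (rule card_image, rule inj_onI)
  fix x y assume "x \<in> iso_points" "y \<in> iso_points" "top x = top y"
  then have "uv x = uv y" using W_top(1) unfolding iso_points_def by simp
  then show "x = y" by simp
 qed
 moreover have "card (top ` iso_pairs) = card ((\<lambda>i. {i, J i}) ` iso_pairs)"
 proof (rule card_image_cong_kernel)
  fix x y assume xy: "x \<in> iso_pairs" "y \<in> iso_pairs"
  have W: "x \<in> W" "y \<in> W" "Q x = 1" "Q y = 1" using xy unfolding iso_pairs_def by blast+
  have t: "top x = uv x + uv (J x)" "top y = uv y + uv (J y)" using W_top(2) W by blast+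
  have JJ: "J (J x) = x" "J (J y) = y" using W_J(2) W by blast+
  show "top x = top y \<longleftrightarrow> {x, J x} = {y, J y}"
  proof
   assume "top x = top y"
   then have "(uv x + uv (J x)) y = (uv y + uv (J y)) y" unfolding t by simp
   then have "y = x \<or> y = J x" by (auto simp: uv_apply split: if_splits)
   then show "{x, J x} = {y, J y}" by (elim disjE) (simp_all add: JJ insert_commute)
  next
   assume "{x, J x} = {y, J y}"
   then have "y \<in> {x, J x}" by (simp only: insert_iff simp_thms)
   then have "y = x \<or> y = J x" by simp
   then show "top x = top y" unfolding t by (elim disjE) (simp_all add: JJ add.commute)
  qed
 qed
 ultimately show ?thesis using card_Un_disjoint[of "top ` iso_points" "top ` iso_pairs"] by (simp only:)
qed

end

lemma (in wpair) card_derivs_eq: "card A.derivs = card B.derivs"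
proof -
 have "bij_betw \<psi> {a \<in> Zn n. 0 < A.w a} {a \<in> Zn n. 0 < B.w a}"
 proof (rule bij_betw_byWitness[where f' = \<psi>'])
  show "\<forall>a\<in>{a \<in> Zn n. 0 < A.w a}. \<psi>' (\<psi> a) = a" using inv by blast
  show "\<forall>a\<in>{a \<in> Zn n. 0 < B.w a}. \<psi> (\<psi>' a) = a" using inv' by blast
  show "\<psi> ` {a \<in> Zn n. 0 < A.w a} \<subseteq> {a \<in> Zn n. 0 < B.w a}"
  proof (rule image_subsetI)
   fix a assume "a \<in> {a \<in> Zn n. 0 < A.w a}"
   then have a: "a \<in> Zn n" "0 < A.w a" by blast+
   have "0 < B.w (\<psi> a)" unfolding weight[OF a(1)] by (rule a(2))
   then show "\<psi> a \<in> {a \<in> Zn n. 0 < B.w a}" using closed[OF a(1)] by blast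
  qed
  show "\<psi>' ` {a \<in> Zn n. 0 < B.w a} \<subseteq> {a \<in> Zn n. 0 < A.w a}"
  proof (rule image_subsetI)
   fix a assume "a \<in> {a \<in> Zn n. 0 < B.w a}"
   then have a: "a \<in> Zn n" "0 < B.w a" by blast+
   have "0 < A.w (\<psi>' a)" unfolding swap.weight[OF a(1)] by (rule a(2))
   then show "\<psi>' a \<in> {a \<in> Zn n. 0 < A.w a}" using closed'[OF a(1)] by blast
  qed
 qed
 then have "(\<Sum>a\<in>{a \<in> Zn n. 0 < A.w a}. B.w (\<psi> a)) = (\<Sum>a\<in>{a \<in> Zn n. 0 < B.w a}. B.w a)"
  by (rule sum.reindex_bij_betw)
 moreover have "(\<Sum>a\<in>{a \<in> Zn n. 0 < A.w a}. B.w (\<psi> a)) = (\<Sum>a\<in>{a \<in> Zn n. 0 < A.w a}. A.w a)"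
  by (rule sum.cong[OF refl], rule weight) blast
 ultimately show ?thesis unfolding A.card_derivs B.card_derivs by (simp only:)
qed

text \<open>An isolated variable divides only monomials of its own block, which contain no variable
  outside \<open>W\<close>.\<close>

lemma (in staircase) core_above:
 assumes "0 \<le> g" "g \<noteq> 0" "\<And>i. i \<in> W \<Longrightarrow> g i = 0" "p \<in> S" "g \<le> p" "i \<in> W"
 shows "p i = 0"
proof (rule ccontr)
 assume "p i \<noteq> 0"
 then have "1 \<le> p i" using S_nonneg_at[OF assms(4), of i] by linarith
 then have f: "p = uv i \<or> (Q i = 1 \<and> p = uv i + uv (J i))" by (rule W_form[OF assms(6,4)])
 obtain k where k: "1 \<le> g k" using nonneg_neq_0[OF assms(1,2)] by blast
 then have kW: "k \<notin> W" using assms(3) by force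
 have "k \<noteq> i" "k \<noteq> J i" using kW assms(6) W_J(1)[OF assms(6)] by blast+
 then have "p k = 0" using f by (auto simp: uv_apply)
 then show False using k le_funD[OF assms(5), of k] by simp
qed

text \<open>If all variables are isolated points, the weights are the differences of unit vectors
  and are symmetric under sign change. In the other staircase \<open>uv 0\<close> is a weight, but
  its negative would be that of a plain partial derivative.\<close>

lemma (in wpair) not_pairs_points:
 assumes "0 < n" "\<And>i. i < n \<Longrightarrow> i \<in> A.iso_pairs" "\<And>i. i < n \<Longrightarrow> i \<in> B.iso_points"
 shows False
proof -
 have neg: "0 < B.w (- a)" if a: "0 < B.w a" for a
 proof -
  obtain m where m: "allowed n S' a m" using a B.w_pos by blast
  define g where "g = a + uv m"
  have gS: "g \<in> S'" and mn: "m < n" using B.allowed_S[OF m] unfolding g_def by blast+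
  have "g \<noteq> 0"
  proof
   assume "g = 0"
   then have "a = - uv m" unfolding g_def by (simp add: eq_neg_iff_add_eq_0)
   then show False using m B.not_allowed_0 by blast
  qed
  then obtain i where i: "1 \<le> g i" using nonneg_neq_0 B.S_nonneg[OF gS] by blast
  have "i < n" using Zn_ge[OF B.S_Zn[OF gS], of i] i by linarith
  then have iW: "i \<in> B.W" "B.Q i = 0" using assms(3) unfolding B.iso_points_def by blast+
  then have "g = uv i" using B.W_form[OF iW(1) gS i] by simp
  then have "- a = uv m - uv i" unfolding g_def by (metis add_diff_cancel_right' minus_diff_eq)
  moreover have mW: "m \<in> B.W" "B.Q m = 0" using assms(3)[OF mn] unfolding B.iso_points_def by blast+
  moreover have "B.maxl (uv m)" using B.maxl_top[OF B.W_thin(1,2)[OF mW(1)]] B.W_top(1)[OF mW] by simp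
  ultimately show ?thesis using B.w_maxl_diff \<open>i < n\<close> by simp
 qed
 have z: "0 \<in> A.W" "A.Q 0 = 1" using assms(2)[OF assms(1)] unfolding A.iso_pairs_def by blast+
 have "uv 0 + uv (A.J 0) \<in> S" using A.top_S[OF A.W_thin(1,2)[OF z(1)]] A.W_top(2)[OF z] by simp
 then have "0 < A.w (uv 0)" using A.w_posI[OF uv_nonneg A.thin_J[OF A.W_thin(1,2)[OF z(1)]]] by blast
 then have "0 < B.w (\<psi> (uv 0))" using weight[OF Zn_uv[OF assms(1)]] by simp
 then have "0 < B.w (- \<psi> (uv 0))" by (rule neg)
 moreover have "\<psi> (0 - uv 0) = \<psi> 0 - \<psi> (uv 0)" by (rule map_diff[OF Zn_0 Zn_uv[OF assms(1)]])
 then have "\<psi> (- uv 0) = - \<psi> (uv 0)" using map_0 by simp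
 ultimately have "0 < A.w (- uv 0)" using weight[OF Zn_uminus[OF Zn_uv[OF assms(1)]]] by metis
 then have "allowed n S (- uv 0) 0" by (rule A.w_pos_neg(1)) simp
 then show False using A.not_allowed_0 by blast
qed

section \<open>Matching the isolated blocks\<close>

locale fcore = fpair +
 assumes W_eq: "B.W = A.W"
  and core: "b \<in> Zn n \<Longrightarrow> 0 \<le> b \<Longrightarrow> (\<And>i. i \<in> A.W \<Longrightarrow> b i = 0) \<Longrightarrow> b \<in> S \<longleftrightarrow> b \<in> S'"

sublocale fcore \<subseteq> cswap: fcore n S' S \<psi>' \<psi>
proof unfold_locales
 show "A.W = B.W" by (rule W_eq[symmetric])
 show "b \<in> S' \<longleftrightarrow> b \<in> S" if "b \<in> Zn n" "0 \<le> b" "\<And>i. i \<in> B.W \<Longrightarrow> b i = 0" for b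
  using core[OF that(1,2)] that(3) W_eq by blast
qed

context fcore
begin

text \<open>Standard monomials above \<open>g\<close> avoid \<open>W\<close> again, so compatibility
  with the relations is tested inside the part common to S and S'. The one exception is a
  differentiated variable in \<open>W\<close>, and there the monomial \<open>q\<close> in question
  is that variable itself.\<close>

lemma core_derivs_imp:
 assumes g: "(g, m) \<in> A.derivs" "\<And>i. i \<in> A.W \<Longrightarrow> g i = 0" shows "(g, m) \<in> B.derivs"
proof -
 have gS: "g \<in> S" and al: "allowed n S (g - uv m) m" using g(1) unfolding A.derivs_def by blast+
 have m: "m < n" by (rule A.allowed_S(1)[OF al])
 have g0: "g \<noteq> 0"
 proof
  assume "g = 0"
  then have "allowed n S (- uv m) m" using al by simp
  then show False using A.not_allowed_0 by blast
 qed
 have gn: "0 \<le> g" by (rule A.S_nonneg[OF gS])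
 have gS': "g \<in> S'" using core[OF A.S_Zn[OF gS] gn g(2)] gS by blast
 have "q \<in> S'" if q: "0 \<le> q" "q \<in> Zn n" "1 \<le> q m" and pS: "q + (g - uv m) \<in> S'" for q
 proof (cases "1 \<le> g m")
  case True
  then have "uv m \<le> g" using uv_le_iff[OF gn] by blast
  then have "q \<le> q + (g - uv m)" by simp
  then show ?thesis by (rule B.S_down[OF pS q(1)])
 next
  case False
  then have gm: "g m = 0" using A.S_nonneg_at[OF gS, of m] by linarith
  define p where "p = q + (g - uv m)"
  have pS': "p \<in> S'" using pS unfolding p_def .
  have "uv m \<le> q" using uv_le_iff[OF q(1)] q(3) by blast
  then have "0 \<le> q - uv m" by simp
  then have gp: "g \<le> p" unfolding p_def by (metis add.commute add_diff_eq le_add_same_cancel1)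
  have pc: "p i = 0" if "i \<in> A.W" for i
   by (rule B.core_above[OF gn g0 _ pS' gp]) (use that W_eq g(2) in blast)+
  have "p \<in> S" using core[OF B.S_Zn[OF pS'] B.S_nonneg[OF pS'] pc] pS' by blast
  moreover have "g - uv m + uv m \<le> p" using gp by simp
  ultimately have "p - (g - uv m) \<in> S" using A.allowedD[OF al] by blast
  then have qS: "q \<in> S" unfolding p_def by simp
  have qi: "q i = p i - g i + uv m i" for i unfolding p_def by simp
  show ?thesis
  proof (cases "m \<in> A.W")
   case True
   have "q = uv m"
   proof (rule ccontr)
    assume "q \<noteq> uv m"
    then have qe: "q = uv m + uv (A.J m)" using A.W_form[OF True qS q(3)] by blast
    have Jm: "A.J m \<in> A.W" by (rule A.W_J(1)[OF True])
    have "q (A.J m) = uv m (A.J m)" using qi[of "A.J m"] pc[OF Jm] g(2)[OF Jm] by simp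
    then show False using fun_cong[OF qe, of "A.J m"] by simp
   qed
   then show ?thesis using B.S_uv[OF m] by simp
  next
   case False
   have "q i = 0" if "i \<in> A.W" for i
   proof -
    have "i \<noteq> m" using that False by blast
    then show ?thesis using qi[of i] pc[OF that] g(2)[OF that] uv_other[of i m] by simp
   qed
   then show ?thesis using core[OF q(2,1)] qS by blast
  qed
 qed
 moreover have "g - uv m + uv m \<in> S'" using gS' by simp
 ultimately have "allowed n S' (g - uv m) m" unfolding allowed_def using m by blast
 then show ?thesis using gS' unfolding B.derivs_def by blast
qed

end

lemma card_split: "finite X \<Longrightarrow> card X = card {x \<in> X. P x} + card {x \<in> X. \<not> P x}"
proof -
 assume f: "finite X"
 have "X = {x \<in> X. P x} \<union> {x \<in> X. \<not> P x}" by blast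
 moreover have "card ({x \<in> X. P x} \<union> {x \<in> X. \<not> P x}) = card {x \<in> X. P x} + card {x \<in> X. \<not> P x}"
  by (rule card_Un_disjoint) (use f in auto)
 ultimately show ?thesis by simp
qed

context fcore
begin

lemma core_derivs: "{x \<in> A.derivs. \<not> (\<exists>i\<in>A.W. fst x i \<noteq> 0)} = {x \<in> B.derivs. \<not> (\<exists>i\<in>B.W. fst x i \<noteq> 0)}"
proof (intro set_eqI iffI)
 fix x assume "x \<in> {x \<in> A.derivs. \<not> (\<exists>i\<in>A.W. fst x i \<noteq> 0)}"
 then have x: "(fst x, snd x) \<in> A.derivs" "\<And>i. i \<in> A.W \<Longrightarrow> fst x i = 0" by auto
 then show "x \<in> {x \<in> B.derivs. \<not> (\<exists>i\<in>B.W. fst x i \<noteq> 0)}" using core_derivs_imp[OF x] W_eq by simp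
next
 fix x assume "x \<in> {x \<in> B.derivs. \<not> (\<exists>i\<in>B.W. fst x i \<noteq> 0)}"
 then have x: "(fst x, snd x) \<in> B.derivs" "\<And>i. i \<in> B.W \<Longrightarrow> fst x i = 0" by auto
 then show "x \<in> {x \<in> A.derivs. \<not> (\<exists>i\<in>A.W. fst x i \<noteq> 0)}" using cswap.core_derivs_imp[OF x] W_eq by simp
qed

text \<open>The total numbers of derivations agree, and those whose image avoids \<open>W\<close>
  are literally the same, so the remaining ones are equally many.\<close>

lemma counts: "card (A.top ` A.W) * n + card A.iso_pairs = card (B.top ` B.W) * n + card B.iso_pairs"
proof -
 have e: "{(g, m) \<in> X. \<exists>i\<in>Y. g i \<noteq> 0} = {x \<in> X. \<exists>i\<in>Y. fst x i \<noteq> 0}" for X :: "((nat \<Rightarrow> int) \<times> nat) set" and Y by auto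
 have "card A.derivs = card {x \<in> A.derivs. \<exists>i\<in>A.W. fst x i \<noteq> 0} + card {x \<in> A.derivs. \<not> (\<exists>i\<in>A.W. fst x i \<noteq> 0)}"
  by (rule card_split[OF A.finite_derivs])
 moreover have "card B.derivs = card {x \<in> B.derivs. \<exists>i\<in>B.W. fst x i \<noteq> 0} + card {x \<in> B.derivs. \<not> (\<exists>i\<in>B.W. fst x i \<noteq> 0)}"
  by (rule card_split[OF B.finite_derivs])
 ultimately show ?thesis
  using card_derivs_eq core_derivs A.card_derivs_W B.card_derivs_W unfolding e by simp
qed

lemma W_sub: "A.W \<subseteq> {..<n}" using A.W_thin(1) by blast

lemma iso_full:
 "card A.iso_pairs = n \<Longrightarrow> i < n \<Longrightarrow> i \<in> A.iso_pairs"
 "card A.iso_points = n \<Longrightarrow> i < n \<Longrightarrow> i \<in> A.iso_points"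
proof -
 have "A.iso_pairs \<subseteq> {..<n}" "A.iso_points \<subseteq> {..<n}" using W_sub unfolding A.iso_pairs_def A.iso_points_def by blast+
 then show "card A.iso_pairs = n \<Longrightarrow> i < n \<Longrightarrow> i \<in> A.iso_pairs"
  "card A.iso_points = n \<Longrightarrow> i < n \<Longrightarrow> i \<in> A.iso_points"
  using card_subset_eq[of "{..<n}" A.iso_pairs] card_subset_eq[of "{..<n}" A.iso_points] by auto
qed

end

context fcore
begin

lemma not_extreme: "0 < n \<Longrightarrow> \<not> (card A.iso_pairs = n \<and> card B.iso_pairs = 0)"
proof
 assume n: "0 < n" and a: "card A.iso_pairs = n \<and> card B.iso_pairs = 0"
 have "A.iso_pairs \<subseteq> A.W" unfolding A.iso_pairs_def by blast
 then have "n \<le> card A.W" using a card_mono[OF A.finite_W] by metis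
 moreover have "card A.W \<le> n" using card_mono[OF _ W_sub] by simp
 ultimately have "card B.iso_points = n" using a B.card_W_split W_eq by simp
 then have "i \<in> B.iso_points" if "i < n" for i using cswap.iso_full(2) that by blast
 then show False using not_pairs_points[OF n] iso_full(1) a by blast
qed

end

context fcore
begin

text \<open>Uniqueness of division with remainder by n, except that the remainders 0 and n can be
  confused.\<close>

lemma mult_cancel_bounded:
 assumes "a * n + r = b * n + (s::nat)" "r \<le> n" "s \<le> n" "r \<noteq> s"
 shows "r = n \<and> s = 0 \<or> r = 0 \<and> s = n"
proof -
 have n: "0 < n" using assms by linarith
 have *: "u = n \<and> v = 0" if "c * n + u = d * n + v" "u \<le> n" "v < u" for c d u v :: nat
 proof -
  have "c * n < d * n" using that by linarith
  then have "c < d" by simp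
  then have "(c + 1) * n \<le> d * n" by (intro mult_le_mono1) simp
  then have "c * n + n \<le> d * n" by simp
  then show ?thesis using that by linarith
 qed
 show ?thesis
 proof (cases "s < r")
  case True then show ?thesis using *[OF assms(1,2)] by blast
 next
  case False
  then have "r < s" using assms(4) by linarith
  then show ?thesis using *[OF assms(1)[symmetric] assms(3)] by blast
 qed
qed

text \<open>The single equation \<open>counts\<close> yields both unknowns, because the number of
  variables in \<open>iso_pairs\<close> acts as a remainder bounded by n. The ambiguous values 0 and
  n are excluded by \<open>not_extreme\<close>.\<close>

lemma card_iso: "card A.iso_pairs = card B.iso_pairs" "card A.iso_points = card B.iso_points"
 "card ((\<lambda>i. {i, A.J i}) ` A.iso_pairs) = card ((\<lambda>i. {i, B.J i}) ` B.iso_pairs)"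
proof -
 have Wn: "card A.W \<le> n" using card_mono[OF _ W_sub] by simp
 have b: "card A.iso_pairs \<le> n" "card B.iso_pairs \<le> n"
  using Wn A.card_W_split B.card_W_split W_eq by simp_all
 show r: "card A.iso_pairs = card B.iso_pairs"
 proof (rule ccontr)
  assume ne: "card A.iso_pairs \<noteq> card B.iso_pairs"
  then have "0 < n" using b by linarith
  then show False using mult_cancel_bounded[OF counts b ne] not_extreme cswap.not_extreme by blast
 qed
 show p: "card A.iso_points = card B.iso_points" using r A.card_W_split B.card_W_split W_eq by simp
 show "card ((\<lambda>i. {i, A.J i}) ` A.iso_pairs) = card ((\<lambda>i. {i, B.J i}) ` B.iso_pairs)"
 proof (cases "n = 0")
  case True
  then have "A.iso_pairs = {}" "B.iso_pairs = {}" using W_sub W_eq unfolding A.iso_pairs_def B.iso_pairs_def by auto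
  then show ?thesis by simp
 next
  case False
  then have "card (A.top ` A.W) = card (B.top ` B.W)" using counts r by simp
  then show ?thesis using p A.card_top_W B.card_top_W by simp
 qed
qed

lemma ex_W_bij:
 "\<exists>\<pi>. fixbij n \<pi> \<and> (\<forall>i. i \<notin> A.W \<longrightarrow> \<pi> i = i) \<and>
  (\<forall>i\<in>A.W. \<pi> i \<in> A.W \<and> B.J (\<pi> i) = \<pi> (A.J i) \<and> B.Q (\<pi> i) = A.Q i)"
proof -
 have fin: "finite A.iso_points" "finite B.iso_points" "finite A.iso_pairs" "finite B.iso_pairs"
  unfolding A.iso_points_def A.iso_pairs_def B.iso_points_def B.iso_pairs_def by simp_all
 obtain h1 where h1: "bij_betw h1 A.iso_points B.iso_points"
  using finite_same_card_bij[OF fin(1,2) card_iso(2)] by blast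
 have Jp: "A.J i \<in> A.iso_pairs \<and> A.J (A.J i) = i" if "i \<in> A.iso_pairs" for i
  using that A.W_J[of i] unfolding A.iso_pairs_def by auto
 have Jp': "B.J i \<in> B.iso_pairs \<and> B.J (B.J i) = i" if "i \<in> B.iso_pairs" for i
  using that B.W_J[of i] unfolding B.iso_pairs_def by auto
 obtain h2 where h2: "bij_betw h2 A.iso_pairs B.iso_pairs" "\<And>i. i \<in> A.iso_pairs \<Longrightarrow> h2 (A.J i) = B.J (h2 i)"
  using involution_bij[OF fin(3,4) card_iso(1) Jp Jp' card_iso(3)] by blast
 define h where "h i = (if i \<in> A.iso_points then h1 i else if i \<in> A.iso_pairs then h2 i else i)" for i
 have disj: "A.iso_points \<inter> A.iso_pairs = {}" "B.iso_points \<inter> B.iso_pairs = {}"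
  unfolding A.iso_points_def A.iso_pairs_def B.iso_points_def B.iso_pairs_def by auto
 have un: "A.W = A.iso_points \<union> A.iso_pairs" "A.W = B.iso_points \<union> B.iso_pairs"
  using A.W_Q(1) B.W_Q(1) W_eq unfolding A.iso_points_def A.iso_pairs_def B.iso_points_def B.iso_pairs_def by auto
 have b1: "bij_betw h A.iso_points B.iso_points"
  by (rule bij_betw_cong[THEN iffD1, OF _ h1]) (simp add: h_def)
 have b2: "bij_betw h A.iso_pairs B.iso_pairs"
  by (rule bij_betw_cong[THEN iffD1, OF _ h2(1)]) (use disj in \<open>auto simp: h_def\<close>)
 have bW: "bij_betw h A.W A.W" using bij_betw_combine[OF b1 b2 disj(2)] un by simp
 have "bij_betw h ({..<n} - A.W) ({..<n} - A.W)"
  by (rule bij_betw_cong[THEN iffD1, OF _ bij_betw_id]) (use un in \<open>auto simp: h_def\<close>)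
 then have "bij_betw h (A.W \<union> ({..<n} - A.W)) (A.W \<union> ({..<n} - A.W))" by (rule bij_betw_combine[OF bW]) blast
 moreover have "A.W \<union> ({..<n} - A.W) = {..<n}" using W_sub by blast
 ultimately have "bij_betw h {..<n} {..<n}" by simp
 then obtain \<pi> where p: "fixbij n \<pi>" "\<forall>i\<in>{..<n}. \<pi> i = h i" using fixbij_extend[of "{..<n}" n "{..<n}" h] by blast
 have e: "\<pi> i = h i" if "i \<in> A.W" for i using p(2) that W_sub by blast
 have f: "\<pi> i = i" if "i \<notin> A.W" for i
 proof (cases "i < n")
  case True
  then have "\<pi> i = h i" using p(2) by blast
  then show ?thesis using that un(1) unfolding h_def by simp
 next
  case False then show ?thesis using p(1) unfolding fixbij_def by simp
 qed
 have "\<pi> i \<in> A.W \<and> B.J (\<pi> i) = \<pi> (A.J i) \<and> B.Q (\<pi> i) = A.Q i" if i: "i \<in> A.W" for i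
 proof (cases "i \<in> A.iso_points")
  case True
  then have "\<pi> i \<in> B.iso_points" using b1 e[OF i] by (metis bij_betwE)
  then have "\<pi> i \<in> B.W" "B.Q (\<pi> i) = 0" unfolding B.iso_points_def by blast+
  moreover have "A.Q i = 0" using True unfolding A.iso_points_def by blast
  ultimately show ?thesis using W_eq A.W_Q(2)[OF i] B.W_Q(2)[of "\<pi> i"] by simp
 next
  case False
  then have ip: "i \<in> A.iso_pairs" using un(1) i by blast
  have h: "\<pi> i = h2 i" "\<pi> (A.J i) = h2 (A.J i)"
   using e[OF i] e[OF A.W_J(1)[OF i]] ip Jp[OF ip] disj(1) unfolding h_def by auto
  have "\<pi> i \<in> B.iso_pairs" using b2 e[OF i] ip by (metis bij_betwE)
  then have "\<pi> i \<in> B.W" "B.Q (\<pi> i) = 1" unfolding B.iso_pairs_def by blast+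
  moreover have "A.Q i = 1" using ip unfolding A.iso_pairs_def by blast
  ultimately show ?thesis using W_eq h h2(2)[OF ip] by simp
 qed
 then show ?thesis using p(1) f by blast
qed

lemma transport:
 assumes p: "fixbij n \<pi>" "\<And>i. i \<notin> A.W \<Longrightarrow> \<pi> i = i"
  "\<And>i. i \<in> A.W \<Longrightarrow> \<pi> i \<in> A.W \<and> B.J (\<pi> i) = \<pi> (A.J i) \<and> B.Q (\<pi> i) = A.Q i"
  and v: "v \<in> S"
 shows "pull (inv \<pi>) v \<in> S'"
proof (cases "\<forall>i\<in>A.W. v i = 0")
 case True
 have "v (inv \<pi> i) = v i" for i
 proof (cases "i \<in> A.W")
  case i: True
  have "inv \<pi> i \<in> A.W" using p(2)[of "inv \<pi> i"] fixbij_inv_apply(2)[OF p(1), of i] i by metis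
  then show ?thesis using True i by simp
 next
  case False
  then have "inv \<pi> i = i" using p(2)[of i] fixbij_inv_apply(1)[OF p(1), of i] by metis
  then show ?thesis by simp
 qed
 then have "pull (inv \<pi>) v = v" by (simp add: fun_eq_iff)
 then show ?thesis using core[OF A.S_Zn[OF v] A.S_nonneg[OF v]] True v by simp
next
 case False
 then obtain i where i: "i \<in> A.W" "v i \<noteq> 0" by blast
 have "1 \<le> v i" using i(2) A.S_nonneg_at[OF v, of i] by linarith
 from A.W_form[OF i(1) v this] show ?thesis
 proof
  assume "v = uv i"
  then have "pull (inv \<pi>) v = uv (\<pi> i)" using pull_inv_uv[OF p(1)] by simp
  moreover have "\<pi> i < n" using p(3)[OF i(1)] W_sub by blast
  ultimately show ?thesis using B.S_uv by simp
 next
  assume a: "A.Q i = 1 \<and> v = uv i + uv (A.J i)"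
  have W: "\<pi> i \<in> B.W" "B.Q (\<pi> i) = 1" using p(3)[OF i(1)] W_eq a by simp_all
  have "pull (inv \<pi>) v = uv (\<pi> i) + uv (B.J (\<pi> i))"
   using a pull_add[of "inv \<pi>"] pull_inv_uv[OF p(1)] p(3)[OF i(1)] by metis
  also have "\<dots> = B.top (\<pi> i)" using B.W_top(2)[OF W] by simp
  finally show ?thesis using B.top_S[OF B.W_thin(1,2)[OF W(1)]] by metis
 qed
qed

end

context fcore
begin

lemma ex_perm: "\<exists>\<pi>. fixbij n \<pi> \<and> S = pull \<pi> ` S'"
proof -
 obtain \<pi> where p: "fixbij n \<pi>" "\<And>i. i \<notin> A.W \<Longrightarrow> \<pi> i = i"
  "\<And>i. i \<in> A.W \<Longrightarrow> \<pi> i \<in> A.W \<and> B.J (\<pi> i) = \<pi> (A.J i) \<and> B.Q (\<pi> i) = A.Q i"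
  using ex_W_bij by blast
 note pi = fixbij_inv[OF p(1)]
 have ii: "inv (inv \<pi>) = \<pi>" using p(1) unfolding fixbij_def by (intro inv_inv_eq) blast
 have q1: "inv \<pi> i = i" if "i \<notin> B.W" for i
  using p(2)[of i] that W_eq fixbij_inv_apply(1)[OF p(1), of i] by metis
 have q2: "inv \<pi> i \<in> B.W \<and> A.J (inv \<pi> i) = inv \<pi> (B.J i) \<and> A.Q (inv \<pi> i) = B.Q i" if i: "i \<in> B.W" for i
 proof -
  have W: "inv \<pi> i \<in> A.W" using p(2)[of "inv \<pi> i"] fixbij_inv_apply(2)[OF p(1), of i] i W_eq by metis
  from p(3)[OF W] have "B.J i = \<pi> (A.J (inv \<pi> i))" "B.Q i = A.Q (inv \<pi> i)"
   using fixbij_inv_apply(2)[OF p(1), of i] by simp_all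
  then show ?thesis using W W_eq fixbij_inv_apply(1)[OF p(1)] by simp
 qed
 have "S = pull \<pi> ` S'"
 proof
  show "S \<subseteq> pull \<pi> ` S'" using transport[OF p] pull_image_iff[OF p(1)] by blast
  have "pull \<pi> v \<in> S" if "v \<in> S'" for v
   using cswap.transport[OF pi q1 q2 that] unfolding ii by blast
  then show "pull \<pi> ` S' \<subseteq> S" by blast
 qed
 then show ?thesis using p(1) by blast
qed

end

text \<open>After the permutation of \<open>ex_core\<close> the staircases agree on all monomials
  avoiding \<open>W\<close>: purely thick ones by \<open>coincide_ZK\<close>, and any other lies on
  the chain of a chain variable, whose direction and length have been matched. This is the situation
  of \<open>fcore\<close>.\<close>

lemma (in fpair) ex_perm: "\<exists>\<pi>. fixbij n \<pi> \<and> S = pull \<pi> ` S'"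
proof -
 obtain \<pi> where p: "fixbij n \<pi>" "\<And>z. z \<in> KK \<Longrightarrow> \<pi> z = z"
  and ch: "\<And>i. i \<in> A.chains \<Longrightarrow> \<pi> i \<in> B.chains \<and> B.J (\<pi> i) = A.J i \<and> B.Q (\<pi> i) = A.Q i"
  and W: "\<And>i. i \<in> A.W \<Longrightarrow> \<pi> i \<in> B.W"
  using ex_core by blast
 interpret P: wpair n S "pull \<pi> ` S'" "\<lambda>v. pull \<pi> (\<psi> v)" "\<lambda>v. \<psi>' (pull (inv \<pi>) v)"
  by (rule wpair_pull[OF wpair_axioms p(1)])
 have ip: "inv \<pi> z = z" if "z \<in> KK" for z using p(2)[OF that] fixbij_inv_apply(1)[OF p(1), of z] by metis
 have fixed: "pull \<pi> (\<psi> (uv z)) = uv z" if "z \<in> A.K" for z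
  using fixK[OF that] pull_uv[OF p(1)] ip[OF that] by simp
 interpret P: fpair n S "pull \<pi> ` S'" "\<lambda>v. pull \<pi> (\<psi> v)" "\<lambda>v. \<psi>' (pull (inv \<pi>) v)"
  by (rule P.fpair_if_fixed[OF fixed])
 have th: "P.B.thins = A.thins" "P.B.K = A.K" by (rule P.thins_eq, rule P.K_eq)
 have J_iff: "P.B.J i \<in> A.K \<longleftrightarrow> B.J (\<pi> i) \<in> A.K" if i: "i \<in> A.thins" "\<pi> i \<in> A.thins" for i
 proof -
  have "uv i + uv z \<in> pull \<pi> ` S' \<longleftrightarrow> uv (\<pi> i) + uv z \<in> S'" if "z \<in> A.K" for z
   unfolding pull_image_iff[OF p(1)] pull_add pull_inv_uv[OF p(1)] p(2)[OF that] ..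
  then show ?thesis
   using P.B.chain_iff[of i] B.chain_iff[of "\<pi> i"] i unfolding th thins_eq K_eq by simp
 qed
 have tW: "\<pi> i \<in> A.thins" if "i \<in> A.thins" for i
  using ch[of i] W[of i] that thins_eq unfolding A.chains_def A.W_def B.chains_def B.W_def by blast
 have "P.B.W = A.W"
 proof (rule set_eqI)
  fix i
  show "i \<in> P.B.W \<longleftrightarrow> i \<in> A.W"
  proof (cases "i \<in> A.thins")
   case True
   have "B.J (\<pi> i) \<in> A.K \<longleftrightarrow> A.J i \<in> A.K"
    using ch[of i] W[of i] True K_eq unfolding A.chains_def A.W_def B.chains_def B.W_def by auto
   then show ?thesis using J_iff[OF True tW[OF True]] True unfolding P.B.W_def A.W_def th by simp
  next
   case False then show ?thesis unfolding P.B.W_def A.W_def th by simp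
  qed
 qed
 moreover have "b \<in> S \<longleftrightarrow> b \<in> pull \<pi> ` S'" if b: "b \<in> Zn n" "0 \<le> b" "\<And>i. i \<in> A.W \<Longrightarrow> b i = 0" for b
 proof (cases "b \<in> A.ZK")
  case True
  then show ?thesis by (rule P.coincide_ZK[OF _ b(2)])
 next
  case False
  then obtain i where i: "i \<notin> A.K" "b i \<noteq> 0" using b(1) unfolding A.ZK_def by blast
  have bi: "1 \<le> b i" using i(2) le_funD[OF b(2), of i] by simp
  have "i < n" using Zn_ge[OF b(1) i(2)] .
  then have "i \<in> A.thins" using i(1) unfolding A.thins_def by blast
  then have ic: "i \<in> A.chains" using b(3) i(2) unfolding A.chains_def A.W_def by blast
  note c = ch[OF ic]
  have JK: "A.J i \<in> A.K" using ic unfolding A.chains_def by blast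
  have t: "i < n" "i \<notin> A.K" "\<pi> i < n" "\<pi> i \<notin> B.K"
   using ic c A.thinsD B.thinsD unfolding A.chains_def B.chains_def by blast+
  have "b \<in> S \<longleftrightarrow> (\<exists>q\<ge>0. q \<le> A.Q i \<and> b = uv i + vsc q (uv (A.J i)))"
   using A.thin_form[where p = b, OF t(1) t(2) _ bi] A.thin_mem[OF t(1,2)] by blast
  moreover have "b \<in> pull \<pi> ` S' \<longleftrightarrow> (\<exists>q\<ge>0. q \<le> A.Q i \<and> pull (inv \<pi>) b = uv (\<pi> i) + vsc q (uv (A.J i)))"
  proof -
   have "1 \<le> pull (inv \<pi>) b (\<pi> i)" using bi fixbij_inv_apply(1)[OF p(1)] by simp
   then show ?thesis unfolding pull_image_iff[OF p(1)]
    using B.thin_form[OF t(3,4), of "pull (inv \<pi>) b"] B.thin_mem[OF t(3,4)] c by metis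
  qed
  moreover have "pull (inv \<pi>) b = uv (\<pi> i) + vsc q (uv (A.J i)) \<longleftrightarrow> b = uv i + vsc q (uv (A.J i))" for q
  proof -
   have "pull (inv \<pi>) (uv i + vsc q (uv (A.J i))) = uv (\<pi> i) + vsc q (uv (A.J i))"
    unfolding pull_add pull_vsc pull_inv_uv[OF p(1)] p(2)[OF JK] ..
   then show ?thesis using pull_inv(1)[OF p(1)] by metis
  qed
  ultimately show ?thesis by simp
 qed
 ultimately interpret C: fcore n S "pull \<pi> ` S'" "\<lambda>v. pull \<pi> (\<psi> v)" "\<lambda>v. \<psi>' (pull (inv \<pi>) v)"
  by unfold_locales blast+
 obtain \<sigma> where s: "fixbij n \<sigma>" "S = pull \<sigma> ` pull \<pi> ` S'" using C.ex_perm by blast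
 have "S = pull (\<pi> \<circ> \<sigma>) ` S'" using s(2) by (simp add: image_image pull_pull)
 then show ?thesis using fixbij_comp[OF s(1) p(1)] by blast
qed

theorem (in wpair) ex_perm: "\<exists>\<pi>. fixbij n \<pi> \<and> S = pull \<pi> ` S'"
proof -
 obtain \<pi> where p: "fixbij n \<pi>" "fpair n S (pull \<pi> ` S') (\<lambda>v. pull \<pi> (\<psi> v)) (\<lambda>v. \<psi>' (pull (inv \<pi>) v))"
  using ex_fpair by blast
 obtain \<sigma> where s: "fixbij n \<sigma>" "S = pull \<sigma> ` pull \<pi> ` S'" using fpair.ex_perm[OF p(2)] by blast
 have "S = pull (\<pi> \<circ> \<sigma>) ` S'" using s(2) by (simp add: image_image pull_pull)
 then show ?thesis using fixbij_comp[OF s(1) p(1)] by blast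
qed

section \<open>Matrices and Zariski-connected components\<close>

text \<open>Elimination of one unknown per equation. Every comparison of dimensions below goes back
  to this: multiplicities, nilpotency, the rank of the weight lattice and the number of standard
  monomials.\<close>

lemma nontrivial_solution:
 fixes \<kappa> :: "'a \<Rightarrow> 'b \<Rightarrow> 'k::field"
 assumes "finite B" "finite A" "card B < card A"
 shows "\<exists>c. (\<exists>a\<in>A. c a \<noteq> 0) \<and> (\<forall>b\<in>B. (\<Sum>a\<in>A. c a * \<kappa> a b) = 0)"
 using assms
proof (induction B arbitrary: A \<kappa> rule: finite_induct)
 case empty
 then have "A \<noteq> {}" by auto
 then show ?case by (intro exI[of _ "\<lambda>_. 1"]) auto
next
 case (insert b B)
 show ?case
 proof (cases "\<forall>a\<in>A. \<kappa> a b = 0")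
  case True
  have "card B < card A" using insert by simp
  from insert.IH[OF insert.prems(1) this] obtain c
   where "\<exists>a\<in>A. c a \<noteq> 0" "\<forall>b\<in>B. (\<Sum>a\<in>A. c a * \<kappa> a b) = 0" by blast
  then show ?thesis using True by (intro exI[of _ c]) simp
 next
  case False
  then obtain z where z: "z \<in> A" "\<kappa> z b \<noteq> 0" by blast
  define \<mu> where "\<mu> a y = \<kappa> a y - \<kappa> a b / \<kappa> z b * \<kappa> z y" for a y
  have "card B < card (A - {z})" using insert z by simp
  from insert.IH[OF _ this, of \<mu>] insert.prems(1) obtain c
   where c: "\<exists>a\<in>A - {z}. c a \<noteq> 0" "\<forall>y\<in>B. (\<Sum>a\<in>A - {z}. c a * \<mu> a y) = 0" by auto
  define d where "d a = (if a = z then - (\<Sum>a\<in>A - {z}. c a * \<kappa> a b) / \<kappa> z b else c a)" for a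
  have s: "(\<Sum>a\<in>A. d a * \<kappa> a y) = d z * \<kappa> z y + (\<Sum>a\<in>A - {z}. c a * \<kappa> a y)" for y
   using insert.prems(1) z(1) by (simp add: sum.remove d_def)
  have "(\<Sum>a\<in>A. d a * \<kappa> a y) = (\<Sum>a\<in>A - {z}. c a * \<mu> a y)" for y
  proof -
   have "(\<Sum>a\<in>A - {z}. c a * \<mu> a y) = (\<Sum>a\<in>A - {z}. c a * \<kappa> a y) - (\<Sum>a\<in>A - {z}. c a * \<kappa> a b) / \<kappa> z b * \<kappa> z y"
    by (simp add: \<mu>_def algebra_simps sum_subtractf sum_distrib_left sum_distrib_right sum_divide_distrib)
   then show ?thesis unfolding s by (simp add: d_def)
  qed
  moreover have "(\<Sum>a\<in>A. d a * \<kappa> a b) = 0" unfolding s using z(2) by (simp add: d_def)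
  ultimately have "\<forall>y\<in>insert b B. (\<Sum>a\<in>A. d a * \<kappa> a y) = 0" using c(2) by simp
  moreover have "\<exists>a\<in>A. d a \<noteq> 0" using c(1) by (auto simp: d_def)
  ultimately show ?thesis by blast
 qed
qed

lemma delta_mult: "(if P then 1 else 0) * x = (if P then x else (0::'a::semiring_1))" by simp

lemma padded_mul [simp]: "padded N (mat_mul N g h)" by (simp add: padded_def mat_mul_def)
lemma padded_id [simp]: "padded N (mat_id N)" by (auto simp: padded_def mat_id_def)

lemma mat_mul_assoc: "mat_mul N (mat_mul N g h) k = mat_mul N g (mat_mul N h k)"
proof (intro ext)
 fix i j
 have "(\<Sum>x<N. (\<Sum>y<N. g i y * h y x) * k x j) = (\<Sum>y<N. g i y * (\<Sum>x<N. h y x * k x j))"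
  unfolding sum_distrib_left sum_distrib_right by (subst sum.swap) (simp add: mult.assoc)
 then show "mat_mul N (mat_mul N g h) k i j = mat_mul N g (mat_mul N h k) i j" by (simp add: mat_mul_def)
qed

lemma mat_mul_id:
 assumes "padded N g" shows "mat_mul N g (mat_id N) = g" "mat_mul N (mat_id N) g = g"
 using assms by (auto simp: fun_eq_iff mat_mul_def mat_id_def padded_def if_distrib if_distribR cong: if_cong)

lemma is_inverse_unique:
 assumes "is_inverse N g h" "is_inverse N g h'" shows "h = h'"
proof -
 have "h = mat_mul N h (mat_mul N g h')" using assms mat_mul_id unfolding is_inverse_def by metis
 also have "\<dots> = h'" using assms mat_mul_id unfolding is_inverse_def by (metis mat_mul_assoc)
 finally show ?thesis .
qed

lemma mat_inv_eq: "is_inverse N g h \<Longrightarrow> mat_inv N g = h"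
 unfolding mat_inv_def by (rule some_equality) (auto intro: is_inverse_unique)

lemma is_inverse_mat_inv: "invertible_mat N g \<Longrightarrow> is_inverse N g (mat_inv N g)"
 unfolding invertible_mat_def mat_inv_def by (metis someI_ex)

lemma is_inverse_mul:
 assumes "is_inverse N g g'" "is_inverse N h h'" "padded N g" "padded N h"
 shows "is_inverse N (mat_mul N g h) (mat_mul N h' g')"
proof -
 have "mat_mul N (mat_mul N g h) (mat_mul N h' g') = mat_mul N g (mat_mul N (mat_mul N h h') g')"
  "mat_mul N (mat_mul N h' g') (mat_mul N g h) = mat_mul N h' (mat_mul N (mat_mul N g' g) h)"
  by (simp_all only: mat_mul_assoc)
 then show ?thesis using assms unfolding is_inverse_def by (simp add: mat_mul_id)
qed

lemma invertible_mul: "invertible_mat N g \<Longrightarrow> invertible_mat N h \<Longrightarrow> invertible_mat N (mat_mul N g h)"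
 unfolding invertible_mat_def using is_inverse_mul padded_mul by metis

lemma mat_inv_mul:
 "invertible_mat N g \<Longrightarrow> invertible_mat N h \<Longrightarrow> mat_inv N (mat_mul N g h) = mat_mul N (mat_inv N h) (mat_inv N g)"
 by (rule mat_inv_eq, rule is_inverse_mul) (auto simp: is_inverse_mat_inv invertible_mat_def[of N g] invertible_mat_def[of N h])

lemma invertible_id [simp]: "invertible_mat N (mat_id N)"
 unfolding invertible_mat_def is_inverse_def using mat_mul_id(1)[OF padded_id] by force

lemma aut_mats_invertible: "g \<in> aut_mats N sc u \<Longrightarrow> invertible_mat N g" by (simp add: aut_mats_def)

lemma aut_mats_mul:
 assumes g: "g \<in> aut_mats N sc u" and h: "h \<in> aut_mats N sc u" shows "mat_mul N g h \<in> aut_mats N sc u"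
proof -
 have gm: "(\<Sum>k<N. sc i j k * g l k) = (\<Sum>p<N. \<Sum>q<N. g p i * g q j * sc p q l)"
  and hm: "(\<Sum>k<N. sc i j k * h l k) = (\<Sum>p<N. \<Sum>q<N. h p i * h q j * sc p q l)"
  if "i < N" "j < N" "l < N" for i j l using g h that unfolding aut_mats_def by blast+
 have gu: "(\<Sum>k<N. g l k * u k) = u l" and hu: "(\<Sum>k<N. h l k * u k) = u l" if "l < N" for l
  using g h that unfolding aut_mats_def by blast+
 have "(\<Sum>k<N. sc i j k * mat_mul N g h l k) = (\<Sum>p<N. \<Sum>q<N. mat_mul N g h p i * mat_mul N g h q j * sc p q l)"
  if l: "i < N" "j < N" "l < N" for i j l
 proof -
  have "(\<Sum>k<N. sc i j k * mat_mul N g h l k) = (\<Sum>k<N. \<Sum>r<N. g l r * (sc i j k * h r k))"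
   using l by (simp add: mat_mul_def sum_distrib_left mult_ac)
  also have "\<dots> = (\<Sum>r<N. g l r * (\<Sum>k<N. sc i j k * h r k))" by (subst sum.swap) (simp add: sum_distrib_left)
  also have "\<dots> = (\<Sum>r<N. \<Sum>a<N. \<Sum>b<N. h a i * h b j * (sc a b r * g l r))"
   using hm[OF l(1,2)] by (simp add: sum_distrib_left mult_ac)
  also have "\<dots> = (\<Sum>a<N. \<Sum>r<N. \<Sum>b<N. h a i * h b j * (sc a b r * g l r))" by (rule sum.swap)
  also have "\<dots> = (\<Sum>a<N. \<Sum>b<N. \<Sum>r<N. h a i * h b j * (sc a b r * g l r))" by (rule sum.cong[OF refl], rule sum.swap)
  also have "\<dots> = (\<Sum>a<N. \<Sum>b<N. h a i * h b j * (\<Sum>p<N. \<Sum>q<N. g p a * g q b * sc p q l))"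
   using gm[OF _ _ l(3)] by (simp add: sum_distrib_left[symmetric])
  also have "\<dots> = (\<Sum>a<N. \<Sum>b<N. \<Sum>p<N. \<Sum>q<N. (g p a * h a i) * (g q b * h b j) * sc p q l)"
   by (simp add: sum_distrib_left mult_ac)
  also have "\<dots> = (\<Sum>a<N. \<Sum>p<N. \<Sum>b<N. \<Sum>q<N. (g p a * h a i) * (g q b * h b j) * sc p q l)"
   by (rule sum.cong[OF refl], rule sum.swap)
  also have "\<dots> = (\<Sum>p<N. \<Sum>a<N. \<Sum>b<N. \<Sum>q<N. (g p a * h a i) * (g q b * h b j) * sc p q l)" by (rule sum.swap)
  also have "\<dots> = (\<Sum>p<N. \<Sum>a<N. \<Sum>q<N. \<Sum>b<N. (g p a * h a i) * (g q b * h b j) * sc p q l)"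
   by (rule sum.cong[OF refl], rule sum.cong[OF refl], rule sum.swap)
  also have "\<dots> = (\<Sum>p<N. \<Sum>q<N. \<Sum>a<N. \<Sum>b<N. (g p a * h a i) * (g q b * h b j) * sc p q l)"
   by (rule sum.cong[OF refl], rule sum.swap)
  also have "\<dots> = (\<Sum>p<N. \<Sum>q<N. mat_mul N g h p i * mat_mul N g h q j * sc p q l)"
  proof -
   have "(\<Sum>a<N. \<Sum>b<N. (g p a * h a i) * (g q b * h b j) * sc p q l) = mat_mul N g h p i * mat_mul N g h q j * sc p q l"
    if "p < N" "q < N" for p q
    using l that by (simp add: mat_mul_def sum_product) (simp add: sum_distrib_right)
   then show ?thesis by (intro sum.cong refl) simp
  qed
  finally show ?thesis .
 qed
 moreover have "(\<Sum>k<N. mat_mul N g h l k * u k) = u l" if l: "l < N" for l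
 proof -
  have "(\<Sum>k<N. mat_mul N g h l k * u k) = (\<Sum>k<N. \<Sum>r<N. g l r * (h r k * u k))"
   using l by (simp add: mat_mul_def sum_distrib_right mult.assoc)
  also have "\<dots> = (\<Sum>r<N. g l r * (\<Sum>k<N. h r k * u k))" by (subst sum.swap) (simp add: sum_distrib_left)
  also have "\<dots> = u l" using hu gu[OF l] by simp
  finally show ?thesis .
 qed
 ultimately show ?thesis using invertible_mul aut_mats_invertible g h unfolding aut_mats_def by blast
qed

lemma aut_mats_id: "mat_id N \<in> aut_mats N sc u"
proof -
 have "(\<Sum>p<N. \<Sum>q<N. mat_id N p i * mat_id N q j * sc p q l) = sc i j l" if "i < N" "j < N" for i j l
 proof -
  have "(\<Sum>p<N. \<Sum>q<N. mat_id N p i * mat_id N q j * sc p q l) = (\<Sum>p<N. if p = i then \<Sum>q<N. if q = j then sc p q l else 0 else 0)"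
   by (intro sum.cong refl) (auto simp: mat_id_def delta_mult)
  then show ?thesis using that by simp
 qed
 moreover have "(\<Sum>k<N. sc i j k * mat_id N l k) = sc i j l" if "l < N" for i j l
 proof -
  have "(\<Sum>k<N. sc i j k * mat_id N l k) = (\<Sum>k<N. if k = l then sc i j k else 0)"
   using that by (intro sum.cong refl) (auto simp: mat_id_def)
  then show ?thesis using that by simp
 qed
 moreover have "(\<Sum>k<N. mat_id N l k * u k) = u l" if "l < N" for l
 proof -
  have "(\<Sum>k<N. mat_id N l k * u k) = (\<Sum>k<N. if k = l then u k else 0)"
   using that by (intro sum.cong refl) (auto simp: mat_id_def)
  then show ?thesis using that by simp
 qed
 ultimately show ?thesis unfolding aut_mats_def by simp
qed

section \<open>Regular functions and Zariski-connected sets\<close>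

lemma reg_fun_sum: "(\<And>x. x \<in> X \<Longrightarrow> f x \<in> reg_fun N) \<Longrightarrow> (\<lambda>g. \<Sum>x\<in>X. f x g) \<in> reg_fun N"
proof (induction X rule: infinite_finite_induct)
 case (insert x F)
 then have "(\<lambda>g. f x g + (\<Sum>x\<in>F. f x g)) \<in> reg_fun N" by (intro reg_fun.rf_add) auto
 then show ?case using insert by simp
qed (simp_all add: reg_fun.rf_const)

text \<open>Regular functions are only controlled on invertible matrices, because the inverse matrix is
 an arbitrary choice elsewhere; so pullbacks are compared on a subset.\<close>

lemma reg_fun_comp:
 assumes "f \<in> reg_fun N"
  and "\<And>i j. i < N \<Longrightarrow> j < N \<Longrightarrow> \<exists>h\<in>reg_fun M. \<forall>g\<in>X. \<Phi> g i j = h g"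
  and "\<And>i j. i < N \<Longrightarrow> j < N \<Longrightarrow> \<exists>h\<in>reg_fun M. \<forall>g\<in>X. mat_inv N (\<Phi> g) i j = h g"
 shows "\<exists>h\<in>reg_fun M. \<forall>g\<in>X. f (\<Phi> g) = h g"
 using assms(1)
proof induction
 case (rf_const c) then show ?case by (intro bexI[OF _ reg_fun.rf_const]) auto
next
 case (rf_add f h)
 then obtain a b where "a \<in> reg_fun M" "b \<in> reg_fun M" "\<forall>g\<in>X. f (\<Phi> g) = a g" "\<forall>g\<in>X. h (\<Phi> g) = b g" by blast
 then show ?case by (intro bexI[OF _ reg_fun.rf_add[of a _ b]]) auto
next
 case (rf_mul f h)
 then obtain a b where "a \<in> reg_fun M" "b \<in> reg_fun M" "\<forall>g\<in>X. f (\<Phi> g) = a g" "\<forall>g\<in>X. h (\<Phi> g) = b g" by blast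
 then show ?case by (intro bexI[OF _ reg_fun.rf_mul[of a _ b]]) auto
qed (use assms(2,3) in blast)+

lemma zclosed_in_subset: "zclosed_in N S C \<Longrightarrow> T \<subseteq> S \<Longrightarrow> zclosed_in N T (C \<inter> T)"
 unfolding zclosed_in_def by blast

lemma zconnectedD:
 assumes "zconnected N X" "zclosed_in N X A" "zclosed_in N X B" "A \<noteq> {}" "B \<noteq> {}" "A \<inter> B = {}" "A \<union> B = X"
 shows False
 using assms unfolding zconnected_def by blast

text \<open>Preimages of closed sets are closed, since by \<open>reg_fun_comp\<close> each equation
  pulls back to a function that agrees with a regular one on X.\<close>

lemma zconnected_image:
 assumes "zconnected M X"
  and "\<And>i j. i < N \<Longrightarrow> j < N \<Longrightarrow> \<exists>h\<in>reg_fun M. \<forall>g\<in>X. \<Phi> g i j = h g"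
  and "\<And>i j. i < N \<Longrightarrow> j < N \<Longrightarrow> \<exists>h\<in>reg_fun M. \<forall>g\<in>X. mat_inv N (\<Phi> g) i j = h g"
 shows "zconnected N (\<Phi> ` X)"
proof -
 have pre: "zclosed_in M X {g \<in> X. \<Phi> g \<in> A}" if A: "zclosed_in N (\<Phi> ` X) A" for A
 proof -
  obtain F where F: "F \<subseteq> reg_fun N" "A = {g \<in> \<Phi> ` X. \<forall>f\<in>F. f g = 0}" using A unfolding zclosed_in_def by blast
  have "\<forall>f\<in>F. \<exists>h. h \<in> reg_fun M \<and> (\<forall>g\<in>X. f (\<Phi> g) = h g)"
  proof
   fix f assume "f \<in> F"
   then have "f \<in> reg_fun N" using F(1) by blast
   from reg_fun_comp[OF this assms(2,3)]
   show "\<exists>h. h \<in> reg_fun M \<and> (\<forall>g\<in>X. f (\<Phi> g) = h g)" unfolding Bex_def .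
  qed
  from bchoice[OF this] obtain h where h0: "\<forall>f\<in>F. h f \<in> reg_fun M \<and> (\<forall>g\<in>X. f (\<Phi> g) = h f g)" ..
  then have h: "\<And>f. f \<in> F \<Longrightarrow> h f \<in> reg_fun M" "\<And>f g. f \<in> F \<Longrightarrow> g \<in> X \<Longrightarrow> f (\<Phi> g) = h f g" by blast+
  have "\<Phi> g \<in> A \<longleftrightarrow> (\<forall>k\<in>h ` F. k g = 0)" if g: "g \<in> X" for g
  proof -
   have "(\<forall>f\<in>F. f (\<Phi> g) = 0) \<longleftrightarrow> (\<forall>f\<in>F. h f g = 0)"
    by (rule ball_cong[OF refl], rule arg_cong[where f = "\<lambda>x. x = 0", OF h(2)[OF _ g]])
   moreover have "\<Phi> g \<in> A \<longleftrightarrow> (\<forall>f\<in>F. f (\<Phi> g) = 0)" unfolding F(2) using g by simp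
   ultimately show ?thesis by simp
  qed
  then have e1: "{g \<in> X. \<Phi> g \<in> A} = {g \<in> X. \<forall>k\<in>h ` F. k g = 0}" by (intro Collect_cong conj_cong refl)
  have e2: "h ` F \<subseteq> reg_fun M" by (rule image_subsetI, rule h(1))
  show ?thesis unfolding zclosed_in_def
   by (rule conjI, blast, rule exI[of _ "h ` F"], rule conjI, rule e2, rule e1)
 qed
 show ?thesis
  unfolding zconnected_def
 proof (rule notI, elim exE conjE)
  fix A B assume ab: "zclosed_in N (\<Phi> ` X) A" "zclosed_in N (\<Phi> ` X) B" "A \<noteq> {}" "B \<noteq> {}" "A \<inter> B = {}" "A \<union> B = \<Phi> ` X"
  have cov: "\<Phi> g \<in> A \<or> \<Phi> g \<in> B" if "g \<in> X" for g using that ab(6) by (metis UnE imageI)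
  have sub: "A \<subseteq> \<Phi> ` X" "B \<subseteq> \<Phi> ` X" unfolding ab(6)[symmetric] by (rule Un_upper1, rule Un_upper2)
  have disj: "x \<in> A \<Longrightarrow> x \<in> B \<Longrightarrow> False" for x using ab(5) by (metis disjoint_iff)
  from ab(3) obtain x where x: "x \<in> A" by blast
  from ab(4) obtain y where y: "y \<in> B" by blast
  from subsetD[OF sub(1) x] obtain g where g: "x = \<Phi> g" "g \<in> X" by (rule imageE)
  from subsetD[OF sub(2) y] obtain h where h: "y = \<Phi> h" "h \<in> X" by (rule imageE)
  have gh: "g \<in> X" "\<Phi> g \<in> A" "h \<in> X" "\<Phi> h \<in> B" using x y g h by simp_all
  show False
  proof (rule zconnectedD[OF assms(1) pre[OF ab(1)] pre[OF ab(2)]])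
   show "{g \<in> X. \<Phi> g \<in> A} \<noteq> {}" "{g \<in> X. \<Phi> g \<in> B} \<noteq> {}" using gh by (intro notI, elim equals0D[THEN notE], simp)+
   show "{g \<in> X. \<Phi> g \<in> A} \<inter> {g \<in> X. \<Phi> g \<in> B} = {}" by (intro equals0I) (auto dest: disj)
   show "{g \<in> X. \<Phi> g \<in> A} \<union> {g \<in> X. \<Phi> g \<in> B} = X" using cov by (intro equalityI subsetI) auto
  qed
 qed
qed

lemma zconnected_Un:
 assumes "zconnected N C" "zconnected N D" "x \<in> C" "x \<in> D" shows "zconnected N (C \<union> D)"
 unfolding zconnected_def
proof (rule notI, elim exE conjE)
 fix A B assume ab: "zclosed_in N (C \<union> D) A" "zclosed_in N (C \<union> D) B" "A \<noteq> {}" "B \<noteq> {}" "A \<inter> B = {}" "A \<union> B = C \<union> D"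
 have cov: "x \<in> A \<or> x \<in> B" if "x \<in> C \<union> D" for x using that ab(6) by (metis UnE)
 have disj: "x \<in> A \<Longrightarrow> x \<in> B \<Longrightarrow> False" for x using ab(5) by (metis disjoint_iff)
 have sub: "A \<subseteq> C \<union> D" "B \<subseteq> C \<union> D" unfolding ab(6)[symmetric] by (rule Un_upper1, rule Un_upper2)
 obtain y z where yz: "y \<in> A" "z \<in> B" using ab(3,4) by (metis all_not_in_conv)
 have one: "X \<subseteq> A \<or> X \<subseteq> B" if X: "zconnected N X" "X \<subseteq> C \<union> D" for X
 proof (rule ccontr)
  assume n: "\<not> (X \<subseteq> A \<or> X \<subseteq> B)"
  obtain a b where "a \<in> X" "a \<notin> A" "b \<in> X" "b \<notin> B" using n by (metis subsetI)
  then have ab': "a \<in> B \<inter> X" "b \<in> A \<inter> X" using cov X(2) by blast+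
  show False
  proof (rule zconnectedD[OF X(1) zclosed_in_subset[OF ab(1) X(2)] zclosed_in_subset[OF ab(2) X(2)]])
   show "A \<inter> X \<noteq> {}" "B \<inter> X \<noteq> {}" using ab' by (metis empty_iff)+
   show "A \<inter> X \<inter> (B \<inter> X) = {}" using disj by (intro equals0I) blast
   show "A \<inter> X \<union> B \<inter> X = X" using cov X(2) by (intro equalityI subsetI) blast+
  qed
 qed
 have "C \<subseteq> A \<or> C \<subseteq> B" "D \<subseteq> A \<or> D \<subseteq> B" using one[OF assms(1)] one[OF assms(2)] by blast+
 then show False using disj sub yz assms(3,4) by blast
qed

text \<open>Translating by g a connected set that contains the identity and h gives a connected set
  that contains g and gh. It meets, in g, a connected set containing the identity.\<close>

lemma neutral_comp_mul:
 assumes inv: "\<And>g. g \<in> G \<Longrightarrow> invertible_mat N g" and mul: "\<And>g h. g \<in> G \<Longrightarrow> h \<in> G \<Longrightarrow> mat_mul N g h \<in> G"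
  and g: "g \<in> neutral_comp N G" and h: "h \<in> neutral_comp N G"
 shows "mat_mul N g h \<in> neutral_comp N G"
proof -
 obtain C D where C: "C \<subseteq> G" "mat_id N \<in> C" "zconnected N C" "g \<in> C"
  and D: "D \<subseteq> G" "mat_id N \<in> D" "zconnected N D" "h \<in> D" using g h unfolding neutral_comp_def by blast
 have ig: "invertible_mat N g" using inv C by blast
 have iD: "invertible_mat N x" if "x \<in> D" for x using inv D that by blast
 have "zconnected N (mat_mul N g ` D)"
 proof (rule zconnected_image[OF D(3)])
  fix i j assume ij: "i < N" "j < N"
  show "\<exists>f\<in>reg_fun N. \<forall>x\<in>D. mat_mul N g x i j = f x"
   by (rule bexI[of _ "\<lambda>x. \<Sum>k<N. g i k * x k j"])
    (use ij in \<open>auto simp: mat_mul_def intro!: reg_fun_sum reg_fun.rf_mul reg_fun.rf_const reg_fun.rf_entry\<close>)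
  have "(\<lambda>x. \<Sum>k<N. mat_inv N x i k * mat_inv N g k j) \<in> reg_fun N"
   by (rule reg_fun_sum, rule reg_fun.rf_mul[OF reg_fun.rf_inv_entry reg_fun.rf_const]) (use ij in auto)
  then show "\<exists>f\<in>reg_fun N. \<forall>x\<in>D. mat_inv N (mat_mul N g x) i j = f x"
   by (rule bexI[rotated]) (use ij mat_inv_mul[OF ig iD] in \<open>auto simp: mat_mul_def\<close>)
 qed
 moreover have "g \<in> mat_mul N g ` D"
  by (rule image_eqI[where x = "mat_id N", OF _ D(2)]) (use ig in \<open>simp add: invertible_mat_def mat_mul_id\<close>)
 ultimately have "zconnected N (C \<union> mat_mul N g ` D)" by (intro zconnected_Un[OF C(3) _ C(4)])
 moreover have "C \<union> mat_mul N g ` D \<subseteq> G"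
  using C(1,4) D(1) by (intro Un_least image_subsetI mul) auto
 ultimately have "C \<union> mat_mul N g ` D \<in> {C. C \<subseteq> G \<and> mat_id N \<in> C \<and> zconnected N C}" using C(2) by simp
 then show ?thesis unfolding neutral_comp_def by (rule UnionI) (use D(4) in simp)
qed

lemma neutral_comp_subset: "neutral_comp N G \<subseteq> G" unfolding neutral_comp_def by blast

section \<open>Rational curves on the line minus the roots of a polynomial\<close>

definition ratf :: "'k::field poly \<Rightarrow> ('k \<Rightarrow> 'k) \<Rightarrow> bool" where
 "ratf q h \<longleftrightarrow> (\<exists>p k. \<forall>s. poly q s \<noteq> 0 \<longrightarrow> h s * poly q s ^ k = poly p s)"

lemma ratf_poly: "ratf q (poly p)" unfolding ratf_def by (intro exI[of _ p] exI[of _ 0]) simp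

lemma ratf_add: assumes "ratf q f" "ratf q h" shows "ratf q (\<lambda>s. f s + h s)"
proof -
 obtain p k r m where a: "\<And>s. poly q s \<noteq> 0 \<Longrightarrow> f s * poly q s ^ k = poly p s"
  "\<And>s. poly q s \<noteq> 0 \<Longrightarrow> h s * poly q s ^ m = poly r s" using assms unfolding ratf_def by blast
 show ?thesis unfolding ratf_def
  by (rule exI[of _ "p * q ^ m + r * q ^ k"], rule exI[of _ "k + m"])
   (simp add: a[symmetric] poly_power power_add algebra_simps)
qed

lemma ratf_mult: assumes "ratf q f" "ratf q h" shows "ratf q (\<lambda>s. f s * h s)"
proof -
 obtain p k r m where a: "\<And>s. poly q s \<noteq> 0 \<Longrightarrow> f s * poly q s ^ k = poly p s"
  "\<And>s. poly q s \<noteq> 0 \<Longrightarrow> h s * poly q s ^ m = poly r s" using assms unfolding ratf_def by blast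
 show ?thesis unfolding ratf_def
  by (rule exI[of _ "p * r"], rule exI[of _ "k + m"]) (simp add: a[symmetric] power_add algebra_simps)
qed

lemma ratf_reg_fun:
 assumes "f \<in> reg_fun N" "\<And>i j. i < N \<Longrightarrow> j < N \<Longrightarrow> ratf q (\<lambda>s. c s i j)"
  "\<And>i j. i < N \<Longrightarrow> j < N \<Longrightarrow> ratf q (\<lambda>s. mat_inv N (c s) i j)"
 shows "ratf q (\<lambda>s. f (c s))"
 using assms(1)
proof induction
 case (rf_const a)
 have "poly [:a:] = (\<lambda>s. a)" by (simp add: fun_eq_iff)
 then show ?case using ratf_poly[of q "[:a:]"] by simp
next
 case (rf_add f h) then show ?case by (intro ratf_add)
next
 case (rf_mul f h) then show ?case by (intro ratf_mult)
qed (use assms(2,3) in blast)+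

lemma ratf_vanish:
 assumes "ratf q h" "infinite {s. poly q s \<noteq> 0 \<and> h s = 0}" "poly q s \<noteq> 0" shows "h s = 0"
proof -
 obtain p k where p: "\<And>s. poly q s \<noteq> 0 \<Longrightarrow> h s * poly q s ^ k = poly p s" using assms(1) unfolding ratf_def by blast
 have "{s. poly q s \<noteq> 0 \<and> h s = 0} \<subseteq> {s. poly p s = 0}" using p by force
 then have "infinite {s. poly p s = 0}" using assms(2) finite_subset by blast
 then have "p = 0" using poly_roots_finite by blast
 then show ?thesis using p[OF assms(3)] assms(3) by simp
qed

text \<open>Of two closed sets covering the curve, one contains it for infinitely many parameters.
  Its equations restrict to rational functions with infinitely many zeros, so it contains the whole
  curve.\<close>

lemma curve_zconnected:
 fixes q :: "'k::field_char_0 poly"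
 assumes "q \<noteq> 0" "\<And>i j. i < N \<Longrightarrow> j < N \<Longrightarrow> ratf q (\<lambda>s. c s i j)"
  "\<And>i j. i < N \<Longrightarrow> j < N \<Longrightarrow> ratf q (\<lambda>s. mat_inv N (c s) i j)"
 shows "zconnected N (c ` {s. poly q s \<noteq> 0})"
proof -
 let ?U = "{s. poly q s \<noteq> 0}"
 have "finite {s. poly q s = 0}" using poly_roots_finite[OF assms(1)] .
 moreover have "?U = UNIV - {s. poly q s = 0}" by blast
 ultimately have inf: "infinite ?U" by (metis Diff_infinite_finite infinite_UNIV_char_0)
 have all: "c ` ?U \<subseteq> A" if A: "zclosed_in N (c ` ?U) A" and i: "infinite {s \<in> ?U. c s \<in> A}" for A
 proof -
  obtain F where F: "F \<subseteq> reg_fun N" "A = {g \<in> c ` ?U. \<forall>f\<in>F. f g = 0}" using A unfolding zclosed_in_def by blast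
  have z: "f (c s) = 0" if f: "f \<in> F" "poly q s \<noteq> 0" for f s
  proof (rule ratf_vanish[OF ratf_reg_fun[OF _ assms(2,3)] _ f(2)])
   show "f \<in> reg_fun N" using f F by blast
   have "{s \<in> ?U. c s \<in> A} \<subseteq> {s. poly q s \<noteq> 0 \<and> f (c s) = 0}" unfolding F(2) using f(1) by (intro subsetI) simp
   then show "infinite {s. poly q s \<noteq> 0 \<and> f (c s) = 0}" using i finite_subset by blast
  qed auto
  show ?thesis
  proof
   fix g assume "g \<in> c ` ?U"
   then obtain s where "poly q s \<noteq> 0" "g = c s" by auto
   then show "g \<in> A" unfolding F(2) using z by simp
  qed
 qed
 show ?thesis
  unfolding zconnected_def
 proof (rule notI, elim exE conjE)
  fix A B assume ab: "zclosed_in N (c ` ?U) A" "zclosed_in N (c ` ?U) B" "A \<noteq> {}" "B \<noteq> {}" "A \<inter> B = {}" "A \<union> B = c ` ?U"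
  have cov: "c s \<in> A \<or> c s \<in> B" if "s \<in> ?U" for s using that ab(6) by (metis UnE imageI)
  have disj: "x \<in> A \<Longrightarrow> x \<in> B \<Longrightarrow> False" for x using ab(5) by (metis disjoint_iff)
  have sub: "A \<subseteq> c ` ?U" "B \<subseteq> c ` ?U" unfolding ab(6)[symmetric] by (rule Un_upper1, rule Un_upper2)
  obtain y z where yz: "y \<in> A" "z \<in> B" using ab(3,4) by (metis all_not_in_conv)
  have "?U = {s \<in> ?U. c s \<in> A} \<union> {s \<in> ?U. c s \<in> B}" using cov by (intro equalityI subsetI) blast+
  then have "infinite {s \<in> ?U. c s \<in> A} \<or> infinite {s \<in> ?U. c s \<in> B}" using inf by (metis (no_types, lifting) finite_Un)
  then have "c ` ?U \<subseteq> A \<or> c ` ?U \<subseteq> B" using all ab(1,2) by blast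
  then show False using disj sub yz by blast
 qed
qed

lemma curve_in_neutral_comp:
 fixes q :: "'k::field_char_0 poly"
 assumes "\<And>i j. i < N \<Longrightarrow> j < N \<Longrightarrow> ratf q (\<lambda>s. c s i j)"
  "\<And>i j. i < N \<Longrightarrow> j < N \<Longrightarrow> ratf q (\<lambda>s. mat_inv N (c s) i j)"
  "\<And>s. poly q s \<noteq> 0 \<Longrightarrow> c s \<in> G" "poly q a \<noteq> 0" "c a = mat_id N" "poly q s \<noteq> 0"
 shows "c s \<in> neutral_comp N G"
proof -
 have "q \<noteq> 0" using assms(4) by auto
 then have "zconnected N (c ` {s. poly q s \<noteq> 0})" using curve_zconnected assms(1,2) by blast
 moreover have "c ` {s. poly q s \<noteq> 0} \<subseteq> G" using assms(3) by blast
 moreover have "mat_id N \<in> c ` {s. poly q s \<noteq> 0}" using assms(4,5) by (metis (mono_tags, lifting) imageI mem_Collect_eq)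
 ultimately show ?thesis using assms(6) unfolding neutral_comp_def by blast
qed

section \<open>Polynomial curves and differentials at the identity\<close>

definition evm :: "(nat \<Rightarrow> nat \<Rightarrow> 'k::comm_ring_1 poly) \<Rightarrow> 'k \<Rightarrow> nat \<Rightarrow> nat \<Rightarrow> 'k" where
 "evm c s = (\<lambda>i j. poly (c i j) s)"

text \<open>The inverse curve is required to be polynomial as well, so that all regular functions,
  inverse entries included, restrict to polynomials.\<close>

definition pcurve :: "nat \<Rightarrow> (nat \<Rightarrow> nat \<Rightarrow> 'k::field poly) \<Rightarrow> (nat \<Rightarrow> nat \<Rightarrow> 'k poly) \<Rightarrow> bool" where
 "pcurve N c d \<longleftrightarrow> (\<forall>s. padded N (evm c s) \<and> is_inverse N (evm c s) (evm d s)) \<and> evm c 0 = mat_id N"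

lemma coeff_mult_1: "coeff (p * q) (Suc 0) = coeff p 0 * coeff q 1 + coeff p 1 * (coeff q 0 :: 'a::comm_semiring_0)"
 by (simp add: coeff_mult)

lemma pcurve_inverse_coeff:
 fixes c d :: "nat \<Rightarrow> nat \<Rightarrow> 'k::field_char_0 poly"
 assumes "pcurve N c d" "i < N" "j < N" shows "coeff (d i j) 1 = - coeff (c i j) 1"
proof -
 have c0: "evm c 0 = mat_id N" and inv: "\<And>s. is_inverse N (evm c s) (evm d s)" using assms unfolding pcurve_def by blast+
 have "evm d 0 = mat_id N"
  by (rule is_inverse_unique[OF inv[of 0]]) (simp add: c0 is_inverse_def mat_mul_id)
 then have cd: "coeff (c i j) 0 = (if i = j then 1 else 0)" "coeff (d i j) 0 = (if i = j then 1 else 0)" if "i < N" for i j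
  using c0 that by (auto simp: evm_def mat_id_def fun_eq_iff poly_0_coeff_0)
 have "poly (\<Sum>k<N. c i k * d k j) = poly [:if i = j then 1 else 0:]"
 proof
  fix s
  have "mat_mul N (evm c s) (evm d s) i j = mat_id N i j" using inv[of s] unfolding is_inverse_def by simp
  then show "poly (\<Sum>k<N. c i k * d k j) s = poly [:if i = j then 1 else 0:] s"
   using assms(2,3) by (auto simp: mat_mul_def mat_id_def evm_def poly_sum)
 qed
 then have "(\<Sum>k<N. c i k * d k j) = [:if i = j then 1 else 0:]" by (simp add: poly_eq_poly_eq_iff)
 then have "0 = coeff (\<Sum>k<N. c i k * d k j) (Suc 0)" by simp
 also have "\<dots> = (\<Sum>k<N. (if k = i then coeff (d k j) 1 else 0) + (if k = j then coeff (c i k) 1 else 0))"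
  unfolding coeff_sum by (intro sum.cong refl) (use assms(2) in \<open>auto simp: coeff_mult_1 cd\<close>)
 also have "\<dots> = coeff (d i j) 1 + coeff (c i j) 1" using assms(2,3) by (simp add: sum.distrib)
 finally show ?thesis by (simp add: eq_neg_iff_add_eq_0)
qed

text \<open>\<open>w\<close> is the differential of f at the identity, computed by the sum and
  product rules, with inverse entries contributing a sign. It is chosen before the curve, so the
  linear coefficient is a linear function of the tangent vector.\<close>

lemma reg_fun_differential:
 fixes f :: "(nat \<Rightarrow> nat \<Rightarrow> 'k::field_char_0) \<Rightarrow> 'k"
 assumes "f \<in> reg_fun N"
 shows "\<exists>w. \<forall>c d. pcurve N c d \<longrightarrow>
  (\<exists>p. (\<forall>s. f (evm c s) = poly p s) \<and> coeff p 1 = (\<Sum>i<N. \<Sum>j<N. w i j * coeff (c i j) 1))"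
 using assms
proof induction
 case (rf_const a)
 show ?case by (rule exI[of _ "\<lambda>_ _. 0"]) (intro allI impI exI[of _ "[:a:]"], simp)
next
 case (rf_entry x y)
 have *: "(\<Sum>i<N. \<Sum>j<N. (if i = x \<and> j = y then 1 else 0) * coeff (c i j) 1) = coeff (c x y) 1" for c :: "nat \<Rightarrow> nat \<Rightarrow> 'k poly"
 proof -
  have "(\<Sum>i<N. \<Sum>j<N. (if i = x \<and> j = y then 1 else 0) * coeff (c i j) 1) =
   (\<Sum>i<N. if i = x then \<Sum>j<N. if j = y then coeff (c i j) 1 else 0 else 0)"
   by (intro sum.cong refl) (auto simp: delta_mult)
  then show ?thesis using rf_entry by simp
 qed
 show ?case
 proof (intro exI[of _ "\<lambda>i j. if i = x \<and> j = y then 1 else 0"] allI impI)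
  fix c d :: "nat \<Rightarrow> nat \<Rightarrow> 'k poly"
  show "\<exists>p. (\<forall>s. evm c s x y = poly p s) \<and>
    coeff p 1 = (\<Sum>i<N. \<Sum>j<N. (if i = x \<and> j = y then 1 else 0) * coeff (c i j) 1)"
   unfolding * by (intro exI[of _ "c x y"]) (simp add: evm_def)
 qed
next
 case (rf_inv_entry x y)
 have *: "(\<Sum>i<N. \<Sum>j<N. (if i = x \<and> j = y then - 1 else 0) * coeff (c i j) 1) = - coeff (c x y) 1" for c :: "nat \<Rightarrow> nat \<Rightarrow> 'k poly"
 proof -
  have "(\<Sum>i<N. \<Sum>j<N. (if i = x \<and> j = y then - 1 else 0) * coeff (c i j) 1) =
   (\<Sum>i<N. if i = x then \<Sum>j<N. if j = y then - coeff (c i j) 1 else 0 else 0)"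
   by (intro sum.cong refl) (auto simp: if_distrib[of "\<lambda>x. x * _"] cong: if_cong)
  then show ?thesis using rf_inv_entry by simp
 qed
 show ?case
 proof (intro exI[of _ "\<lambda>i j. if i = x \<and> j = y then - 1 else 0"] allI impI)
  fix c d :: "nat \<Rightarrow> nat \<Rightarrow> 'k poly" assume cd: "pcurve N c d"
  then have "mat_inv N (evm c s) = evm d s" for s unfolding pcurve_def by (intro mat_inv_eq) blast
  then show "\<exists>p. (\<forall>s. mat_inv N (evm c s) x y = poly p s) \<and>
    coeff p 1 = (\<Sum>i<N. \<Sum>j<N. (if i = x \<and> j = y then - 1 else 0) * coeff (c i j) 1)"
   unfolding * using pcurve_inverse_coeff[OF cd] rf_inv_entry by (intro exI[of _ "d x y"]) (simp add: evm_def)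
 qed
next
 case (rf_add f h)
 then obtain v w where v: "\<And>c d. pcurve N c d \<Longrightarrow> \<exists>p. (\<forall>s. f (evm c s) = poly p s) \<and> coeff p 1 = (\<Sum>i<N. \<Sum>j<N. v i j * coeff (c i j) 1)"
  and w: "\<And>c d. pcurve N c d \<Longrightarrow> \<exists>p. (\<forall>s. h (evm c s) = poly p s) \<and> coeff p 1 = (\<Sum>i<N. \<Sum>j<N. w i j * coeff (c i j) 1)" by blast
 show ?case
 proof (intro exI[of _ "\<lambda>i j. v i j + w i j"] allI impI)
  fix c d :: "nat \<Rightarrow> nat \<Rightarrow> 'k poly" assume cd: "pcurve N c d"
  from v[OF cd] w[OF cd] obtain p r where "\<forall>s. f (evm c s) = poly p s" "coeff p 1 = (\<Sum>i<N. \<Sum>j<N. v i j * coeff (c i j) 1)"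
   "\<forall>s. h (evm c s) = poly r s" "coeff r 1 = (\<Sum>i<N. \<Sum>j<N. w i j * coeff (c i j) 1)" by blast
  then show "\<exists>p. (\<forall>s. f (evm c s) + h (evm c s) = poly p s) \<and> coeff p 1 = (\<Sum>i<N. \<Sum>j<N. (v i j + w i j) * coeff (c i j) 1)"
   by (intro exI[of _ "p + r"]) (simp add: algebra_simps sum.distrib)
 qed
next
 case (rf_mul f h)
 then obtain v w where v: "\<And>c d. pcurve N c d \<Longrightarrow> \<exists>p. (\<forall>s. f (evm c s) = poly p s) \<and> coeff p 1 = (\<Sum>i<N. \<Sum>j<N. v i j * coeff (c i j) 1)"
  and w: "\<And>c d. pcurve N c d \<Longrightarrow> \<exists>p. (\<forall>s. h (evm c s) = poly p s) \<and> coeff p 1 = (\<Sum>i<N. \<Sum>j<N. w i j * coeff (c i j) 1)" by blast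
 show ?case
 proof (intro exI[of _ "\<lambda>i j. f (mat_id N) * w i j + h (mat_id N) * v i j"] allI impI)
  fix c d :: "nat \<Rightarrow> nat \<Rightarrow> 'k poly" assume cd: "pcurve N c d"
  from v[OF cd] w[OF cd] obtain p r where p: "\<forall>s. f (evm c s) = poly p s" "coeff p 1 = (\<Sum>i<N. \<Sum>j<N. v i j * coeff (c i j) 1)"
   and r: "\<forall>s. h (evm c s) = poly r s" "coeff r 1 = (\<Sum>i<N. \<Sum>j<N. w i j * coeff (c i j) 1)" by blast
  have "evm c 0 = mat_id N" using cd unfolding pcurve_def by blast
  then have "coeff p 0 = f (mat_id N)" "coeff r 0 = h (mat_id N)" using p(1) r(1) by (metis poly_0_coeff_0)+
  then show "\<exists>p. (\<forall>s. f (evm c s) * h (evm c s) = poly p s) \<and>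
    coeff p 1 = (\<Sum>i<N. \<Sum>j<N. (f (mat_id N) * w i j + h (mat_id N) * v i j) * coeff (c i j) 1)"
   using p r by (intro exI[of _ "p * r"]) (simp add: coeff_mult_1 algebra_simps sum.distrib sum_distrib_left)
 qed
qed

section \<open>Tori and root subgroups\<close>

definition ive :: "(nat \<Rightarrow> nat) \<Rightarrow> nat \<Rightarrow> int" where "ive a = (\<lambda>i. int (a i))"

lemma ive_apply [simp]: "ive a i = int (a i)" by (simp add: ive_def)
lemma ive_inject [simp]: "ive a = ive b \<longleftrightarrow> a = b" by (auto simp: ive_def fun_eq_iff)
lemma ive_addvec: "ive (addvec a b) = ive a + ive b" by (simp add: fun_eq_iff addvec_def)
lemma ive_0 [simp]: "ive (\<lambda>_. 0) = 0" by (simp add: fun_eq_iff)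
lemma ive_eq_0: "ive a = 0 \<longleftrightarrow> a = (\<lambda>_. 0)" by (auto simp: fun_eq_iff)

text \<open>Coordinates beyond n are unconstrained; characters do not see them.\<close>

definition torus :: "nat \<Rightarrow> (nat \<Rightarrow> 'k::field) set" where "torus n = {t. \<forall>i<n. t i \<noteq> 0}"

definition chr :: "nat \<Rightarrow> (nat \<Rightarrow> 'k::field) \<Rightarrow> (nat \<Rightarrow> int) \<Rightarrow> 'k" where
 "chr n t v = (\<Prod>i<n. t i powi v i)"

lemma chr_0 [simp]: "chr n t 0 = 1" by (simp add: chr_def)
lemma chr_neq_0: "t \<in> torus n \<Longrightarrow> chr n t v \<noteq> 0" by (simp add: chr_def torus_def)
lemma chr_add: "t \<in> torus n \<Longrightarrow> chr n t (a + b) = chr n t a * chr n t b"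
 by (simp add: chr_def torus_def power_int_add prod.distrib[symmetric])
lemma chr_minus: "t \<in> torus n \<Longrightarrow> chr n t (- a) * chr n t a = 1"
 using chr_add[of t n "- a" a] by simp
lemma chr_diff: "t \<in> torus n \<Longrightarrow> chr n t (a - b) * chr n t b = chr n t a"
 using chr_add[of t n "a - b" b] by simp
lemma chr_mult: "chr n (\<lambda>i. s i * t i) v = chr n s v * chr n t v"
 by (simp add: chr_def power_int_mult_distrib prod.distrib)
lemma chr_inverse: "chr n (\<lambda>i. inverse (t i)) v = inverse (chr n t v)"
 by (simp add: chr_def power_int_inverse prod_inversef[symmetric])
lemma chr_one [simp]: "chr n (\<lambda>_. 1) v = 1" by (simp add: chr_def)
lemma chr_uv: "i < n \<Longrightarrow> chr n t (uv i) = t i"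
proof -
 assume i: "i < n"
 have "chr n t (uv i) = (\<Prod>j<n. if j = i then t j else 1)" unfolding chr_def by (rule prod.cong) (auto simp: uv_def)
 then show ?thesis using i by simp
qed
lemma torus_mult: "s \<in> torus n \<Longrightarrow> t \<in> torus n \<Longrightarrow> (\<lambda>i. s i * t i) \<in> torus n" by (simp add: torus_def)
lemma torus_inverse: "t \<in> torus n \<Longrightarrow> (\<lambda>i. inverse (t i)) \<in> torus n" by (simp add: torus_def)
lemma torus_one [simp]: "(\<lambda>_. 1) \<in> torus n" by (simp add: torus_def)

lemma chr_vsc: "t \<in> torus n \<Longrightarrow> chr n t (vsc (int j) v) = chr n t v ^ j"
proof (induction j)
 case (Suc j)
 have "vsc (int (Suc j)) v = v + vsc (int j) v" by (simp add: fun_eq_iff algebra_simps)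
 then show ?case unfolding power_Suc using chr_add[OF Suc.prems, of v "vsc (int j) v"] Suc.IH[OF Suc.prems] by (simp only:)
qed simp

lemma powi_2_inject: "(2::'k::field_char_0) powi a = 2 powi b \<longleftrightarrow> a = b"
proof
 have *: "a \<le> b" if "(2::'k) powi a = 2 powi b" for a b
 proof (rule ccontr)
  assume "\<not> a \<le> b"
  then have k: "a = b + int (nat (a - b))" "nat (a - b) > 0" by simp_all
  define k where "k = nat (a - b)"
  note k = k[folded k_def]
  have "(2::'k) ^ k = 1" using that unfolding k(1) by (simp add: power_int_add)
  then have "of_nat (2 ^ k) = (of_nat 1 :: 'k)" by simp
  then have "(2::nat) ^ k = 1" unfolding of_nat_eq_iff .
  then show False using k(2) by simp
 qed
 show "2 powi a = (2::'k) powi b \<Longrightarrow> a = b" using *[of a b] *[of b a] by simp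
qed simp

text \<open>In characteristic 0 the integer powers of 2 are distinct, so the value 2 at a coordinate
  where the exponents differ, and 1 elsewhere, separates the characters.\<close>

lemma ex_chr_neq:
 assumes "v \<in> Zn n" "w \<in> Zn n" "v \<noteq> w" shows "\<exists>t\<in>torus n. chr n t v \<noteq> (chr n t w :: 'k::field_char_0)"
proof -
 obtain i where i: "v i \<noteq> w i" using assms(3) by (auto simp: fun_eq_iff)
 then have "i < n" using assms(1,2) by (metis Zn_ge)
 define t where "t j = (if j = i then 2 else 1 :: 'k)" for j
 have "chr n t x = 2 powi x i" for x
 proof -
  have "chr n t x = (\<Prod>j<n. if j = i then 2 powi x j else 1)" unfolding chr_def t_def by (rule prod.cong) auto
  then show ?thesis using \<open>i < n\<close> by simp
 qed
 then have "chr n t v \<noteq> chr n t w" using i powi_2_inject by metis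
 moreover have "t \<in> torus n" by (simp add: torus_def t_def)
 ultimately show ?thesis by blast
qed

definition mdiag :: "nat \<Rightarrow> (nat \<Rightarrow> 'k::field) \<Rightarrow> nat \<Rightarrow> nat \<Rightarrow> 'k" where
 "mdiag N d = (\<lambda>i j. if i < N \<and> i = j then d i else 0)"

lemma mdiag_mul: "mat_mul N (mdiag N d) g = (\<lambda>i j. if i < N \<and> j < N then d i * g i j else 0)"
 "mat_mul N g (mdiag N d) = (\<lambda>i j. if i < N \<and> j < N then g i j * d j else 0)"
proof -
 have a: "mdiag N d i k * g k j = (if k = i then d i * g i j else 0)" if "i < N" for i j k using that by (simp add: mdiag_def)
 have b: "g i k * mdiag N d k j = (if k = j then g i j * d j else 0)" if "j < N" for i j k using that by (simp add: mdiag_def)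
 show "mat_mul N (mdiag N d) g = (\<lambda>i j. if i < N \<and> j < N then d i * g i j else 0)"
  by (intro ext) (simp add: mat_mul_def a cong: if_cong)
 show "mat_mul N g (mdiag N d) = (\<lambda>i j. if i < N \<and> j < N then g i j * d j else 0)"
  by (intro ext) (simp add: mat_mul_def b cong: if_cong)
qed

section \<open>Automorphisms in a monomial basis and the diagonal torus\<close>

locale monlist = staircase n S for n S +
 fixes ms :: "(nat \<Rightarrow> nat) list"
 assumes distinct_ms: "distinct ms" and S_eq: "S = ive ` set ms"
begin

abbreviation "N \<equiv> length ms"
abbreviation "im k \<equiv> ive (ms ! k)"

lemma im_S: "k < N \<Longrightarrow> im k \<in> S" unfolding S_eq by simp
lemma im_inject: "k < N \<Longrightarrow> l < N \<Longrightarrow> im k = im l \<longleftrightarrow> k = l" using distinct_ms by (simp add: nth_eq_iff_index_eq)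

lemma bij_im: "bij_betw im {..<N} S"
proof (rule bij_betw_imageI)
 show "inj_on im {..<N}" by (rule inj_onI) (use im_inject in auto)
 show "im ` {..<N} = S" unfolding S_eq by (auto simp: set_conv_nth image_iff)
qed

lemma sum_im: "(\<Sum>k<N. f (im k)) = (\<Sum>p\<in>S. f p)" by (rule sum.reindex_bij_betw[OF bij_im])

definition idx :: "(nat \<Rightarrow> int) \<Rightarrow> nat" where "idx = inv_into {..<N} im"

lemma idx: assumes "p \<in> S" shows "idx p < N" "im (idx p) = p"
proof -
 have "p \<in> im ` {..<N}" using bij_im assms unfolding bij_betw_def by simp
 from inv_into_into[OF this] f_inv_into_f[OF this] show "idx p < N" "im (idx p) = p" unfolding idx_def by auto
qed

lemma idx_im: "k < N \<Longrightarrow> idx (im k) = k" using idx[OF im_S] im_inject by metis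

text \<open>Matrix entries indexed by exponent vectors and extended by 0, so that products leaving
  the staircase vanish without case distinctions.\<close>

definition gx :: "(nat \<Rightarrow> nat \<Rightarrow> 'a::zero) \<Rightarrow> (nat \<Rightarrow> int) \<Rightarrow> (nat \<Rightarrow> int) \<Rightarrow> 'a" where
 "gx g p q = (if p \<in> S \<and> q \<in> S then g (idx p) (idx q) else 0)"

lemma gx_im: "k < N \<Longrightarrow> l < N \<Longrightarrow> gx g (im k) (im l) = g k l" unfolding gx_def using im_S idx_im by simp

text \<open>The structure constants are 0 or 1 and force the second factor to have exponent
  \<open>l - p\<close>, so the double sum collapses to a convolution.\<close>

lemma Aut_M_iff:
 "g \<in> Aut_M ms \<longleftrightarrow> invertible_mat N g \<and>
  (\<forall>i\<in>S. \<forall>j\<in>S. \<forall>l\<in>S. gx g l (i + j) = (\<Sum>p\<in>S. gx g p i * gx g (l - p) j)) \<and>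
  (\<forall>l\<in>S. gx g l 0 = (if l = 0 then 1 else (0::'k::field)))"
proof -
 have add: "addvec (ms ! i) (ms ! j) = ms ! k \<longleftrightarrow> im i + im j = im k" for i j k
  unfolding ive_inject[symmetric] ive_addvec ..
 have L: "(\<Sum>k<N. (if addvec (ms ! i) (ms ! j) = ms ! k then 1 else 0) * g l k) = gx g (im l) (im i + im j)"
  if "l < N" for i j l
 proof -
  have "(\<Sum>k<N. (if addvec (ms ! i) (ms ! j) = ms ! k then 1 else 0) * g l k) =
    (\<Sum>k<N. if im i + im j = im k then gx g (im l) (im k) else 0)"
   by (rule sum.cong) (use that in \<open>auto simp: add gx_im delta_mult\<close>)
  also have "\<dots> = (\<Sum>p\<in>S. if im i + im j = p then gx g (im l) p else 0)"
   using sum_im[of "\<lambda>p. if im i + im j = p then gx g (im l) p else 0"] by simp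
  also have "\<dots> = gx g (im l) (im i + im j)" by (simp add: gx_def)
  finally show ?thesis .
 qed
 have R: "(\<Sum>p<N. \<Sum>q<N. g p i * g q j * (if addvec (ms ! p) (ms ! q) = ms ! l then 1 else 0)) =
   (\<Sum>p\<in>S. gx g p (im i) * gx g (im l - p) (im j))" if "i < N" "j < N" for i j l
 proof -
  have "(\<Sum>q<N. g p i * g q j * (if addvec (ms ! p) (ms ! q) = ms ! l then 1 else 0)) =
   gx g (im p) (im i) * gx g (im l - im p) (im j)" if p: "p < N" for p
  proof -
   have "(\<Sum>q<N. g p i * g q j * (if addvec (ms ! p) (ms ! q) = ms ! l then 1 else 0)) =
    (\<Sum>q<N. if im q = im l - im p then gx g (im p) (im i) * gx g (im q) (im j) else 0)"
    by (rule sum.cong) (use that p \<open>j < N\<close> \<open>i < N\<close> in \<open>auto simp: add gx_im algebra_simps\<close>)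
   also have "\<dots> = (\<Sum>q\<in>S. if q = im l - im p then gx g (im p) (im i) * gx g q (im j) else 0)"
    using sum_im[of "\<lambda>q. if q = im l - im p then gx g (im p) (im i) * gx g q (im j) else 0"] by simp
   also have "\<dots> = gx g (im p) (im i) * gx g (im l - im p) (im j)" by (simp add: gx_def)
   finally show ?thesis .
  qed
  then show ?thesis using sum_im[of "\<lambda>p. gx g p (im i) * gx g (im l - p) (im j)"] by simp
 qed
 have U: "(\<Sum>k<N. g l k * (if k < N \<and> ms ! k = (\<lambda>_. 0) then 1 else 0)) = gx g (im l) 0" if "l < N" for l
 proof -
  have "(\<Sum>k<N. g l k * (if k < N \<and> ms ! k = (\<lambda>_. 0) then 1 else 0)) = (\<Sum>k<N. if im k = 0 then gx g (im l) (im k) else 0)"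
  proof (rule sum.cong[OF refl])
   fix x assume "x \<in> {..<N}"
   then have "gx g (im l) (im x) = g l x" using gx_im that by simp
   then show "g l x * (if x < N \<and> ms ! x = (\<lambda>_. 0) then 1 else 0) = (if im x = 0 then gx g (im l) (im x) else 0)"
    using \<open>x \<in> {..<N}\<close> by (cases "ms ! x = (\<lambda>_. 0)") (simp_all add: ive_eq_0)
  qed
  also have "\<dots> = (\<Sum>p\<in>S. if p = 0 then gx g (im l) p else 0)"
   using sum_im[of "\<lambda>p. if p = 0 then gx g (im l) p else 0"] by simp
  also have "\<dots> = gx g (im l) 0" by (simp add: gx_def)
  finally show ?thesis .
 qed
 have all: "(\<forall>i<N. P (im i)) \<longleftrightarrow> (\<forall>i\<in>S. P i)" for P using im_S idx by metis
 have "g \<in> Aut_M ms \<longleftrightarrow> invertible_mat N g \<and>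
  (\<forall>i<N. \<forall>j<N. \<forall>l<N. gx g (im l) (im i + im j) = (\<Sum>p\<in>S. gx g p (im i) * gx g (im l - p) (im j))) \<and>
  (\<forall>l<N. gx g (im l) 0 = (if im l = 0 then 1 else 0))"
  unfolding Aut_M_def aut_mats_def mem_Collect_eq using L R U by (simp add: ive_eq_0 cong: conj_cong)
 then show ?thesis
  using all[of "\<lambda>l. gx g l 0 = (if l = 0 then 1 else 0)"]
   all[of "\<lambda>i. \<forall>j<N. \<forall>l<N. gx g (im l) (i + im j) = (\<Sum>p\<in>S. gx g p i * gx g (im l - p) (im j))"]
   all[of "\<lambda>j. \<forall>l<N. gx g (im l) (i + j) = (\<Sum>p\<in>S. gx g p i * gx g (im l - p) j)" for i]
   all[of "\<lambda>l. gx g l (i + j) = (\<Sum>p\<in>S. gx g p i * gx g (l - p) j)" for i j] by simp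
qed

definition of_fun :: "((nat \<Rightarrow> int) \<Rightarrow> (nat \<Rightarrow> int) \<Rightarrow> 'a::zero) \<Rightarrow> nat \<Rightarrow> nat \<Rightarrow> 'a" where
 "of_fun F = (\<lambda>l k. if l < N \<and> k < N then F (im l) (im k) else 0)"

lemma gx_of_fun: "gx (of_fun F) p q = (if p \<in> S \<and> q \<in> S then F p q else 0)"
 unfolding gx_def of_fun_def using idx by simp

lemma padded_of_fun [simp]: "padded N (of_fun F)" by (simp add: padded_def of_fun_def)

lemma of_fun_cong: "(\<And>p q. p \<in> S \<Longrightarrow> q \<in> S \<Longrightarrow> F p q = G p q) \<Longrightarrow> of_fun F = of_fun G"
 unfolding of_fun_def using im_S by (intro ext) simp

lemma of_fun_mul: "mat_mul N (of_fun F) (of_fun G) = of_fun (\<lambda>p q. \<Sum>r\<in>S. F p r * G r q)"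
 by (intro ext) (simp add: mat_mul_def of_fun_def sum_im[of "\<lambda>r. F _ r * G r _", symmetric])

lemma of_fun_id: "of_fun (\<lambda>p q. if p = q then 1 else 0) = mat_id N"
 by (intro ext) (auto simp: of_fun_def mat_id_def nth_eq_iff_index_eq[OF distinct_ms])

definition Tor :: "(nat \<Rightarrow> 'k::field) \<Rightarrow> nat \<Rightarrow> nat \<Rightarrow> 'k" where
 "Tor t = mdiag N (\<lambda>k. chr n t (im k))"

lemma gx_Tor: "gx (Tor t) p q = (if p \<in> S \<and> p = q then chr n t p else 0)"
proof (cases "p \<in> S \<and> q \<in> S")
 case True
 then have "idx p = idx q \<longleftrightarrow> p = q" using idx(2)[of p] idx(2)[of q] by metis
 then show ?thesis using True idx unfolding gx_def Tor_def mdiag_def by simp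
next
 case False then show ?thesis unfolding gx_def by auto
qed

lemma Tor_mult: "mat_mul N (Tor s) (Tor t) = Tor (\<lambda>i. s i * t i)"
 unfolding Tor_def mdiag_mul by (auto simp: mdiag_def chr_mult fun_eq_iff)

lemma Tor_1: "Tor (\<lambda>_. 1) = mat_id N" by (auto simp: Tor_def mdiag_def mat_id_def)

lemma padded_Tor [simp]: "padded N (Tor t)" by (auto simp: padded_def Tor_def mdiag_def)

lemma is_inverse_Tor: "t \<in> torus n \<Longrightarrow> is_inverse N (Tor t) (Tor (\<lambda>i. inverse (t i)))"
proof -
 assume t: "t \<in> torus n"
 have "chr n t v * chr n (\<lambda>i. inverse (t i)) v = 1" "chr n (\<lambda>i. inverse (t i)) v * chr n t v = 1" for v
  using chr_neq_0[OF t] by (simp_all add: chr_inverse)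
 then show ?thesis unfolding is_inverse_def Tor_mult
  by (auto simp: Tor_def mdiag_def mat_id_def padded_def chr_mult)
qed

lemma Tor_Aut: assumes t: "t \<in> torus n" shows "Tor t \<in> Aut_M ms"
 unfolding Aut_M_iff
proof (intro conjI ballI)
 show "invertible_mat N (Tor t)" unfolding invertible_mat_def using is_inverse_Tor[OF t] by auto
 show "gx (Tor t) l 0 = (if l = 0 then 1 else 0)" if "l \<in> S" for l using that by (simp add: gx_Tor)
 fix i j l assume S: "i \<in> S" "j \<in> S" "l \<in> S"
 have "(\<Sum>p\<in>S. gx (Tor t) p i * gx (Tor t) (l - p) j) = (\<Sum>p\<in>S. if p = i then chr n t i * gx (Tor t) (l - i) j else 0)"
  by (rule sum.cong) (auto simp: gx_Tor)
 also have "\<dots> = chr n t i * gx (Tor t) (l - i) j" using S by simp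
 also have "\<dots> = gx (Tor t) l (i + j)"
 proof (cases "l = i + j")
  case True then show ?thesis using S chr_add[OF t] by (simp add: gx_Tor)
 next
  case False then have "l - i \<noteq> j" by (auto simp: algebra_simps)
  then show ?thesis using False by (simp add: gx_Tor)
 qed
 finally show "gx (Tor t) l (i + j) = (\<Sum>p\<in>S. gx (Tor t) p i * gx (Tor t) (l - p) j)" by simp
qed

lemma ratf_prod_powi:
 assumes "finite X" shows "ratf (\<Prod>i\<in>X. q i) (\<lambda>s. \<Prod>i\<in>X. poly (q i) s powi (v i :: int))"
proof -
 have *: "ratf (\<Prod>i\<in>X. q i) (\<lambda>s. poly (q i) s powi k)" if i: "i \<in> X" for i and k :: int
 proof (cases "0 \<le> k")
  case True
  then have "(\<lambda>s. poly (q i) s powi k) = poly (q i ^ nat k)" by (simp add: fun_eq_iff power_int_def poly_power)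
  then show ?thesis using ratf_poly by metis
 next
  case False
  have "poly (q i) s powi k * poly (\<Prod>i\<in>X. q i) s ^ nat (- k) = poly ((\<Prod>i\<in>X - {i}. q i) ^ nat (- k)) s"
   if "poly (\<Prod>i\<in>X. q i) s \<noteq> 0" for s
  proof -
   have e: "(\<Prod>i\<in>X. q i) = q i * (\<Prod>i\<in>X - {i}. q i)" using i assms by (simp add: prod.remove)
   then have "poly (q i) s \<noteq> 0" using that by auto
   then show ?thesis unfolding e using False by (simp add: power_int_def poly_power power_mult_distrib field_simps)
  qed
  then show ?thesis unfolding ratf_def by blast
 qed
 have "ratf (\<Prod>i\<in>X. q i) (\<lambda>s. \<Prod>i\<in>Y. poly (q i) s powi (v i :: int))" if "Y \<subseteq> X" for Y
  using finite_subset[OF that assms] that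
 proof (induction Y rule: finite_induct)
  case empty
  have "poly [:1:] = (\<lambda>s. 1)" by (simp add: fun_eq_iff)
  from ratf_poly[of "prod q X" "[:1:]"] have "ratf (prod q X) (\<lambda>s. 1)" unfolding \<open>poly [:1:] = (\<lambda>s. 1)\<close> .
  then show ?case by simp
 next
  case (insert y Y)
  then show ?case using ratf_mult[OF *[of y "v y"], of "\<lambda>s. \<Prod>i\<in>Y. poly (q i) s powi v i"] by simp
 qed
 then show ?thesis by blast
qed

end

section \<open>Exponentials of monomial derivations\<close>

locale mroot = monlist +
 fixes \<alpha> :: "nat \<Rightarrow> int" and m :: nat
 assumes al: "allowed n S \<alpha> m" and nz: "\<alpha> \<noteq> 0"
begin

abbreviation step :: "nat \<Rightarrow> nat \<Rightarrow> int" where "step j \<equiv> vsc (int j) \<alpha>"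

lemma step_add: "step (i + j) = step i + step j" by (simp add: fun_eq_iff algebra_simps)
lemma step_0: "step 0 = 0" by simp
lemma step_inject: "step i = step j \<longleftrightarrow> i = j"
proof
 assume e: "step i = step j"
 obtain x where "\<alpha> x \<noteq> 0" using nz by (auto simp: fun_eq_iff)
 then show "i = j" using fun_cong[OF e, of x] by simp
qed simp

lemma \<alpha>_nonneg: "x \<noteq> m \<Longrightarrow> 0 \<le> \<alpha> x" and \<alpha>_ge: "-1 \<le> \<alpha> m" using allowed_neg[OF al] by blast+
lemma m_less: "m < n" using allowed_S[OF al] by blast
lemma \<alpha>_Zn: "\<alpha> \<in> Zn n"
 using Zn_diff[OF S_Zn[OF allowed_S(2)[OF al]] Zn_uv[OF m_less]] by simp

lemma step_Zn: "step j \<in> Zn n" using \<alpha>_Zn by (simp add: Zn_def)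

text \<open>Let \<delta> be the derivation of weight \<alpha> with differentiated variable x_m. Then
  \<delta>^j multiplies x^q by the product of the numbers q_m + i \<alpha>_m for i < j and shifts
  its exponent by j \<alpha>. Hence \<open>rf j (q m)\<close> is the coefficient of s^j in exp(s
  \<delta>) x^q.\<close>

definition rf :: "nat \<Rightarrow> 'k::field_char_0 \<Rightarrow> 'k" where
 "rf j x = (\<Prod>i<j. x + of_nat i * of_int (\<alpha> m)) / fact j"

lemma rf_0 [simp]: "rf 0 x = 1" by (simp add: rf_def)
lemma rf_1: "rf (Suc 0) x = x" by (simp add: rf_def)

lemma rf_Suc: "of_nat (Suc j) * rf (Suc j) x = (x + of_nat j * of_int (\<alpha> m)) * rf j x"
proof -
 have "(of_nat (Suc j) :: 'a) \<noteq> 0" using of_nat_neq_0 .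
 then show ?thesis unfolding rf_def by (simp add: fact_Suc divide_simps del: of_nat_Suc)
qed

text \<open>With F_x the power series whose coefficients are the \<open>rf j x\<close>, this says
  that F_x F_y = F_(x+y). The induction multiplies by j + 1, that is, it compares derivatives of the
  series.\<close>

lemma rf_Vandermonde: "(\<Sum>b\<le>j. rf b x * rf (j - b) y) = rf j (x + y)"
proof (induction j)
 case (Suc j)
 let ?r = "of_int (\<alpha> m) :: 'a"
 have 1: "(\<Sum>b\<le>Suc j. of_nat b * rf b x * rf (Suc j - b) y) = (\<Sum>b\<le>j. (x + of_nat b * ?r) * rf b x * rf (j - b) y)"
  unfolding sum.atMost_Suc_shift rf_Suc by simp
 have 2: "(\<Sum>b\<le>Suc j. rf b x * (of_nat (Suc j - b) * rf (Suc j - b) y)) =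
   (\<Sum>b\<le>j. rf b x * ((y + of_nat (j - b) * ?r) * rf (j - b) y))"
  unfolding sum.atMost_Suc by (simp add: Suc_diff_le rf_Suc del: of_nat_Suc)
 have "of_nat (Suc j) * (\<Sum>b\<le>Suc j. rf b x * rf (Suc j - b) y) =
   (\<Sum>b\<le>Suc j. of_nat b * rf b x * rf (Suc j - b) y + rf b x * (of_nat (Suc j - b) * rf (Suc j - b) y))"
  unfolding sum_distrib_left by (rule sum.cong) (simp_all add: of_nat_diff algebra_simps del: of_nat_Suc)
 also have "\<dots> = (\<Sum>b\<le>j. (x + of_nat b * ?r) * rf b x * rf (j - b) y) + (\<Sum>b\<le>j. rf b x * ((y + of_nat (j - b) * ?r) * rf (j - b) y))"
  unfolding sum.distrib 1 2 ..
 also have "\<dots> = (\<Sum>b\<le>j. (x + y + of_nat j * ?r) * (rf b x * rf (j - b) y))"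
  unfolding sum.distrib[symmetric] by (rule sum.cong) (simp_all add: of_nat_diff algebra_simps)
 also have "\<dots> = (x + y + of_nat j * ?r) * rf j (x + y)" unfolding sum_distrib_left[symmetric] Suc ..
 also have "\<dots> = of_nat (Suc j) * rf (Suc j) (x + y)" unfolding rf_Suc ..
 finally show ?case using of_nat_neq_0[of j, where ?'a = 'a] by (simp del: of_nat_Suc)
qed simp

text \<open>The product defining \<open>rf j x\<close> is cut after i factors; the factorials give
  the binomial coefficient.\<close>

lemma rf_comp:
 assumes "i \<le> j" shows "rf i x * rf (j - i) (x + of_nat i * of_int (\<alpha> m)) = of_nat (j choose i) * rf j x"
proof -
 have split: "(\<Prod>a<i + k. f a) = (\<Prod>a<i. f a) * (\<Prod>a<k. f (i + a))" for k and f :: "nat \<Rightarrow> 'a"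
  by (induction k) (simp_all add: mult.assoc)
 have "(\<Prod>a<i. x + of_nat a * of_int (\<alpha> m)) * (\<Prod>a<j - i. x + of_nat i * of_int (\<alpha> m) + of_nat a * of_int (\<alpha> m)) =
   (\<Prod>a<j. x + of_nat a * of_int (\<alpha> m))"
  using split[of "\<lambda>a. x + of_nat a * of_int (\<alpha> m)" "j - i"] assms by (simp add: algebra_simps)
 then show ?thesis unfolding rf_def using assms by (simp add: binomial_fact divide_simps)
qed

lemma rf_nonzero:
 assumes "rf j (of_int z :: 'k::field_char_0) \<noteq> 0" "i < j" shows "z + int i * \<alpha> m \<noteq> 0"
proof
 assume "z + int i * \<alpha> m = 0"
 then have "of_int (z + int i * \<alpha> m) = (0 :: 'k)" by simp
 then have "of_int z + of_nat i * of_int (\<alpha> m) = (0 :: 'k)" by simp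
 then have "(\<Prod>i<j. of_int z + of_nat i * of_int (\<alpha> m)) = (0 :: 'k)" using assms(2) by (intro prod_zero) auto
 then show False using assms(1) unfolding rf_def by simp
qed

text \<open>A nonzero coefficient means that no exponent at m met on the way vanishes, so the
  condition in \<open>allowed\<close> can be applied step by step downwards from
  \<open>q + step j\<close>. With i = 0 this shows that the exponential respects the
  relations.\<close>

lemma chain:
 assumes q: "0 \<le> q" "q \<in> Zn n" and S: "q + step j \<in> S" and nzr: "rf j (of_int (q m) :: 'k::field_char_0) \<noteq> 0"
 shows "i \<le> j \<Longrightarrow> q + step i \<in> S"
proof -
 have H: "0 \<le> q \<Longrightarrow> q \<in> Zn n \<Longrightarrow> 1 \<le> q m \<Longrightarrow> q + \<alpha> \<in> S \<Longrightarrow> q \<in> S" for q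
  using al unfolding allowed_def by blast
 have "d \<le> j \<Longrightarrow> q + step (j - d) \<in> S" for d
 proof (induction d)
  case 0 then show ?case using S by (simp only: diff_zero)
 next
  case (Suc d)
  define k where "k = j - Suc d"
  have k: "k < j" "j - d = Suc k" using Suc.prems unfolding k_def by simp_all
  define x where "x = q + step k"
  have a: "q + step (j - d) \<in> S" by (rule Suc.IH) (use Suc.prems in simp)
  have b: "q + step (j - d) = x + \<alpha>" unfolding k(2) x_def by (simp add: fun_eq_iff algebra_simps)
  have xS: "x + \<alpha> \<in> S" using a unfolding b .
  have xm: "x m \<noteq> 0" using rf_nonzero[OF nzr k(1)] unfolding x_def by simp
  have x0: "0 \<le> x y" for y
  proof (cases "0 \<le> \<alpha> y")
   case True
   then show ?thesis using le_funD[OF q(1), of y] unfolding x_def by simp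
  next
   case False
   then have y: "y = m" using \<alpha>_nonneg by blast
   then have "\<alpha> y = -1" using False \<alpha>_ge by simp
   then show ?thesis using S_nonneg_at[OF xS, of y] by simp
  qed
  have "x \<in> S"
  proof (rule H[OF _ _ _ xS])
   show "0 \<le> x" using x0 by (simp add: le_fun_def)
   show "x \<in> Zn n" unfolding x_def using q(2) step_Zn by blast
   show "1 \<le> x m" using x0[of m] xm by simp
  qed
  then show ?case unfolding x_def k_def .
 qed
 from this[of "j - i"] show "i \<le> j \<Longrightarrow> q + step i \<in> S" by simp
qed

text \<open>If \<alpha> is -1 at m, the product in \<open>rf\<close> contains the factor 0 as soon
  as b exceeds the exponent at m.\<close>

lemma step_nonneg:
 assumes "q \<in> S" "rf b (of_int (q m) :: 'k::field_char_0) \<noteq> 0" shows "0 \<le> q + step b"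
proof (rule le_funI)
 fix y
 show "(0 :: nat \<Rightarrow> int) y \<le> (q + step b) y"
 proof (cases "0 \<le> \<alpha> y")
  case True
  then show ?thesis using S_nonneg_at[OF assms(1), of y] by simp
 next
  case False
  then have y: "y = m" using \<alpha>_nonneg by blast
  then have a: "\<alpha> m = -1" using False \<alpha>_ge by simp
  have "int b \<le> q m"
  proof (rule ccontr)
   assume "\<not> int b \<le> q m"
   then have "nat (q m) < b" using S_nonneg_at[OF assms(1), of m] by linarith
   from rf_nonzero[OF assms(2) this] show False using a S_nonneg_at[OF assms(1), of m] by simp
  qed
  then show ?thesis using a y by simp
 qed
qed

text \<open>Entry (p, q) of exp(s \<delta>) as a polynomial in s. As \<alpha> is nonzero, at most
  one power of \<delta> leads from q to p, so the entry is a single monomial and the series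
  terminates on the finite set S.\<close>

definition ec :: "(nat \<Rightarrow> int) \<Rightarrow> (nat \<Rightarrow> int) \<Rightarrow> 'k::field_char_0 poly" where
 "ec p q = (if \<exists>j. p - q = step j then monom (rf (THE j. p - q = step j) (of_int (q m))) (THE j. p - q = step j) else 0)"

abbreviation es :: "'k::field_char_0 \<Rightarrow> (nat \<Rightarrow> int) \<Rightarrow> (nat \<Rightarrow> int) \<Rightarrow> 'k" where
 "es s p q \<equiv> poly (ec p q) s"

lemma ec_step: "p - q = step j \<Longrightarrow> ec p q = monom (rf j (of_int (q m))) j"
proof -
 assume e: "p - q = step j"
 then have "(THE j. p - q = step j) = j" using step_inject by (intro the_equality) auto
 then show ?thesis using e unfolding ec_def by auto
qed

lemma es_step: "p - q = step j \<Longrightarrow> es s p q = rf j (of_int (q m)) * s ^ j"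
 by (simp add: ec_step poly_monom)

lemma ec_none: "\<nexists>j. p - q = step j \<Longrightarrow> ec p q = 0" unfolding ec_def by simp

lemma es_none: "\<nexists>j. p - q = step j \<Longrightarrow> es s p q = 0" by (simp only: ec_none poly_0 not_False_eq_True)

lemma es_nonzero: "es s p q \<noteq> 0 \<Longrightarrow> \<exists>j. p - q = step j" using es_none by blast

lemma inj_step: "inj_on (\<lambda>b. q + step b) X"
 by (rule inj_onI) (use step_inject in \<open>metis add_left_cancel\<close>)

text \<open>The binomial theorem together with \<open>rf_comp\<close>. Terms whose intermediate
  monomial is not standard have coefficient 0 by \<open>chain\<close>, so summing over S loses
  nothing.\<close>

lemma es_comp:
 assumes p: "p \<in> S" and q: "q \<in> S"
 shows "(\<Sum>r\<in>S. es s p r * es t r q) = es (s + t) p q"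
proof (cases "\<exists>j. p - q = step j")
 case False
 have "es s p r * es t r q = 0" for r
 proof (rule ccontr)
  assume "es s p r * es t r q \<noteq> 0"
  then obtain i k where "p - r = step i" "r - q = step k" using es_nonzero by (metis mult_zero_left mult_zero_right)
  then have "p - q = step (i + k)" unfolding step_add by (metis diff_add_cancel add_diff_eq)
  then show False using False by blast
 qed
 then show ?thesis using es_none[OF False, of "s + t"] by (simp only: sum.neutral_const)
next
 case True
 then obtain j where j: "p - q = step j" by blast
 have pj: "p = q + step j" using j by (metis add.commute diff_add_cancel)
 define R where "R = (\<lambda>i. q + step i) ` {..j}"
 have pr: "p - (q + step i) = step (j - i)" if "i \<le> j" for i
 proof -
  have "step j = step i + step (j - i)" using step_add[of i "j - i"] that by simp
  then show ?thesis using pj by simp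
 qed
 have val: "es s p (q + step i) * es t (q + step i) q = of_nat (j choose i) * rf j (of_int (q m)) * (t ^ i * s ^ (j - i))" if i: "i \<le> j" for i
 proof -
  have "q + step i - q = step i" by simp
  then have "es t (q + step i) q = rf i (of_int (q m)) * t ^ i" by (rule es_step)
  moreover have "es s p (q + step i) = rf (j - i) (of_int (q m) + of_nat i * of_int (\<alpha> m)) * s ^ (j - i)"
   using es_step[OF pr[OF i], of s] by simp
  ultimately have "es s p (q + step i) * es t (q + step i) q =
   (rf i (of_int (q m)) * rf (j - i) (of_int (q m) + of_nat i * of_int (\<alpha> m))) * (t ^ i * s ^ (j - i))" by (simp add: mult_ac)
  then show ?thesis unfolding rf_comp[OF i] .
 qed
 have "(\<Sum>r\<in>S. es s p r * es t r q) = (\<Sum>r\<in>R. es s p r * es t r q)"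
 proof (rule sum.mono_neutral_cong)
  show "finite R" unfolding R_def by simp
  fix r assume "r \<in> R - S"
  then obtain i where i: "i \<le> j" "r = q + step i" "q + step i \<notin> S" unfolding R_def by auto
  then have "rf j (of_int (q m) :: 'a) = 0" using chain[OF S_nonneg[OF q] S_Zn[OF q], of j i] p pj by metis
  then show "es s p r * es t r q = 0" using val[OF i(1)] i(2) by simp
 next
  fix r assume r: "r \<in> S - R"
  show "es s p r * es t r q = 0"
  proof (rule ccontr)
   assume "es s p r * es t r q \<noteq> 0"
   then obtain i k where ik: "p - r = step i" "r - q = step k" using es_nonzero by (metis mult_zero_left mult_zero_right)
   then have "step j = step (i + k)" unfolding step_add j[symmetric] by (metis diff_add_cancel add_diff_eq)
   then have "j = i + k" unfolding step_inject .
   then have "k \<le> j" by simp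
   moreover have "r = q + step k" using ik(2) by (metis add.commute diff_add_cancel)
   ultimately show False using r unfolding R_def by blast
  qed
 qed simp_all
 also have "\<dots> = (\<Sum>i\<le>j. es s p (q + step i) * es t (q + step i) q)"
  unfolding R_def by (subst sum.reindex[OF inj_step]) simp
 also have "\<dots> = (\<Sum>i\<le>j. rf j (of_int (q m)) * (of_nat (j choose i) * t ^ i * s ^ (j - i)))"
  by (rule sum.cong) (simp_all only: val atMost_iff mult_ac)
 also have "\<dots> = rf j (of_int (q m)) * (t + s) ^ j" unfolding sum_distrib_left[symmetric] binomial_ring ..
 also have "\<dots> = es (s + t) p q" unfolding es_step[OF j] by (simp add: add.commute)
 finally show ?thesis .
qed

text \<open>Compatibility with products is \<open>rf_Vandermonde\<close>. If \<open>i + j\<close> is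
  not standard, the left side is 0, and \<open>chain\<close> makes the right side vanish
  too.\<close>

lemma es_mult:
 assumes S: "i \<in> S" "j \<in> S" "l \<in> S"
 shows "(if i + j \<in> S then es s l (i + j) else 0) = (\<Sum>p\<in>S. es s p i * (if l - p \<in> S then es s (l - p) j else 0))"
proof (cases "\<exists>r. l - (i + j) = step r")
 case False
 have "es s p i * (if l - p \<in> S then es s (l - p) j else 0) = 0" for p
 proof (rule ccontr)
  assume "es s p i * (if l - p \<in> S then es s (l - p) j else 0) \<noteq> 0"
  then have "es s p i \<noteq> 0" "es s (l - p) j \<noteq> 0" by (auto split: if_splits)
  then obtain b c where "p - i = step b" "l - p - j = step c" using es_nonzero by metis
  then have "l - (i + j) = step (b + c)" unfolding step_add by (simp add: algebra_simps flip: \<open>p - i = step b\<close> \<open>l - p - j = step c\<close>)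
  then show False using False by blast
 qed
 then show ?thesis using es_none[OF False, of s] by (simp only: sum.neutral_const if_cancel)
next
 case True
 then obtain r where r: "l - (i + j) = step r" by blast
 then have lr: "l = i + j + step r" by (metis add.commute diff_add_cancel)
 define R where "R = (\<lambda>b. i + step b) ` {..r}"
 define f where "f p = es s p i * es s (l - p) j" for p
 have lb: "l - (i + step b) - j = step (r - b)" "l - (i + step b) = j + step (r - b)" if "b \<le> r" for b
 proof -
  have "step r = step b + step (r - b)" using step_add[of b "r - b"] that by simp
  then show "l - (i + step b) - j = step (r - b)" "l - (i + step b) = j + step (r - b)" using lr by simp_all
 qed
 have val: "f (i + step b) = rf b (of_int (i m)) * rf (r - b) (of_int (j m)) * s ^ r" if b: "b \<le> r" for b
 proof -
  have "i + step b - i = step b" by simp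
  then have "es s (i + step b) i = rf b (of_int (i m)) * s ^ b" by (rule es_step)
  moreover have "s ^ r = s ^ b * s ^ (r - b)" using b by (simp flip: power_add)
  ultimately show ?thesis unfolding f_def es_step[OF lb(1)[OF b]] by (simp add: mult_ac)
 qed
 have fS: "i + step b \<in> S \<and> l - (i + step b) \<in> S" if b: "b \<le> r" "f (i + step b) \<noteq> 0" for b
 proof -
  have "rf b (of_int (i m) :: 'a) \<noteq> 0" "rf (r - b) (of_int (j m) :: 'a) \<noteq> 0" using b(2) unfolding val[OF b(1)] by auto
  then have nn: "0 \<le> i + step b" "0 \<le> l - (i + step b)"
   using step_nonneg[OF S(1)] step_nonneg[OF S(2)] unfolding lb(2)[OF b(1)] by blast+
  have "i + step b \<le> l" using nn(2) unfolding diff_ge_0_iff_ge .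
  moreover have "l - (i + step b) \<le> l" by (simp only: diff_le_eq le_add_same_cancel1 nn(1))
  ultimately show ?thesis using S_down[OF S(3)] nn by blast
 qed
 have "(\<Sum>p\<in>S. es s p i * (if l - p \<in> S then es s (l - p) j else 0)) = (\<Sum>p\<in>R. f p)"
 proof (rule sum.mono_neutral_cong)
  show "finite R" unfolding R_def by simp
  fix p assume "p \<in> R - S"
  then obtain b where b: "b \<le> r" "p = i + step b" "p \<notin> S" unfolding R_def by auto
  then show "f p = 0" using fS[OF b(1)] by metis
 next
  fix p assume p: "p \<in> S - R"
  show "es s p i * (if l - p \<in> S then es s (l - p) j else 0) = 0"
  proof (rule ccontr)
   assume "es s p i * (if l - p \<in> S then es s (l - p) j else 0) \<noteq> 0"
   then have "es s p i \<noteq> 0" "es s (l - p) j \<noteq> 0" by (auto split: if_splits)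
   then obtain b c where bc: "p - i = step b" "l - p - j = step c" using es_nonzero by metis
   then have "step r = step (b + c)" unfolding r[symmetric] step_add
    by (simp add: algebra_simps flip: \<open>p - i = step b\<close> \<open>l - p - j = step c\<close>)
   then have "r = b + c" unfolding step_inject .
   then have "b \<le> r" by simp
   moreover have "p = i + step b" using bc(1) by (metis add.commute diff_add_cancel)
   ultimately show False using p unfolding R_def by blast
  qed
 next
  fix p assume "p \<in> S \<inter> R"
  then obtain b where b: "b \<le> r" "p = i + step b" unfolding R_def by auto
  show "es s p i * (if l - p \<in> S then es s (l - p) j else 0) = f p"
  proof (cases "l - p \<in> S")
   case True then show ?thesis unfolding f_def by simp
  next
   case False
   then have "f p = 0" using fS[OF b(1)] b(2) by metis
   then show ?thesis using False by simp
  qed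
 qed simp_all
 also have "\<dots> = (\<Sum>b\<le>r. f (i + step b))" unfolding R_def by (subst sum.reindex[OF inj_step]) simp
 also have "\<dots> = (\<Sum>b\<le>r. rf b (of_int (i m)) * rf (r - b) (of_int (j m)) * s ^ r)"
  by (rule sum.cong) (simp_all only: val atMost_iff)
 also have "\<dots> = rf r (of_int (i m) + of_int (j m)) * s ^ r" unfolding sum_distrib_right[symmetric] rf_Vandermonde ..
 also have "\<dots> = es s l (i + j)" unfolding es_step[OF r] by simp
 also have "\<dots> = (if i + j \<in> S then es s l (i + j) else 0)"
 proof (cases "i + j \<in> S")
  case False
  have "rf r (of_int ((i + j) m) :: 'a) = 0"
  proof (rule ccontr)
   assume n0: "rf r (of_int ((i + j) m) :: 'a) \<noteq> 0"
   have "0 \<le> i + j" "i + j \<in> Zn n" using S S_nonneg S_Zn by (simp_all add: add_nonneg_nonneg)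
   from chain[OF this _ n0, of 0] S(3)[unfolded lr] have "i + j + step 0 \<in> S" by blast
   then show False unfolding step_0 add_0_right using False by blast
  qed
  then show ?thesis unfolding es_step[OF r] using False by simp
 qed simp
 finally show ?thesis by (rule sym)
qed

lemma es_unit: "es s l 0 = (if l = 0 then 1 else 0)"
proof (cases "\<exists>r. l - 0 = step r")
 case True
 then obtain r where r: "l - 0 = step r" by blast
 show ?thesis
 proof (cases r)
  case 0 then show ?thesis using es_step[OF r, of s] r by simp
 next
  case (Suc k)
  then have "l \<noteq> 0" using r step_inject[of r 0] by auto
  moreover have "rf r (of_int ((0 :: nat \<Rightarrow> int) m) :: 'a) = 0"
   using rf_nonzero[of r 0 0, where ?'k = 'a] Suc by auto
  ultimately show ?thesis using es_step[OF r, of s] by simp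
 qed
next
 case False
 then have "l \<noteq> 0" using step_0 by (metis diff_0_right)
 then show ?thesis using es_none[OF False, of s] by simp
qed

lemma es_0: "es (0 :: 'k::field_char_0) p q = (if p = q then 1 else 0)"
proof (cases "\<exists>r. p - q = step r")
 case True
 then obtain r where r: "p - q = step r" by blast
 then have "p = q \<longleftrightarrow> r = 0" using step_inject[of r 0] by auto
 then show ?thesis using es_step[OF r, of "0 :: 'k"] by (simp add: power_0_left)
next
 case False
 then have "p \<noteq> q" using step_0 by (metis diff_self)
 then show ?thesis using es_none[OF False, of "0 :: 'k"] by simp
qed

definition expm :: "'k::field_char_0 \<Rightarrow> nat \<Rightarrow> nat \<Rightarrow> 'k" where "expm s = of_fun (es s)"

lemma expm_add: "mat_mul N (expm s) (expm t) = expm (s + t)"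
 unfolding expm_def of_fun_mul by (rule of_fun_cong, rule es_comp)

lemma expm_0: "expm 0 = mat_id N" unfolding expm_def es_0 of_fun_id ..

lemma is_inverse_expm: "is_inverse N (expm s) (expm (- s))"
 unfolding is_inverse_def expm_add by (simp add: expm_0) (simp add: expm_def)

lemma expm_Aut: "expm s \<in> Aut_M ms"
 unfolding Aut_M_iff
proof (intro conjI ballI)
 show "invertible_mat N (expm s)" unfolding invertible_mat_def using is_inverse_expm[of s] by (auto simp: expm_def)
 show "gx (expm s) l 0 = (if l = 0 then 1 else 0)" if "l \<in> S" for l
  using that S_0 es_unit[of l s] unfolding expm_def gx_of_fun by simp
 fix i j l assume S: "i \<in> S" "j \<in> S" "l \<in> S"
 have "gx (expm s) l (i + j) = (if i + j \<in> S then es s l (i + j) else 0)"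
  using S unfolding expm_def gx_of_fun by simp
 also have "\<dots> = (\<Sum>p\<in>S. es s p i * (if l - p \<in> S then es s (l - p) j else 0))" by (rule es_mult[OF S])
 also have "\<dots> = (\<Sum>p\<in>S. gx (expm s) p i * gx (expm s) (l - p) j)"
  by (rule sum.cong) (use S in \<open>simp_all add: expm_def gx_of_fun\<close>)
 finally show "gx (expm s) l (i + j) = (\<Sum>p\<in>S. gx (expm s) p i * gx (expm s) (l - p) j)" .
qed

lemma evm_ec: "evm (of_fun ec) s = expm s"
 unfolding evm_def expm_def of_fun_def by (intro ext) simp

lemma pcurve_ec: "pcurve N (of_fun ec) (\<lambda>i j. pcompose (of_fun ec i j) [:0, - 1:])"
proof -
 have "evm (\<lambda>i j. pcompose (of_fun ec i j) [:0, - 1:]) s = expm (- s)" for s :: 'a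
  unfolding evm_ec[symmetric] by (simp add: evm_def poly_pcompose)
 then show ?thesis unfolding pcurve_def evm_ec using is_inverse_expm expm_0 by (auto simp: expm_def)
qed

text \<open>Conjugation by the torus rescales the parameter by the character \<alpha>. This relation
  survives a group homomorphism and identifies the weight of the image curve in
  \<open>root_image\<close>.\<close>

lemma Tor_expm:
 assumes t: "t \<in> torus n"
 shows "mat_mul N (Tor t) (mat_mul N (expm s) (Tor (\<lambda>i. inverse (t i)))) = expm (s * chr n t \<alpha>)"
proof -
 have "chr n t p * (es s p q * chr n (\<lambda>i. inverse (t i)) q) = es (s * chr n t \<alpha>) p q" for p q
 proof (cases "\<exists>r. p - q = step r")
  case True
  then obtain r where r: "p - q = step r" by blast
  then have "chr n t p = chr n t \<alpha> ^ r * chr n t q" using chr_diff[OF t, of p q] chr_vsc[OF t, of r \<alpha>] by simp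
  then show ?thesis unfolding es_step[OF r] chr_inverse using chr_neq_0[OF t, of q]
   by (simp add: power_mult_distrib)
 next
  case False then show ?thesis by (simp only: es_none mult_zero_left mult_zero_right not_False_eq_True)
 qed
 then show ?thesis unfolding Tor_def mdiag_mul expm_def of_fun_def by (intro ext) simp
qed

text \<open>These entries of the tangent vector tell apart the derivations with the same weight and
  different m.\<close>

lemma coeff_ec: "coeff (ec (\<alpha> + uv x) (uv x) :: 'k::field_char_0 poly) 1 = (if x = m then 1 else 0)"
proof -
 have "\<alpha> + uv x - uv x = step 1" by (simp add: fun_eq_iff)
 then have "ec (\<alpha> + uv x) (uv x) = (monom (rf 1 (of_int (uv x m))) 1 :: 'k poly)" by (rule ec_step)
 then show ?thesis by (simp add: rf_1 uv_apply)
qed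

end

section \<open>Tangent vectors of curves of automorphisms\<close>

context monlist
begin

lemma gx_evm: "gx (evm p s) a b = poly (gx p a b) s" by (simp add: gx_def evm_def)

text \<open>The linear part of the automorphism condition is the Leibniz rule, so the tangent vector
  is determined by its values \<open>\<kappa> j\<close> on the variables. A nonzero
  \<open>\<kappa> j\<close> that is not allowed would give
  \<open>\<kappa> j * of_int (q j) = 0\<close> for some \<open>q\<close> divisible by x_j,
  impossible in characteristic 0.\<close>

lemma deriv_form:
 fixes p :: "nat \<Rightarrow> nat \<Rightarrow> 'k::field_char_0 poly"
 assumes aut: "\<And>s. evm p s \<in> Aut_M ms" and p0: "evm p 0 = mat_id N"
  and weight: "\<And>l k. l < N \<Longrightarrow> k < N \<Longrightarrow> coeff (p l k) 1 \<noteq> 0 \<Longrightarrow> im l - im k = \<beta>"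
 shows "\<exists>\<kappa>. (\<forall>j. \<kappa> j \<noteq> 0 \<longrightarrow> allowed n S \<beta> j) \<and>
  (\<forall>l<N. \<forall>k<N. coeff (p l k) 1 = (if im l = im k + \<beta> then \<Sum>j<n. \<kappa> j * of_int (im k j) else 0))"
proof -
 define \<Gamma> where "\<Gamma> a b = coeff (gx p a b) 1" for a b
 have \<Gamma>0: "\<Gamma> a b = 0" if "a \<notin> S \<or> b \<notin> S" for a b using that unfolding \<Gamma>_def gx_def by auto
 have c0: "coeff (gx p a b) 0 = (if a \<in> S \<and> a = b then 1 else 0)" for a b
 proof -
  have "coeff (gx p a b) 0 = gx (mat_id N) a b" unfolding p0[symmetric] gx_evm poly_0_coeff_0 ..
  also have "\<dots> = (if a \<in> S \<and> a = b then 1 else 0)" unfolding of_fun_id[symmetric] gx_of_fun by auto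
  finally show ?thesis .
 qed
 have W: "a = b + \<beta>" if "\<Gamma> a b \<noteq> 0" for a b
 proof -
  have S: "a \<in> S" "b \<in> S" using that \<Gamma>0 by blast+
  have "coeff (p (idx a) (idx b)) 1 \<noteq> 0" using that S unfolding \<Gamma>_def gx_def by simp
  from weight[OF idx(1)[OF S(1)] idx(1)[OF S(2)] this] have "a - b = \<beta>" using idx(2) S by simp
  then show ?thesis by (metis add.commute diff_add_cancel)
 qed
 have Leib: "\<Gamma> l (i + j) = \<Gamma> (l - i) j + \<Gamma> (l - j) i" if S: "i \<in> S" "j \<in> S" "l \<in> S" for i j l
 proof -
  have "poly (gx p l (i + j)) s = poly (\<Sum>q\<in>S. gx p q i * gx p (l - q) j) s" for s
   using aut[of s] S unfolding Aut_M_iff gx_evm by (simp add: poly_sum)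
  then have "gx p l (i + j) = (\<Sum>q\<in>S. gx p q i * gx p (l - q) j)" by (simp add: poly_eq_poly_eq_iff fun_eq_iff flip: poly_eq_poly_eq_iff)
  then have "\<Gamma> l (i + j) = coeff (\<Sum>q\<in>S. gx p q i * gx p (l - q) j) (Suc 0)" unfolding \<Gamma>_def by simp
  also have "\<dots> = (\<Sum>q\<in>S. (if q = i then \<Gamma> (l - i) j else 0) + (if q = l - j then \<Gamma> (l - j) i else 0))"
   unfolding coeff_sum
  proof (rule sum.cong[OF refl])
   fix q assume q: "q \<in> S"
   have e: "l - q \<in> S \<and> l - q = j \<longleftrightarrow> q = l - j"
   proof
    assume "l - q \<in> S \<and> l - q = j" then show "q = l - j" by (metis add_diff_cancel_left' diff_add_cancel)
   next
    assume "q = l - j" then have "l - q = j" by simp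
    then show "l - q \<in> S \<and> l - q = j" using S(2) by simp
   qed
   have "coeff (gx p q i * gx p (l - q) j) (Suc 0) = (if q \<in> S \<and> q = i then 1 else 0) * \<Gamma> (l - q) j +
     \<Gamma> q i * (if l - q \<in> S \<and> l - q = j then 1 else 0)"
    unfolding coeff_mult_1 c0 \<Gamma>_def ..
   also have "\<dots> = (if q = i then \<Gamma> (l - i) j else 0) + (if q = l - j then \<Gamma> (l - j) i else 0)"
    unfolding e using q by (cases "q = i"; cases "q = l - j") auto
   finally show "coeff (gx p q i * gx p (l - q) j) (Suc 0) = (if q = i then \<Gamma> (l - i) j else 0) + (if q = l - j then \<Gamma> (l - j) i else 0)" .
  qed
  also have "\<dots> = \<Gamma> (l - i) j + \<Gamma> (l - j) i" using S \<Gamma>0[of "l - j" i] by (simp add: sum.distrib)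
  finally show ?thesis .
 qed
 define \<kappa> where "\<kappa> j = (if j < n then \<Gamma> (uv j + \<beta>) (uv j) else 0)" for j
 have \<kappa>S: "j < n \<and> uv j + \<beta> \<in> S" if "\<kappa> j \<noteq> 0" for j using that \<Gamma>0 unfolding \<kappa>_def by (meson)
 have \<kappa>neg: "j = x \<and> \<beta> x = -1" if "\<kappa> j \<noteq> 0" "\<beta> x < 0" for j x
 proof -
  have "0 \<le> (uv j + \<beta>) x" using S_nonneg_at[of "uv j + \<beta>" x] \<kappa>S[OF that(1)] by blast
  then show ?thesis using that(2) by (cases "j = x") (auto simp: uv_apply)
 qed
 have main: "k + \<beta> \<in> S \<longrightarrow> \<Gamma> (k + \<beta>) k = (\<Sum>j<n. \<kappa> j * of_int (k j))" if k: "k \<in> S" for k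
 proof (rule Zn_nonneg_induct[OF S_nonneg[OF k] S_Zn[OF k]])
  have "\<Gamma> l 0 = 0" if "l \<in> S" for l using Leib[OF S_0 S_0 that] by simp
  then show "0 + \<beta> \<in> S \<longrightarrow> \<Gamma> (0 + \<beta>) 0 = (\<Sum>j<n. \<kappa> j * of_int ((0 :: nat \<Rightarrow> int) j))" by simp
  fix w i assume w: "0 \<le> w" "i < n" "w + uv i \<le> k" and IH: "w + \<beta> \<in> S \<longrightarrow> \<Gamma> (w + \<beta>) w = (\<Sum>j<n. \<kappa> j * of_int (w j))"
  have wu: "w + uv i \<in> S" using S_down[OF k _ w(3)] add_nonneg_nonneg[OF w(1) uv_nonneg] by blast
  have wS: "w \<in> S" by (rule S_down[OF wu w(1) le_add_uv])
  show "w + uv i + \<beta> \<in> S \<longrightarrow> \<Gamma> (w + uv i + \<beta>) (w + uv i) = (\<Sum>j<n. \<kappa> j * of_int ((w + uv i) j))"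
  proof
   assume l: "w + uv i + \<beta> \<in> S"
   have z: "\<Gamma> (w + \<beta>) w = (\<Sum>j<n. \<kappa> j * of_int (w j))"
   proof (cases "w + \<beta> \<in> S")
    case True then show ?thesis using IH by blast
   next
    \<comment> \<open>If \<open>w + \<beta>\<close> is not standard, then \<beta> is negative at
      some x with \<open>w x = 0\<close>. Only \<open>\<kappa> x\<close> can be nonzero there, so
      the expected sum is 0 as well.\<close>
    case False
    have "w + \<beta> \<le> w + uv i + \<beta>" by (simp add: le_fun_def)
    then have "\<not> 0 \<le> w + \<beta>" using False S_down[OF l] by blast
    then obtain x where x: "w x + \<beta> x < 0" by (auto simp: le_fun_def not_le)
    have "0 \<le> w x" using le_funD[OF w(1), of x] by simp
    then have bx: "\<beta> x < 0" using x by simp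
    have "\<kappa> j * of_int (w j) = 0" for j
    proof (cases "\<kappa> j = 0")
     case False
     from \<kappa>neg[OF this bx] have "j = x" "\<beta> x = -1" by blast+
     then have "w j = 0" using x \<open>0 \<le> w x\<close> by simp
     then show ?thesis by simp
    qed simp
    then show ?thesis using \<Gamma>0 False by (simp add: sum.neutral)
   qed
   have e: "w + uv i + \<beta> - w = uv i + \<beta>" "w + uv i + \<beta> - uv i = w + \<beta>" by (simp_all add: fun_eq_iff)
   have "\<Gamma> (w + uv i + \<beta>) (w + uv i) = \<kappa> i + \<Gamma> (w + \<beta>) w"
    using Leib[OF wS S_uv[OF w(2)] l] w(2) unfolding e \<kappa>_def by simp
   also have "\<dots> = (\<Sum>j<n. \<kappa> j * of_int (w j)) + (\<Sum>j<n. if j = i then \<kappa> j else 0)" unfolding z using w(2) by simp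
   also have "\<dots> = (\<Sum>j<n. \<kappa> j * of_int ((w + uv i) j))"
    unfolding sum.distrib[symmetric] by (rule sum.cong) (auto simp: uv_apply algebra_simps)
   finally show "\<Gamma> (w + uv i + \<beta>) (w + uv i) = (\<Sum>j<n. \<kappa> j * of_int ((w + uv i) j))" .
  qed
 qed
 have allowed: "allowed n S \<beta> j" if kj: "\<kappa> j \<noteq> 0" for j
 proof -
  have j: "j < n" "uv j + \<beta> \<in> S" using \<kappa>S[OF kj] by blast+
  have "q \<in> S" if q: "0 \<le> q" "q \<in> Zn n" "1 \<le> q j" and l: "q + \<beta> \<in> S" for q
  proof (rule ccontr)
   assume nS: "q \<notin> S"
   have "\<not> 0 \<le> \<beta>"
   proof
    assume "0 \<le> \<beta>"
    then have "q \<le> q + \<beta>" by simp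
    then show False using S_down[OF l q(1)] nS by blast
   qed
   then obtain x where x: "\<beta> x < 0" by (auto simp: le_fun_def not_le)
   have only: "j' = j" if "\<kappa> j' \<noteq> 0" for j' using \<kappa>neg[OF that x] \<kappa>neg[OF kj x] by simp
   define i where "i = q - uv j"
   have i0: "0 \<le> i" unfolding i_def diff_ge_0_iff_ge using uv_le_iff[OF q(1)] q(3) by blast
   have qi: "q = i + uv j" unfolding i_def by simp
   have "i \<le> q + \<beta>"
   proof (rule le_funI)
    fix y show "i y \<le> (q + \<beta>) y" using S_nonneg_at[OF j(2), of y] unfolding i_def by simp
   qed
   then have iS: "i \<in> S" by (rule S_down[OF l i0])
   have e: "q + \<beta> - i = uv j + \<beta>" "q + \<beta> - uv j = i + \<beta>" unfolding qi by (simp_all add: fun_eq_iff)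
   have "\<Gamma> (q + \<beta>) (i + uv j) = 0" using nS \<Gamma>0 unfolding qi[symmetric] by blast
   then have z: "\<kappa> j + \<Gamma> (i + \<beta>) i = 0" using Leib[OF iS S_uv[OF j(1)] l] j(1) unfolding e \<kappa>_def by simp
   show False
   proof (cases "i + \<beta> \<in> S")
    case True
    then have "\<Gamma> (i + \<beta>) i = (\<Sum>j'<n. \<kappa> j' * of_int (i j'))" using main[OF iS] by blast
    also have "\<dots> = (\<Sum>j'<n. if j' = j then \<kappa> j * of_int (i j) else 0)" by (rule sum.cong) (use only in auto)
    also have "\<dots> = \<kappa> j * of_int (i j)" using j(1) by simp
    finally have "\<kappa> j * of_int (q j) = 0" using z unfolding qi by (simp add: algebra_simps)
    then show False using kj q(3) by simp
   next
    case False then show False using z \<Gamma>0 kj by simp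
   qed
  qed
  then show ?thesis unfolding allowed_def using j by (simp only: add.commute) blast
 qed
 have "coeff (p l k) 1 = (if im l = im k + \<beta> then \<Sum>j<n. \<kappa> j * of_int (im k j) else 0)" if lk: "l < N" "k < N" for l k
 proof -
  have e: "coeff (p l k) 1 = \<Gamma> (im l) (im k)" unfolding \<Gamma>_def gx_im[OF lk] ..
  show ?thesis
  proof (cases "im l = im k + \<beta>")
   case True
   then have "im k + \<beta> \<in> S" using im_S[OF lk(1)] by simp
   then show ?thesis unfolding e using main[OF im_S[OF lk(2)]] True by simp
  next
   case False then show ?thesis unfolding e using W by auto
  qed
 qed
 then show ?thesis using allowed by blast
qed

end

section \<open>Comparing multiplicities along a regular homomorphism\<close>

locale mpair = A: monlist n S ms + B: monlist n S' ms' for n S S' ms ms' +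
 fixes G G' :: "(nat \<Rightarrow> nat \<Rightarrow> 'k::field_char_0) set" and \<theta> \<phi> :: "(nat \<Rightarrow> nat \<Rightarrow> 'k) \<Rightarrow> nat \<Rightarrow> nat \<Rightarrow> 'k"
  and \<psi>' :: "(nat \<Rightarrow> int) \<Rightarrow> nat \<Rightarrow> int" and \<tau> :: "(nat \<Rightarrow> 'k) \<Rightarrow> nat \<Rightarrow> 'k"
 assumes sub: "G \<subseteq> Aut_M ms" "G' \<subseteq> Aut_M ms'"
  and mem: "g \<in> G \<Longrightarrow> \<theta> g \<in> G'"
  and mul: "g \<in> G \<Longrightarrow> h \<in> G \<Longrightarrow> mat_mul A.N g h \<in> G"
  and hom: "g \<in> G \<Longrightarrow> h \<in> G \<Longrightarrow> \<theta> (mat_mul A.N g h) = mat_mul B.N (\<theta> g) (\<theta> h)"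
  and reg: "i < B.N \<Longrightarrow> j < B.N \<Longrightarrow> \<exists>f\<in>reg_fun A.N. \<forall>g\<in>G. \<theta> g i j = f g"
  and reg': "i < A.N \<Longrightarrow> j < A.N \<Longrightarrow> \<exists>f\<in>reg_fun B.N. \<forall>g\<in>G'. \<phi> g i j = f g"
  and inv: "g \<in> G \<Longrightarrow> \<phi> (\<theta> g) = g"
  and tor: "t \<in> torus n \<Longrightarrow> A.Tor t \<in> G" and tor_eq: "t \<in> torus n \<Longrightarrow> \<theta> (A.Tor t) = B.Tor (\<tau> t)"
  and \<tau>: "t \<in> torus n \<Longrightarrow> \<tau> t \<in> torus n" "t \<in> torus n \<Longrightarrow> v \<in> Zn n \<Longrightarrow> chr n (\<tau> t) v = chr n t (\<psi>' v)"
  and exp: "allowed n S \<alpha> m \<Longrightarrow> \<alpha> \<noteq> 0 \<Longrightarrow> A.of_fun (\<lambda>p q. poly (mroot.ec \<alpha> m p q) s) \<in> G"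
  and closed': "v \<in> Zn n \<Longrightarrow> \<psi>' v \<in> Zn n" and inj': "v \<in> Zn n \<Longrightarrow> v' \<in> Zn n \<Longrightarrow> \<psi>' v = \<psi>' v' \<Longrightarrow> v = v'"
begin

lemma invertible: "g \<in> G' \<Longrightarrow> invertible_mat B.N g"
 using sub(2) aut_mats_invertible unfolding Aut_M_def by blast

lemma \<theta>_padded: "g \<in> G \<Longrightarrow> padded B.N (\<theta> g)" using invertible[OF mem] unfolding invertible_mat_def by blast

lemma id_G: "mat_id A.N \<in> G" using tor[OF torus_one] unfolding A.Tor_1 .

lemma \<theta>_id: "\<theta> (mat_id A.N) = mat_id B.N"
proof -
 let ?e = "\<theta> (mat_id A.N)"
 have ee: "mat_mul B.N ?e ?e = ?e" using hom[OF id_G id_G] unfolding mat_mul_id(1)[OF padded_id] by (rule sym)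
 obtain h where h: "is_inverse B.N ?e h" using invertible[OF mem[OF id_G]] unfolding invertible_mat_def by blast
 have "?e = mat_mul B.N (mat_mul B.N h ?e) ?e" using h \<theta>_padded[OF id_G] by (simp add: is_inverse_def mat_mul_id)
 also have "\<dots> = mat_id B.N" unfolding mat_mul_assoc ee using h by (simp add: is_inverse_def)
 finally show ?thesis .
qed

definition is_diff :: "nat \<Rightarrow> nat \<Rightarrow> (nat \<Rightarrow> nat \<Rightarrow> 'k) \<Rightarrow> bool" where
 "is_diff i j w \<longleftrightarrow> (\<exists>f\<in>reg_fun A.N. (\<forall>g\<in>G. \<theta> g i j = f g) \<and> (\<forall>c d. pcurve A.N c d \<longrightarrow>
  (\<exists>p. (\<forall>s. f (evm c s) = poly p s) \<and> coeff p 1 = (\<Sum>x<A.N. \<Sum>y<A.N. w x y * coeff (c x y) 1))))"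

definition \<omega> :: "nat \<Rightarrow> nat \<Rightarrow> nat \<Rightarrow> nat \<Rightarrow> 'k" where "\<omega> i j = (SOME w. is_diff i j w)"

lemma is_diff_\<omega>: assumes "i < B.N" "j < B.N" shows "is_diff i j (\<omega> i j)"
proof -
 obtain f where f: "f \<in> reg_fun A.N" "\<forall>g\<in>G. \<theta> g i j = f g" using reg[OF assms] by blast
 from reg_fun_differential[OF f(1)] obtain w where "\<forall>c d. pcurve A.N c d \<longrightarrow>
  (\<exists>p. (\<forall>s. f (evm c s) = poly p s) \<and> coeff p 1 = (\<Sum>x<A.N. \<Sum>y<A.N. w x y * coeff (c x y) 1))" ..
 then have "is_diff i j w" unfolding is_diff_def using f by (intro bexI[OF _ f(1)] conjI)
 then show ?thesis unfolding \<omega>_def by (rule someI[of "is_diff i j"])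
qed

lemmas \<omega> = is_diff_\<omega>[unfolded is_diff_def]

text \<open>Regular functions are polynomial along a polynomial curve with polynomial inverse, and
  since \<theta> is multiplicative, the inverse of the image is the image of the inverse.\<close>

lemma image_curve:
 assumes "pcurve A.N c d" and G: "\<And>s. evm c s \<in> G" and dG: "\<And>s. evm d s \<in> G"
 shows "\<exists>p q. (\<forall>s. evm p s = \<theta> (evm c s)) \<and> pcurve B.N p q \<and>
  (\<forall>i<B.N. \<forall>j<B.N. coeff (p i j) 1 = (\<Sum>x<A.N. \<Sum>y<A.N. \<omega> i j x y * coeff (c x y) 1))"
proof -
 have cd: "\<And>s. is_inverse A.N (evm c s) (evm d s)" "evm c 0 = mat_id A.N" using assms(1) unfolding pcurve_def by blast+
 have ex: "\<exists>p. (i < B.N \<and> j < B.N \<longrightarrow> (\<forall>s. \<theta> (evm c s) i j = poly p s) \<and>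
   coeff p 1 = (\<Sum>x<A.N. \<Sum>y<A.N. \<omega> i j x y * coeff (c x y) 1)) \<and> (\<not> (i < B.N \<and> j < B.N) \<longrightarrow> p = 0)" for i j
 proof (cases "i < B.N \<and> j < B.N")
  case True
  then obtain f where f: "\<forall>g\<in>G. \<theta> g i j = f g" "\<forall>c d. pcurve A.N c d \<longrightarrow>
   (\<exists>p. (\<forall>s. f (evm c s) = poly p s) \<and> coeff p 1 = (\<Sum>x<A.N. \<Sum>y<A.N. \<omega> i j x y * coeff (c x y) 1))" using \<omega> by blast
  from f(2)[rule_format, OF assms(1)] obtain p where "\<forall>s. f (evm c s) = poly p s"
   "coeff p 1 = (\<Sum>x<A.N. \<Sum>y<A.N. \<omega> i j x y * coeff (c x y) 1)" by blast
  then show ?thesis using True f(1) G by (intro exI[of _ p]) simp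
 next
  case False then show ?thesis by (intro exI[of _ 0]) blast
 qed
 have ex2: "\<exists>p. \<forall>s. \<theta> (evm d s) i j = poly p s" for i j
 proof -
  have "pcurve A.N d c"
  proof -
   have "evm d 0 = mat_id A.N"
    by (rule is_inverse_unique[OF cd(1)[of 0]]) (simp add: cd(2) is_inverse_def mat_mul_id)
   then show ?thesis using assms(1) unfolding pcurve_def is_inverse_def by blast
  qed
  show ?thesis
  proof (cases "i < B.N \<and> j < B.N")
   case True
   then obtain f where f: "\<forall>g\<in>G. \<theta> g i j = f g" "\<forall>c d. pcurve A.N c d \<longrightarrow>
    (\<exists>p. (\<forall>s. f (evm c s) = poly p s) \<and> coeff p 1 = (\<Sum>x<A.N. \<Sum>y<A.N. \<omega> i j x y * coeff (c x y) 1))" using \<omega> by blast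
   from f(2)[rule_format, OF \<open>pcurve A.N d c\<close>] obtain p where "\<forall>s. f (evm d s) = poly p s" by blast
   then show ?thesis using f(1) dG by (intro exI[of _ p]) simp
  next
   case False
   then have "\<theta> (evm d s) i j = 0" for s using \<theta>_padded[OF dG[of s]] unfolding padded_def by blast
   then show ?thesis by (intro exI[of _ 0]) simp
  qed
 qed
 have "\<exists>p. \<forall>i j. (i < B.N \<and> j < B.N \<longrightarrow> (\<forall>s. \<theta> (evm c s) i j = poly (p i j) s) \<and>
   coeff (p i j) 1 = (\<Sum>x<A.N. \<Sum>y<A.N. \<omega> i j x y * coeff (c x y) 1)) \<and> (\<not> (i < B.N \<and> j < B.N) \<longrightarrow> p i j = 0)"
  by (rule choice, rule allI, rule choice, rule allI, rule ex)
 then obtain p where p: "\<And>i j. (i < B.N \<and> j < B.N \<longrightarrow> (\<forall>s. \<theta> (evm c s) i j = poly (p i j) s) \<and>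
   coeff (p i j) 1 = (\<Sum>x<A.N. \<Sum>y<A.N. \<omega> i j x y * coeff (c x y) 1)) \<and> (\<not> (i < B.N \<and> j < B.N) \<longrightarrow> p i j = 0)" by blast
 have "\<exists>q. \<forall>i j. \<forall>s. \<theta> (evm d s) i j = poly (q i j) s" by (rule choice, rule allI, rule choice, rule allI, rule ex2)
 then obtain q where q: "\<And>i j s. \<theta> (evm d s) i j = poly (q i j) s" by blast
 have ep: "evm p s = \<theta> (evm c s)" for s
 proof (intro ext)
  fix i j show "evm p s i j = \<theta> (evm c s) i j"
   using p[of i j] \<theta>_padded[OF G[of s]] unfolding padded_def evm_def by (cases "i < B.N \<and> j < B.N") auto
 qed
 have eq: "evm q s = \<theta> (evm d s)" for s by (intro ext, unfold q, simp add: evm_def)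
 have "is_inverse B.N (evm p s) (evm q s)" for s
  unfolding is_inverse_def ep eq hom[OF G dG, symmetric] hom[OF dG G, symmetric]
  using cd(1)[of s] \<theta>_padded[OF dG] by (simp add: is_inverse_def \<theta>_id)
 moreover have "padded B.N (evm p s)" for s unfolding ep by (rule \<theta>_padded[OF G])
 moreover have "evm p 0 = mat_id B.N" unfolding ep cd(2) \<theta>_id ..
 ultimately have "pcurve B.N p q" unfolding pcurve_def by blast
 then show ?thesis using ep p by (intro exI[of _ p] exI[of _ q]) blast
qed

text \<open>By \<open>Tor_expm\<close>, conjugating the image curve with the image of t rescales its
  parameter by the character \<alpha> at t. Comparing linear coefficients for all t, every nonzero
  entry of the tangent vector has a weight \<gamma> with \<open>\<psi>' \<gamma> = \<alpha>\<close>,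
  which is \<beta> by injectivity. Then \<open>deriv_form\<close> applies.\<close>

lemma root_image:
 assumes al: "allowed n S \<alpha> m" and nz: "\<alpha> \<noteq> 0" and \<beta>: "\<beta> \<in> Zn n" "\<psi>' \<beta> = \<alpha>"
 shows "\<exists>p q \<kappa>. (\<forall>s. evm p s = \<theta> (A.of_fun (\<lambda>p q. poly (mroot.ec \<alpha> m p q) s))) \<and> pcurve B.N p q \<and>
  (\<forall>j. \<kappa> j \<noteq> 0 \<longrightarrow> allowed n S' \<beta> j) \<and>
  (\<forall>l<B.N. \<forall>k<B.N. coeff (p l k) 1 = (if B.im l = B.im k + \<beta> then \<Sum>j<n. \<kappa> j * of_int (B.im k j) else 0))"
proof -
 interpret R: mroot n S ms \<alpha> m by unfold_locales (rule al nz)+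
 have eG: "R.expm s \<in> G" for s using exp[OF al nz, of s] unfolding R.expm_def .
 have dG: "evm (\<lambda>i j. pcompose (A.of_fun R.ec i j) [:0, - 1:]) s \<in> G" for s
 proof -
  have "evm (\<lambda>i j. pcompose (A.of_fun R.ec i j) [:0, - 1:]) s = R.expm (- s)"
   unfolding R.evm_ec[symmetric] by (simp add: evm_def poly_pcompose)
  then show ?thesis using eG by simp
 qed
 have "evm (A.of_fun R.ec) s \<in> G" for s unfolding R.evm_ec by (rule eG)
 from image_curve[OF R.pcurve_ec this dG] obtain p q where p: "\<And>s. evm p s = \<theta> (R.expm s)" "pcurve B.N p q"
  unfolding R.evm_ec by blast
 have pG: "evm p s \<in> G'" for s unfolding p(1) by (rule mem[OF eG])
 have p0: "evm p 0 = mat_id B.N" using p(2) unfolding pcurve_def by blast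
 have "\<exists>\<kappa>. (\<forall>j. \<kappa> j \<noteq> 0 \<longrightarrow> allowed n S' \<beta> j) \<and>
  (\<forall>l<B.N. \<forall>k<B.N. coeff (p l k) 1 = (if B.im l = B.im k + \<beta> then \<Sum>j<n. \<kappa> j * of_int (B.im k j) else 0))"
 proof (rule B.deriv_form[OF _ p0])
  show "evm p s \<in> Aut_M ms'" for s using pG sub(2) by blast
  fix l k assume lk: "l < B.N" "k < B.N" "coeff (p l k) 1 \<noteq> 0"
  define \<gamma> where "\<gamma> = B.im l - B.im k"
  have \<gamma>Z: "\<gamma> \<in> Zn n" unfolding \<gamma>_def using B.S_Zn[OF B.im_S] lk by blast
  have "chr n t (\<psi>' \<gamma>) = chr n t \<alpha>" if t: "t \<in> torus n" for t :: "nat \<Rightarrow> 'k"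
  proof -
   let ?t' = "\<lambda>i. inverse (t i)"
   have t': "?t' \<in> torus n" by (rule torus_inverse[OF t])
   have inv: "chr n (\<tau> ?t') v * chr n (\<tau> t) v = 1" if "v \<in> Zn n" for v
    using \<tau>(2)[OF t that] \<tau>(2)[OF t' that] chr_neq_0[OF t] by (simp add: chr_inverse)
   have "poly (smult (chr n t (\<psi>' \<gamma>)) (p l k)) s = poly (pcompose (p l k) [:0, chr n t \<alpha>:]) s" for s
   proof -
    have "evm p (s * chr n t \<alpha>) = mat_mul B.N (B.Tor (\<tau> t)) (mat_mul B.N (evm p s) (B.Tor (\<tau> ?t')))"
     unfolding p(1) R.Tor_expm[OF t, symmetric] tor_eq[OF t, symmetric] tor_eq[OF t', symmetric]
     by (simp add: hom tor[OF t] tor[OF t'] eG mul)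
    then have "evm p (s * chr n t \<alpha>) l k = chr n (\<tau> t) (B.im l) * (evm p s l k * chr n (\<tau> ?t') (B.im k))"
     using lk(1,2) unfolding B.Tor_def mdiag_mul by simp
    moreover have "chr n (\<tau> t) (B.im l) = chr n t (\<psi>' \<gamma>) * chr n (\<tau> t) (B.im k)"
     using \<tau>(2)[OF t \<gamma>Z] chr_diff[OF \<tau>(1)[OF t], of "B.im l" "B.im k"] unfolding \<gamma>_def by simp
    ultimately have "evm p (s * chr n t \<alpha>) l k = chr n t (\<psi>' \<gamma>) * evm p s l k * (chr n (\<tau> ?t') (B.im k) * chr n (\<tau> t) (B.im k))"
     by (simp add: mult_ac)
    then have "evm p (s * chr n t \<alpha>) l k = chr n t (\<psi>' \<gamma>) * evm p s l k"
     using inv[OF B.S_Zn[OF B.im_S[OF lk(2)]]] by simp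
    then show ?thesis by (simp add: evm_def poly_pcompose)
   qed
   then have "poly (smult (chr n t (\<psi>' \<gamma>)) (p l k)) = poly (pcompose (p l k) [:0, chr n t \<alpha>:])" by (rule ext)
   then have "smult (chr n t (\<psi>' \<gamma>)) (p l k) = pcompose (p l k) [:0, chr n t \<alpha>:]" unfolding poly_eq_poly_eq_iff .
   then have "chr n t (\<psi>' \<gamma>) * coeff (p l k) 1 = coeff (pcompose (p l k) [:0, chr n t \<alpha>:]) 1" by (metis coeff_smult)
   also have "\<dots> = chr n t \<alpha> * coeff (p l k) 1"
    using coeff_pcompose_linear[of "p l k" "chr n t \<alpha>" 1] by simp
   finally show ?thesis using lk(3) by simp
  qed
  then have "\<psi>' \<gamma> = \<alpha>" using ex_chr_neq[OF closed'[OF \<gamma>Z] R.\<alpha>_Zn] by metis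
  then show "B.im l - B.im k = \<beta>" using inj'[OF \<gamma>Z \<beta>(1)] \<beta>(2) unfolding \<gamma>_def by simp
 qed
 then show ?thesis using p unfolding R.expm_def by blast
qed

text \<open>With more derivations of weight \<alpha> than of weight \<beta>, the tangent vectors of
  the image curves are linearly dependent. The differential of the left inverse \<phi> carries this
  relation back to the original tangent vectors, which \<open>coeff_ec\<close> shows to be
  independent.\<close>

lemma wt_le:
 assumes nz: "\<alpha> \<noteq> 0" and \<beta>: "\<beta> \<in> Zn n" "\<psi>' \<beta> = \<alpha>"
 shows "wt n S \<alpha> \<le> wt n S' \<beta>"
proof (rule ccontr)
 define X where "X = {m. allowed n S \<alpha> m}"
 define Y where "Y = {j. allowed n S' \<beta> j}"
 let ?E = "\<lambda>m s. A.of_fun (\<lambda>p q. poly (mroot.ec \<alpha> m p q) s)"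
 assume "\<not> wt n S \<alpha> \<le> wt n S' \<beta>"
 then have card: "card Y < card X" unfolding wt_def X_def Y_def by simp
 have fin: "finite X" "finite Y" unfolding X_def Y_def by simp_all
 let ?P = "\<lambda>m p q \<kappa>. (\<forall>s. evm p s = \<theta> (?E m s)) \<and> pcurve B.N p q \<and> (\<forall>j. \<kappa> j \<noteq> 0 \<longrightarrow> allowed n S' \<beta> j) \<and>
  (\<forall>l<B.N. \<forall>k<B.N. coeff (p l k) 1 = (if B.im l = B.im k + \<beta> then \<Sum>j<n. \<kappa> j * of_int (B.im k j) else 0))"
 have "\<forall>m\<in>X. \<exists>x. ?P m (fst x) (fst (snd x)) (snd (snd x))"
 proof
  fix m assume "m \<in> X"
  then have "allowed n S \<alpha> m" unfolding X_def by simp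
  from root_image[OF this nz \<beta>] obtain p q \<kappa> where "?P m p q \<kappa>" by blast
  then show "\<exists>x. ?P m (fst x) (fst (snd x)) (snd (snd x))" by (intro exI[of _ "(p, q, \<kappa>)"]) simp
 qed
 from bchoice[OF this] obtain x where x: "\<forall>m\<in>X. ?P m (fst (x m)) (fst (snd (x m))) (snd (snd (x m)))" ..
 define p q \<kappa> where "p m = fst (x m)" and "q m = fst (snd (x m))" and "\<kappa> m = snd (snd (x m))" for m
 have P: "?P m (p m) (q m) (\<kappa> m)" if "m \<in> X" for m using bspec[OF x that] unfolding p_def q_def \<kappa>_def .
 obtain c where c: "\<exists>m\<in>X. c m \<noteq> 0" "\<forall>j\<in>Y. (\<Sum>m\<in>X. c m * \<kappa> m j) = 0"
  using nontrivial_solution[OF fin(2,1) card, of \<kappa>] by blast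
 have sumk: "(\<Sum>m\<in>X. c m * \<kappa> m j) = 0" for j
 proof (cases "j \<in> Y")
  case False
  then have "\<kappa> m j = 0" if "m \<in> X" for m using P[OF that] unfolding Y_def by blast
  then show ?thesis by simp
 qed (use c(2) in blast)
 have sump: "(\<Sum>m\<in>X. c m * coeff (p m l k) 1) = 0" if lk: "l < B.N" "k < B.N" for l k
 proof -
  have e: "coeff (p m l k) 1 = (if B.im l = B.im k + \<beta> then \<Sum>j<n. \<kappa> m j * of_int (B.im k j) else 0)" if "m \<in> X" for m
   using P[OF that] lk by blast
  show ?thesis
  proof (cases "B.im l = B.im k + \<beta>")
   case True
   then have "(\<Sum>m\<in>X. c m * coeff (p m l k) 1) = (\<Sum>m\<in>X. \<Sum>j<n. c m * \<kappa> m j * of_int (B.im k j))"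
    by (intro sum.cong refl) (simp only: e simp_thms if_True sum_distrib_left mult.assoc)
   also have "\<dots> = (\<Sum>j<n. \<Sum>m\<in>X. c m * \<kappa> m j * of_int (B.im k j))" by (rule sum.swap)
   also have "\<dots> = (\<Sum>j<n. 0)" unfolding sum_distrib_right[symmetric] sumk by simp
   finally show ?thesis by simp
  next
   case False then show ?thesis by (intro sum.neutral ballI) (simp only: e if_False mult_zero_right)
  qed
 qed
 obtain m0 where m0: "m0 \<in> X" "c m0 \<noteq> 0" using c(1) by blast
 have al0: "allowed n S \<alpha> m0" using m0(1) unfolding X_def by simp
 have aS: "\<alpha> + uv m0 \<in> S" "uv m0 \<in> S" using A.allowed_S[OF al0] A.S_uv by blast+
 let ?x = "A.idx (\<alpha> + uv m0)" and ?y = "A.idx (uv m0)"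
 note xy = A.idx[OF aS(1)] A.idx[OF aS(2)]
 obtain f where f: "f \<in> reg_fun B.N" "\<forall>g\<in>G'. \<phi> g ?x ?y = f g" using reg'[OF xy(1,3)] by blast
 from reg_fun_differential[OF f(1)] obtain w where w: "\<forall>c d. pcurve B.N c d \<longrightarrow>
  (\<exists>p. (\<forall>s. f (evm c s) = poly p s) \<and> coeff p 1 = (\<Sum>i<B.N. \<Sum>j<B.N. w i j * coeff (c i j) 1))" ..
 \<comment> \<open>Along the image curve, \<phi> returns the exponential itself. So its differential
   applied to the m-th image tangent vector is the linear coefficient known from
   \<open>coeff_ec\<close>.\<close>
 have one: "(if m0 = m then 1 else 0) = (\<Sum>i<B.N. \<Sum>j<B.N. w i j * coeff (p m i j) 1)" if m: "m \<in> X" for m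
 proof -
  have al: "allowed n S \<alpha> m" using m unfolding X_def by simp
  interpret R: mroot n S ms \<alpha> m by unfold_locales (rule al nz)+
  have pm: "\<And>s. evm (p m) s = \<theta> (?E m s)" "pcurve B.N (p m) (q m)" using P[OF m] by blast+
  from w pm(2) obtain r where r: "\<And>s. f (evm (p m) s) = poly r s"
   "coeff r 1 = (\<Sum>i<B.N. \<Sum>j<B.N. w i j * coeff (p m i j) 1)" by blast
  have "poly r s = poly (R.ec (\<alpha> + uv m0) (uv m0)) s" for s
  proof -
   have E: "?E m s \<in> G" by (rule exp[OF al nz])
   have "poly r s = \<phi> (\<theta> (?E m s)) ?x ?y" unfolding r(1)[symmetric] pm(1) using f(2) mem[OF E] by simp
   also have "\<dots> = ?E m s ?x ?y" unfolding inv[OF E] ..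
   also have "\<dots> = poly (R.ec (\<alpha> + uv m0) (uv m0)) s" unfolding A.of_fun_def using xy by simp
   finally show ?thesis .
  qed
  then have "r = R.ec (\<alpha> + uv m0) (uv m0)" by (simp add: fun_eq_iff flip: poly_eq_poly_eq_iff)
  then show ?thesis using r(2) R.coeff_ec[of m0, where ?'k = 'k] by simp
 qed
 have "(\<Sum>m\<in>X. c m * (if m0 = m then 1 else 0)) = (\<Sum>m\<in>X. if m0 = m then c m else 0)" by (rule sum.cong) auto
 also have "\<dots> = c m0" using m0(1) fin(1) by (simp only: sum.delta'[OF fin(1)] if_True)
 finally have "c m0 = (\<Sum>m\<in>X. c m * (if m0 = m then 1 else 0))" by (rule sym)
 also have "\<dots> = (\<Sum>m\<in>X. \<Sum>i<B.N. \<Sum>j<B.N. w i j * (c m * coeff (p m i j) 1))"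
  by (intro sum.cong[OF refl]) (simp only: one sum_distrib_left mult.left_commute)
 also have "\<dots> = (\<Sum>i<B.N. \<Sum>m\<in>X. \<Sum>j<B.N. w i j * (c m * coeff (p m i j) 1))" by (rule sum.swap)
 also have "\<dots> = (\<Sum>i<B.N. \<Sum>j<B.N. \<Sum>m\<in>X. w i j * (c m * coeff (p m i j) 1))" by (rule sum.cong[OF refl], rule sum.swap)
 also have "\<dots> = 0" unfolding sum_distrib_left[symmetric] by (intro sum.neutral ballI) (simp add: sump[simplified])
 finally show False using m0(2) by simp
qed

end

section \<open>Local algebras with a torus action\<close>

locale kalg =
 fixes \<iota> :: "'k::field_char_0 \<Rightarrow> 'b::comm_ring_1"
 assumes alg: "alg_structure \<iota>"
begin

lemma \<iota>_add: "\<iota> (a + b) = \<iota> a + \<iota> b" and \<iota>_mult: "\<iota> (a * b) = \<iota> a * \<iota> b" and \<iota>_1 [simp]: "\<iota> 1 = 1"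
 using alg unfolding alg_structure_def by blast+
lemma \<iota>_0 [simp]: "\<iota> 0 = 0" using \<iota>_add[of 0 0] by simp
lemma \<iota>_minus: "\<iota> (- a) = - \<iota> a" using \<iota>_add[of a "- a"] by (simp add: eq_neg_iff_add_eq_0 add.commute)
lemma \<iota>_diff: "\<iota> (a - b) = \<iota> a - \<iota> b" using \<iota>_add[of a "- b"] by (simp add: \<iota>_minus)
lemma \<iota>_sum: "\<iota> (\<Sum>x\<in>X. f x) = (\<Sum>x\<in>X. \<iota> (f x))"
 by (induction X rule: infinite_finite_induct) (simp_all add: \<iota>_add)
lemma \<iota>_inverse: "c \<noteq> 0 \<Longrightarrow> \<iota> (inverse c) * \<iota> c = 1" by (simp flip: \<iota>_mult)
lemma \<iota>_cancel: assumes "\<iota> c * x = 0" "c \<noteq> 0" shows "x = 0"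
proof -
 have "x = \<iota> (inverse c) * \<iota> c * x" using \<iota>_inverse[OF assms(2)] by simp
 then show ?thesis using assms(1) by (simp add: mult.assoc)
qed

text \<open>Dedekind's argument.\<close>

lemma chr_independent:
 assumes "finite I" "inj_on \<chi> I" "\<And>i. i \<in> I \<Longrightarrow> \<chi> i \<in> Zn n"
  and "\<And>t. t \<in> torus n \<Longrightarrow> (\<Sum>i\<in>I. \<iota> (chr n t (\<chi> i)) * b i) = 0"
 shows "\<forall>i\<in>I. b i = 0"
 using assms
proof (induction I arbitrary: b rule: finite_induct)
 case (insert z I)
 have z: "b i = 0" if i: "i \<in> I" for i
 proof -
  have "\<chi> i \<noteq> \<chi> z" using insert.hyps(2) insert.prems(1) i by (auto simp: inj_on_def)
  then obtain s where s: "s \<in> torus n" "chr n s (\<chi> i) \<noteq> (chr n s (\<chi> z) :: 'k)"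
   using ex_chr_neq insert.prems(2) i by blast
  have "\<forall>i\<in>I. \<iota> (chr n s (\<chi> i) - chr n s (\<chi> z)) * b i = 0"
  proof (rule insert.IH)
   show "inj_on \<chi> I" using insert.prems(1) by simp
   show "\<chi> i \<in> Zn n" if "i \<in> I" for i using insert.prems(2) that by simp
   fix t :: "nat \<Rightarrow> 'k" assume t: "t \<in> torus n"
   have c: "chr n (\<lambda>i. s i * t i) v = chr n s v * chr n t v" for v :: "nat \<Rightarrow> int" by (rule chr_mult)
   have "(\<Sum>i\<in>I. \<iota> (chr n t (\<chi> i)) * (\<iota> (chr n s (\<chi> i) - chr n s (\<chi> z)) * b i)) =
    (\<Sum>i\<in>insert z I. \<iota> (chr n t (\<chi> i)) * (\<iota> (chr n s (\<chi> i) - chr n s (\<chi> z)) * b i))"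
    using insert.hyps by simp
   also have "\<dots> = (\<Sum>i\<in>insert z I. \<iota> (chr n (\<lambda>i. s i * t i) (\<chi> i)) * b i) -
     \<iota> (chr n s (\<chi> z)) * (\<Sum>i\<in>insert z I. \<iota> (chr n t (\<chi> i)) * b i)"
    unfolding sum_distrib_left sum_subtractf[symmetric] c
    by (rule sum.cong) (simp_all add: \<iota>_mult \<iota>_diff algebra_simps)
   also have "\<dots> = 0" using insert.prems(3)[OF t] insert.prems(3)[OF torus_mult[OF s(1) t]] by simp
   finally show "(\<Sum>i\<in>I. \<iota> (chr n t (\<chi> i)) * (\<iota> (chr n s (\<chi> i) - chr n s (\<chi> z)) * b i)) = 0" .
  qed
  then have "\<iota> (chr n s (\<chi> i) - chr n s (\<chi> z)) * b i = 0" using i by blast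
  then show ?thesis by (rule \<iota>_cancel) (use s(2) in simp)
 qed
 have "\<iota> (chr n (\<lambda>_. 1) (\<chi> z)) * b z = 0" using insert.prems(3)[OF torus_one] insert.hyps z by simp
 then show ?case using z by simp
qed simp

end

section \<open>Coordinates and the action of matrices\<close>

locale kbasis = kalg \<iota> for \<iota> :: "'k::field_char_0 \<Rightarrow> 'b::comm_ring_1" +
 fixes bs :: "'b list"
 assumes basis: "is_basis \<iota> bs"
begin

abbreviation "D \<equiv> length bs"
abbreviation "cx \<equiv> coords \<iota> bs"

lemma coords_spec: "k \<ge> D \<Longrightarrow> cx x k = 0" "(\<Sum>k<D. \<iota> (cx x k) * bs ! k) = x"
proof -
 have "\<exists>!c. (\<forall>k\<ge>D. c k = 0) \<and> x = (\<Sum>k<D. \<iota> (c k) * bs ! k)" using basis unfolding is_basis_def by blast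
 from theI'[OF this] show "k \<ge> D \<Longrightarrow> cx x k = 0" "(\<Sum>k<D. \<iota> (cx x k) * bs ! k) = x"
  unfolding coords_def by simp_all
qed

lemma coords_eqI: assumes "x = (\<Sum>k<D. \<iota> (c k) * bs ! k)" "j < D" shows "cx x j = c j"
proof -
 let ?c = "\<lambda>k. if k < D then c k else 0"
 have ex1: "\<exists>!c. (\<forall>k\<ge>D. c k = 0) \<and> x = (\<Sum>k<D. \<iota> (c k) * bs ! k)" using basis unfolding is_basis_def by blast
 have "cx x = ?c" unfolding coords_def
  by (rule the1_equality[OF ex1]) (simp add: assms(1))
 then show ?thesis using assms(2) by simp
qed

lemma coords_inj: assumes "\<And>k. k < D \<Longrightarrow> cx x k = cx y k" shows "x = y"
proof -
 have "(\<Sum>k<D. \<iota> (cx x k) * bs ! k) = (\<Sum>k<D. \<iota> (cx y k) * bs ! k)" using assms by simp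
 then show ?thesis unfolding coords_spec .
qed

lemma coords_add: "j < D \<Longrightarrow> cx (x + y) j = cx x j + cx y j"
 by (rule coords_eqI[where c = "\<lambda>k. cx x k + cx y k"]) (simp_all add: \<iota>_add distrib_right sum.distrib coords_spec)
lemma coords_scale: "j < D \<Longrightarrow> cx (\<iota> c * x) j = c * cx x j"
 by (rule coords_eqI[where c = "\<lambda>k. c * cx x k"])
  (simp_all add: \<iota>_mult mult.assoc coords_spec flip: sum_distrib_left)
lemma coords_0: "j < D \<Longrightarrow> cx 0 j = 0" by (rule coords_eqI[where c = "\<lambda>_. 0"]) simp_all
lemma coords_sum: "j < D \<Longrightarrow> cx (\<Sum>x\<in>X. f x) j = (\<Sum>x\<in>X. cx (f x) j)"
 by (induction X rule: infinite_finite_induct) (simp_all add: coords_add coords_0)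
lemma coords_basis: assumes "i < D" "j < D" shows "cx (bs ! i) j = (if j = i then 1 else 0)"
proof (rule coords_eqI[OF _ assms(2)])
 have "(\<Sum>k<D. \<iota> (if k = i then 1 else 0) * bs ! k) = (\<Sum>k<D. if k = i then bs ! k else 0)" by (rule sum.cong) auto
 then show "bs ! i = (\<Sum>k<D. \<iota> (if k = i then 1 else 0) * bs ! k)" using assms(1) by simp
qed

definition act :: "(nat \<Rightarrow> nat \<Rightarrow> 'k) \<Rightarrow> 'b \<Rightarrow> 'b" where
 "act g x = (\<Sum>l<D. \<iota> (\<Sum>k<D. g l k * cx x k) * bs ! l)"

lemma coords_act: "l < D \<Longrightarrow> cx (act g x) l = (\<Sum>k<D. g l k * cx x k)"
 by (rule coords_eqI[where c = "\<lambda>l. \<Sum>k<D. g l k * cx x k"]) (simp_all add: act_def)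

lemma act_add: "act g (x + y) = act g x + act g y"
 by (rule coords_inj) (simp add: coords_act coords_add algebra_simps sum.distrib)
lemma act_scale: "act g (\<iota> c * x) = \<iota> c * act g x"
 by (rule coords_inj) (simp add: coords_act coords_scale sum_distrib_left mult.left_commute)
lemma act_0: "act g 0 = 0" by (rule coords_inj) (simp add: coords_act coords_0)
lemma act_sum: "act g (\<Sum>x\<in>X. f x) = (\<Sum>x\<in>X. act g (f x))"
 by (induction X rule: infinite_finite_induct) (simp_all add: act_add act_0)

lemma act_mul: "act (mat_mul D g h) x = act g (act h x)"
proof (rule coords_inj)
 fix l assume l: "l < D"
 have "(\<Sum>k<D. mat_mul D g h l k * cx x k) = (\<Sum>k<D. \<Sum>r<D. g l r * (h r k * cx x k))"
  using l by (simp add: mat_mul_def sum_distrib_right mult.assoc)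
 also have "\<dots> = (\<Sum>r<D. g l r * (\<Sum>k<D. h r k * cx x k))" by (subst sum.swap) (simp add: sum_distrib_left)
 finally show "cx (act (mat_mul D g h) x) l = cx (act g (act h x)) l" using l by (simp add: coords_act)
qed

lemma act_id: "act (mat_id D) x = x"
proof (rule coords_inj)
 fix l assume l: "l < D"
 have "(\<Sum>k<D. mat_id D l k * cx x k) = (\<Sum>k<D. if k = l then cx x k else 0)" by (rule sum.cong) (use l in \<open>auto simp: mat_id_def\<close>)
 then show "cx (act (mat_id D) x) l = cx x l" using l by (simp add: coords_act)
qed

lemma act_basis: "k < D \<Longrightarrow> act g (bs ! k) = (\<Sum>l<D. \<iota> (g l k) * bs ! l)"
proof (rule coords_inj)
 fix l assume k: "k < D" and l: "l < D"
 have "(\<Sum>j<D. g l j * cx (bs ! k) j) = (\<Sum>j<D. if j = k then g l j else 0)" by (rule sum.cong) (use k in \<open>auto simp: coords_basis\<close>)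
 moreover have "cx (\<Sum>l<D. \<iota> (g l k) * bs ! l) l = g l k" by (rule coords_eqI[OF refl l])
 ultimately show "cx (act g (bs ! k)) l = cx (\<Sum>l<D. \<iota> (g l k) * bs ! l) l" using k l by (simp add: coords_act)
qed

lemma act_inject:
 assumes "padded D g" "padded D h" "\<And>x. act g x = act h x" shows "g = h"
proof (intro ext)
 fix l k show "g l k = h l k"
 proof (cases "l < D \<and> k < D")
  case True
  have "cx (\<Sum>l<D. \<iota> (g l k) * bs ! l) l = g l k" "cx (\<Sum>l<D. \<iota> (h l k) * bs ! l) l = h l k"
   using True by (intro coords_eqI refl; simp)+
  then show ?thesis using assms(3)[of "bs ! k"] True by (simp add: act_basis)
 next
  case False then show ?thesis using assms(1,2) unfolding padded_def by simp
 qed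
qed

lemma Aut_B_iff:
 "g \<in> Aut_B \<iota> bs \<longleftrightarrow> invertible_mat D g \<and> (\<forall>x y. act g (x * y) = act g x * act g y) \<and> act g 1 = 1"
proof -
 have L: "cx (act g (bs ! i * bs ! j)) l = (\<Sum>k<D. cx (bs ! i * bs ! j) k * g l k)" if "l < D" for i j l
  unfolding coords_act[OF that] by (simp add: mult.commute)
 have R: "cx (act g (bs ! i) * act g (bs ! j)) l = (\<Sum>p<D. \<Sum>q<D. g p i * g q j * cx (bs ! p * bs ! q) l)"
  if "i < D" "j < D" "l < D" for i j l
 proof -
  have "act g (bs ! i) * act g (bs ! j) = (\<Sum>p<D. \<Sum>q<D. \<iota> (g p i * g q j) * (bs ! p * bs ! q))"
   unfolding act_basis[OF that(1)] act_basis[OF that(2)] sum_product by (simp add: \<iota>_mult mult_ac)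
  then show ?thesis using that by (simp add: coords_sum coords_scale)
 qed
 have U: "(\<forall>l<D. (\<Sum>k<D. g l k * cx 1 k) = cx 1 l) \<longleftrightarrow> act g 1 = 1"
  using coords_inj[of "act g 1" 1] coords_act[of _ g 1] by metis
 have M: "(\<forall>i<D. \<forall>j<D. act g (bs ! i * bs ! j) = act g (bs ! i) * act g (bs ! j)) \<longleftrightarrow> (\<forall>x y. act g (x * y) = act g x * act g y)"
 proof
  assume b: "\<forall>i<D. \<forall>j<D. act g (bs ! i * bs ! j) = act g (bs ! i) * act g (bs ! j)"
  show "\<forall>x y. act g (x * y) = act g x * act g y"
  proof (intro allI)
   fix x y
   have "x * y = (\<Sum>i<D. \<Sum>j<D. \<iota> (cx x i) * (\<iota> (cx y j) * (bs ! i * bs ! j)))"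
    by (subst (1) coords_spec(2)[of x, symmetric], subst (1) coords_spec(2)[of y, symmetric]) (simp add: sum_product mult_ac)
   then have "act g (x * y) = (\<Sum>i<D. \<Sum>j<D. \<iota> (cx x i) * (\<iota> (cx y j) * (act g (bs ! i) * act g (bs ! j))))"
    using b by (simp add: act_sum act_scale)
   also have "\<dots> = (\<Sum>i<D. \<iota> (cx x i) * act g (bs ! i)) * (\<Sum>j<D. \<iota> (cx y j) * act g (bs ! j))"
    by (simp add: sum_product mult_ac)
   also have "\<dots> = act g x * act g y" unfolding act_scale[symmetric] act_sum[symmetric] coords_spec ..
   finally show "act g (x * y) = act g x * act g y" .
  qed
 qed blast
 have "g \<in> Aut_B \<iota> bs \<longleftrightarrow> invertible_mat D g \<and>
   (\<forall>i<D. \<forall>j<D. \<forall>l<D. cx (act g (bs ! i * bs ! j)) l = cx (act g (bs ! i) * act g (bs ! j)) l) \<and> act g 1 = 1"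
  unfolding Aut_B_def aut_mats_def mem_Collect_eq U using L R by simp
 also have "\<dots> \<longleftrightarrow> invertible_mat D g \<and>
   (\<forall>i<D. \<forall>j<D. act g (bs ! i * bs ! j) = act g (bs ! i) * act g (bs ! j)) \<and> act g 1 = 1"
  using coords_inj by metis
 finally show ?thesis unfolding M .
qed

end

section \<open>Local rings with residue field K\<close>

locale klocal = kalg \<iota> for \<iota> :: "'k::field_char_0 \<Rightarrow> 'b::comm_ring_1" +
 fixes mm :: "'b set"
 assumes local: "local_ring_with mm" and residue: "\<forall>x. \<exists>c. x - \<iota> c \<in> mm"
begin

lemma mm_ideal: "is_ideal mm" "1 \<notin> mm"
 using local unfolding local_ring_with_def is_maximal_ideal_def by blast+
lemma mm_0: "0 \<in> mm" and mm_add: "x \<in> mm \<Longrightarrow> y \<in> mm \<Longrightarrow> x + y \<in> mm" and mm_mult: "x \<in> mm \<Longrightarrow> r * x \<in> mm"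
 using mm_ideal(1) unfolding is_ideal_def by blast+
lemma mm_minus: "x \<in> mm \<Longrightarrow> - x \<in> mm" using mm_mult[of x "- 1"] by simp
lemma mm_diff: "x \<in> mm \<Longrightarrow> y \<in> mm \<Longrightarrow> x - y \<in> mm" using mm_add[OF _ mm_minus, of x y] by simp
lemma mm_sum: "(\<And>x. x \<in> X \<Longrightarrow> f x \<in> mm) \<Longrightarrow> (\<Sum>x\<in>X. f x) \<in> mm"
 by (induction X rule: infinite_finite_induct) (simp_all add: mm_0 mm_add)
lemma \<iota>_mm: assumes "\<iota> c \<in> mm" shows "c = 0"
proof (rule ccontr)
 assume "c \<noteq> 0"
 then have "1 \<in> mm" using mm_mult[OF assms, of "\<iota> (inverse c)"] \<iota>_inverse by simp
 then show False using mm_ideal by blast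
qed

text \<open>By Zorn's lemma a non-unit lies in some maximal ideal, and \<open>mm\<close> is the only
  one.\<close>

lemma unit: assumes "x \<notin> mm" shows "\<exists>y. x * y = 1"
proof (rule ccontr)
 assume nu: "\<nexists>y. x * y = 1"
 define \<A> where "\<A> = {J. is_ideal J \<and> x \<in> J \<and> 1 \<notin> J}"
 have "\<exists>M\<in>\<A>. \<forall>X\<in>\<A>. M \<subseteq> X \<longrightarrow> X = M"
 proof (rule subset_Zorn_nonempty)
  have "is_ideal (range (\<lambda>y. x * y))" unfolding is_ideal_def
  proof (intro conjI ballI allI)
   show "0 \<in> range (\<lambda>y. x * y)" by (rule range_eqI[of _ _ 0]) simp
   fix a assume "a \<in> range (\<lambda>y. x * y)"
   then obtain u where u: "a = x * u" by blast
   show "r * a \<in> range (\<lambda>y. x * y)" for r by (rule range_eqI[of _ _ "r * u"]) (simp add: u mult_ac)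
   fix b assume "b \<in> range (\<lambda>y. x * y)"
   then obtain v where v: "b = x * v" by blast
   show "a + b \<in> range (\<lambda>y. x * y)" by (rule range_eqI[of _ _ "u + v"]) (simp add: u v algebra_simps)
  qed
  moreover have "x \<in> range (\<lambda>y. x * y)" by (rule range_eqI[of _ _ 1]) simp
  moreover have "1 \<notin> range (\<lambda>y. x * y)" using nu by (metis rangeE)
  ultimately have "range (\<lambda>y. x * y) \<in> \<A>" unfolding \<A>_def by simp
  then show "\<A> \<noteq> {}" by (metis empty_iff)
  fix C assume C: "C \<noteq> {}" "subset.chain \<A> C"
  have sub: "J \<in> \<A>" if "J \<in> C" for J using C(2) that unfolding subset.chain_def by blast
  have tot: "J \<subseteq> J' \<or> J' \<subseteq> J" if "J \<in> C" "J' \<in> C" for J J' using C(2) that unfolding subset.chain_def by blast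
  obtain J0 where J0: "J0 \<in> C" using C(1) by blast
  have id: "is_ideal J" "x \<in> J" "1 \<notin> J" if "J \<in> C" for J using sub[OF that] unfolding \<A>_def by blast+
  have "is_ideal (\<Union>C)" unfolding is_ideal_def
  proof (intro conjI ballI allI)
   show "0 \<in> \<Union>C" using id(1)[OF J0] J0 unfolding is_ideal_def by blast
   fix a assume "a \<in> \<Union>C"
   then obtain J where J: "J \<in> C" "a \<in> J" by blast
   show "r * a \<in> \<Union>C" for r using id(1)[OF J(1)] J unfolding is_ideal_def by blast
   fix b assume "b \<in> \<Union>C"
   then obtain J' where J': "J' \<in> C" "b \<in> J'" by blast
   from tot[OF J(1) J'(1)] show "a + b \<in> \<Union>C"
   proof
    assume "J \<subseteq> J'"
    then have "a + b \<in> J'" using J J' id(1)[OF J'(1)] unfolding is_ideal_def by blast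
    then show ?thesis using J'(1) by blast
   next
    assume "J' \<subseteq> J"
    then have "a + b \<in> J" using J J' id(1)[OF J(1)] unfolding is_ideal_def by blast
    then show ?thesis using J(1) by blast
   qed
  qed
  moreover have "x \<in> \<Union>C" using id(2)[OF J0] J0 by blast
  moreover have "1 \<notin> \<Union>C" using id(3) by blast
  ultimately show "\<Union>C \<in> \<A>" unfolding \<A>_def by simp
 qed
 then obtain M where M: "M \<in> \<A>" "\<And>X. X \<in> \<A> \<Longrightarrow> M \<subseteq> X \<Longrightarrow> X = M" by blast
 have "is_maximal_ideal M" unfolding is_maximal_ideal_def
 proof (intro conjI allI impI)
  show "is_ideal M" "1 \<notin> M" using M(1) unfolding \<A>_def by blast+
  fix J' assume J': "is_ideal J' \<and> M \<subseteq> J' \<and> 1 \<notin> J'"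
  then have "J' \<in> \<A>" using M(1) unfolding \<A>_def by blast
  then show "J' = M" using M(2) J' by blast
 qed
 then have "M = mm" using local unfolding local_ring_with_def by blast
 then show False using M(1) assms unfolding \<A>_def by blast
qed

lemma unit_minus: assumes "x \<in> mm" shows "\<exists>y. (1 - x) * y = 1"
proof (rule unit, rule notI)
 assume "1 - x \<in> mm"
 then have "1 \<in> mm" using mm_add[OF _ assms, of "1 - x"] by simp
 then show False using mm_ideal by blast
qed

abbreviation "sq \<equiv> ideal_sq mm"

lemma sq_I: "a \<in> mm \<Longrightarrow> b \<in> mm \<Longrightarrow> a * b \<in> sq"
 unfolding ideal_sq_def by (rule CollectI, rule exI[of _ 1], rule exI[of _ "\<lambda>_. a"], rule exI[of _ "\<lambda>_. b"]) simp

lemma sq_0: "0 \<in> sq" using sq_I[OF mm_0 mm_0] by simp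

lemma sq_add: assumes "x \<in> sq" "y \<in> sq" shows "x + y \<in> sq"
proof -
 obtain L :: nat and a b where x: "\<forall>k<L. a k \<in> mm \<and> b k \<in> mm" "x = (\<Sum>k<L. a k * b k)" using assms(1) unfolding ideal_sq_def by blast
 obtain M :: nat and c d where y: "\<forall>k<M. c k \<in> mm \<and> d k \<in> mm" "y = (\<Sum>k<M. c k * d k)" using assms(2) unfolding ideal_sq_def by blast
 define e f where "e k = (if k < L then a k else c (k - L))" and "f k = (if k < L then b k else d (k - L))" for k
 have s: "(\<Sum>k<L + m. e k * f k) = (\<Sum>k<L. e k * f k) + (\<Sum>k<m. e (L + k) * f (L + k))" for m
  by (induction m) (simp_all add: add.assoc)
 have "x + y = (\<Sum>k<L + M. e k * f k)" unfolding s x(2) y(2) by (simp add: e_def f_def)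
 moreover have "\<forall>k<L + M. e k \<in> mm \<and> f k \<in> mm" using x(1) y(1) by (simp add: e_def f_def)
 ultimately show ?thesis unfolding ideal_sq_def
  by (intro CollectI exI[of _ "L + M"] exI[of _ e] exI[of _ f] conjI)
qed

lemma sq_mult: assumes "x \<in> sq" shows "r * x \<in> sq"
proof -
 obtain L :: nat and a b where x: "\<forall>k<L. a k \<in> mm \<and> b k \<in> mm" "x = (\<Sum>k<L. a k * b k)" using assms unfolding ideal_sq_def by blast
 have "r * x = (\<Sum>k<L. (r * a k) * b k)" unfolding x(2) sum_distrib_left by (simp add: mult.assoc)
 moreover have "\<forall>k<L. r * a k \<in> mm \<and> b k \<in> mm" using x(1) mm_mult by blast
 ultimately show ?thesis unfolding ideal_sq_def
  by (intro CollectI exI[of _ L] exI[of _ "\<lambda>k. r * a k"] exI[of _ b] conjI)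
qed

lemma sq_minus: "x \<in> sq \<Longrightarrow> - x \<in> sq" using sq_mult[of x "- 1"] by simp
lemma sq_diff: "x \<in> sq \<Longrightarrow> y \<in> sq \<Longrightarrow> x - y \<in> sq" using sq_add[OF _ sq_minus, of x y] by simp
lemma sq_sum: "(\<And>x. x \<in> X \<Longrightarrow> f x \<in> sq) \<Longrightarrow> (\<Sum>x\<in>X. f x) \<in> sq"
 by (induction X rule: infinite_finite_induct) (simp_all add: sq_0 sq_add)

lemma residue_unique: "x - \<iota> c \<in> mm \<Longrightarrow> x - \<iota> d \<in> mm \<Longrightarrow> c = d"
 using mm_diff[of "x - \<iota> c" "x - \<iota> d"] \<iota>_mm[of "d - c"] by (simp add: \<iota>_diff)

definition res :: "'b \<Rightarrow> 'k" where "res x = (SOME c. x - \<iota> c \<in> mm)"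

lemma res: "x - \<iota> (res x) \<in> mm" unfolding res_def using residue by (metis someI_ex)
lemma res_eq: "x - \<iota> c \<in> mm \<Longrightarrow> res x = c" using residue_unique res by blast
lemma res_add: "res (x + y) = res x + res y"
 using mm_add[OF res[of x] res[of y]] by (intro res_eq) (simp add: \<iota>_add algebra_simps)
lemma res_scale: "res (\<iota> c * x) = c * res x"
 using mm_mult[OF res[of x], of "\<iota> c"] by (intro res_eq) (simp add: \<iota>_mult algebra_simps)
lemma res_eq_0: "res x = 0 \<longleftrightarrow> x \<in> mm" using res[of x] res_eq[of x 0] by auto
lemma res_sum: "res (\<Sum>x\<in>X. f x) = (\<Sum>x\<in>X. res (f x))"
 by (induction X rule: infinite_finite_induct) (simp_all add: res_add res_eq_0 mm_0)

end

locale kfull = klocal \<iota> mm + kbasis \<iota> bs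
 for \<iota> :: "'k::field_char_0 \<Rightarrow> 'b::comm_ring_1" and mm :: "'b set" and bs :: "'b list" +
 fixes n :: nat
begin

text \<open>The D + 1 powers of x up to x^D are linearly dependent. Factoring out the lowest power
  in a relation leaves a nonzero scalar plus an element of \<open>mm\<close>, which is a
  unit.\<close>

lemma nilpotent: assumes x: "x \<in> mm" shows "\<exists>k. x ^ k = 0"
proof -
 obtain c where c: "\<exists>i\<in>{..D}. c i \<noteq> 0" "\<forall>j\<in>{..<D}. (\<Sum>i\<in>{..D}. c i * cx (x ^ i) j) = 0"
  using nontrivial_solution[of "{..<D}" "{..D}" "\<lambda>i. cx (x ^ i)"] by auto
 have z: "(\<Sum>i\<le>D. \<iota> (c i) * x ^ i) = 0"
  by (rule coords_inj) (use c(2) in \<open>simp add: coords_sum coords_scale coords_0\<close>)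
 define k where "k = (LEAST i. c i \<noteq> 0)"
 obtain i where i: "i \<le> D" "c i \<noteq> 0" using c(1) by blast
 have ck: "c k \<noteq> 0" unfolding k_def by (rule LeastI[of "\<lambda>i. c i \<noteq> 0", OF i(2)])
 have kD: "k \<le> D" unfolding k_def using Least_le[of "\<lambda>i. c i \<noteq> 0", OF i(2)] i(1) by simp
 have lt: "c i = 0" if "i < k" for i using not_less_Least[of i "\<lambda>i. c i \<noteq> 0"] that unfolding k_def by blast
 define W where "W = (\<Sum>i\<in>{k<..D}. \<iota> (c i) * x ^ (i - k - 1))"
 have "(\<Sum>i\<le>D. \<iota> (c i) * x ^ i) = (\<Sum>i\<in>{k..D}. \<iota> (c i) * x ^ i)"
  by (rule sum.mono_neutral_right) (use lt in \<open>auto simp: not_le\<close>)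
 also have "{k..D} = insert k {k<..D}" using kD by auto
 also have "(\<Sum>i\<in>insert k {k<..D}. \<iota> (c i) * x ^ i) = \<iota> (c k) * x ^ k + (\<Sum>i\<in>{k<..D}. \<iota> (c i) * x ^ i)" by simp
 also have "(\<Sum>i\<in>{k<..D}. \<iota> (c i) * x ^ i) = x ^ k * (x * W)"
  unfolding W_def sum_distrib_left
 proof (rule sum.cong[OF refl])
  fix i assume "i \<in> {k<..D}"
  then have "x ^ i = x ^ k * (x * x ^ (i - k - 1))" by (simp flip: power_Suc power_add)
  then show "\<iota> (c i) * x ^ i = x ^ k * (x * (\<iota> (c i) * x ^ (i - k - 1)))" by (simp add: mult_ac)
 qed
 finally have e: "x ^ k * (\<iota> (c k) + x * W) = 0" using z by (simp add: algebra_simps)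
 have "\<iota> (c k) + x * W \<notin> mm"
 proof
  assume "\<iota> (c k) + x * W \<in> mm"
  then have "\<iota> (c k) \<in> mm" using mm_diff[OF _ mm_mult[OF x, of W], of "\<iota> (c k) + x * W"] by (simp add: mult.commute)
  then show False using \<iota>_mm ck by blast
 qed
 then obtain u where "(\<iota> (c k) + x * W) * u = 1" using unit by blast
 then have "x ^ k = x ^ k * (\<iota> (c k) + x * W) * u" by (simp add: mult.assoc)
 then show ?thesis using e by auto
qed

text \<open>Representatives of a basis of the cotangent space mm/mm^2.\<close>

definition cotb :: "(nat \<Rightarrow> 'b) \<Rightarrow> bool" where
 "cotb v \<longleftrightarrow> (\<forall>i<n. v i \<in> mm) \<and>
  (\<forall>c. (\<Sum>i<n. \<iota> (c i) * v i) \<in> sq \<longrightarrow> (\<forall>i<n. c i = 0)) \<and>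
  (\<forall>x\<in>mm. \<exists>c. x - (\<Sum>i<n. \<iota> (c i) * v i) \<in> sq)"

lemma cotbD:
 assumes "cotb v" shows "i < n \<Longrightarrow> v i \<in> mm" "(\<Sum>i<n. \<iota> (c i) * v i) \<in> sq \<Longrightarrow> i < n \<Longrightarrow> c i = 0"
  "x \<in> mm \<Longrightarrow> \<exists>c. x - (\<Sum>i<n. \<iota> (c i) * v i) \<in> sq"
 using assms unfolding cotb_def by blast+

text \<open>Nakayama's lemma by elimination. The basis elements corrected by their residues span
  \<open>mm\<close>, and each is a combination of the y_i up to a square. Expanding that square with
  coefficients in \<open>mm\<close>, the last remaining element \<open>m r\<close> occurs with the
  unit factor 1 - q_r and can be removed.\<close>

lemma generators:
 assumes y: "cotb y" and x: "x \<in> mm" shows "\<exists>p. x = (\<Sum>i<n. p i * y i)"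
proof -
 define m where "m k = bs ! k - \<iota> (res (bs ! k))" for k
 have m: "m k \<in> mm" for k unfolding m_def by (rule res)
 have "\<forall>x\<in>mm. \<exists>p q. x = (\<Sum>i<n. p i * y i) + (\<Sum>k<D - d. q k * m k)" if "d \<le> D" for d
  using that
 proof (induction d)
  case 0
  show ?case
  proof
   fix x assume x: "x \<in> mm"
   have "x = (\<Sum>k<D. \<iota> (cx x k) * m k) + \<iota> (\<Sum>k<D. cx x k * res (bs ! k))"
    unfolding \<iota>_sum sum.distrib[symmetric] m_def
    by (subst (1) coords_spec(2)[of x, symmetric]) (simp add: algebra_simps \<iota>_mult)
   moreover have "(\<Sum>k<D. \<iota> (cx x k) * m k) \<in> mm" using m mm_mult by (intro mm_sum) blast
   ultimately have "\<iota> (\<Sum>k<D. cx x k * res (bs ! k)) \<in> mm" using x mm_diff by (metis add_diff_cancel_left')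
   then have "(\<Sum>k<D. cx x k * res (bs ! k)) = 0" by (rule \<iota>_mm)
   then have "x = (\<Sum>i<n. 0 * y i) + (\<Sum>k<D - 0. \<iota> (cx x k) * m k)"
    using \<open>x = (\<Sum>k<D. \<iota> (cx x k) * m k) + \<iota> (\<Sum>k<D. cx x k * res (bs ! k))\<close> by simp
   then show "\<exists>p q. x = (\<Sum>i<n. p i * y i) + (\<Sum>k<D - 0. q k * m k)"
    by (intro exI[of _ "\<lambda>_. 0"] exI[of _ "\<lambda>k. \<iota> (cx x k)"])
  qed
 next
  case (Suc d)
  define r where "r = D - Suc d"
  have r: "D - d = Suc r" using Suc.prems unfolding r_def by simp
  have IH: "\<exists>p q. x = (\<Sum>i<n. p i * y i) + (\<Sum>k<Suc r. q k * m k)" if "x \<in> mm" for x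
   using Suc that unfolding r by simp
  \<comment> \<open>One factor of each product is expanded in the generators; the other remains in
    the coefficient and keeps it inside \<open>mm\<close>.\<close>
  have sqf: "\<exists>p q. q r \<in> mm \<and> z = (\<Sum>i<n. p i * y i) + (\<Sum>k<Suc r. q k * m k)" if "z \<in> sq" for z
  proof -
   obtain L :: nat and a b where ab: "\<forall>l<L. a l \<in> mm \<and> b l \<in> mm" "z = (\<Sum>l<L. a l * b l)"
    using \<open>z \<in> sq\<close> unfolding ideal_sq_def by blast
   have "\<forall>l. \<exists>x. l < L \<longrightarrow> b l = (\<Sum>i<n. fst x i * y i) + (\<Sum>k<Suc r. snd x k * m k)"
   proof
    fix l show "\<exists>x. l < L \<longrightarrow> b l = (\<Sum>i<n. fst x i * y i) + (\<Sum>k<Suc r. snd x k * m k)"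
    proof (cases "l < L")
     case True
     then obtain p q where "b l = (\<Sum>i<n. p i * y i) + (\<Sum>k<Suc r. q k * m k)" using IH ab(1) by blast
     then show ?thesis by (intro exI[of _ "(p, q)"]) simp
    qed simp
   qed
   from choice[OF this] obtain w where w: "\<forall>l. l < L \<longrightarrow> b l = (\<Sum>i<n. fst (w l) i * y i) + (\<Sum>k<Suc r. snd (w l) k * m k)" ..
   have "z = (\<Sum>l<L. (\<Sum>i<n. a l * fst (w l) i * y i) + (\<Sum>k<Suc r. a l * snd (w l) k * m k))"
    unfolding ab(2) by (rule sum.cong[OF refl]) (simp only: w lessThan_iff distrib_left sum_distrib_left mult.assoc)
   also have "\<dots> = (\<Sum>i<n. (\<Sum>l<L. a l * fst (w l) i) * y i) + (\<Sum>k<Suc r. (\<Sum>l<L. a l * snd (w l) k) * m k)"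
    unfolding sum.distrib sum_distrib_right by (subst (1 2) sum.swap) (rule refl)
   finally have "z = (\<Sum>i<n. (\<Sum>l<L. a l * fst (w l) i) * y i) + (\<Sum>k<Suc r. (\<Sum>l<L. a l * snd (w l) k) * m k)" .
   moreover have "(\<Sum>l<L. a l * snd (w l) r) \<in> mm"
    by (rule mm_sum, subst mult.commute, rule mm_mult) (use ab(1) in simp)
   ultimately show ?thesis
    by (intro exI[of _ "\<lambda>i. \<Sum>l<L. a l * fst (w l) i"] exI[of _ "\<lambda>k. \<Sum>l<L. a l * snd (w l) k"]) simp
  qed
  obtain c where "m r - (\<Sum>i<n. \<iota> (c i) * y i) \<in> sq" using cotbD(3)[OF y m] by blast
  from sqf[OF this] obtain p q where pq: "q r \<in> mm"
   "m r - (\<Sum>i<n. \<iota> (c i) * y i) = (\<Sum>i<n. p i * y i) + (\<Sum>k<Suc r. q k * m k)" by blast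
  obtain u where u: "(1 - q r) * u = 1" using unit_minus[OF pq(1)] by blast
  have "(1 - q r) * m r = (\<Sum>i<n. (\<iota> (c i) + p i) * y i) + (\<Sum>k<r. q k * m k)"
   using pq(2) by (simp add: algebra_simps sum.distrib)
  then have "(1 - q r) * u * m r = u * ((\<Sum>i<n. (\<iota> (c i) + p i) * y i) + (\<Sum>k<r. q k * m k))" by (metis mult.assoc mult.commute)
  then have mr: "m r = (\<Sum>i<n. u * ((\<iota> (c i) + p i) * y i)) + (\<Sum>k<r. u * (q k * m k))"
   unfolding u mult_1 by (simp only: distrib_left sum_distrib_left)
  show ?case
  proof
   fix x assume "x \<in> mm"
   then obtain p' q' where x: "x = (\<Sum>i<n. p' i * y i) + (\<Sum>k<Suc r. q' k * m k)" using IH by blast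
   have "x = (\<Sum>i<n. p' i * y i) + (\<Sum>k<r. q' k * m k) + q' r * m r" unfolding x by (simp add: add.assoc)
   also have "\<dots> = (\<Sum>i<n. (p' i + q' r * (u * (\<iota> (c i) + p i))) * y i) + (\<Sum>k<r. (q' k + q' r * (u * q k)) * m k)"
    by (subst (1) mr) (simp add: distrib_left distrib_right sum.distrib sum_distrib_left mult.assoc add_ac)
   finally show "\<exists>p q. x = (\<Sum>i<n. p i * y i) + (\<Sum>k<D - Suc d. q k * m k)" unfolding r_def[symmetric]
    by (intro exI[of _ "\<lambda>i. p' i + q' r * (u * (\<iota> (c i) + p i))"] exI[of _ "\<lambda>k. q' k + q' r * (u * q k)"])
  qed
 qed
 from bspec[OF this[OF order_refl] x] show ?thesis by simp
qed

text \<open>Steinitz exchange in mm/mm^2: the coordinates of the summands at position i add up to 1,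
  so one of them is nonzero, and that summand can take the place of v_i.\<close>

lemma cotb_replace:
 assumes v: "cotb v" and i: "i < n" and F: "finite F" "v i = (\<Sum>\<chi>\<in>F. u \<chi>)" "\<And>\<chi>. \<chi> \<in> F \<Longrightarrow> u \<chi> \<in> mm"
 shows "\<exists>\<chi>\<in>F. cotb (v(i := u \<chi>))"
proof -
 have "\<forall>\<chi>\<in>F. \<exists>c. u \<chi> - (\<Sum>j<n. \<iota> (c j) * v j) \<in> sq" using cotbD(3)[OF v F(3)] by blast
 from bchoice[OF this] obtain c where c: "\<forall>\<chi>\<in>F. u \<chi> - (\<Sum>j<n. \<iota> (c \<chi> j) * v j) \<in> sq" ..
 have "(\<Sum>\<chi>\<in>F. u \<chi> - (\<Sum>j<n. \<iota> (c \<chi> j) * v j)) \<in> sq" using c by (intro sq_sum) blast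
 also have "(\<Sum>\<chi>\<in>F. u \<chi> - (\<Sum>j<n. \<iota> (c \<chi> j) * v j)) = v i - (\<Sum>j<n. \<iota> (\<Sum>\<chi>\<in>F. c \<chi> j) * v j)"
  unfolding sum_subtractf F(2) \<iota>_sum sum_distrib_right by (subst (2) sum.swap) (rule refl)
 also have "\<dots> = (\<Sum>j<n. \<iota> ((if j = i then 1 else 0) - (\<Sum>\<chi>\<in>F. c \<chi> j)) * v j)"
 proof -
  have "(\<Sum>j<n. \<iota> (if j = i then 1 else 0) * v j) = (\<Sum>j<n. if j = i then v j else 0)" by (rule sum.cong) auto
  then show ?thesis using i by (simp add: \<iota>_diff left_diff_distrib sum_subtractf)
 qed
 finally have "(if i = i then 1 else 0) - (\<Sum>\<chi>\<in>F. c \<chi> i) = 0" by (rule cotbD(2)[OF v _ i])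
 then have "(\<Sum>\<chi>\<in>F. c \<chi> i) \<noteq> 0" by simp
 then obtain \<chi> where \<chi>: "\<chi> \<in> F" "c \<chi> i \<noteq> 0" by (rule sum.not_neutral_contains_not_neutral)
 define w where "w = v(i := u \<chi>)"
 have split: "(\<Sum>j<n. f j) = f i + (\<Sum>j\<in>{..<n} - {i}. f j)" for f :: "nat \<Rightarrow> 'b"
  using i by (simp add: sum.remove)
 have ws: "(\<Sum>j<n. \<iota> (d j) * w j) = \<iota> (d i) * u \<chi> + (\<Sum>j\<in>{..<n} - {i}. \<iota> (d j) * v j)" for d
  unfolding split w_def by simp
 have us: "u \<chi> - (\<Sum>j<n. \<iota> (c \<chi> j) * v j) \<in> sq" using c \<chi>(1) by blast
 have conv: "(\<Sum>j<n. \<iota> (if j = i then d i * c \<chi> i else d j + d i * c \<chi> j) * v j) =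
   (\<Sum>j<n. \<iota> (d j) * w j) - \<iota> (d i) * (u \<chi> - (\<Sum>j<n. \<iota> (c \<chi> j) * v j))" for d
  unfolding ws unfolding split by (simp add: \<iota>_add \<iota>_mult algebra_simps sum.distrib sum_distrib_left)
 have "cotb w" unfolding cotb_def
 proof (intro conjI allI impI ballI)
  show "w j \<in> mm" if "j < n" for j using cotbD(1)[OF v that] F(3)[OF \<chi>(1)] unfolding w_def by simp
 next
  fix d j assume d: "(\<Sum>j<n. \<iota> (d j) * w j) \<in> sq" and j: "j < n"
  have s: "(\<Sum>j<n. \<iota> (if j = i then d i * c \<chi> i else d j + d i * c \<chi> j) * v j) \<in> sq"
   unfolding conv by (rule sq_diff[OF d sq_mult[OF us]])
  have di: "d i = 0" using cotbD(2)[OF v s i] \<chi>(2) by simp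
  show "d j = 0" using cotbD(2)[OF v s j] di by (cases "j = i") simp_all
 next
  fix x assume "x \<in> mm"
  then obtain e where e: "x - (\<Sum>j<n. \<iota> (e j) * v j) \<in> sq" using cotbD(3)[OF v] by blast
  define d where "d j = (if j = i then e i / c \<chi> i else e j - e i / c \<chi> i * c \<chi> j)" for j
  have "(\<Sum>j<n. \<iota> (if j = i then d i * c \<chi> i else d j + d i * c \<chi> j) * v j) = (\<Sum>j<n. \<iota> (e j) * v j)"
   by (rule sum.cong) (use \<chi>(2) in \<open>auto simp: d_def\<close>)
  then have "(\<Sum>j<n. \<iota> (d j) * w j) = (\<Sum>j<n. \<iota> (e j) * v j) + \<iota> (d i) * (u \<chi> - (\<Sum>j<n. \<iota> (c \<chi> j) * v j))"
   using conv[of d] by (simp add: algebra_simps)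
  then have eq: "x - (\<Sum>j<n. \<iota> (d j) * w j) = x - (\<Sum>j<n. \<iota> (e j) * v j) - \<iota> (d i) * (u \<chi> - (\<Sum>j<n. \<iota> (c \<chi> j) * v j))"
   by (simp add: algebra_simps)
  have "x - (\<Sum>j<n. \<iota> (d j) * w j) \<in> sq" unfolding eq by (rule sq_diff[OF e sq_mult[OF us]])
  then show "\<exists>c. x - (\<Sum>i<n. \<iota> (c i) * w i) \<in> sq" by blast
 qed
 then show ?thesis using \<chi>(1) unfolding w_def by blast
qed

lemma cotb_refine:
 assumes v: "cotb v"
  and H: "\<And>x. x \<in> mm \<Longrightarrow> \<exists>F u. finite F \<and> x = (\<Sum>\<chi>\<in>F. u \<chi>) \<and> (\<forall>\<chi>\<in>F. u \<chi> \<in> mm \<and> hom (u (\<chi> :: nat \<Rightarrow> int)))"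
 shows "\<exists>w. cotb w \<and> (\<forall>i<n. hom (w i))"
proof -
 have "\<exists>w. cotb w \<and> (\<forall>i<k. hom (w i))" if "k \<le> n" for k
  using that
 proof (induction k)
  case 0 then show ?case using v by blast
 next
  case (Suc k)
  then obtain w where w: "cotb w" "\<forall>i<k. hom (w i)" by auto
  have k: "k < n" using Suc.prems by simp
  obtain F u where F: "finite F" "w k = (\<Sum>\<chi>\<in>F. u \<chi>)" "\<forall>\<chi>\<in>F. u \<chi> \<in> mm \<and> hom (u (\<chi> :: nat \<Rightarrow> int))"
   using H[OF cotbD(1)[OF w(1) k]] by blast
  have "\<exists>\<chi>\<in>F. cotb (w(k := u \<chi>))" by (rule cotb_replace[OF w(1) k F(1,2)]) (use F(3) in blast)
  then obtain \<chi> where \<chi>: "\<chi> \<in> F" "cotb (w(k := u \<chi>))" by blast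
  have "hom ((w(k := u \<chi>)) i)" if "i < Suc k" for i using that w(2) F(3) \<chi>(1) by (cases "i = k") auto
  then show ?case using \<chi>(2) by blast
 qed
 then show ?thesis by blast
qed

end

section \<open>Monomials in a system of generators\<close>

locale kgen = kfull + fixes y assumes y: "cotb y"
begin

definition ymon :: "(nat \<Rightarrow> nat) \<Rightarrow> 'b" where "ymon a = (\<Prod>i<n. y i ^ a i)"

lemma ymon_add: "ymon (addvec a b) = ymon a * ymon b"
 by (simp add: ymon_def addvec_def power_add prod.distrib)
lemma ymon_0 [simp]: "ymon (\<lambda>_. 0) = 1" by (simp add: ymon_def)
lemma ymon_unit: "i < n \<Longrightarrow> ymon (unitvec i) = y i"
proof -
 assume i: "i < n"
 have "ymon (unitvec i) = (\<Prod>j<n. if j = i then y j else 1)" unfolding ymon_def by (rule prod.cong) (auto simp: unitvec_def)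
 then show ?thesis using i by simp
qed

definition std :: "(nat \<Rightarrow> nat) set" where "std = {a \<in> expvecs n. ymon a \<noteq> 0}"

lemma ex_bound: "\<exists>M. \<forall>a. ymon a \<noteq> 0 \<longrightarrow> (\<forall>i<n. a i < M)"
proof -
 have "\<forall>i. \<exists>k. i < n \<longrightarrow> y i ^ k = 0" using nilpotent cotbD(1)[OF y] by blast
 from choice[OF this] obtain k where k: "\<forall>i. i < n \<longrightarrow> y i ^ k i = 0" ..
 have "a i < (\<Sum>i<n. k i) + 1" if a: "ymon a \<noteq> 0" and i: "i < n" for a i
 proof (rule ccontr)
  assume "\<not> a i < (\<Sum>i<n. k i) + 1"
  moreover have "k i \<le> (\<Sum>i<n. k i)" by (rule member_le_sum) (use i in auto)
  ultimately have "a i = k i + (a i - k i)" by simp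
  then have "y i ^ a i = 0" using k i by (metis power_add mult_zero_left)
  then have "ymon a = 0" unfolding ymon_def using i by (intro prod_zero) auto
  then show False using a by simp
 qed
 then show ?thesis by blast
qed

lemma finite_std: "finite std"
proof -
 obtain M where M: "\<forall>a. ymon a \<noteq> 0 \<longrightarrow> (\<forall>i<n. a i < M)" using ex_bound by blast
 have "std \<subseteq> {f. \<forall>x. (x \<in> {..<n} \<longrightarrow> f x \<in> {..<M}) \<and> (x \<notin> {..<n} \<longrightarrow> f x = 0)}"
  using M unfolding std_def expvecs_def by auto
 moreover have "finite {f. \<forall>x. (x \<in> {..<n} \<longrightarrow> f x \<in> {..<M}) \<and> (x \<notin> {..<n} \<longrightarrow> f x = (0::nat))}"
  by (rule finite_set_of_finite_funs) simp_all
 ultimately show ?thesis by (rule finite_subset)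
qed

lemma mono_span: assumes "a \<in> expvecs n" shows "\<exists>d. \<iota> c * ymon a = (\<Sum>b\<in>std. \<iota> (d b) * ymon b)"
proof (cases "a \<in> std")
 case True
 have "(\<Sum>b\<in>std. \<iota> (if b = a then c else 0) * ymon b) = (\<Sum>b\<in>std. if b = a then \<iota> c * ymon b else 0)" by (rule sum.cong) auto
 also have "\<dots> = \<iota> c * ymon a" using True finite_std by simp
 finally show ?thesis by (intro exI[of _ "\<lambda>b. if b = a then c else 0"]) simp
next
 case False
 then have "ymon a = 0" using assms unfolding std_def by blast
 then show ?thesis by (intro exI[of _ "\<lambda>_. 0"]) simp
qed

lemma span_add:
 assumes "\<exists>d. u = (\<Sum>b\<in>std. \<iota> (d b) * ymon b)" "\<exists>d. v = (\<Sum>b\<in>std. \<iota> (d b) * ymon b)"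
 shows "\<exists>d. u + v = (\<Sum>b\<in>std. \<iota> (d b) * ymon b)"
proof -
 obtain d e where "u = (\<Sum>b\<in>std. \<iota> (d b) * ymon b)" "v = (\<Sum>b\<in>std. \<iota> (e b) * ymon b)" using assms by blast
 then show ?thesis by (intro exI[of _ "\<lambda>b. d b + e b"]) (simp add: \<iota>_add distrib_right sum.distrib)
qed

text \<open>An element differs from its residue by a combination of the y_i, so x y^a is a scalar
  multiple of y^a plus terms of higher degree. Nilpotency bounds the degree of nonzero monomials and
  ends the process.\<close>

lemma span: "\<exists>d. x = (\<Sum>b\<in>std. \<iota> (d b) * ymon b)"
proof -
 obtain M where M: "\<forall>a. ymon a \<noteq> 0 \<longrightarrow> (\<forall>i<n. a i < M)" using ex_bound by blast
 have "\<exists>d. x * ymon a = (\<Sum>b\<in>std. \<iota> (d b) * ymon b)" if "a \<in> expvecs n" for a x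
  using that
 \<comment> \<open>A nonzero monomial has degree at most \<open>n * M\<close>, so the measure is
   still positive and drops when the degree grows.\<close>
 proof (induction "n * M + 1 - (\<Sum>i<n. a i)" arbitrary: a x rule: less_induct)
  case less
  show ?case
  proof (cases "ymon a = 0")
   case True then show ?thesis by (intro exI[of _ "\<lambda>_. 0"]) simp
  next
   case False
   then have "(\<Sum>i<n. a i) \<le> (\<Sum>i<n. M)" using M by (intro sum_mono) (simp add: less_imp_le)
   then have le: "(\<Sum>i<n. a i) \<le> n * M" by simp
   obtain p where p: "x - \<iota> (res x) = (\<Sum>i<n. p i * y i)" using generators[OF y res] by blast
   have "x * ymon a = \<iota> (res x) * ymon a + (\<Sum>i<n. p i * y i) * ymon a" unfolding p[symmetric] by (simp add: algebra_simps)
   also have "(\<Sum>i<n. p i * y i) * ymon a = (\<Sum>i<n. p i * ymon (addvec a (unitvec i)))"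
    unfolding sum_distrib_right by (rule sum.cong) (simp_all add: ymon_add ymon_unit mult_ac)
   finally have e: "x * ymon a = \<iota> (res x) * ymon a + (\<Sum>i<n. p i * ymon (addvec a (unitvec i)))" .
   have "\<exists>d. (\<Sum>i<k. p i * ymon (addvec a (unitvec i))) = (\<Sum>b\<in>std. \<iota> (d b) * ymon b)" if "k \<le> n" for k
    using that
   proof (induction k)
    case 0 then show ?case by (intro exI[of _ "\<lambda>_. 0"]) simp
   next
    case (Suc k)
    have "(\<Sum>i<n. unitvec k i) = 1" using Suc.prems by (simp add: unitvec_def)
    then have "(\<Sum>i<n. addvec a (unitvec k) i) = (\<Sum>i<n. a i) + 1" by (simp add: addvec_def sum.distrib)
    moreover have "addvec a (unitvec k) \<in> expvecs n" using less.prems Suc.prems by (simp add: expvecs_def addvec_def unitvec_def)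
    ultimately have "\<exists>d. p k * ymon (addvec a (unitvec k)) = (\<Sum>b\<in>std. \<iota> (d b) * ymon b)"
     using less.hyps le by simp
    then show ?case using span_add Suc by simp
   qed
   then show ?thesis unfolding e using span_add[OF mono_span[OF less.prems]] by blast
  qed
 qed
 from this[of "\<lambda>_. 0" x] show ?thesis by (simp add: expvecs_def)
qed

end

section \<open>Laurent polynomial functions on the torus\<close>

lemma chr_subst:
 assumes t: "t \<in> torus n" shows "chr n (\<lambda>i. chr n t (X i)) v = chr n t (\<lambda>j. \<Sum>i<n. v i * X i j)"
proof -
 have t0: "t j \<noteq> 0" if "j < n" for j using t that unfolding torus_def by simp
 have ps: "x powi (\<Sum>i\<in>I. f i) = (\<Prod>i\<in>I. x powi f i)" if "x \<noteq> 0" for x :: 'a and f :: "nat \<Rightarrow> int" and I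
  using that by (induction I rule: infinite_finite_induct) (simp_all add: power_int_add)
 have pp: "(\<Prod>j\<in>I. f j) powi k = (\<Prod>j\<in>I. f j powi k)" for f :: "nat \<Rightarrow> 'a" and I and k :: int
  by (induction I rule: infinite_finite_induct) (simp_all add: power_int_mult_distrib)
 have "chr n (\<lambda>i. chr n t (X i)) v = (\<Prod>i<n. \<Prod>j<n. t j powi (v i * X i j))"
  unfolding chr_def pp by (simp add: power_int_mult[symmetric] mult.commute)
 also have "\<dots> = (\<Prod>j<n. \<Prod>i<n. t j powi (v i * X i j))" by (rule prod.swap)
 also have "\<dots> = chr n t (\<lambda>j. \<Sum>i<n. v i * X i j)" unfolding chr_def by (rule prod.cong[OF refl]) (simp add: ps t0)
 finally show ?thesis .
qed

lemma chr_independent_scalar: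
 fixes b :: "'i \<Rightarrow> 'k::field_char_0"
 assumes "finite I" "inj_on \<chi> I" "\<And>i. i \<in> I \<Longrightarrow> \<chi> i \<in> Zn n"
  and "\<And>t. t \<in> torus n \<Longrightarrow> (\<Sum>i\<in>I. chr n t (\<chi> i) * b i) = 0"
 shows "\<forall>i\<in>I. b i = 0"
proof -
 have "kalg (\<lambda>x :: 'k. x)" by unfold_locales (simp add: alg_structure_def)
 from kalg.chr_independent[OF this assms] show ?thesis .
qed

text \<open>Laurent polynomials with exponents restricted to \<Lambda>. Keeping track of \<Lambda>
  is what later proves that the weights of the generators span the character lattice.\<close>

definition lp :: "nat \<Rightarrow> (nat \<Rightarrow> int) set \<Rightarrow> ((nat \<Rightarrow> 'k::field) \<Rightarrow> 'k) \<Rightarrow> bool" where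
 "lp n \<Lambda> h \<longleftrightarrow> (\<exists>F c. finite F \<and> F \<subseteq> \<Lambda> \<and> (\<forall>t\<in>torus n. h t = (\<Sum>\<chi>\<in>F. c \<chi> * chr n t \<chi>)))"

lemma lp_cong: "lp n \<Lambda> h \<Longrightarrow> (\<And>t. t \<in> torus n \<Longrightarrow> h' t = h t) \<Longrightarrow> lp n \<Lambda> h'"
 unfolding lp_def by (elim exE) (intro exI, auto)

lemma lp_mono: "\<chi> \<in> \<Lambda> \<Longrightarrow> lp n \<Lambda> (\<lambda>t. c * chr n t \<chi>)"
 unfolding lp_def by (intro exI[of _ "{\<chi>}"] exI[of _ "\<lambda>_. c"]) simp

lemma lp_add: assumes "lp n \<Lambda> f" "lp n \<Lambda> g" shows "lp n \<Lambda> (\<lambda>t. f t + g t)"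
proof -
 obtain F c where F: "finite F" "F \<subseteq> \<Lambda>" "\<forall>t\<in>torus n. f t = (\<Sum>\<chi>\<in>F. c \<chi> * chr n t \<chi>)" using assms(1) unfolding lp_def by blast
 obtain G d where G: "finite G" "G \<subseteq> \<Lambda>" "\<forall>t\<in>torus n. g t = (\<Sum>\<chi>\<in>G. d \<chi> * chr n t \<chi>)" using assms(2) unfolding lp_def by blast
 let ?e = "\<lambda>\<chi>. (if \<chi> \<in> F then c \<chi> else 0) + (if \<chi> \<in> G then d \<chi> else 0)"
 have "f t + g t = (\<Sum>\<chi>\<in>F \<union> G. ?e \<chi> * chr n t \<chi>)" if t: "t \<in> torus n" for t
 proof -
  have "(\<Sum>\<chi>\<in>F. c \<chi> * chr n t \<chi>) = (\<Sum>\<chi>\<in>F \<union> G. (if \<chi> \<in> F then c \<chi> else 0) * chr n t \<chi>)"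
   by (rule sum.mono_neutral_cong_left) (use F G in auto)
  moreover have "(\<Sum>\<chi>\<in>G. d \<chi> * chr n t \<chi>) = (\<Sum>\<chi>\<in>F \<union> G. (if \<chi> \<in> G then d \<chi> else 0) * chr n t \<chi>)"
   by (rule sum.mono_neutral_cong_left) (use F G in auto)
  ultimately show ?thesis using F(3) G(3) t by (simp add: distrib_right sum.distrib)
 qed
 then show ?thesis unfolding lp_def using F G by (intro exI[of _ "F \<union> G"] exI[of _ ?e]) simp
qed

lemma lp_0: "lp n \<Lambda> (\<lambda>_. 0)" unfolding lp_def by (intro exI[of _ "{}"]) simp

lemma lp_sum: "(\<And>x. x \<in> X \<Longrightarrow> lp n \<Lambda> (f x)) \<Longrightarrow> lp n \<Lambda> (\<lambda>t. \<Sum>x\<in>X. f x t)"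
 by (induction X rule: infinite_finite_induct) (simp_all add: lp_0 lp_add)

lemma lp_mult:
 assumes "lp n \<Lambda> f" "lp n \<Lambda> g" and add: "\<And>a b. a \<in> \<Lambda> \<Longrightarrow> b \<in> \<Lambda> \<Longrightarrow> a + b \<in> \<Lambda>"
 shows "lp n \<Lambda> (\<lambda>t. f t * g t)"
proof -
 obtain F c where F: "finite F" "F \<subseteq> \<Lambda>" "\<forall>t\<in>torus n. f t = (\<Sum>\<chi>\<in>F. c \<chi> * chr n t \<chi>)" using assms(1) unfolding lp_def by blast
 obtain G d where G: "finite G" "G \<subseteq> \<Lambda>" "\<forall>t\<in>torus n. g t = (\<Sum>\<chi>\<in>G. d \<chi> * chr n t \<chi>)" using assms(2) unfolding lp_def by blast
 have "lp n \<Lambda> (\<lambda>t. \<Sum>\<chi>\<in>F. \<Sum>\<eta>\<in>G. (c \<chi> * d \<eta>) * chr n t (\<chi> + \<eta>))"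
  by (intro lp_sum lp_mono add) (use F(2) G(2) in auto)
 then show ?thesis
  by (rule lp_cong) (simp add: F(3) G(3) sum_product chr_add mult_ac)
qed

lemma lp_reg_fun:
 assumes "f \<in> reg_fun N" and z: "0 \<in> \<Lambda>" and add: "\<And>a b. a \<in> \<Lambda> \<Longrightarrow> b \<in> \<Lambda> \<Longrightarrow> a + b \<in> \<Lambda>"
  and "\<And>i j. i < N \<Longrightarrow> j < N \<Longrightarrow> lp n \<Lambda> (\<lambda>t. g t i j)"
  and "\<And>i j. i < N \<Longrightarrow> j < N \<Longrightarrow> lp n \<Lambda> (\<lambda>t. mat_inv N (g t) i j)"
 shows "lp n \<Lambda> (\<lambda>t. f (g t))"
 using assms(1)
proof induction
 case (rf_const c) then show ?case using lp_mono[OF z, of n c] by simp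
next
 case (rf_add f h) show ?case by (rule lp_add[OF rf_add.IH])
next
 case (rf_mul f h) show ?case by (rule lp_mult[OF rf_mul.IH add])
qed (use assms(4,5) in blast)+

section \<open>Weight decomposition of a local algebra\<close>

locale ktorus = kfull +
 fixes \<rho>
 assumes cot: "cotangent_dim \<iota> mm n"
  and \<rho>_Aut: "t \<in> torus n \<Longrightarrow> \<rho> t \<in> Aut_B \<iota> bs"
  and \<rho>_mult: "s \<in> torus n \<Longrightarrow> t \<in> torus n \<Longrightarrow> \<rho> (\<lambda>i. s i * t i) = mat_mul D (\<rho> s) (\<rho> t)"
  and \<rho>_1: "\<rho> (\<lambda>_. 1) = mat_id D"
  and \<rho>_lp: "i < D \<Longrightarrow> j < D \<Longrightarrow> lp n (Zn n) (\<lambda>t. \<rho> t i j)"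
  and \<rho>_recover: "i < n \<Longrightarrow> \<exists>f\<in>reg_fun D. \<forall>t\<in>torus n. t i = f (\<rho> t)"
begin

lemma R_mult: "t \<in> torus n \<Longrightarrow> act (\<rho> t) (x * y) = act (\<rho> t) x * act (\<rho> t) y"
 and R_1: "t \<in> torus n \<Longrightarrow> act (\<rho> t) 1 = 1"
 using \<rho>_Aut unfolding Aut_B_iff by blast+

lemma R_comp: "s \<in> torus n \<Longrightarrow> t \<in> torus n \<Longrightarrow> act (\<rho> s) (act (\<rho> t) x) = act (\<rho> (\<lambda>i. s i * t i)) x"
 by (simp add: \<rho>_mult act_mul)

lemma R_inverse: assumes t: "t \<in> torus n" shows "act (\<rho> (\<lambda>i. inverse (t i))) (act (\<rho> t) x) = x"
proof -
 have "act (\<rho> (\<lambda>i. inverse (t i))) (act (\<rho> t) x) = act (\<rho> (\<lambda>i. inverse (t i) * t i)) x"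
  by (rule R_comp[OF torus_inverse[OF t] t])
 also have "\<dots> = act (\<rho> (\<lambda>i. t i * inverse (t i))) x" by (simp add: mult.commute)
 finally have e: "act (\<rho> (\<lambda>i. inverse (t i))) (act (\<rho> t) x) = act (\<rho> (\<lambda>i. t i * inverse (t i))) x" .
 \<comment> \<open>Beyond index n an entry of t may be 0, so \<open>u\<close> need not be the
   constant 1. The entries of \<rho> are Laurent polynomials in the first n coordinates and cannot
   tell the difference.\<close>
 define u where "u = (\<lambda>i. t i * inverse (t i))"
 have u: "u \<in> torus n" unfolding u_def by (rule torus_mult[OF t torus_inverse[OF t]])
 have chru: "chr n u v = 1" for v using chr_neq_0[OF t] unfolding u_def chr_mult chr_inverse by simp
 have "\<rho> u = mat_id D"
 proof (intro ext)
  fix i j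
  have pad: "padded D (\<rho> t)" if "t \<in> torus n" for t using \<rho>_Aut[OF that] unfolding Aut_B_iff invertible_mat_def by blast
  show "\<rho> u i j = mat_id D i j"
  proof (cases "i < D \<and> j < D")
   case True
   then obtain F c where "\<forall>t\<in>torus n. \<rho> t i j = (\<Sum>\<chi>\<in>F. c \<chi> * chr n t \<chi>)" using \<rho>_lp unfolding lp_def by blast
   then have "\<rho> u i j = \<rho> (\<lambda>_. 1) i j" using u by (simp add: chru)
   then show ?thesis unfolding \<rho>_1 .
  next
   case False then show ?thesis using pad[OF u] by (auto simp: padded_def mat_id_def)
  qed
 qed
 then show ?thesis unfolding e u_def[symmetric] by (simp add: act_id)
qed

lemma R_mm: assumes t: "t \<in> torus n" and x: "x \<in> mm" shows "act (\<rho> t) x \<in> mm"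
proof (rule ccontr)
 assume "act (\<rho> t) x \<notin> mm"
 then obtain u where "act (\<rho> t) x * u = 1" using unit by blast
 then have "act (\<rho> (\<lambda>i. inverse (t i))) (act (\<rho> t) x * u) = 1" using R_1[OF torus_inverse[OF t]] by simp
 then have "x * act (\<rho> (\<lambda>i. inverse (t i))) u = 1" unfolding R_mult[OF torus_inverse[OF t]] R_inverse[OF t] .
 then have "1 \<in> mm" using mm_mult[OF x, of "act (\<rho> (\<lambda>i. inverse (t i))) u"] by (simp add: mult.commute)
 then show False using mm_ideal by blast
qed

definition hom :: "'b \<Rightarrow> bool" where
 "hom x \<longleftrightarrow> (\<exists>\<chi>\<in>Zn n. \<forall>t\<in>torus n. act (\<rho> t) x = \<iota> (chr n t \<chi>) * x)"

text \<open>The coordinates of \<open>act (\<rho> t) x\<close> are Laurent polynomials in t, and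
  \<open>u \<chi>\<close> collects the coefficient of \<chi>. Independence of characters turns the
  group law into homogeneity of \<open>u \<chi>\<close> and, applied to residues, the invariance of
  \<open>mm\<close> into membership in \<open>mm\<close>.\<close>

lemma decompose:
 "\<exists>F u. finite F \<and> x = (\<Sum>\<chi>\<in>F. u \<chi>) \<and> (\<forall>\<chi>\<in>F. (x \<in> mm \<longrightarrow> u \<chi> \<in> mm) \<and> hom (u (\<chi> :: nat \<Rightarrow> int)))"
proof -
 have "lp n (Zn n) (\<lambda>t. cx (act (\<rho> t) x) l)" if l: "l < D" for l
 proof -
  have "lp n (Zn n) (\<lambda>t. \<rho> t l k * cx x k)" if "k < D" for k
   by (rule lp_mult[OF \<rho>_lp[OF l that]]) (use lp_mono[of 0 "Zn n" n "cx x k"] in auto)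
  then show ?thesis unfolding coords_act[OF l] by (intro lp_sum) simp
 qed
 then have L: "lp n (Zn n) (\<lambda>t. cx (act (\<rho> t) x) l)" if "l < D" for l using that .
 have "\<forall>l. \<exists>w. l < D \<longrightarrow> finite (fst w) \<and> fst w \<subseteq> Zn n \<and>
   (\<forall>t\<in>torus n. cx (act (\<rho> t) x) l = (\<Sum>\<chi>\<in>fst w. snd w \<chi> * chr n t \<chi>))"
 proof
  fix l show "\<exists>w. l < D \<longrightarrow> finite (fst w) \<and> fst w \<subseteq> Zn n \<and>
   (\<forall>t\<in>torus n. cx (act (\<rho> t) x) l = (\<Sum>\<chi>\<in>fst w. snd w \<chi> * chr n t \<chi>))"
  proof (cases "l < D")
   case True
   from L[OF this] obtain F c where "finite F" "F \<subseteq> Zn n"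
    "\<forall>t\<in>torus n. cx (act (\<rho> t) x) l = (\<Sum>\<chi>\<in>F. c \<chi> * chr n t \<chi>)" unfolding lp_def by blast
   then show ?thesis by (intro exI[of _ "(F, c)"]) simp
  qed simp
 qed
 from choice[OF this] obtain w where w: "\<forall>l. l < D \<longrightarrow> finite (fst (w l)) \<and> fst (w l) \<subseteq> Zn n \<and>
   (\<forall>t\<in>torus n. cx (act (\<rho> t) x) l = (\<Sum>\<chi>\<in>fst (w l). snd (w l) \<chi> * chr n t \<chi>))" ..
 define F where "F = (\<Union>l\<in>{..<D}. fst (w l))"
 have F: "finite F" "F \<subseteq> Zn n" unfolding F_def using w by auto
 define u where "u \<chi> = (\<Sum>l<D. \<iota> (if \<chi> \<in> fst (w l) then snd (w l) \<chi> else 0) * bs ! l)" for \<chi>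
 have act: "act (\<rho> t) x = (\<Sum>\<chi>\<in>F. \<iota> (chr n t \<chi>) * u \<chi>)" if t: "t \<in> torus n" for t
 proof (rule coords_inj)
  fix l assume l: "l < D"
  have "cx (u \<chi>) l = (if \<chi> \<in> fst (w l) then snd (w l) \<chi> else 0)" for \<chi> by (rule coords_eqI[OF _ l]) (simp add: u_def)
  then have "cx (\<Sum>\<chi>\<in>F. \<iota> (chr n t \<chi>) * u \<chi>) l = (\<Sum>\<chi>\<in>F. chr n t \<chi> * (if \<chi> \<in> fst (w l) then snd (w l) \<chi> else 0))"
   using l by (simp add: coords_sum coords_scale)
  also have "\<dots> = (\<Sum>\<chi>\<in>fst (w l). snd (w l) \<chi> * chr n t \<chi>)"
  proof (rule sum.mono_neutral_cong_right[OF F(1)])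
   show "fst (w l) \<subseteq> F" unfolding F_def using l by auto
  qed auto
  also have "\<dots> = cx (act (\<rho> t) x) l" using w l t by simp
  finally show "cx (act (\<rho> t) x) l = cx (\<Sum>\<chi>\<in>F. \<iota> (chr n t \<chi>) * u \<chi>) l" by simp
 qed
 have "x = (\<Sum>\<chi>\<in>F. u \<chi>)" using act[OF torus_one] by (simp add: \<rho>_1 act_id)
 moreover have "hom (u \<chi>)" if \<chi>: "\<chi> \<in> F" for \<chi>
  unfolding hom_def
 proof (intro bexI[of _ \<chi>] ballI)
  show "\<chi> \<in> Zn n" using \<chi> F by blast
  fix t :: "nat \<Rightarrow> 'a" assume t: "t \<in> torus n"
  have "\<forall>\<chi>\<in>F. act (\<rho> t) (u \<chi>) - \<iota> (chr n t \<chi>) * u \<chi> = 0"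
  proof (rule chr_independent[OF F(1), of "\<lambda>\<chi>. \<chi>"])
   show "\<chi> \<in> Zn n" if "\<chi> \<in> F" for \<chi> using that F by blast
   fix s :: "nat \<Rightarrow> 'a" assume s: "s \<in> torus n"
   have "act (\<rho> t) (act (\<rho> s) x) = act (\<rho> (\<lambda>i. t i * s i)) x" by (rule R_comp[OF t s])
   then have "(\<Sum>\<chi>\<in>F. \<iota> (chr n s \<chi>) * act (\<rho> t) (u \<chi>)) = (\<Sum>\<chi>\<in>F. \<iota> (chr n s \<chi>) * (\<iota> (chr n t \<chi>) * u \<chi>))"
    unfolding act[OF s] act[OF torus_mult[OF t s]] by (simp only: act_sum act_scale chr_mult \<iota>_mult mult.assoc mult.left_commute)
   then show "(\<Sum>\<chi>\<in>F. \<iota> (chr n s \<chi>) * (act (\<rho> t) (u \<chi>) - \<iota> (chr n t \<chi>) * u \<chi>)) = 0"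
    by (simp only: right_diff_distrib sum_subtractf diff_self)
  qed simp
  then show "act (\<rho> t) (u \<chi>) = \<iota> (chr n t \<chi>) * u \<chi>" using \<chi> by simp
 qed
 moreover have "u \<chi> \<in> mm" if x: "x \<in> mm" and \<chi>: "\<chi> \<in> F" for \<chi>
 proof -
  have "\<forall>\<chi>\<in>F. res (u \<chi>) = 0"
  proof (rule chr_independent_scalar[OF F(1), of "\<lambda>\<chi>. \<chi>"])
   show "\<chi> \<in> Zn n" if "\<chi> \<in> F" for \<chi> using that F by blast
   fix t :: "nat \<Rightarrow> 'a" assume t: "t \<in> torus n"
   have "res (act (\<rho> t) x) = 0" unfolding res_eq_0 by (rule R_mm[OF t x])
   then show "(\<Sum>\<chi>\<in>F. chr n t \<chi> * res (u \<chi>)) = 0" unfolding act[OF t] res_sum res_scale .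
  qed simp
  then show ?thesis using \<chi> res_eq_0 by blast
 qed
 ultimately show ?thesis using F(1) by blast
qed

lemma ex_homogeneous: "\<exists>y. cotb y \<and> (\<forall>i<n. hom (y i))"
proof -
 obtain v where "cotb v" using cot unfolding cotangent_dim_def cotb_def by blast
 moreover have "\<exists>F u. finite F \<and> x = (\<Sum>\<chi>\<in>F. u \<chi>) \<and> (\<forall>\<chi>\<in>F. u \<chi> \<in> mm \<and> hom (u (\<chi> :: nat \<Rightarrow> int)))" if "x \<in> mm" for x
  using decompose[of x] that by blast
 ultimately show ?thesis by (rule cotb_refine)
qed

end

section \<open>The weights of homogeneous generators form a lattice basis\<close>

locale kweights = ktorus + kgen +
 fixes X :: "nat \<Rightarrow> nat \<Rightarrow> int"
 assumes X_Zn: "i < n \<Longrightarrow> X i \<in> Zn n" and R_y: "i < n \<Longrightarrow> t \<in> torus n \<Longrightarrow> act (\<rho> t) (y i) = \<iota> (chr n t (X i)) * y i"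
begin

text \<open>The torus weight of the monomial with exponent v in the generators, extended linearly to
  integer exponents.\<close>

definition wx :: "(nat \<Rightarrow> int) \<Rightarrow> nat \<Rightarrow> int" where "wx v = (\<lambda>j. \<Sum>i<n. v i * X i j)"

definition \<tau>' :: "(nat \<Rightarrow> 'a) \<Rightarrow> nat \<Rightarrow> 'a" where "\<tau>' t = (\<lambda>i. chr n t (X i))"

lemma wx_Zn: "wx v \<in> Zn n" using X_Zn unfolding wx_def Zn_def by simp
lemma wx_add: "wx (a + b) = wx a + wx b" by (simp add: wx_def fun_eq_iff distrib_right sum.distrib)
lemma wx_minus: "wx (- a) = - wx a" by (simp add: wx_def fun_eq_iff sum_negf)
lemma wx_0: "wx 0 = 0" by (simp add: wx_def fun_eq_iff)
lemma wx_diff: "wx (a - b) = wx a - wx b" using wx_add[of "a - b" b] by simp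

lemma \<tau>'_torus: "t \<in> torus n \<Longrightarrow> \<tau>' t \<in> torus n" unfolding \<tau>'_def by (subst torus_def) (simp add: chr_neq_0)

lemma chr_\<tau>': "t \<in> torus n \<Longrightarrow> chr n (\<tau>' t) v = chr n t (wx v)"
 unfolding \<tau>'_def wx_def by (rule chr_subst)

lemma R_ymon: assumes t: "t \<in> torus n" shows "act (\<rho> t) (ymon a) = \<iota> (chr n t (wx (ive a))) * ymon a"
proof -
 have pw: "act (\<rho> t) (x ^ k) = act (\<rho> t) x ^ k" for x k by (induction k) (simp_all add: R_mult[OF t] R_1[OF t])
 have pr: "act (\<rho> t) (\<Prod>i\<in>I. f i) = (\<Prod>i\<in>I. act (\<rho> t) (f i))" for I and f :: "nat \<Rightarrow> 'b"
  by (induction I rule: infinite_finite_induct) (simp_all add: R_mult[OF t] R_1[OF t])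
 have ip: "\<iota> (x ^ k) = \<iota> x ^ k" for x k by (induction k) (simp_all add: \<iota>_mult)
 have ipr: "\<iota> (\<Prod>i\<in>I. f i) = (\<Prod>i\<in>I. \<iota> (f i))" for I and f :: "nat \<Rightarrow> 'a"
  by (induction I rule: infinite_finite_induct) (simp_all add: \<iota>_mult)
 have "act (\<rho> t) (ymon a) = (\<Prod>i<n. (\<iota> (\<tau>' t i) * y i) ^ a i)"
  unfolding ymon_def pr pw by (rule prod.cong[OF refl]) (simp add: R_y[OF _ t] \<tau>'_def)
 also have "\<dots> = (\<Prod>i<n. \<iota> (\<tau>' t i ^ a i)) * ymon a" by (simp add: ymon_def power_mult_distrib prod.distrib ip)
 also have "(\<Prod>i<n. \<iota> (\<tau>' t i ^ a i)) = \<iota> (chr n (\<tau>' t) (ive a))" by (simp add: chr_def ipr)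
 finally show ?thesis unfolding chr_\<tau>'[OF t] .
qed

definition \<Lambda> :: "(nat \<Rightarrow> int) set" where "\<Lambda> = wx ` Zn n"

lemma \<Lambda>_add: "a \<in> \<Lambda> \<Longrightarrow> b \<in> \<Lambda> \<Longrightarrow> a + b \<in> \<Lambda>"
 unfolding \<Lambda>_def by (elim imageE) (simp only: wx_add[symmetric], intro imageI Zn_add)
lemma \<Lambda>_0: "0 \<in> \<Lambda>" unfolding \<Lambda>_def by (rule image_eqI[where f = wx and x = 0]) (simp_all add: wx_0)

lemma ive_Zn: "a \<in> expvecs n \<Longrightarrow> ive a \<in> Zn n" by (simp add: expvecs_def Zn_def)

lemma \<rho>_entry: assumes "l < D" "k < D"
 shows "\<exists>c. \<forall>t\<in>torus n. \<rho> t l k = (\<Sum>a\<in>std. c a * chr n t (wx (ive a)))"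
proof -
 obtain d where d: "bs ! k = (\<Sum>a\<in>std. \<iota> (d a) * ymon a)" using span by blast
 have "\<rho> t l k = (\<Sum>a\<in>std. (d a * cx (ymon a) l) * chr n t (wx (ive a)))" if t: "t \<in> torus n" for t
 proof -
  have "\<rho> t l k = cx (\<Sum>l<D. \<iota> (\<rho> t l k) * bs ! l) l" by (rule coords_eqI[OF refl assms(1), symmetric])
  also have "\<dots> = cx (act (\<rho> t) (\<Sum>a\<in>std. \<iota> (d a) * ymon a)) l" unfolding d[symmetric] act_basis[OF assms(2)] ..
  also have "\<dots> = (\<Sum>a\<in>std. (d a * cx (ymon a) l) * chr n t (wx (ive a)))"
   using assms(1) by (simp add: act_sum act_scale R_ymon[OF t] coords_sum coords_scale) (simp add: mult_ac)
  finally show ?thesis .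
 qed
 then show ?thesis by (intro exI[of _ "\<lambda>a. d a * cx (ymon a) l"]) blast
qed

text \<open>The coordinate t_i is a regular function of \<open>\<rho> t\<close>, whose entries and
  inverse entries have exponents in \<Lambda>; so t_i is a Laurent polynomial with exponents in
  \<Lambda>. By independence of characters its own exponent \<open>uv i\<close> must occur.\<close>

lemma uv_\<Lambda>: assumes i: "i < n" shows "uv i \<in> \<Lambda>"
proof -
 obtain f where f: "f \<in> reg_fun D" "\<forall>t\<in>torus n. t i = f (\<rho> t)" using \<rho>_recover[OF i] by blast
 have stdZ: "ive a \<in> Zn n" if "a \<in> std" for a using that ive_Zn unfolding std_def by blast
 have 1: "lp n \<Lambda> (\<lambda>t. \<rho> t l k)" if lk: "l < D" "k < D" for l k
 proof -
  obtain c where c: "\<forall>t\<in>torus n. \<rho> t l k = (\<Sum>a\<in>std. c a * chr n t (wx (ive a)))" using \<rho>_entry[OF lk] by blast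
  have "lp n \<Lambda> (\<lambda>t. \<Sum>a\<in>std. c a * chr n t (wx (ive a)))" by (intro lp_sum lp_mono) (use stdZ in \<open>auto simp: \<Lambda>_def\<close>)
  then show ?thesis by (rule lp_cong) (use c in blast)
 qed
 have inv: "mat_inv D (\<rho> t) = \<rho> (\<lambda>i. inverse (t i))" if t: "t \<in> torus n" for t
 proof (rule mat_inv_eq)
  have p: "padded D (\<rho> t)" if "t \<in> torus n" for t using \<rho>_Aut[OF that] unfolding Aut_B_iff invertible_mat_def by blast
  note ti = torus_inverse[OF t]
  have tt: "(\<lambda>i. inverse (inverse (t i))) = t" by simp
  show "is_inverse D (\<rho> t) (\<rho> (\<lambda>i. inverse (t i)))" unfolding is_inverse_def
  proof (intro conjI p[OF ti])
   show "mat_mul D (\<rho> t) (\<rho> (\<lambda>i. inverse (t i))) = mat_id D"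
    by (rule act_inject) (simp_all add: act_mul act_id R_inverse[OF ti, unfolded tt])
   show "mat_mul D (\<rho> (\<lambda>i. inverse (t i))) (\<rho> t) = mat_id D"
    by (rule act_inject) (simp_all add: act_mul act_id R_inverse[OF t])
  qed
 qed
 have 2: "lp n \<Lambda> (\<lambda>t. mat_inv D (\<rho> t) l k)" if lk: "l < D" "k < D" for l k
 proof -
  obtain c where c: "\<forall>t\<in>torus n. \<rho> t l k = (\<Sum>a\<in>std. c a * chr n t (wx (ive a)))" using \<rho>_entry[OF lk] by blast
  have neg: "chr n (\<lambda>i. inverse (t i)) v = chr n t (- v)" if t: "t \<in> torus n" for t :: "nat \<Rightarrow> 'a" and v
   using chr_minus[OF t, of v] chr_neq_0[OF t, of v] unfolding chr_inverse by (simp add: field_simps)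
  have "lp n \<Lambda> (\<lambda>t. \<Sum>a\<in>std. c a * chr n t (wx (- ive a)))" by (intro lp_sum lp_mono) (use stdZ in \<open>auto simp: \<Lambda>_def\<close>)
  then show ?thesis
  proof (rule lp_cong)
   fix t :: "nat \<Rightarrow> 'a" assume t: "t \<in> torus n"
   show "mat_inv D (\<rho> t) l k = (\<Sum>a\<in>std. c a * chr n t (wx (- ive a)))"
    unfolding inv[OF t] wx_minus neg[OF t, symmetric] using c torus_inverse[OF t] by blast
  qed
 qed
 have "lp n \<Lambda> (\<lambda>t. f (\<rho> t))" by (rule lp_reg_fun[OF f(1) \<Lambda>_0 \<Lambda>_add 1 2])
 then obtain F c where F: "finite F" "F \<subseteq> \<Lambda>" "\<forall>t\<in>torus n. f (\<rho> t) = (\<Sum>\<chi>\<in>F. c \<chi> * chr n t \<chi>)" unfolding lp_def by blast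
 have "uv i \<in> F"
 proof (rule ccontr)
  assume n: "uv i \<notin> F"
  have "\<forall>\<chi>\<in>insert (uv i) F. (if \<chi> = uv i then 1 else - c \<chi>) = 0"
  proof (rule chr_independent_scalar[of _ "\<lambda>\<chi>. \<chi>"])
   show "finite (insert (uv i) F)" using F by simp
   show "\<chi> \<in> Zn n" if x: "\<chi> \<in> insert (uv i) F" for \<chi>
   proof (cases "\<chi> = uv i")
    case True then show ?thesis using i by simp
   next
    case False
    then have "\<chi> \<in> wx ` Zn n" using x F(2) unfolding \<Lambda>_def by blast
    then obtain v where "\<chi> = wx v" by blast
    then show ?thesis using wx_Zn[of v] by simp
   qed
   fix t :: "nat \<Rightarrow> 'a" assume t: "t \<in> torus n"
   have "(\<Sum>\<chi>\<in>F. chr n t \<chi> * (if \<chi> = uv i then 1 else - c \<chi>)) = (\<Sum>\<chi>\<in>F. - (c \<chi> * chr n t \<chi>))"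
   proof (rule sum.cong[OF refl])
    fix \<chi> assume "\<chi> \<in> F"
    then have "\<chi> \<noteq> uv i" using n by blast
    then show "chr n t \<chi> * (if \<chi> = uv i then 1 else - c \<chi>) = - (c \<chi> * chr n t \<chi>)" by (simp only: if_False mult_minus_right mult_minus_left mult.commute)
   qed
   also have "\<dots> = - t i" using F(3) f(2) t by (simp add: sum_negf)
   finally have sF: "(\<Sum>\<chi>\<in>F. chr n t \<chi> * (if \<chi> = uv i then 1 else - c \<chi>)) = - t i" .
   show "(\<Sum>\<chi>\<in>insert (uv i) F. chr n t \<chi> * (if \<chi> = uv i then 1 else - c \<chi>)) = 0"
    unfolding sum.insert[OF F(1) n] sF chr_uv[OF i] by simp
  qed simp
  from bspec[OF this insertI1] show False by (simp only: if_True simp_thms one_neq_zero)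
 qed
 then show ?thesis using F(2) by blast
qed

definition W :: "nat \<Rightarrow> nat \<Rightarrow> int" where "W i = (SOME v. v \<in> Zn n \<and> wx v = uv i)"

lemma W: assumes "i < n" shows "W i \<in> Zn n" "wx (W i) = uv i"
proof -
 from uv_\<Lambda>[OF assms, unfolded \<Lambda>_def] obtain v where "uv i = wx v" "v \<in> Zn n" by (rule imageE)
 then have "\<exists>v. v \<in> Zn n \<and> wx v = uv i" by (intro exI[of _ v]) simp
 from someI_ex[OF this] show "W i \<in> Zn n" "wx (W i) = uv i" unfolding W_def by blast+
qed

text \<open>A surjective endomorphism of Z^n is injective. If v were a nonzero kernel vector, the n
  preimages \<open>W i\<close> taken modulo v would live in rank n - 1, so a nontrivial rational
  combination of them is proportional to v. Its image is 0, although the images of the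
  \<open>W i\<close> are the unit vectors.\<close>

lemma wx_eq_0: assumes v: "v \<in> Zn n" "wx v = 0" shows "v = 0"
proof (rule ccontr)
 assume "v \<noteq> 0"
 then obtain j where vj: "v j \<noteq> 0" by (auto simp: fun_eq_iff)
 have j: "j < n" using Zn_ge[OF v(1) vj] .
 \<comment> \<open>Coordinates of \<open>W i\<close> after clearing coordinate j with a multiple of
   v, without denominators. The value at k = j is 0, which leaves n - 1 equations.\<close>
 define \<kappa> :: "nat \<Rightarrow> nat \<Rightarrow> rat" where "\<kappa> i k = of_int (W i k * v j - W i j * v k)" for i k
 have "card ({..<n} - {j}) < card {..<n}" using j by (simp add: card_Diff_singleton)
 from nontrivial_solution[OF _ _ this, of \<kappa>] obtain c
  where c: "\<exists>i\<in>{..<n}. c i \<noteq> 0" "\<forall>k\<in>{..<n} - {j}. (\<Sum>i<n. c i * \<kappa> i k) = 0" by auto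
 define z where "z k = (\<Sum>i<n. c i * of_int (W i k))" for k
 have zv: "z k * of_int (v j) = z j * of_int (v k)" if "k < n" for k
 proof -
  have "(\<Sum>i<n. c i * \<kappa> i k) = 0" using c(2) that by (cases "k = j") (auto simp: \<kappa>_def)
  moreover have "(\<Sum>i<n. c i * \<kappa> i k) = z k * of_int (v j) - z j * of_int (v k)"
   unfolding z_def \<kappa>_def sum_distrib_right sum_subtractf[symmetric] by (rule sum.cong) (simp_all add: algebra_simps)
  ultimately show ?thesis by simp
 qed
 have "c q = 0" if q: "q < n" for q
 proof -
  have "(\<Sum>k<n. z k * of_int (X k q)) = (\<Sum>k<n. \<Sum>i<n. c i * (of_int (W i k) * of_int (X k q)))"
   unfolding z_def sum_distrib_right by (simp add: mult.assoc)
  also have "\<dots> = (\<Sum>i<n. c i * of_int (wx (W i) q))"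
   unfolding wx_def by (subst sum.swap) (simp add: sum_distrib_left)
  also have "\<dots> = (\<Sum>i<n. if i = q then c i else 0)" by (rule sum.cong) (auto simp: W uv_apply)
  also have "\<dots> = c q" using q by simp
  finally have cq: "(\<Sum>k<n. z k * of_int (X k q)) = c q" .
  have "of_int (v j) * c q = (\<Sum>k<n. (z k * of_int (v j)) * of_int (X k q))"
   unfolding cq[symmetric] sum_distrib_left by (rule sum.cong) (simp_all add: mult_ac)
  also have "\<dots> = (\<Sum>k<n. z j * (of_int (v k) * of_int (X k q)))" by (rule sum.cong) (simp_all add: zv mult.assoc)
  also have "\<dots> = z j * of_int (wx v q)" unfolding wx_def by (simp add: sum_distrib_left)
  finally show ?thesis using v(2) vj by simp
 qed
 then show False using c(1) by blast
qed

lemma wx_inject: "a \<in> Zn n \<Longrightarrow> b \<in> Zn n \<Longrightarrow> wx a = wx b \<Longrightarrow> a = b"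
 using wx_eq_0[of "a - b"] by (simp add: wx_diff)

definition \<psi> :: "(nat \<Rightarrow> int) \<Rightarrow> nat \<Rightarrow> int" where "\<psi> v = (\<lambda>j. \<Sum>i<n. v i * W i j)"

lemma \<psi>_Zn: "\<psi> v \<in> Zn n" using W(1) unfolding \<psi>_def Zn_def by simp
lemma \<psi>_add: "\<psi> (a + b) = \<psi> a + \<psi> b" by (simp add: \<psi>_def fun_eq_iff distrib_right sum.distrib)

lemma wx_\<psi>: assumes "v \<in> Zn n" shows "wx (\<psi> v) = v"
proof
 fix q
 have "wx (\<psi> v) q = (\<Sum>j<n. \<Sum>i<n. v i * (W i j * X j q))" unfolding wx_def \<psi>_def sum_distrib_right by (simp add: mult.assoc)
 also have "\<dots> = (\<Sum>i<n. v i * wx (W i) q)" unfolding wx_def by (subst sum.swap) (simp add: sum_distrib_left)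
 also have "\<dots> = (\<Sum>i<n. if i = q then v i else 0)" by (rule sum.cong) (auto simp: W uv_apply)
 also have "\<dots> = v q" using assms by (simp add: Zn_def)
 finally show "wx (\<psi> v) q = v q" .
qed

lemma \<psi>_wx: "v \<in> Zn n \<Longrightarrow> \<psi> (wx v) = v"
 using wx_inject[OF \<psi>_Zn _ wx_\<psi>[OF wx_Zn]] by blast

text \<open>By \<open>wx_inject\<close> distinct monomials have distinct weights, so independence of
  characters separates the terms of a relation.\<close>

lemma ymon_independent:
 assumes "(\<Sum>a\<in>std. \<iota> (c a) * ymon a) = 0" "a \<in> std" shows "c a = 0"
proof -
 have "\<forall>a\<in>std. \<iota> (c a) * ymon a = 0"
 proof (rule chr_independent[OF finite_std, of "\<lambda>a. wx (ive a)"])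
  show "inj_on (\<lambda>a. wx (ive a)) std"
   by (rule inj_onI) (use wx_inject[OF ive_Zn ive_Zn] in \<open>auto simp: std_def\<close>)
  show "wx (ive a) \<in> Zn n" for a by (rule wx_Zn)
  fix t :: "nat \<Rightarrow> 'a" assume t: "t \<in> torus n"
  have "act (\<rho> t) (\<Sum>a\<in>std. \<iota> (c a) * ymon a) = 0" unfolding assms(1) by (rule act_0)
  then show "(\<Sum>a\<in>std. \<iota> (chr n t (wx (ive a))) * (\<iota> (c a) * ymon a)) = 0"
   by (simp add: act_sum act_scale R_ymon[OF t] mult.left_commute)
 qed
 then have "\<iota> (c a) * ymon a = 0" using assms(2) by blast
 then show ?thesis using \<iota>_cancel[of "c a" "ymon a"] assms(2) unfolding std_def by blast
qed

lemma downset_std: "downset n (ive ` std)"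
 unfolding downset_def
proof (intro conjI ballI allI impI)
 show "finite (ive ` std)" using finite_std by simp
 show "0 \<le> p" "p \<in> Zn n" if "p \<in> ive ` std" for p using that ive_Zn unfolding std_def by (auto simp: le_fun_def)
 have one: "(1 :: 'b) \<noteq> 0"
 proof
  assume "(1 :: 'b) = 0" then show False using mm_ideal(2) mm_0 by simp
 qed
 show "0 \<in> ive ` std" by (rule image_eqI[of _ _ "\<lambda>_. 0"]) (simp_all add: std_def expvecs_def one)
 show "uv i \<in> ive ` std" if i: "i < n" for i
 proof (rule image_eqI)
  show "uv i = ive (unitvec i)" by (simp add: fun_eq_iff uv_apply unitvec_def)
  have "y i \<noteq> 0"
  proof
   assume "y i = 0"
   have "(\<Sum>j<n. \<iota> (if j = i then 1 else 0) * y j) = (\<Sum>j<n. if j = i then y j else 0)" by (rule sum.cong) auto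
   also have "\<dots> = 0" using \<open>y i = 0\<close> i by simp
   finally have s: "(\<Sum>j<n. \<iota> (if j = i then 1 else 0) * y j) \<in> sq" using sq_0 by simp
   show False using cotbD(2)[OF y s i] by simp
  qed
  then have "ymon (unitvec i) \<noteq> 0" unfolding ymon_unit[OF i] .
  moreover have "unitvec i \<in> expvecs n" using i by (simp add: expvecs_def unitvec_def)
  ultimately show "unitvec i \<in> std" unfolding std_def by simp
 qed
 fix p q assume p: "p \<in> ive ` std" and q: "0 \<le> q \<and> q \<le> p"
 then obtain a where a: "p = ive a" "a \<in> std" by blast
 define b where "b i = nat (q i)" for i
 have qb: "q = ive b" using q by (auto simp: fun_eq_iff b_def le_fun_def)
 have ba: "b i \<le> a i" for i using q unfolding qb a(1) by (simp add: le_fun_def)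
 have e: "addvec b (\<lambda>i. a i - b i) = a" using ba by (simp add: fun_eq_iff addvec_def)
 have "ymon a = ymon b * ymon (\<lambda>i. a i - b i)" using ymon_add[of b "\<lambda>i. a i - b i"] unfolding e .
 then have "ymon b \<noteq> 0" using a(2) unfolding std_def by auto
 moreover have "b i = 0" if "n \<le> i" for i
 proof -
  have "a i = 0" using a(2) that unfolding std_def expvecs_def by simp
  then show ?thesis using ba[of i] by simp
 qed
 then have "b \<in> expvecs n" unfolding expvecs_def by simp
 ultimately have "b \<in> std" unfolding std_def by simp
 then show "q \<in> ive ` std" unfolding qb by (rule imageI)
qed

end

section \<open>The isomorphism\<close>

lemma ratf_cong: "ratf q f \<Longrightarrow> (\<And>s. poly q s \<noteq> 0 \<Longrightarrow> g s = f s) \<Longrightarrow> ratf q g"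
 unfolding ratf_def by (elim exE) (intro exI, auto)

lemma ratf_const: "ratf q (\<lambda>s. c)"
proof -
 have "ratf q (poly [:c:])" by (rule ratf_poly)
 moreover have "poly [:c:] = (\<lambda>s. c)" by (simp add: fun_eq_iff)
 ultimately show ?thesis by (simp only:)
qed

lemma ratf_sum: "(\<And>x. x \<in> X \<Longrightarrow> ratf q (f x)) \<Longrightarrow> ratf q (\<lambda>s. \<Sum>x\<in>X. f x s)"
 by (induction X rule: infinite_finite_induct) (simp_all add: ratf_const ratf_add)

text \<open>Conjugation by P once Q is its inverse. Passing Q explicitly makes the entries visibly
  linear in g.\<close>

definition cj :: "nat \<Rightarrow> (nat \<Rightarrow> nat \<Rightarrow> 'k::field) \<Rightarrow> (nat \<Rightarrow> nat \<Rightarrow> 'k) \<Rightarrow> (nat \<Rightarrow> nat \<Rightarrow> 'k) \<Rightarrow> nat \<Rightarrow> nat \<Rightarrow> 'k" where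
 "cj N P Q g = mat_mul N P (mat_mul N g Q)"

lemma padded_cj [simp]: "padded N (cj N P Q g)" unfolding cj_def by simp

lemma cj_entry: "i < N \<Longrightarrow> j < N \<Longrightarrow> cj N P Q g i j = (\<Sum>a<N. P i a * (\<Sum>b<N. g a b * Q b j))"
 unfolding cj_def mat_mul_def by simp

context
 fixes N :: nat and P Q :: "nat \<Rightarrow> nat \<Rightarrow> 'k::field_char_0"
 assumes PQ: "is_inverse N P Q" and P: "padded N P"
begin

lemma Q_padded: "padded N Q" using PQ unfolding is_inverse_def by blast

lemma QP: "mat_mul N Q (mat_mul N P g) = mat_mul N (mat_id N) g" "mat_mul N P (mat_mul N Q g) = mat_mul N (mat_id N) g"
 using PQ unfolding is_inverse_def mat_mul_assoc[symmetric] by simp_all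

lemma cj_mul: "mat_mul N (cj N P Q g) (cj N P Q h) = cj N P Q (mat_mul N g h)"
 unfolding cj_def mat_mul_assoc QP by (simp add: mat_mul_id)

lemma cj_id: "cj N P Q (mat_id N) = mat_id N"
 unfolding cj_def using PQ by (simp add: mat_mul_id Q_padded is_inverse_def)

lemma cj_cj: "padded N g \<Longrightarrow> cj N Q P (cj N P Q g) = g" "padded N g \<Longrightarrow> cj N P Q (cj N Q P g) = g"
proof -
 have e: "mat_mul N Q P = mat_id N" "mat_mul N P Q = mat_id N" using PQ unfolding is_inverse_def by blast+
 show "padded N g \<Longrightarrow> cj N Q P (cj N P Q g) = g" "padded N g \<Longrightarrow> cj N P Q (cj N Q P g) = g"
  unfolding cj_def mat_mul_assoc QP by (simp_all add: e mat_mul_id)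
qed

lemma cj_inverse: "is_inverse N g h \<Longrightarrow> is_inverse N (cj N P Q g) (cj N P Q h)"
 unfolding is_inverse_def cj_mul by (simp add: cj_id)

lemma cj_invertible: "invertible_mat N g \<Longrightarrow> invertible_mat N (cj N P Q g)"
 unfolding invertible_mat_def using cj_inverse padded_cj by blast

lemma cj_reg_fun: "i < N \<Longrightarrow> j < N \<Longrightarrow> (\<lambda>g. cj N P Q g i j) \<in> reg_fun N"
proof -
 assume ij: "i < N" "j < N"
 have "(\<lambda>g. \<Sum>a<N. P i a * (\<Sum>b<N. g a b * Q b j)) \<in> reg_fun N"
  by (intro reg_fun_sum reg_fun.rf_mul reg_fun.rf_const reg_fun.rf_entry) auto
 then show ?thesis unfolding cj_entry[OF ij] .
qed

lemma cj_mat_inv: "invertible_mat N g \<Longrightarrow> mat_inv N (cj N P Q g) = cj N P Q (mat_inv N g)"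
 by (intro mat_inv_eq cj_inverse is_inverse_mat_inv)

lemma cj_inv_reg_fun: "i < N \<Longrightarrow> j < N \<Longrightarrow> (\<lambda>g. cj N P Q (mat_inv N g) i j) \<in> reg_fun N"
proof -
 assume ij: "i < N" "j < N"
 have "(\<lambda>g. \<Sum>a<N. P i a * (\<Sum>b<N. mat_inv N g a b * Q b j)) \<in> reg_fun N"
  by (intro reg_fun_sum reg_fun.rf_mul reg_fun.rf_const reg_fun.rf_inv_entry) auto
 then show ?thesis unfolding cj_entry[OF ij] .
qed

lemma cj_curve:
 fixes c d :: "'k \<Rightarrow> nat \<Rightarrow> nat \<Rightarrow> 'k"
 assumes inv: "\<And>s. poly q s \<noteq> 0 \<Longrightarrow> is_inverse N (c s) (d s)"
  and c: "\<And>i j. i < N \<Longrightarrow> j < N \<Longrightarrow> ratf q (\<lambda>s. c s i j)" and d: "\<And>i j. i < N \<Longrightarrow> j < N \<Longrightarrow> ratf q (\<lambda>s. d s i j)"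
  and H: "\<And>s. poly q s \<noteq> 0 \<Longrightarrow> cj N P Q (c s) \<in> H" and a: "poly q a \<noteq> 0" "c a = mat_id N" and s: "poly q s \<noteq> 0"
 shows "cj N P Q (c s) \<in> neutral_comp N H"
proof (rule curve_in_neutral_comp[where c = "\<lambda>s. cj N P Q (c s)" and q = q, OF _ _ H a(1) _ s])
 show "cj N P Q (c a) = mat_id N" unfolding a(2) by (rule cj_id)
 fix i j assume ij: "i < N" "j < N"
 show "ratf q (\<lambda>s. cj N P Q (c s) i j)" unfolding cj_entry[OF ij]
  by (intro ratf_sum ratf_mult ratf_const c) (use ij in auto)
 have "ratf q (\<lambda>s. cj N P Q (d s) i j)" unfolding cj_entry[OF ij]
  by (intro ratf_sum ratf_mult ratf_const d) (use ij in auto)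
 then show "ratf q (\<lambda>s. mat_inv N (cj N P Q (c s)) i j)"
  by (rule ratf_cong) (simp add: mat_inv_eq[OF cj_inverse[OF inv]])
qed

end

context monlist
begin

lemma Tor_neutral:
 assumes PQ: "is_inverse N U V" "padded N U" and H: "\<And>g. g \<in> Aut_M ms \<Longrightarrow> cj N U V g \<in> H" and t: "t \<in> torus n"
 shows "cj N U V (Tor t) \<in> neutral_comp N (H :: (nat \<Rightarrow> nat \<Rightarrow> 'k::field_char_0) set)"
proof -
 define q where "q i = [:1, t i - 1:]" for i
 define c where "c s = (\<lambda>i. poly (q i) s)" for s
 have c1: "c 1 = t" "c 0 = (\<lambda>_. 1)" by (simp_all add: c_def q_def fun_eq_iff)
 have tor: "c s \<in> torus n" if "poly (\<Prod>i<n. q i) s \<noteq> 0" for s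
  using that by (simp add: torus_def c_def poly_prod)
 have "cj N U V (Tor (c 1)) \<in> neutral_comp N H"
 proof (rule cj_curve[OF PQ, where c = "\<lambda>s. Tor (c s)" and d = "\<lambda>s. Tor (\<lambda>i. inverse (c s i))" and q = "\<Prod>i<n. q i" and a = 0])
  show "is_inverse N (Tor (c s)) (Tor (\<lambda>i. inverse (c s i)))" if "poly (\<Prod>i<n. q i) s \<noteq> 0" for s
   by (rule is_inverse_Tor[OF tor[OF that]])
  show "cj N U V (Tor (c s)) \<in> H" if "poly (\<Prod>i<n. q i) s \<noteq> 0" for s by (rule H[OF Tor_Aut[OF tor[OF that]]])
  show "poly (\<Prod>i<n. q i) 0 \<noteq> 0" by (simp add: poly_prod q_def)
  show "Tor (c 0) = mat_id N" unfolding c1 by (rule Tor_1)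
  show "poly (\<Prod>i<n. q i) 1 \<noteq> 0" using t by (simp add: poly_prod q_def torus_def)
  fix i j
  have 1: "ratf (\<Prod>i<n. q i) (\<lambda>s. chr n (c s) v)" for v unfolding chr_def c_def by (rule ratf_prod_powi) simp
  show "ratf (\<Prod>i<n. q i) (\<lambda>s. Tor (c s) i j)"
   using 1 ratf_const[of _ 0] by (cases "i < N \<and> i = j") (auto simp: Tor_def mdiag_def)
  have "chr n (\<lambda>i. inverse (c s i)) v = chr n (c s) (- v)" for s v
   unfolding chr_def by (rule prod.cong) (simp_all add: power_int_minus power_int_inverse)
  then show "ratf (\<Prod>i<n. q i) (\<lambda>s. Tor (\<lambda>i. inverse (c s i)) i j)"
   using 1 ratf_const[of _ 0] by (cases "i < N \<and> i = j") (auto simp: Tor_def mdiag_def)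
 qed
 then show ?thesis unfolding c1 .
qed

lemma exp_neutral:
 assumes PQ: "is_inverse N U V" "padded N U" and H: "\<And>g. g \<in> Aut_M ms \<Longrightarrow> cj N U V g \<in> H"
  and al: "allowed n S \<alpha> m" "\<alpha> \<noteq> 0"
 shows "cj N U V (of_fun (\<lambda>p q. poly (mroot.ec \<alpha> m p q) s)) \<in> neutral_comp N (H :: (nat \<Rightarrow> nat \<Rightarrow> 'k::field_char_0) set)"
proof -
 interpret R: mroot n S ms \<alpha> m by unfold_locales (rule al)+
 have "cj N U V (R.expm s) \<in> neutral_comp N H"
 proof (rule cj_curve[OF PQ, where c = R.expm and d = "\<lambda>s. R.expm (- s)" and q = 1 and a = 0])
  show "is_inverse N (R.expm s) (R.expm (- s))" for s :: 'k by (rule R.is_inverse_expm)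
  show "cj N U V (R.expm s) \<in> H" for s by (rule H[OF R.expm_Aut])
  show "R.expm 0 = mat_id N" by (rule R.expm_0)
  fix i j
  show "ratf 1 (\<lambda>s. R.expm s i j)" unfolding R.evm_ec[symmetric] evm_def by (rule ratf_poly)
  have "ratf 1 (poly (pcompose (of_fun R.ec i j) [:0, - 1:]) :: 'k \<Rightarrow> 'k)" by (rule ratf_poly)
  then show "ratf 1 (\<lambda>s :: 'k. R.expm (- s) i j)"
   by (rule ratf_cong) (simp add: evm_def poly_pcompose flip: R.evm_ec)
 qed simp_all
 then show ?thesis unfolding R.expm_def .
qed

end

text \<open>Weight 0 belongs to the derivations x_m d/dx_m. It is counted here because
  \<open>wt_le\<close> compares nonzero weights only.\<close>

lemma (in staircase) wt_0: "wt n S 0 = n"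
proof -
 have "{m. allowed n S 0 m} = {..<n}" using allowed_nonneg[of 0] S_uv by auto
 then show ?thesis unfolding wt_def by simp
qed

lemma aut_mats_cong:
 assumes "\<And>i j k. i < N \<Longrightarrow> j < N \<Longrightarrow> k < N \<Longrightarrow> sc i j k = sc' i j k" "\<And>k. k < N \<Longrightarrow> u k = u' k"
 shows "aut_mats N sc u = aut_mats N sc' u'"
 unfolding aut_mats_def using assms by simp

lemma downset_std_monos:
 assumes E: "monomial_ideal n E" "full_monomial_ideal n E" "finite (std_monos n E)"
 shows "downset n (ive ` std_monos n E)"
 unfolding downset_def
proof (intro conjI ballI allI impI)
 show "finite (ive ` std_monos n E)" using E(3) by simp
 show "0 \<le> p" "p \<in> Zn n" if "p \<in> ive ` std_monos n E" for p
  using that unfolding std_monos_def expvecs_def Zn_def by (auto simp: le_fun_def)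
 show "0 \<in> ive ` std_monos n E"
  by (rule image_eqI[of _ _ "\<lambda>_. 0"]) (use E(1) in \<open>simp_all add: std_monos_def expvecs_def monomial_ideal_def\<close>)
 show "uv i \<in> ive ` std_monos n E" if i: "i < n" for i
 proof (rule image_eqI)
  show "uv i = ive (unitvec i)" by (simp add: fun_eq_iff uv_apply unitvec_def)
  show "unitvec i \<in> std_monos n E" using i E(2) by (simp add: std_monos_def expvecs_def unitvec_def full_monomial_ideal_def)
 qed
 fix p q assume p: "p \<in> ive ` std_monos n E" and q: "0 \<le> q \<and> q \<le> p"
 then obtain a where a: "p = ive a" "a \<in> std_monos n E" by blast
 define b where "b i = nat (q i)" for i
 have qb: "q = ive b" using q by (auto simp: fun_eq_iff b_def le_fun_def)
 have ba: "b i \<le> a i" for i using q unfolding qb a(1) by (simp add: le_fun_def)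
 have aE: "a \<in> expvecs n" "a \<notin> E" using a(2) unfolding std_monos_def by blast+
 have "b i = 0" if "n \<le> i" for i using ba[of i] aE(1) that unfolding expvecs_def by simp
 then have bE: "b \<in> expvecs n" unfolding expvecs_def by simp
 have "b \<notin> E" using E(1) aE ba unfolding monomial_ideal_def by blast
 then show "q \<in> ive ` std_monos n E" unfolding qb std_monos_def using bE by blast
qed

lemma (in kalg) monalg_iso:
 fixes n :: nat and E :: "(nat \<Rightarrow> nat) set" and M :: "(nat \<Rightarrow> nat) \<Rightarrow> 'b"
 defines "T \<equiv> std_monos n E"
 assumes fin: "finite T" and M_add: "\<And>a b. M (addvec a b) = M a * M b" and M_0: "M (\<lambda>_. 0) = 1" and T0: "(\<lambda>_. 0) \<in> T"
  and M_E: "\<And>a. a \<in> expvecs n \<Longrightarrow> a \<notin> T \<Longrightarrow> M a = 0"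
  and span: "\<And>x. \<exists>d. x = (\<Sum>a\<in>T. \<iota> (d a) * M a)"
  and indep: "\<And>c a. (\<Sum>a\<in>T. \<iota> (c a) * M a) = 0 \<Longrightarrow> a \<in> T \<Longrightarrow> c a = 0"
 shows "\<exists>f. alg_iso_to_monalg \<iota> n E f"
proof -
 define L where "L u = (\<Sum>a\<in>T. \<iota> (u a) * M a)" for u
 define f where "f x = (SOME u. u \<in> mcar n E \<and> x = L u)" for x
 have mcar: "u \<in> mcar n E \<longleftrightarrow> (\<forall>a. a \<notin> T \<longrightarrow> u a = 0)" for u :: "(nat \<Rightarrow> nat) \<Rightarrow> 'k" unfolding mcar_def T_def by simp
 have f: "f x \<in> mcar n E" "L (f x) = x" for x
 proof -
  obtain d where d: "x = (\<Sum>a\<in>T. \<iota> (d a) * M a)" using span by blast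
  have "x = L (\<lambda>a. if a \<in> T then d a else 0)" unfolding d L_def by (rule sum.cong) auto
  then have "\<exists>u. u \<in> mcar n E \<and> x = L u" by (intro exI[of _ "\<lambda>a. if a \<in> T then d a else 0"]) (simp add: mcar)
  from someI_ex[OF this] show "f x \<in> mcar n E" "L (f x) = x" unfolding f_def by auto
 qed
 have uniq: "f x = u" if u: "u \<in> mcar n E" "L u = x" for x u
 proof
  fix a
  have "(\<Sum>a\<in>T. \<iota> (f x a - u a) * M a) = L (f x) - L u" unfolding L_def by (simp add: \<iota>_diff left_diff_distrib sum_subtractf)
  then have z: "(\<Sum>a\<in>T. \<iota> (f x a - u a) * M a) = 0" using f(2) u(2) by simp
  show "f x a = u a"
  proof (cases "a \<in> T")
   case True then show ?thesis using indep[OF z True] by simp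
  next
   case False then show ?thesis using f(1)[of x] u(1) unfolding mcar by simp
  qed
 qed
 have "bij_betw f UNIV (mcar n E)"
 proof (rule bij_betw_byWitness[where f' = L])
  show "\<forall>x\<in>UNIV. L (f x) = x" using f(2) by blast
  show "\<forall>u\<in>mcar n E. f (L u) = u" using uniq by blast
  show "f ` UNIV \<subseteq> mcar n E" using f(1) by blast
 qed simp
 moreover have "f (x + y) = madd (f x) (f y)" for x y
 proof (rule uniq)
  show "madd (f x) (f y) \<in> mcar n E" using f(1)[of x] f(1)[of y] unfolding mcar madd_def by simp
  have "L (madd (f x) (f y)) = L (f x) + L (f y)" unfolding L_def madd_def by (simp add: \<iota>_add distrib_right sum.distrib)
  then show "L (madd (f x) (f y)) = x + y" unfolding f(2) .
 qed
 moreover have "f (\<iota> c * x) = msmul c (f x)" for c x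
 proof (rule uniq)
  show "msmul c (f x) \<in> mcar n E" using f(1)[of x] unfolding mcar msmul_def by simp
  have "L (msmul c (f x)) = \<iota> c * L (f x)" unfolding L_def msmul_def by (simp add: \<iota>_mult sum_distrib_left mult.assoc)
  then show "L (msmul c (f x)) = \<iota> c * x" unfolding f(2) .
 qed
 moreover have "f (x * y) = mmul n E (f x) (f y)" for x y
 proof (rule uniq)
  show "mmul n E (f x) (f y) \<in> mcar n E" unfolding mcar mmul_def T_def by simp
  let ?g = "\<lambda>(a, b). \<iota> (f x a * f y b) * M (addvec a b)"
  let ?S = "{p \<in> T \<times> T. addvec (fst p) (snd p) \<in> T}"
  have "L (mmul n E (f x) (f y)) = (\<Sum>m\<in>T. \<Sum>p\<in>{p \<in> ?S. addvec (fst p) (snd p) = m}. ?g p)"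
   unfolding L_def
  proof (rule sum.cong[OF refl])
   fix m assume m: "m \<in> T"
   have e: "{(a, b). a \<in> T \<and> b \<in> T \<and> addvec a b = m} = {p \<in> ?S. addvec (fst p) (snd p) = m}" using m by auto
   have "\<iota> (mmul n E (f x) (f y) m) * M m = (\<Sum>p\<in>{p \<in> ?S. addvec (fst p) (snd p) = m}. \<iota> (case p of (a, b) \<Rightarrow> f x a * f y b) * M m)"
    using m unfolding mmul_def T_def[symmetric] e by (simp add: \<iota>_sum sum_distrib_right)
   also have "\<dots> = (\<Sum>p\<in>{p \<in> ?S. addvec (fst p) (snd p) = m}. ?g p)" by (rule sum.cong) auto
   finally show "\<iota> (mmul n E (f x) (f y) m) * M m = (\<Sum>p\<in>{p \<in> ?S. addvec (fst p) (snd p) = m}. ?g p)" .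
  qed
  also have "\<dots> = (\<Sum>p\<in>?S. ?g p)" by (rule sum.group) (use fin in auto)
  \<comment> \<open>\<open>mmul\<close> drops the pairs whose product is not standard. They may be
    restored, because their monomial is 0 in the algebra.\<close>
  also have "\<dots> = (\<Sum>p\<in>T \<times> T. ?g p)"
  proof (rule sum.mono_neutral_left)
   show "\<forall>p\<in>T \<times> T - ?S. ?g p = 0"
   proof
    fix p assume p: "p \<in> T \<times> T - ?S"
    obtain a b where ab: "p = (a, b)" by (cases p)
    have "a \<in> expvecs n" "b \<in> expvecs n" using p unfolding ab T_def std_monos_def by auto
    then have "addvec a b \<in> expvecs n" by (simp add: expvecs_def addvec_def)
    moreover have "addvec a b \<notin> T" using p unfolding ab by auto
    ultimately show "?g p = 0" using M_E ab by simp
   qed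
  qed (use fin in auto)
  also have "\<dots> = L (f x) * L (f y)"
   unfolding L_def sum_product sum.cartesian_product by (rule sum.cong) (auto simp: M_add \<iota>_mult mult_ac)
  finally show "L (mmul n E (f x) (f y)) = x * y" unfolding f(2) .
 qed
 moreover have "f 1 = mone"
 proof (rule uniq)
  show "(mone :: (nat \<Rightarrow> nat) \<Rightarrow> 'k) \<in> mcar n E" using T0 unfolding mcar mone_def by auto
  have "L mone = (\<Sum>a\<in>T. if a = (\<lambda>_. 0) then M a else 0)" unfolding L_def mone_def by (rule sum.cong) auto
  then show "L mone = 1" using fin T0 M_0 by simp
 qed
 ultimately show ?thesis unfolding alg_iso_to_monalg_def by blast
qed

section \<open>Change of basis\<close>

locale kbases = A: kbasis \<iota> bs + B: kbasis \<iota> bs' for \<iota> :: "'k::field_char_0 \<Rightarrow> 'b::comm_ring_1" and bs bs' +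
 assumes len: "length bs' = length bs"
begin

abbreviation "D \<equiv> length bs"

definition P :: "nat \<Rightarrow> nat \<Rightarrow> 'k" where "P = (\<lambda>l k. if l < D \<and> k < D then A.cx (bs' ! k) l else 0)"
definition Q :: "nat \<Rightarrow> nat \<Rightarrow> 'k" where "Q = (\<lambda>l k. if l < D \<and> k < D then B.cx (bs ! k) l else 0)"

lemma coords_P: "l < D \<Longrightarrow> A.cx x l = (\<Sum>k<D. P l k * B.cx x k)"
 by (subst (1) B.coords_spec(2)[of x, symmetric]) (simp add: A.coords_sum A.coords_scale P_def len, simp add: mult.commute)

lemma coords_Q: "l < D \<Longrightarrow> B.cx x l = (\<Sum>k<D. Q l k * A.cx x k)"
 by (subst (1) A.coords_spec(2)[of x, symmetric]) (simp add: B.coords_sum B.coords_scale Q_def len, simp add: mult.commute)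

lemma padded_P: "padded D P" and padded_Q: "padded D Q" by (auto simp: padded_def P_def Q_def)

lemma is_inverse_PQ: "is_inverse D P Q"
 unfolding is_inverse_def
proof (intro conjI padded_Q ext)
 fix i j
 show "mat_mul D P Q i j = mat_id D i j"
  using coords_P[of i "bs ! j"] A.coords_basis[of j i] by (auto simp: mat_mul_def mat_id_def Q_def)
 show "mat_mul D Q P i j = mat_id D i j"
  using coords_Q[of i "bs' ! j"] B.coords_basis[of j i] by (auto simp: mat_mul_def mat_id_def P_def len)
qed

lemma act_cj: "A.act (cj D P Q g) x = B.act g x"
proof (rule A.coords_inj)
 fix l assume l: "l < D"
 have "(\<Sum>k<D. cj D P Q g l k * A.cx x k) = (\<Sum>k<D. \<Sum>a<D. P l a * ((\<Sum>b<D. g a b * Q b k) * A.cx x k))"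
  by (rule sum.cong[OF refl]) (simp add: cj_entry l sum_distrib_right mult.assoc)
 also have "\<dots> = (\<Sum>a<D. P l a * (\<Sum>k<D. \<Sum>b<D. g a b * (Q b k * A.cx x k)))"
  by (subst sum.swap) (simp add: sum_distrib_left sum_distrib_right mult.assoc)
 also have "\<dots> = (\<Sum>a<D. P l a * B.cx (B.act g x) a)"
 proof (rule sum.cong[OF refl])
  fix a assume a: "a \<in> {..<D}"
  have "(\<Sum>k<D. \<Sum>b<D. g a b * (Q b k * A.cx x k)) = (\<Sum>b<D. g a b * B.cx x b)"
   by (subst sum.swap) (simp add: coords_Q sum_distrib_left)
  then show "P l a * (\<Sum>k<D. \<Sum>b<D. g a b * (Q b k * A.cx x k)) = P l a * B.cx (B.act g x) a"
   using a B.coords_act[of a g x] len by simp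
 qed
 also have "\<dots> = A.cx (B.act g x) l" using coords_P[OF l] by simp
 finally show "A.cx (A.act (cj D P Q g) x) l = A.cx (B.act g x) l" unfolding A.coords_act[OF l] .
qed

lemma Aut_cj: "g \<in> Aut_B \<iota> bs' \<Longrightarrow> cj D P Q g \<in> Aut_B \<iota> bs"
 unfolding A.Aut_B_iff B.Aut_B_iff act_cj using cj_invertible[OF is_inverse_PQ padded_P] len by metis

lemma Aut_cj': assumes "g \<in> Aut_B \<iota> bs" shows "cj D Q P g \<in> Aut_B \<iota> bs'"
proof -
 have g: "invertible_mat D g" "padded D g" using assms unfolding A.Aut_B_iff invertible_mat_def by blast+
 have i: "is_inverse D Q P" using is_inverse_PQ padded_P unfolding is_inverse_def by blast
 have "B.act (cj D Q P g) x = A.act g x" for x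
  unfolding act_cj[symmetric] cj_cj(2)[OF is_inverse_PQ padded_P g(2)] ..
 then show ?thesis using assms cj_invertible[OF i padded_Q g(1)] unfolding A.Aut_B_iff B.Aut_B_iff len by simp
qed

end

lemma cj_mat_id: "padded N g \<Longrightarrow> cj N (mat_id N) (mat_id N) g = g"
 unfolding cj_def by (simp add: mat_mul_id)

lemma is_inverse_id: "is_inverse N (mat_id N) (mat_id N)" by (simp add: is_inverse_def mat_mul_id)

context kweights
begin

lemma card_std: "card std = D"
proof (rule antisym)
 show "card std \<le> D"
 proof (rule ccontr)
  assume "\<not> card std \<le> D"
  then have "card {..<D} < card std" by simp
  from nontrivial_solution[OF _ finite_std this, of "\<lambda>a. cx (ymon a)"] obtain c
   where c: "\<exists>a\<in>std. c a \<noteq> 0" "\<forall>j\<in>{..<D}. (\<Sum>a\<in>std. c a * cx (ymon a) j) = 0" by auto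
  have "(\<Sum>a\<in>std. \<iota> (c a) * ymon a) = 0"
   by (rule coords_inj) (use c(2) in \<open>simp add: coords_sum coords_scale coords_0\<close>)
  then show False using ymon_independent c(1) by blast
 qed
 show "D \<le> card std"
 proof (rule ccontr)
  assume "\<not> D \<le> card std"
  then have lt: "card std < card {..<D}" by simp
  have "\<forall>k. \<exists>d. bs ! k = (\<Sum>b\<in>std. \<iota> (d b) * ymon b)" using span by blast
  from choice[OF this] obtain d where d: "\<forall>k. bs ! k = (\<Sum>b\<in>std. \<iota> (d k b) * ymon b)" ..
  from nontrivial_solution[OF finite_std _ lt, of d] obtain c
   where c: "\<exists>k\<in>{..<D}. c k \<noteq> 0" "\<forall>b\<in>std. (\<Sum>k<D. c k * d k b) = 0" by auto
  have "(\<Sum>k<D. \<iota> (c k) * bs ! k) = (\<Sum>k<D. \<Sum>b\<in>std. \<iota> (c k * d k b) * ymon b)"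
   by (rule sum.cong[OF refl]) (simp only: d[rule_format] sum_distrib_left \<iota>_mult mult.assoc)
  also have "\<dots> = (\<Sum>b\<in>std. \<iota> (\<Sum>k<D. c k * d k b) * ymon b)"
   unfolding \<iota>_sum sum_distrib_right by (rule sum.swap)
  also have "\<dots> = 0" using c(2) by simp
  finally have z: "0 = (\<Sum>k<D. \<iota> (c k) * bs ! k)" by simp
  have "c k = 0" if "k < D" for k using coords_eqI[OF z that] coords_0[OF that] by simp
  then show False using c(1) by blast
 qed
qed

lemma sum_nth: assumes "distinct xs" "set xs = std" shows "(\<Sum>k<length xs. f (xs ! k)) = (\<Sum>a\<in>std. f a)"
 using sum.reindex_bij_betw[OF bij_betw_nth[OF assms(1) refl refl], of f] assms(2) by simp

lemma is_basis_ymon: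
 assumes xs: "distinct xs" "set xs = std" shows "is_basis \<iota> (map ymon xs)"
 unfolding is_basis_def
proof (intro allI ex_ex1I)
 fix x
 obtain d where d: "x = (\<Sum>a\<in>std. \<iota> (d a) * ymon a)" using span by blast
 have "x = (\<Sum>k<length xs. \<iota> (d (xs ! k)) * ymon (xs ! k))" unfolding d sum_nth[OF xs, of "\<lambda>a. \<iota> (d a) * ymon a"] ..
 then show "\<exists>c. (\<forall>k\<ge>length (map ymon xs). c k = 0) \<and> x = (\<Sum>k<length (map ymon xs). \<iota> (c k) * map ymon xs ! k)"
  by (intro exI[of _ "\<lambda>k. if k < length xs then d (xs ! k) else 0"]) simp
next
 fix x c c'
 assume c: "(\<forall>k\<ge>length (map ymon xs). c k = 0) \<and> x = (\<Sum>k<length (map ymon xs). \<iota> (c k) * map ymon xs ! k)"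
  and c': "(\<forall>k\<ge>length (map ymon xs). c' k = 0) \<and> x = (\<Sum>k<length (map ymon xs). \<iota> (c' k) * map ymon xs ! k)"
 define ix where "ix = inv_into {..<length xs} ((!) xs)"
 have ix: "ix (xs ! k) = k" if "k < length xs" for k
  unfolding ix_def by (rule inv_into_f_f) (use that xs(1) in \<open>auto simp: inj_on_nth\<close>)
 have "(\<Sum>a\<in>std. \<iota> (c (ix a) - c' (ix a)) * ymon a) = (\<Sum>k<length xs. \<iota> (c k - c' k) * ymon (xs ! k))"
  unfolding sum_nth[OF xs, symmetric] by (rule sum.cong) (simp_all add: ix)
 also have "\<dots> = (\<Sum>k<length xs. \<iota> (c k) * ymon (xs ! k)) - (\<Sum>k<length xs. \<iota> (c' k) * ymon (xs ! k))"
  by (simp add: \<iota>_diff left_diff_distrib sum_subtractf)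
 also have "\<dots> = 0"
 proof -
  have "(\<Sum>k<length xs. \<iota> (c k) * ymon (xs ! k)) = x" using c by simp
  moreover have "(\<Sum>k<length xs. \<iota> (c' k) * ymon (xs ! k)) = x" using c' by simp
  ultimately show ?thesis by (simp only: diff_self)
 qed
 finally have z: "(\<Sum>a\<in>std. \<iota> (c (ix a) - c' (ix a)) * ymon a) = 0" .
 show "c = c'"
 proof
  fix k show "c k = c' k"
  proof (cases "k < length xs")
   case True
   then have "xs ! k \<in> std" using xs(2) nth_mem by blast
   from ymon_independent[OF z this] show ?thesis unfolding ix[OF True] by simp
  next
   case False then show ?thesis using c c' by simp
  qed
 qed
qed

text \<open>A product of two standard monomials is a standard monomial or 0, so in this basis the
  structure constants are those of a monomial algebra.\<close>

lemma Aut_B_ymon: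
 assumes xs: "distinct xs" "set xs = std" shows "Aut_B \<iota> (map ymon xs) = Aut_M xs"
proof -
 interpret Y: kbasis \<iota> "map ymon xs" by unfold_locales (rule is_basis_ymon[OF xs])
 have k: "Y.cx (ymon a) k = (if a = xs ! k then 1 else 0)" if a: "a \<in> expvecs n" and k: "k < length xs" for a k
 proof (cases "a \<in> std")
  case True
  then have "a \<in> set xs" unfolding xs(2) .
  then obtain i where i: "i < length xs" "a = xs ! i" by (auto simp: in_set_conv_nth)
  then show ?thesis using Y.coords_basis[of i k] k nth_eq_iff_index_eq[OF xs(1) i(1) k] by auto
 next
  case False
  then have "ymon a = 0" using a unfolding std_def by blast
  moreover have "a \<noteq> xs ! k" using False k nth_mem[OF k] xs(2) by blast
  ultimately show ?thesis using Y.coords_0[of k] k by simp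
 qed
 have e: "xs ! i \<in> expvecs n" if "i < length xs" for i using nth_mem[OF that] xs(2) unfolding std_def by blast
 have ea: "addvec (xs ! i) (xs ! j) \<in> expvecs n" if "i < length xs" "j < length xs" for i j
  using e[OF that(1)] e[OF that(2)] by (simp add: expvecs_def addvec_def)
 have e0: "(\<lambda>_. 0) \<in> expvecs n" by (simp add: expvecs_def)
 show ?thesis unfolding Aut_B_def Aut_M_def length_map
 proof (rule aut_mats_cong)
  fix i j l assume "i < length xs" "j < length xs" "l < length xs"
  then show "Y.cx (map ymon xs ! i * map ymon xs ! j) l = (if addvec (xs ! i) (xs ! j) = xs ! l then 1 else 0)"
   using k[OF ea, of i j l] by (simp add: ymon_add)
 next
  fix l assume "l < length xs"
  then show "Y.cx 1 l = (if l < length xs \<and> xs ! l = (\<lambda>_. 0) then 1 else 0)"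
   using k[OF e0, of l] by auto
 qed
qed

text \<open>In the monomial basis B has an automorphism group of the form \<open>Aut_M\<close>, so
  \<open>wt_le\<close> applies to the isomorphism and to its inverse and gives equal multiplicities.
  The permutation from \<open>wpair.ex_perm\<close> then renames the generators so that their
  nonzero monomials are the standard monomials of E.\<close>

lemma conclude:
 fixes ms :: "(nat \<Rightarrow> nat) list" and \<phi> \<theta> :: "(nat \<Rightarrow> nat \<Rightarrow> 'a) \<Rightarrow> nat \<Rightarrow> nat \<Rightarrow> 'a"
 defines "GM \<equiv> neutral_comp (length ms) (Aut_M ms :: (nat \<Rightarrow> nat \<Rightarrow> 'a) set)" and "GB \<equiv> neutral_comp D (Aut_B \<iota> bs)"
 assumes E: "monomial_ideal n E" "full_monomial_ideal n E" "finite (std_monos n E)"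
  and ms: "distinct ms" "set ms = std_monos n E"
  and \<theta>: "\<And>g. g \<in> GM \<Longrightarrow> \<theta> g \<in> GB" "\<And>g h. g \<in> GM \<Longrightarrow> h \<in> GM \<Longrightarrow> \<theta> (mat_mul (length ms) g h) = mat_mul D (\<theta> g) (\<theta> h)"
   "\<And>i j. i < D \<Longrightarrow> j < D \<Longrightarrow> \<exists>f\<in>reg_fun (length ms). \<forall>g\<in>GM. \<theta> g i j = f g"
  and \<phi>: "\<And>g. g \<in> GB \<Longrightarrow> \<phi> g \<in> GM" "\<And>g h. g \<in> GB \<Longrightarrow> h \<in> GB \<Longrightarrow> \<phi> (mat_mul D g h) = mat_mul (length ms) (\<phi> g) (\<phi> h)"
   "\<And>i j. i < length ms \<Longrightarrow> j < length ms \<Longrightarrow> \<exists>f\<in>reg_fun D. \<forall>g\<in>GB. \<phi> g i j = f g"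
  and inv: "\<And>g. g \<in> GM \<Longrightarrow> \<phi> (\<theta> g) = g" "\<And>g. g \<in> GB \<Longrightarrow> \<theta> (\<phi> g) = g"
  and \<rho>: "\<And>t. t \<in> torus n \<Longrightarrow> \<rho> t = \<theta> (monlist.Tor n ms t)"
 shows "\<exists>f. alg_iso_to_monalg \<iota> n E f"
proof -
 let ?S = "ive ` set ms" and ?S' = "ive ` std"
 have dS: "downset n ?S" unfolding ms(2) by (rule downset_std_monos[OF E])
 interpret A: monlist n ?S ms by unfold_locales (rule dS ms(1) refl)+
 obtain xs where xs: "set xs = std" "distinct xs" using finite_distinct_list[OF finite_std] by blast
 interpret B: monlist n ?S' xs by unfold_locales (rule downset_std, rule xs(2), simp only: xs(1))
 have lxs: "length xs = D" using card_std distinct_card[OF xs(2)] xs(1) by simp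
 interpret K: kbases \<iota> bs "map ymon xs"
  by unfold_locales (rule is_basis_ymon[OF xs(2,1)], simp add: lxs)
 let ?c = "cj D K.P K.Q" and ?u = "cj D K.Q K.P"
 note PQ = K.is_inverse_PQ and Pp = K.padded_P and Qp = K.padded_Q
 have QP: "is_inverse D K.Q K.P" using PQ Pp unfolding is_inverse_def by blast
 have AB: "Aut_B \<iota> (map ymon xs) = Aut_M xs" by (rule Aut_B_ymon[OF xs(2,1)])
 have subM: "GM \<subseteq> Aut_M ms" and subB: "GB \<subseteq> Aut_B \<iota> bs" unfolding GM_def GB_def by (rule neutral_comp_subset)+
 have invM: "invertible_mat (length ms) g" if "g \<in> Aut_M ms" for g :: "nat \<Rightarrow> nat \<Rightarrow> 'a"
  using that unfolding Aut_M_def by (rule aut_mats_invertible)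
 have invX: "invertible_mat D g" if "g \<in> Aut_M xs" for g :: "nat \<Rightarrow> nat \<Rightarrow> 'a"
  using that unfolding Aut_M_def lxs by (rule aut_mats_invertible)
 have invB: "invertible_mat D g" if "g \<in> Aut_B \<iota> bs" for g using that unfolding Aut_B_def by (rule aut_mats_invertible)
 have padB: "padded D g" if "g \<in> GB" for g using invB subB that unfolding invertible_mat_def by blast
 have padX: "padded D g" if "g \<in> Aut_M xs" for g :: "nat \<Rightarrow> nat \<Rightarrow> 'a" using invX[OF that] unfolding invertible_mat_def by blast
 have padM: "padded (length ms) g" if "g \<in> Aut_M ms" for g :: "nat \<Rightarrow> nat \<Rightarrow> 'a" using invM[OF that] unfolding invertible_mat_def by blast
 have mulM: "mat_mul (length ms) g h \<in> GM" if "g \<in> GM" "h \<in> GM" for g h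
  unfolding GM_def by (rule neutral_comp_mul[OF _ _ that[unfolded GM_def]], erule invM, simp add: Aut_M_def aut_mats_mul)
 have mulB: "mat_mul D g h \<in> GB" if "g \<in> GB" "h \<in> GB" for g h
  unfolding GB_def by (rule neutral_comp_mul[OF _ _ that[unfolded GB_def]], erule invB, simp add: Aut_B_def aut_mats_mul)
 \<comment> \<open>The neutral component formed in the given basis and rewritten in the monomial
   one. This avoids comparing neutral components computed in two bases.\<close>
 define GX where "GX = {g \<in> Aut_M xs. ?c g \<in> GB}"
 have GX_I: "g \<in> Aut_M xs \<Longrightarrow> ?c g \<in> GB \<Longrightarrow> g \<in> GX" for g unfolding GX_def by simp
 have GX_D: "g \<in> Aut_M xs" "?c g \<in> GB" if "g \<in> GX" for g using that unfolding GX_def by simp_all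
 have c_Aut: "?c g \<in> Aut_B \<iota> bs" if "g \<in> Aut_M xs" for g by (rule K.Aut_cj) (use that AB in simp)
 have u_Aut: "?u g \<in> Aut_M xs" if "g \<in> Aut_B \<iota> bs" for g using K.Aut_cj'[OF that] AB by simp
 have cu: "?c (?u g) = g" if "g \<in> GB" for g by (rule cj_cj(2)[OF PQ Pp padB[OF that]])
 have uc: "?u (?c g) = g" if "g \<in> Aut_M xs" for g by (rule cj_cj(1)[OF PQ Pp padX[OF that]])
 have u_GX: "?u g \<in> GX" if "g \<in> GB" for g
  by (rule GX_I[OF u_Aut]) (use that subB cu[OF that] in auto)
 have mulX: "mat_mul D g h \<in> GX" if "g \<in> GX" "h \<in> GX" for g h
 proof (rule GX_I)
  show "mat_mul D g h \<in> Aut_M xs" using GX_D(1)[OF that(1)] GX_D(1)[OF that(2)] unfolding Aut_M_def lxs by (rule aut_mats_mul)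
  show "?c (mat_mul D g h) \<in> GB" unfolding cj_mul[OF PQ Pp, symmetric] by (rule mulB[OF GX_D(2)[OF that(1)] GX_D(2)[OF that(2)]])
 qed
 have cM: "cj (length ms) (mat_id (length ms)) (mat_id (length ms)) g \<in> Aut_M ms" if "g \<in> Aut_M ms" for g :: "nat \<Rightarrow> nat \<Rightarrow> 'a"
  unfolding cj_mat_id[OF padM[OF that]] by (rule that)
 have TorM: "A.Tor t \<in> GM" if "t \<in> torus n" for t :: "nat \<Rightarrow> 'a"
 proof -
  have "cj (length ms) (mat_id (length ms)) (mat_id (length ms)) (A.Tor t) \<in> GM"
   unfolding GM_def by (rule A.Tor_neutral[OF is_inverse_id padded_id _ that], rule cM)
  then show ?thesis unfolding cj_mat_id[OF padM[OF A.Tor_Aut[OF that]]] .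
 qed
 have expM: "A.of_fun (\<lambda>p q. poly (mroot.ec \<alpha> m p q) s) \<in> GM" if "allowed n ?S \<alpha> m" "\<alpha> \<noteq> 0" for \<alpha> m and s :: 'a
 proof -
  have "cj (length ms) (mat_id (length ms)) (mat_id (length ms)) (A.of_fun (\<lambda>p q. poly (mroot.ec \<alpha> m p q) s)) \<in> GM"
   unfolding GM_def by (rule A.exp_neutral[OF is_inverse_id padded_id _ that], rule cM)
  then show ?thesis unfolding cj_mat_id[OF A.padded_of_fun] .
 qed
 have TorX: "B.Tor t \<in> GX" if "t \<in> torus n" for t :: "nat \<Rightarrow> 'a"
 proof (rule GX_I[OF B.Tor_Aut[OF that]])
  show "?c (B.Tor t) \<in> GB" unfolding GB_def
   by (rule B.Tor_neutral[unfolded lxs, OF PQ Pp _ that], rule c_Aut)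
 qed
 have expX: "B.of_fun (\<lambda>p q. poly (mroot.ec \<alpha> m p q) s) \<in> GX" if al: "allowed n ?S' \<alpha> m" "\<alpha> \<noteq> 0" for \<alpha> m and s :: 'a
 proof (rule GX_I)
  interpret R: mroot n ?S' xs \<alpha> m by unfold_locales (rule al)+
  show "B.of_fun (\<lambda>p q. poly (mroot.ec \<alpha> m p q) s) \<in> Aut_M xs" using R.expm_Aut[of s] unfolding R.expm_def .
  show "?c (B.of_fun (\<lambda>p q. poly (mroot.ec \<alpha> m p q) s)) \<in> GB" unfolding GB_def
   by (rule B.exp_neutral[unfolded lxs, OF PQ Pp _ al], rule c_Aut)
 qed
 have reg1: "\<exists>f\<in>reg_fun (length ms). \<forall>g\<in>GM. ?u (\<theta> g) i j = f g" if ij: "i < D" "j < D" for i j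
 proof -
  have ex: "\<exists>f. a < D \<and> b < D \<longrightarrow> f \<in> reg_fun (length ms) \<and> (\<forall>g\<in>GM. \<theta> g a b = f g)" for a b
  proof (cases "a < D \<and> b < D")
   case True
   then obtain f where "f \<in> reg_fun (length ms)" "\<forall>g\<in>GM. \<theta> g a b = f g" using \<theta>(3)[of a b] by blast
   then show ?thesis by (intro exI[of _ f]) blast
  next
   case False then show ?thesis by blast
  qed
  have "\<exists>f. \<forall>a b. a < D \<and> b < D \<longrightarrow> f a b \<in> reg_fun (length ms) \<and> (\<forall>g\<in>GM. \<theta> g a b = f a b g)"
   by (rule choice, rule allI, rule choice, rule allI, rule ex)
  then obtain f where f: "\<And>a b. a < D \<Longrightarrow> b < D \<Longrightarrow> f a b \<in> reg_fun (length ms)"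
   "\<And>a b g. a < D \<Longrightarrow> b < D \<Longrightarrow> g \<in> GM \<Longrightarrow> \<theta> g a b = f a b g" by blast
  have "(\<lambda>g. \<Sum>a<D. K.Q i a * (\<Sum>b<D. f a b g * K.P b j)) \<in> reg_fun (length ms)"
   by (intro reg_fun_sum reg_fun.rf_mul reg_fun.rf_const f(1)) simp_all
  moreover have "?u (\<theta> g) i j = (\<Sum>a<D. K.Q i a * (\<Sum>b<D. f a b g * K.P b j))" if "g \<in> GM" for g
   unfolding cj_entry[OF ij] by (intro sum.cong[OF refl] arg_cong[where f = "\<lambda>x. _ * x"] arg_cong[where f = "\<lambda>x. x * _"] f(2) that) simp_all
  ultimately show ?thesis by (intro bexI[where x = "\<lambda>g. \<Sum>a<D. K.Q i a * (\<Sum>b<D. f a b g * K.P b j)"] ballI)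
 qed
 have reg2: "\<exists>f\<in>reg_fun D. \<forall>g\<in>GX. \<phi> (?c g) i j = f g" if ij: "i < length ms" "j < length ms" for i j
 proof -
  obtain f where f: "f \<in> reg_fun D" "\<forall>g\<in>GB. \<phi> g i j = f g" using \<phi>(3)[OF ij] by blast
  have h: "\<exists>h\<in>reg_fun D. \<forall>g\<in>GX. f (?c g) = h g"
  proof (rule reg_fun_comp[OF f(1)])
   fix a b assume ab: "a < D" "b < D"
   show "\<exists>h\<in>reg_fun D. \<forall>g\<in>GX. ?c g a b = h g" by (rule bexI[OF _ cj_reg_fun[OF PQ Pp ab]]) simp
   show "\<exists>h\<in>reg_fun D. \<forall>g\<in>GX. mat_inv D (?c g) a b = h g"
    by (rule bexI[OF _ cj_inv_reg_fun[OF PQ Pp ab]]) (simp add: cj_mat_inv[OF PQ Pp invX[OF GX_D(1)]])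
  qed
  have "\<phi> (?c g) i j = f (?c g)" if "g \<in> GX" for g using f(2) GX_D(2)[OF that] by simp
  then show ?thesis using h by simp
 qed
 have Tor_eq: "?u (\<theta> (A.Tor t)) = B.Tor (\<tau>' t)" if t: "t \<in> torus n" for t
 proof (rule K.B.act_inject)
  have \<rho>B: "\<rho> t \<in> GB" using \<rho>[OF t] \<theta>(1)[OF TorM[OF t]] by simp
  show "padded (length (map ymon xs)) (?u (\<theta> (A.Tor t)))" unfolding length_map lxs by simp
  show "padded (length (map ymon xs)) (B.Tor (\<tau>' t))" by simp
  fix x
  have b: "act (\<rho> t) (ymon a) = \<iota> (chr n (\<tau>' t) (ive a)) * ymon a" for a unfolding R_ymon[OF t] chr_\<tau>'[OF t] ..
  have "K.B.act (?u (\<rho> t)) x = act (\<rho> t) x" unfolding K.act_cj[symmetric] cu[OF \<rho>B] ..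
  also have "\<dots> = (\<Sum>k<length xs. \<iota> (K.B.cx x k) * (\<iota> (chr n (\<tau>' t) (ive (xs ! k))) * ymon (xs ! k)))"
   by (subst (1) K.B.coords_spec(2)[of x, symmetric]) (simp add: act_sum act_scale b)
  also have "\<dots> = K.B.act (B.Tor (\<tau>' t)) x"
  proof -
   have "K.B.act (B.Tor (\<tau>' t)) (ymon (xs ! k)) = \<iota> (chr n (\<tau>' t) (ive (xs ! k))) * ymon (xs ! k)" if k: "k < length xs" for k
   proof -
    have "K.B.act (B.Tor (\<tau>' t)) (map ymon xs ! k) = (\<Sum>l<length xs. \<iota> (B.Tor (\<tau>' t) l k) * map ymon xs ! l)"
     using K.B.act_basis[of k] k by simp
    also have "\<dots> = (\<Sum>l<length xs. if l = k then \<iota> (chr n (\<tau>' t) (ive (xs ! k))) * ymon (xs ! k) else 0)"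
     by (rule sum.cong) (auto simp: B.Tor_def mdiag_def)
    finally show ?thesis using k by simp
   qed
   moreover have e: "K.B.act (B.Tor (\<tau>' t)) x =
     K.B.act (B.Tor (\<tau>' t)) (\<Sum>k<length (map ymon xs). \<iota> (K.B.cx x k) * map ymon xs ! k)"
    unfolding K.B.coords_spec ..
   ultimately show ?thesis unfolding e by (simp add: K.B.act_sum K.B.act_scale)
  qed
  finally show "K.B.act (?u (\<theta> (A.Tor t))) x = K.B.act (B.Tor (\<tau>' t)) x" unfolding \<rho>[OF t] .
 qed
 have M1: "mpair n ?S ?S' ms xs GM GX (\<lambda>g. ?u (\<theta> g)) (\<lambda>g. \<phi> (?c g)) wx \<tau>'"
 proof (rule mpair.intro[OF A.monlist_axioms B.monlist_axioms], rule mpair_axioms.intro)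
  show "GX \<subseteq> Aut_M xs" by (rule subsetI, rule GX_D(1))
  show "?u (\<theta> g) \<in> GX" if "g \<in> GM" for g by (rule u_GX[OF \<theta>(1)[OF that]])
  show "?u (\<theta> (mat_mul (length ms) g h)) = mat_mul (length xs) (?u (\<theta> g)) (?u (\<theta> h))" if "g \<in> GM" "h \<in> GM" for g h
   unfolding \<theta>(2)[OF that] lxs cj_mul[OF QP Qp] ..
  show "\<exists>f\<in>reg_fun (length ms). \<forall>g\<in>GM. ?u (\<theta> g) i j = f g" if "i < length xs" "j < length xs" for i j
   by (rule reg1) (use that in \<open>simp_all only: lxs\<close>)
  show "\<exists>f\<in>reg_fun (length xs). \<forall>g\<in>GX. \<phi> (?c g) i j = f g" if "i < length ms" "j < length ms" for i j
   unfolding lxs by (rule reg2[OF that])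
  show "\<phi> (?c (?u (\<theta> g))) = g" if "g \<in> GM" for g unfolding cu[OF \<theta>(1)[OF that]] by (rule inv(1)[OF that])
  show "\<tau>' t \<in> torus n" if "t \<in> torus n" for t by (rule \<tau>'_torus[OF that])
  show "chr n (\<tau>' t) v = chr n t (wx v)" if "t \<in> torus n" for t v by (rule chr_\<tau>'[OF that])
 qed (rule subM mulM TorM Tor_eq expM wx_Zn wx_inject; assumption)+
 \<comment> \<open>The substitution inverse to \<open>\<tau>'\<close> as far as characters can tell,
   built from the preimages \<open>W i\<close> of the unit vectors.\<close>
 define \<tau>2 where "\<tau>2 t = (\<lambda>i. chr n t (W i))" for t :: "nat \<Rightarrow> 'a"
 have \<tau>2: "\<tau>2 t \<in> torus n" "chr n (\<tau>2 t) v = chr n t (\<psi> v)" if "t \<in> torus n" for t v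
  unfolding \<tau>2_def \<psi>_def by (subst torus_def, simp add: chr_neq_0[OF that], rule chr_subst[OF that])
 have Tor_eq2: "\<phi> (?c (B.Tor t)) = A.Tor (\<tau>2 t)" if t: "t \<in> torus n" for t
 proof -
  have "chr n (\<tau>' (\<tau>2 t)) v = chr n t v" if "v \<in> Zn n" for v
   unfolding chr_\<tau>'[OF \<tau>2(1)[OF t]] \<tau>2(2)[OF t] \<psi>_wx[OF that] ..
  then have "B.Tor (\<tau>' (\<tau>2 t)) = B.Tor t"
   unfolding B.Tor_def using B.S_Zn[OF B.im_S] by (intro ext) (simp add: mdiag_def)
  then have "?c (B.Tor t) = ?c (?u (\<theta> (A.Tor (\<tau>2 t))))" using Tor_eq[OF \<tau>2(1)[OF t]] by simp
  also have "\<dots> = \<theta> (A.Tor (\<tau>2 t))" by (rule cu[OF \<theta>(1)[OF TorM[OF \<tau>2(1)[OF t]]]])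
  finally show ?thesis using inv(1)[OF TorM[OF \<tau>2(1)[OF t]]] by simp
 qed
 have M2: "mpair n ?S' ?S xs ms GX GM (\<lambda>g. \<phi> (?c g)) (\<lambda>g. ?u (\<theta> g)) \<psi> \<tau>2"
 proof (rule mpair.intro[OF B.monlist_axioms A.monlist_axioms], rule mpair_axioms.intro)
  show "GX \<subseteq> Aut_M xs" by (rule subsetI, rule GX_D(1))
  show "\<phi> (?c g) \<in> GM" if "g \<in> GX" for g by (rule \<phi>(1)[OF GX_D(2)[OF that]])
  show "mat_mul (length xs) g h \<in> GX" if "g \<in> GX" "h \<in> GX" for g h unfolding lxs by (rule mulX[OF that])
  show "\<phi> (?c (mat_mul (length xs) g h)) = mat_mul (length ms) (\<phi> (?c g)) (\<phi> (?c h))" if "g \<in> GX" "h \<in> GX" for g h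
   unfolding lxs cj_mul[OF PQ Pp, symmetric] by (rule \<phi>(2)[OF GX_D(2)[OF that(1)] GX_D(2)[OF that(2)]])
  show "\<exists>f\<in>reg_fun (length ms). \<forall>g\<in>GM. ?u (\<theta> g) i j = f g" if "i < length xs" "j < length xs" for i j
   by (rule reg1) (use that in \<open>simp_all only: lxs\<close>)
  show "\<exists>f\<in>reg_fun (length xs). \<forall>g\<in>GX. \<phi> (?c g) i j = f g" if "i < length ms" "j < length ms" for i j
   unfolding lxs by (rule reg2[OF that])
  show "?u (\<theta> (\<phi> (?c g))) = g" if "g \<in> GX" for g unfolding inv(2)[OF GX_D(2)[OF that]] by (rule uc[OF GX_D(1)[OF that]])
  show "\<tau>2 t \<in> torus n" if "t \<in> torus n" for t by (rule \<tau>2(1)[OF that])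
  show "chr n (\<tau>2 t) v = chr n t (\<psi> v)" if "t \<in> torus n" for t v by (rule \<tau>2(2)[OF that])
  show "v = v'" if "v \<in> Zn n" "v' \<in> Zn n" "\<psi> v = \<psi> v'" for v v'
  proof -
   have "wx (\<psi> v) = wx (\<psi> v')" using that(3) by simp
   then show ?thesis unfolding wx_\<psi>[OF that(1)] wx_\<psi>[OF that(2)] .
  qed
 qed (rule subM TorX Tor_eq2 expX \<psi>_Zn; assumption)+
 have \<psi>0: "\<psi> 0 = 0" unfolding \<psi>_def by (simp add: fun_eq_iff)
 have weight: "wt n ?S' (\<psi> a) = wt n ?S a" if a: "a \<in> Zn n" for a
 proof (cases "a = 0")
  case True then show ?thesis using A.wt_0 B.wt_0 \<psi>0 by simp
 next
  case False
  have "\<psi> a \<noteq> 0"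
  proof
   assume "\<psi> a = 0"
   then have "wx (\<psi> a) = 0" by (simp only: wx_0)
   then show False using False unfolding wx_\<psi>[OF a] by simp
  qed
  from mpair.wt_le[OF M2 this a refl] mpair.wt_le[OF M1 False \<psi>_Zn wx_\<psi>[OF a]] show ?thesis by simp
 qed
 have "wpair n ?S ?S' \<psi> wx"
 proof (rule wpair.intro[OF A.staircase_axioms B.staircase_axioms], rule wpair_axioms.intro)
  show "\<psi> (a + b) = \<psi> a + \<psi> b" for a b by (rule \<psi>_add)
  show "wx (a + b) = wx a + wx b" for a b by (rule wx_add)
 qed (rule \<psi>_Zn wx_Zn wx_\<psi> \<psi>_wx weight; assumption)+
 from wpair.ex_perm[OF this] obtain \<pi> where \<pi>: "fixbij n \<pi>" "?S = pull \<pi> ` ?S'" by blast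
 have ive_image: "ive a \<in> ive ` X \<longleftrightarrow> a \<in> X" for a X by (auto simp: image_iff)
 have mem: "a \<in> std_monos n E \<longleftrightarrow> a \<circ> inv \<pi> \<in> std" for a
 proof -
  have "pull (inv \<pi>) (ive a) = ive (a \<circ> inv \<pi>)" by (simp add: fun_eq_iff)
  then have "ive a \<in> ?S \<longleftrightarrow> ive (a \<circ> inv \<pi>) \<in> ?S'" unfolding \<pi>(2) pull_image_iff[OF \<pi>(1)] by simp
  then show ?thesis unfolding ive_image ms(2) .
 qed
 have ii: "(a \<circ> \<pi>) \<circ> inv \<pi> = a" "(a \<circ> inv \<pi>) \<circ> \<pi> = a" for a :: "nat \<Rightarrow> nat"
  using fixbij_inv_apply[OF \<pi>(1)] by (simp_all add: fun_eq_iff)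
 have bij: "bij_betw (\<lambda>a. a \<circ> inv \<pi>) (std_monos n E) std"
 proof (rule bij_betw_byWitness[where f' = "\<lambda>a. a \<circ> \<pi>"])
  show "\<forall>a\<in>std_monos n E. (a \<circ> inv \<pi>) \<circ> \<pi> = a" by (intro ballI, rule ii(2))
  show "\<forall>a\<in>std. (a \<circ> \<pi>) \<circ> inv \<pi> = a" by (intro ballI, rule ii(1))
  show "(\<lambda>a. a \<circ> inv \<pi>) ` std_monos n E \<subseteq> std" by (rule image_subsetI, rule mem[THEN iffD1])
  show "(\<lambda>a. a \<circ> \<pi>) ` std \<subseteq> std_monos n E" by (rule image_subsetI) (simp only: mem ii(1))
 qed
 show ?thesis
 proof (rule monalg_iso[where M = "\<lambda>a. ymon (a \<circ> inv \<pi>)", OF E(3)])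
  show "ymon (addvec a b \<circ> inv \<pi>) = ymon (a \<circ> inv \<pi>) * ymon (b \<circ> inv \<pi>)" for a b
  proof -
   have "addvec a b \<circ> inv \<pi> = addvec (a \<circ> inv \<pi>) (b \<circ> inv \<pi>)" by (simp add: fun_eq_iff addvec_def)
   then show ?thesis by (simp only: ymon_add)
  qed
  have "(\<lambda>_. 0) \<circ> inv \<pi> = (\<lambda>_. 0 :: nat)" by (simp add: fun_eq_iff)
  then show "ymon ((\<lambda>_. 0) \<circ> inv \<pi>) = 1" by (simp only: ymon_0)
  show "(\<lambda>_. 0) \<in> std_monos n E" using E(1) unfolding std_monos_def expvecs_def monomial_ideal_def by simp
  fix a assume a: "a \<in> expvecs n" "a \<notin> std_monos n E"
  have "a (inv \<pi> i) = 0" if "n \<le> i" for i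
  proof -
   have "inv \<pi> i = i" using fixbij_inv[OF \<pi>(1)] that unfolding fixbij_def by blast
   then show ?thesis using a(1) that unfolding expvecs_def by simp
  qed
  then have "a \<circ> inv \<pi> \<in> expvecs n" unfolding expvecs_def by simp
  moreover have "a \<circ> inv \<pi> \<notin> std" using a(2) unfolding mem .
  ultimately show "ymon (a \<circ> inv \<pi>) = 0" unfolding std_def by simp
 next
  fix x
  from span[of x] obtain d where d: "x = (\<Sum>b\<in>std. \<iota> (d b) * ymon b)" ..
  show "\<exists>d. x = (\<Sum>a\<in>std_monos n E. \<iota> (d a) * ymon (a \<circ> inv \<pi>))"
   by (rule exI[of _ "\<lambda>a. d (a \<circ> inv \<pi>)"])
    (simp only: d sum.reindex_bij_betw[OF bij, of "\<lambda>b. \<iota> (d b) * ymon b", symmetric])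
 next
  fix c a assume z: "(\<Sum>a\<in>std_monos n E. \<iota> (c a) * ymon (a \<circ> inv \<pi>)) = 0" and a: "a \<in> std_monos n E"
  have "(\<Sum>b\<in>std. \<iota> (c (b \<circ> \<pi>)) * ymon b) = (\<Sum>a\<in>std_monos n E. \<iota> (c (a \<circ> inv \<pi> \<circ> \<pi>)) * ymon (a \<circ> inv \<pi>))"
   by (rule sum.reindex_bij_betw[OF bij, symmetric])
  then have "(\<Sum>b\<in>std. \<iota> (c (b \<circ> \<pi>)) * ymon b) = 0" unfolding ii(2) z .
  from ymon_independent[OF this mem[THEN iffD1, OF a]] show "c a = 0" unfolding ii(2) .
 qed
qed

end

theorem theorem1p1:
 fixes \<iota> :: "'k::field_char_0 \<Rightarrow> 'b::comm_ring_1"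
  and n :: nat and E :: "(nat \<Rightarrow> nat) set" and mm :: "'b set"
 assumes "monomial_ideal n E"
  and "full_monomial_ideal n E"
  and "finite (std_monos n E)"
  and "alg_structure \<iota>"
  and "\<exists>bs. is_basis \<iota> bs"
  and "local_ring_with mm"
  and "\<forall>x. \<exists>c. x - \<iota> c \<in> mm"
  and "cotangent_dim \<iota> mm n"
  and "aut0_isomorphic \<iota> n E"
 shows "\<exists>f. alg_iso_to_monalg \<iota> n E f"
proof -
 obtain bs ms where bs: "is_basis \<iota> bs" and ms: "distinct ms" "set ms = std_monos n E"
  and iso: "alg_group_iso (length bs) (neutral_comp (length bs) (Aut_B \<iota> bs))
   (length ms) (neutral_comp (length ms) (Aut_M ms :: (nat \<Rightarrow> nat \<Rightarrow> 'k) set))"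
  using assms(9) unfolding aut0_isomorphic_def by blast
 define GB where "GB = neutral_comp (length bs) (Aut_B \<iota> bs)"
 define GM where "GM = neutral_comp (length ms) (Aut_M ms :: (nat \<Rightarrow> nat \<Rightarrow> 'k) set)"
 obtain \<phi> where bij: "bij_betw \<phi> GB GM"
  and hom: "\<forall>g\<in>GB. \<forall>h\<in>GB. \<phi> (mat_mul (length bs) g h) = mat_mul (length ms) (\<phi> g) (\<phi> h)"
  and reg: "\<forall>i<length ms. \<forall>j<length ms. \<exists>f\<in>reg_fun (length bs). \<forall>g\<in>GB. \<phi> g i j = f g"
  and reg': "\<forall>i<length bs. \<forall>j<length bs. \<exists>f\<in>reg_fun (length ms). \<forall>h\<in>GM. inv_into GB \<phi> h i j = f h"
  using iso unfolding alg_group_iso_def GB_def[symmetric] GM_def[symmetric] by blast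
 define \<theta> where "\<theta> = inv_into GB \<phi>"
 have im: "\<phi> ` GB = GM" and inj: "inj_on \<phi> GB" using bij unfolding bij_betw_def by blast+
 have \<theta>GB: "\<theta> g \<in> GB" if "g \<in> GM" for g unfolding \<theta>_def by (rule inv_into_into) (use that im in simp)
 have \<phi>\<theta>: "\<phi> (\<theta> g) = g" if "g \<in> GM" for g unfolding \<theta>_def by (rule f_inv_into_f[of g \<phi> GB]) (use that im in simp)
 have \<theta>\<phi>: "\<theta> (\<phi> g) = g" if "g \<in> GB" for g unfolding \<theta>_def by (rule inv_into_f_f[OF inj that])
 have \<phi>GM: "\<phi> g \<in> GM" if "g \<in> GB" for g using that im by blast
 have subM: "GM \<subseteq> Aut_M ms" and subB: "GB \<subseteq> Aut_B \<iota> bs" unfolding GM_def GB_def by (rule neutral_comp_subset)+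
 have invB: "invertible_mat (length bs) g" if "g \<in> Aut_B \<iota> bs" for g using that unfolding Aut_B_def by (rule aut_mats_invertible)
 have invM: "invertible_mat (length ms) g" if "g \<in> Aut_M ms" for g :: "nat \<Rightarrow> nat \<Rightarrow> 'k"
  using that unfolding Aut_M_def by (rule aut_mats_invertible)
 have mulB: "mat_mul (length bs) g h \<in> GB" if "g \<in> GB" "h \<in> GB" for g h
  unfolding GB_def by (rule neutral_comp_mul[OF _ _ that[unfolded GB_def]], erule invB, simp add: Aut_B_def aut_mats_mul)
 have \<theta>hom: "\<theta> (mat_mul (length ms) g h) = mat_mul (length bs) (\<theta> g) (\<theta> h)" if gh: "g \<in> GM" "h \<in> GM" for g h
 proof -
  have "\<phi> (mat_mul (length bs) (\<theta> g) (\<theta> h)) = mat_mul (length ms) g h"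
   using hom \<theta>GB[OF gh(1)] \<theta>GB[OF gh(2)] by (simp add: \<phi>\<theta>[OF gh(1)] \<phi>\<theta>[OF gh(2)])
  then show ?thesis using \<theta>\<phi>[OF mulB[OF \<theta>GB[OF gh(1)] \<theta>GB[OF gh(2)]]] by simp
 qed
 let ?S = "ive ` set ms"
 have dS: "downset n ?S" unfolding ms(2) by (rule downset_std_monos[OF assms(1-3)])
 interpret A: monlist n ?S ms by unfold_locales (rule dS ms(1) refl)+
 have padM: "padded (length ms) g" if "g \<in> Aut_M ms" for g :: "nat \<Rightarrow> nat \<Rightarrow> 'k" using invM[OF that] unfolding invertible_mat_def by blast
 have cM: "cj (length ms) (mat_id (length ms)) (mat_id (length ms)) g \<in> Aut_M ms" if "g \<in> Aut_M ms" for g :: "nat \<Rightarrow> nat \<Rightarrow> 'k"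
  unfolding cj_mat_id[OF padM[OF that]] by (rule that)
 have TorM: "A.Tor t \<in> GM" if "t \<in> torus n" for t :: "nat \<Rightarrow> 'k"
 proof -
  have "cj (length ms) (mat_id (length ms)) (mat_id (length ms)) (A.Tor t) \<in> GM"
   unfolding GM_def by (rule A.Tor_neutral[OF is_inverse_id padded_id _ that], rule cM)
  then show ?thesis unfolding cj_mat_id[OF padM[OF A.Tor_Aut[OF that]]] .
 qed
 have kfull: "klocal \<iota> mm" "kbasis \<iota> bs" by unfold_locales (rule assms bs)+
 define \<rho> where "\<rho> t = \<theta> (A.Tor t)" for t
 have \<rho>GB: "\<rho> t \<in> GB" if "t \<in> torus n" for t unfolding \<rho>_def by (rule \<theta>GB[OF TorM[OF that]])
 have kt: "ktorus \<iota> mm bs n \<rho>"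
 proof (rule ktorus.intro[OF kfull.intro[OF kfull]], rule ktorus_axioms.intro)
  show "cotangent_dim \<iota> mm n" by (rule assms(8))
  show "\<rho> t \<in> Aut_B \<iota> bs" if "t \<in> torus n" for t using \<rho>GB[OF that] subB by blast
  show "\<rho> (\<lambda>i. s i * t i) = mat_mul (length bs) (\<rho> s) (\<rho> t)" if "s \<in> torus n" "t \<in> torus n" for s t
   unfolding \<rho>_def A.Tor_mult[symmetric] by (rule \<theta>hom[OF TorM[OF that(1)] TorM[OF that(2)]])
  show "\<rho> (\<lambda>_. 1) = mat_id (length bs)"
  proof -
   \<comment> \<open>An invertible idempotent is the identity.\<close>
   let ?e = "\<rho> (\<lambda>_. 1)"
   have e: "?e \<in> GB" by (rule \<rho>GB[OF torus_one])
   have pe: "padded (length bs) ?e" and "invertible_mat (length bs) ?e" using invB e subB unfolding invertible_mat_def by blast+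
   then obtain h where h: "is_inverse (length bs) ?e h" unfolding invertible_mat_def by blast
   have ee: "mat_mul (length bs) ?e ?e = ?e"
    unfolding \<rho>_def \<theta>hom[OF TorM[OF torus_one] TorM[OF torus_one], symmetric] A.Tor_mult by simp
   have "?e = mat_mul (length bs) (mat_mul (length bs) h ?e) ?e" using h pe by (simp add: is_inverse_def mat_mul_id)
   also have "\<dots> = mat_id (length bs)" unfolding mat_mul_assoc ee using h by (simp add: is_inverse_def)
   finally show ?thesis .
  qed
  show "lp n (Zn n) (\<lambda>t. \<rho> t i j)" if ij: "i < length bs" "j < length bs" for i j
  proof -
   obtain f where f: "f \<in> reg_fun (length ms)" "\<forall>h\<in>GM. \<theta> h i j = f h" using reg' ij unfolding \<theta>_def by blast
   have Z: "A.im k \<in> Zn n" if "k < length ms" for k using A.S_Zn[OF A.im_S[OF that]] .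
   have "lp n (Zn n) (\<lambda>t. f (A.Tor t))"
   proof (rule lp_reg_fun[OF f(1) Zn_0 Zn_add])
    fix k l assume kl: "k < length ms" "l < length ms"
    have "lp n (Zn n) (\<lambda>t :: nat \<Rightarrow> 'k. (if k = l then 1 else 0) * chr n t (A.im k))" by (rule lp_mono[OF Z[OF kl(1)]])
    then show "lp n (Zn n) (\<lambda>t :: nat \<Rightarrow> 'k. A.Tor t k l)" by (rule lp_cong) (use kl in \<open>simp add: A.Tor_def mdiag_def\<close>)
    have "lp n (Zn n) (\<lambda>t :: nat \<Rightarrow> 'k. (if k = l then 1 else 0) * chr n t (- A.im k))" by (rule lp_mono[OF Zn_uminus[OF Z[OF kl(1)]]])
    then show "lp n (Zn n) (\<lambda>t :: nat \<Rightarrow> 'k. mat_inv (length ms) (A.Tor t) k l)"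
    proof (rule lp_cong)
     fix t :: "nat \<Rightarrow> 'k" assume t: "t \<in> torus n"
     have "chr n t (- A.im k) = inverse (chr n t (A.im k))"
      using chr_minus[OF t, of "A.im k"] chr_neq_0[OF t, of "A.im k"] by (simp add: field_simps)
     then show "mat_inv (length ms) (A.Tor t) k l = (if k = l then 1 else 0) * chr n t (- A.im k)"
      unfolding mat_inv_eq[OF A.is_inverse_Tor[OF t]] using kl by (simp add: A.Tor_def mdiag_def chr_inverse)
    qed
   qed
   then show ?thesis by (rule lp_cong) (use f(2) TorM in \<open>simp add: \<rho>_def\<close>)
  qed
  \<comment> \<open>The value t_i is the diagonal entry of \<open>Tor t\<close> at the monomial x_i,
    and \<phi> recovers \<open>Tor t\<close> from \<open>\<rho> t\<close> by regular
    functions.\<close>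
  show "\<exists>f\<in>reg_fun (length bs). \<forall>t\<in>torus n. t i = f (\<rho> t)" if i: "i < n" for i
  proof -
   note k = A.idx[OF A.S_uv[OF i]]
   obtain f where f: "f \<in> reg_fun (length bs)" "\<forall>g\<in>GB. \<phi> g (A.idx (uv i)) (A.idx (uv i)) = f g" using reg k(1) by blast
   have "t i = f (\<rho> t)" if t: "t \<in> torus n" for t
   proof -
    have "f (\<rho> t) = \<phi> (\<rho> t) (A.idx (uv i)) (A.idx (uv i))" using f(2) \<rho>GB[OF t] by simp
    also have "\<dots> = A.Tor t (A.idx (uv i)) (A.idx (uv i))" unfolding \<rho>_def \<phi>\<theta>[OF TorM[OF t]] ..
    also have "\<dots> = t i" using k chr_uv[OF i, of t] by (simp add: A.Tor_def mdiag_def)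
    finally show ?thesis by simp
   qed
   then show ?thesis using f(1) by blast
  qed
 qed
 then interpret T: ktorus \<iota> mm bs n \<rho> .
 obtain y where y: "T.cotb y" "\<forall>i<n. T.hom (y i)" using T.ex_homogeneous by blast
 have "\<forall>i. \<exists>\<chi>. i < n \<longrightarrow> \<chi> \<in> Zn n \<and> (\<forall>t\<in>torus n. T.act (\<rho> t) (y i) = \<iota> (chr n t \<chi>) * y i)"
  using y(2) unfolding T.hom_def by blast
 from choice[OF this] obtain X where X: "\<forall>i. i < n \<longrightarrow> X i \<in> Zn n \<and> (\<forall>t\<in>torus n. T.act (\<rho> t) (y i) = \<iota> (chr n t (X i)) * y i)" ..
 interpret Y: kweights \<iota> mm bs n \<rho> y X by unfold_locales (use y(1) X in blast)+
 show ?thesis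
 proof (rule Y.conclude[where \<phi> = \<phi> and \<theta> = \<theta>, OF assms(1-3) ms, folded GM_def GB_def])
  show "\<theta> g \<in> GB" if "g \<in> GM" for g by (rule \<theta>GB[OF that])
  show "\<phi> (mat_mul (length bs) g h) = mat_mul (length ms) (\<phi> g) (\<phi> h)" if "g \<in> GB" "h \<in> GB" for g h
   by (rule hom[rule_format, OF that])
  show "\<exists>f\<in>reg_fun (length bs). \<forall>g\<in>GB. \<phi> g i j = f g" if "i < length ms" "j < length ms" for i j using reg that by blast
  show "\<exists>f\<in>reg_fun (length ms). \<forall>g\<in>GM. \<theta> g i j = f g" if "i < length bs" "j < length bs" for i j
   using reg' that unfolding \<theta>_def by blast
  show "\<rho> t = \<theta> (A.Tor t)" if "t \<in> torus n" for t by (rule \<rho>_def)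
 qed (rule \<theta>hom \<phi>GM \<phi>\<theta> \<theta>\<phi>; assumption)+
qed

end
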